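(* Let $\Xi_1=(\mathbb{X}_1,d_1,\mu_1^*,\{\lambda_{1,k}\},\{\phi_{1,k}\})$ and $\Xi_2=(\mathbb{X}_2,d_2,\mu_2^*,\{\lambda_{2,k}\},\{\phi_{2,k}\})$ be two admissible systems, satisfying the Gaussian upper bound condition with exponents $q_1,q_2$ respectively, where $\{\phi_{1,j}\}$ and $\{\phi_{2,k}\}$ are orthonormal with respect to $\mu_1^*$ and $\mu_2^*$ respectively. Let $\mathbb{Y}\subseteq\mathbb{X}_1\cap\mathbb{X}_2$ be measurable with respect to both $\mu_1^*$ and $\mu_2^*$, let $\nu^*$ be a probability measure on $\mathbb{Y}$, and let $\Gamma_{j,k}=\int_{\mathbb{Y}}\overline{\phi_{1,j}(y)}\phi_{2,k}(y)\,d\nu^*(y)$, $j,k=0,1,\dots$. Let $h$ be a sufficiently smooth low pass filter, and assume there is $c>0$ with $\mu_j^*(\mathbb{B}_j(x,r))\le c\,r^{q_j}$ for all $x\in\mathbb{X}_j$, $r>0$, $j=1,2$. Let $1\le p\le\infty$ (with $1/p=0$ if $p=\infty$). Assume further that there exist $\beta>0$ and $c>0$ such that for all $m,n\ge1$ and $P\in\Pi_n(\Xi_2)$, $$\|\sigma_{2^{m+1},\otimes}(\Xi_1,\Xi_2;h,P)-\sigma_{2^m,\otimes}(\Xi_1,\Xi_2;h,P)\|_{\mathbb{X}_1,\mu_1^*,p}\le c\,2^{-m\beta}n^{q_1+(q_2-q_1)/p}\|P\|_{\mathbb{X}_2,\mu_2^*,p}.$$ If $f\in L^p(\mathbb{X}_2,\mu_2^*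 )$ and $$\sum_{m=0}^\infty2^{m(q_1+(q_2-q_1)/p)}E_{2^m,p}(\Xi_2;f)<\infty,$$ then $\mathcal{E}_\otimes(f)=\lim_{n\to\infty}\sigma_{2^n,\otimes}(\Xi_1,\Xi_2;h,f)$ exists in the sense of $L^p(\mathbb{X}_1,\mu_1^* )$, and there is a constant $c>0$ independent of $f$ and $n$ such that for all integers $n\ge0$ $$E_{2^n,p}(\Xi_1;\mathcal{E}_\otimes(f))\le c\left\{\sum_{m=n}^\infty2^{m(q_1+(q_2-q_1)/p)}E_{2^m,p}(\Xi_2;f)+2^{n(q_1+(q_2-q_1)/p-\beta)}\|f\|_{\mathbb{X}_2,\mu_2^*,p}\right\}.$$ In particular, if $\beta>\gamma>q_1+(q_2-q_1)/p$, $0<\rho\le\infty$, and $f\in B_{p,\rho,\gamma}(\Xi_2)$, then $\mathcal{E}_\otimes(f)\in B_{p,\rho,\gamma-q_1-(q_2-q_1)/p}(\Xi_1)$.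
   Context: A quasi-metric is a symmetric nonnegative function vanishing exactly on the diagonal and satisfying $d(x,y)\le C(d(x,z)+d(z,y))$ for some constant $C$. $\|f\|_{\mathbb{X},\nu,p}$ is the usual $L^p(\mathbb{X},\nu)$ norm. Bessel system: $\{\phi_k\}_{k=0}^\infty\subset L^2(\mu^* )$ is a Bessel system if there are a subset $\mathcal{D}\subset L^1(\mu^* )\cap L^\infty(\mu^* )$ dense in $L^2(\mu^* )$ and a (finite valued) functional $\mathcal{N}$ on $L^2(\mu^* )$ with $\sum_{k}|\int f\overline{\phi_k}\,d\mu^*|^2\le\mathcal{N}(f)$ for $f\in\mathcal{D}$. Admissible system: a tuple $\Xi=(\mathbb{X},d,\mu^*,\{\lambda_k\},\{\phi_k\})$ where $\mathbb{X}$ is a locally compact quasi-metric space with quasi-metric $d$ and sigma-finite positive Borel measure $\mu^*$; $\{\lambda_k\}_{k\ge0}$ is a non-decreasing sequence of nonnegative numbers with $\lambda_0=0$, $\lambda_k\to\infty$; and $\{\phi_k\}$ is a Bessel system in $L^2(\mu^* )$ with each $\phi_k$ continuous, bounded and integrable. $\mathbb{B}_j(x,r)=\{z\in\mathbb{X}_j:d_j(x,z)\le r\}$. Gaussian upper bound condition with exponent $q>0$ for $\Xi$: the series $K_t(\Xi;x,y)=\sum_{k}\exp(-\lambda_k^2t)\phi_k(x)\overline{\phi_k(y)}$ converges for all $x,y$, and there are constants $c_1,c_2>0$ with $|K_t(\Xi;x,y)|\le c_1t^{-q/2}\exp(-c_2d(x,y)^2/t)$ for $0<t\le1$, $x,y\in\mathbb{X}$.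 Low pass filter: an even function $h:\mathbb{R}\to[0,1]$, non-increasing on $[0,\infty)$, with $h(u)=1$ if $|u|<1/2$ and $h(u)=0$ if $|u|\ge1$. Here $h$ is "sufficiently smooth" if there are an integer $S>\max(q_1,q_2)+1$ and a signed measure $h^{[S]}$ on $[0,\infty)$ (of bounded variation on compact intervals) with $h(u)=\int_0^\infty(v^2-u^2)_+^S\,dh^{[S]}(v)$ for $u\ge0$ and $\int_0^\infty(v+2)^{\max(q_1,q_2)}(v^S+v^{2S})\,d|h^{[S]}|(v)<\infty$, where $x_+^S=x^S$ if $x>0$ and $0$ otherwise. Operators: for $n>0$, $x_1\in\mathbb{X}_1$, $x_2\in\mathbb{X}_2$, $$\Phi_{n,\otimes}(\Xi_1,\Xi_2;h,x_1,x_2)=\sum_{j,k=0}^\infty h\left(\frac{\lambda_{1,j}}{n}\right)h\left(\frac{\lambda_{2,k}}{n}\right)\Gamma_{j,k}\phi_{1,j}(x_1)\overline{\phi_{2,k}(x_2)},$$ and for $f\in L^1(\mathbb{X}_2,\mu_2^* )+L^\infty(\mathbb{X}_2,\mu_2^* )$, $\sigma_{n,\otimes}(\Xi_1,\Xi_2;h,f,x_1)=\int_{\mathbb{X}_2}f(x_2)\Phi_{n,\otimes}(\Xi_1,\Xi_2;h,x_1,x_2)\,d\mu_2^*(x_2)$. For an admissible system $\Xi$ and $n>0$: $\Pi_n(\Xi)=\mathrm{span}\{\phi_k:\lambda_k<n\}$; $E_{n,p}(\Xi;g)=\inf_{P\in\Pi_n(\Xi)}\|g-P\|_{\mathbb{X},\mu^*,p}$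 for $g\in L^p(\mathbb{X},\mu^* )$; $X^p(\Xi)$ is the set of $g\in L^p(\mathbb{X},\mu^* )$ with $E_{n,p}(\Xi;g)\to0$ as $n\to\infty$. For $0<\gamma<\infty$, the Besov space $B_{p,\rho,\gamma}(\Xi)$ is the set of $g\in X^p(\Xi)$ such that $\left(\sum_{j=0}^\infty2^{\gamma\rho j}E_{2^j,p}(\Xi;g)^\rho\right)^{1/\rho}<\infty$ if $0<\rho<\infty$, or $\sup_{j\ge0}2^{\gamma j}E_{2^j,p}(\Xi;g)<\infty$ if $\rho=\infty$. *)

theory Defs
  imports "HOL-Probability.Essential_Supremum" "HOL-Probability.Probability"
begin

section \<open>\<open>L\<^sup>p\<close> norms\<close>

text \<open>Exponents \<open>p \<in> [1,\<infinity>]\<close> and \<open>\<rho> \<in> (0,\<infinity>]\<close> have type \<^typ>\<open>ennreal\<close>, where \<open>1 / \<infinity> = 0\<close>.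
  Norms are \<^typ>\<open>ennreal\<close>-valued, so that a function outside \<open>L\<^sup>p\<close> has norm \<open>\<infinity>\<close> (and not \<open>0\<close>).\<close>

definition enn_powr :: "ennreal \<Rightarrow> real \<Rightarrow> ennreal"
  where "enn_powr x a = (if x = \<infinity> then \<infinity> else ennreal (enn2real x powr a))"
  \<comment> \<open>only used with \<open>a > 0\<close>\<close>

definition Lp_norm :: "ennreal \<Rightarrow> 'a measure \<Rightarrow> ('a \<Rightarrow> complex) \<Rightarrow> ennreal"
  where "Lp_norm p M f =
    (if p = \<infinity> then esssup M (\<lambda>x. ennreal (cmod (f x)))
     else enn_powr (\<integral>\<^sup>+x. ennreal (cmod (f x) powr enn2real p) \<partial>M) (1 / enn2real p))"

definition Lp :: "ennreal \<Rightarrow> 'a measure \<Rightarrow> ('a \<Rightarrow> complex) set"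
  where "Lp p M = {f \<in> borel_measurable M. Lp_norm p M f < \<infinity>}"


section \<open>Quasi-metric spaces\<close>

definition quasi_metric_on :: "'a set \<Rightarrow> ('a \<Rightarrow> 'a \<Rightarrow> real) \<Rightarrow> bool"
  where "quasi_metric_on X d \<longleftrightarrow>
    (\<forall>x\<in>X. \<forall>y\<in>X. 0 \<le> d x y \<and> d x y = d y x \<and> (d x y = 0 \<longleftrightarrow> x = y)) \<and>
    (\<exists>C. \<forall>x\<in>X. \<forall>y\<in>X. \<forall>z\<in>X. d x y \<le> C * (d x z + d z y))"

text \<open>The balls of a quasi-metric need be neither open nor Borel; as usual, a set is open if
  it contains a ball around each of its points.\<close>

definition qm_topology :: "'a set \<Rightarrow> ('a \<Rightarrow> 'a \<Rightarrow> real) \<Rightarrow> 'a topology"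
  where "qm_topology X d =
    topology (\<lambda>U. U \<subseteq> X \<and> (\<forall>x\<in>U. \<exists>r>0. \<forall>y\<in>X. d x y < r \<longrightarrow> y \<in> U))"

lemma openin_qm_topology:
  "openin (qm_topology X d) U \<longleftrightarrow> U \<subseteq> X \<and> (\<forall>x\<in>U. \<exists>r>0. \<forall>y\<in>X. d x y < r \<longrightarrow> y \<in> U)"
proof -
  let ?P = "\<lambda>U. U \<subseteq> X \<and> (\<forall>x\<in>U. \<exists>r>0. \<forall>y\<in>X. d x y < r \<longrightarrow> y \<in> U)"
  have inter: "?P (S \<inter> T)" if S: "?P S" and T: "?P T" for S T
  proof (intro conjI ballI)
    show "S \<inter> T \<subseteq> X" using S by auto
    fix x assume x: "x \<in> S \<inter> T"
    obtain r where r: "r > 0" "\<forall>y\<in>X. d x y < r \<longrightarrow> y \<in> S" using S x by blast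
    obtain s where s: "s > 0" "\<forall>y\<in>X. d x y < s \<longrightarrow> y \<in> T" using T x by blast
    show "\<exists>r>0. \<forall>y\<in>X. d x y < r \<longrightarrow> y \<in> S \<inter> T"
      by (rule exI[of _ "min r s"]) (use r s in auto)
  qed
  have union: "?P (\<Union>\<K>)" if K: "\<forall>K\<in>\<K>. ?P K" for \<K>
  proof (intro conjI ballI)
    show "\<Union>\<K> \<subseteq> X" using K by blast
    fix x assume "x \<in> \<Union>\<K>"
    then obtain K0 where K0: "K0 \<in> \<K>" "x \<in> K0" by blast
    then obtain r where "r > 0" "\<forall>y\<in>X. d x y < r \<longrightarrow> y \<in> K0" using K by blast
    then show "\<exists>r>0. \<forall>y\<in>X. d x y < r \<longrightarrow> y \<in> \<Union>\<K>" using K0(1) by blast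
  qed
  have "istopology ?P"
    unfolding istopology_def using inter union by blast
  then show ?thesis
    unfolding qm_topology_def by (simp add: topology_inverse')
qed

lemma topspace_qm_topology: "topspace (qm_topology X d) = X"
proof -
  have "openin (qm_topology X d) X"
    unfolding openin_qm_topology by (auto intro: exI[of _ "1::real"])
  then show ?thesis
    by (meson openin_qm_topology openin_subset openin_topspace subset_antisym)
qed


section \<open>Admissible systems\<close>

text \<open>A tuple \<open>(\<bbbX>, d, \<mu>\<^sup>*, {\<lambda>\<^sub>k}, {\<phi>\<^sub>k})\<close>; the set \<open>\<bbbX>\<close> is the space of the measure \<open>\<mu>\<^sup>*\<close>.
  Values of \<open>d\<close> and \<open>\<phi>\<^sub>k\<close> outside \<open>\<bbbX>\<close> are irrelevant.\<close>

record 'a spectral_system =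
  qdist :: "'a \<Rightarrow> 'a \<Rightarrow> real"
  msr :: "'a measure"
  lam :: "nat \<Rightarrow> real"
  phi :: "nat \<Rightarrow> 'a \<Rightarrow> complex"

abbreviation pts :: "'a spectral_system \<Rightarrow> 'a set"
  where "pts \<Xi> \<equiv> space (msr \<Xi>)"

abbreviation sys_topology :: "'a spectral_system \<Rightarrow> 'a topology"
  where "sys_topology \<Xi> \<equiv> qm_topology (pts \<Xi>) (qdist \<Xi>)"

definition qball :: "'a spectral_system \<Rightarrow> 'a \<Rightarrow> real \<Rightarrow> 'a set"
  where "qball \<Xi> x r = {z \<in> pts \<Xi>. qdist \<Xi> x z \<le> r}"

definition bessel_system :: "'a measure \<Rightarrow> (nat \<Rightarrow> 'a \<Rightarrow> complex) \<Rightarrow> bool"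
  where "bessel_system M \<phi> \<longleftrightarrow>
    (\<forall>k. \<phi> k \<in> Lp 2 M) \<and>
    (\<exists>D. \<exists>N :: ('a \<Rightarrow> complex) \<Rightarrow> real.
       D \<subseteq> Lp 1 M \<inter> Lp \<infinity> M \<and>
       (\<forall>g\<in>Lp 2 M. \<forall>\<epsilon>>0. \<exists>f\<in>D. Lp_norm 2 M (\<lambda>x. g x - f x) < ennreal \<epsilon>) \<and>
       (\<forall>f\<in>D. (\<Sum>k. ennreal ((cmod (LINT x|M. f x * cnj (\<phi> k x)))\<^sup>2)) \<le> ennreal (N f)))"

definition admissible_system :: "'a spectral_system \<Rightarrow> bool"
  where "admissible_system \<Xi> \<longleftrightarrow>
    quasi_metric_on (pts \<Xi>) (qdist \<Xi>) \<and>
    locally_compact_space (sys_topology \<Xi>) \<and>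
    sets (msr \<Xi>) = sigma_sets (pts \<Xi>) {U. openin (sys_topology \<Xi>) U} \<and>
    sigma_finite_measure (msr \<Xi>) \<and>
    incseq (lam \<Xi>) \<and> lam \<Xi> 0 = 0 \<and> filterlim (lam \<Xi>) at_top sequentially \<and>
    bessel_system (msr \<Xi>) (phi \<Xi>) \<and>
    (\<forall>k. continuous_map (sys_topology \<Xi>) euclidean (phi \<Xi> k) \<and>
         bounded (phi \<Xi> k ` pts \<Xi>) \<and> integrable (msr \<Xi>) (phi \<Xi> k))"

definition orthonormal_system :: "'a spectral_system \<Rightarrow> bool"
  where "orthonormal_system \<Xi> \<longleftrightarrow>
    (\<forall>j k. (LINT x|msr \<Xi>. phi \<Xi> j x * cnj (phi \<Xi> k x)) = (if j = k then 1 else 0))"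

definition heat_term :: "'a spectral_system \<Rightarrow> real \<Rightarrow> 'a \<Rightarrow> 'a \<Rightarrow> nat \<Rightarrow> complex"
  where "heat_term \<Xi> t x y k =
    complex_of_real (exp (- ((lam \<Xi> k)\<^sup>2 * t))) * phi \<Xi> k x * cnj (phi \<Xi> k y)"

definition gaussian_upper_bound :: "'a spectral_system \<Rightarrow> real \<Rightarrow> bool"
  where "gaussian_upper_bound \<Xi> q \<longleftrightarrow> q > 0 \<and>
    (\<forall>t x y. 0 < t \<and> t \<le> 1 \<and> x \<in> pts \<Xi> \<and> y \<in> pts \<Xi> \<longrightarrow> summable (heat_term \<Xi> t x y)) \<and>
    (\<exists>c1>0. \<exists>c2>0. \<forall>t x y. 0 < t \<and> t \<le> 1 \<and> x \<in> pts \<Xi> \<and> y \<in> pts \<Xi> \<longrightarrow>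
       cmod (\<Sum>k. heat_term \<Xi> t x y k) \<le> c1 * t powr (- q / 2) * exp (- c2 * (qdist \<Xi> x y)\<^sup>2 / t))"

text \<open>Outer measure agrees with the measure on measurable sets; it is used because closed
  quasi-metric balls need not be Borel, and \<^const>\<open>emeasure\<close> vanishes on non-measurable sets.\<close>

definition ball_growth :: "'a spectral_system \<Rightarrow> real \<Rightarrow> real \<Rightarrow> bool"
  where "ball_growth \<Xi> q c \<longleftrightarrow>
    (\<forall>x\<in>pts \<Xi>. \<forall>r>0. outer_measure_of (msr \<Xi>) (qball \<Xi> x r) \<le> ennreal (c * r powr q))"


section \<open>Low pass filters\<close>

definition low_pass_filter :: "(real \<Rightarrow> real) \<Rightarrow> bool"
  where "low_pass_filter h \<longleftrightarrow>
    (\<forall>u. h (- u) = h u) \<and> (\<forall>u. 0 \<le> h u \<and> h u \<le> 1) \<and> antimono_on {0..} h \<and>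
    (\<forall>u. \<bar>u\<bar> < 1/2 \<longrightarrow> h u = 1) \<and> (\<forall>u. \<bar>u\<bar> \<ge> 1 \<longrightarrow> h u = 0)"

text \<open>A signed Borel measure on \<open>[0,\<infinity>)\<close> of bounded variation on compact intervals is given by its
  Jordan decomposition: \<open>\<mu> = P - N\<close> with \<open>P\<close>, \<open>N\<close> mutually singular, so that \<open>\<bar>\<mu>\<bar> = P + N\<close>.\<close>

definition jordan_pair :: "real measure \<Rightarrow> real measure \<Rightarrow> bool"
  where "jordan_pair P N \<longleftrightarrow>
    sets P = sets (restrict_space borel {0..}) \<and> sets N = sets (restrict_space borel {0..}) \<and>
    (\<exists>A\<in>sets P. emeasure P ({0..} - A) = 0 \<and> emeasure N A = 0) \<and>
    (\<forall>b\<ge>0. emeasure P {0..b} < \<infinity> \<and> emeasure N {0..b} < \<infinity>)"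

definition sufficiently_smooth :: "real \<Rightarrow> real \<Rightarrow> (real \<Rightarrow> real) \<Rightarrow> bool"
  where "sufficiently_smooth q1 q2 h \<longleftrightarrow>
    (\<exists>S::nat. \<exists>P N. real S > max q1 q2 + 1 \<and> jordan_pair P N \<and>
       (\<forall>u\<ge>0. integrable P (\<lambda>v. (max 0 (v\<^sup>2 - u\<^sup>2)) ^ S) \<and>
               integrable N (\<lambda>v. (max 0 (v\<^sup>2 - u\<^sup>2)) ^ S) \<and>
               h u = (LINT v|P. (max 0 (v\<^sup>2 - u\<^sup>2)) ^ S) - (LINT v|N. (max 0 (v\<^sup>2 - u\<^sup>2)) ^ S)) \<and>
       (\<integral>\<^sup>+v. ennreal ((v + 2) powr max q1 q2 * (v ^ S + v ^ (2 * S))) \<partial>P) +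
       (\<integral>\<^sup>+v. ennreal ((v + 2) powr max q1 q2 * (v ^ S + v ^ (2 * S))) \<partial>N) < \<infinity>)"


section \<open>Operators\<close>

definition conn_coeff ::
    "'a spectral_system \<Rightarrow> 'a spectral_system \<Rightarrow> 'a measure \<Rightarrow> nat \<Rightarrow> nat \<Rightarrow> complex"
  where "conn_coeff \<Xi>1 \<Xi>2 \<nu> j k = (LINT y|\<nu>. cnj (phi \<Xi>1 j y) * phi \<Xi>2 k y)"

text \<open>For admissible systems and \<open>n > 0\<close>, only finitely many terms of the sum are non-zero.\<close>

definition tensor_kernel ::
    "'a spectral_system \<Rightarrow> 'a spectral_system \<Rightarrow> (nat \<Rightarrow> nat \<Rightarrow> complex) \<Rightarrow> (real \<Rightarrow> real) \<Rightarrow> real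
      \<Rightarrow> 'a \<Rightarrow> 'a \<Rightarrow> complex"
  where "tensor_kernel \<Xi>1 \<Xi>2 \<Gamma> h n x1 x2 =
    (\<Sum>\<^sub>\<infinity>(j, k)\<in>UNIV. complex_of_real (h (lam \<Xi>1 j / n)) * complex_of_real (h (lam \<Xi>2 k / n)) *
       \<Gamma> j k * phi \<Xi>1 j x1 * cnj (phi \<Xi>2 k x2))"

definition tensor_op ::
    "'a spectral_system \<Rightarrow> 'a spectral_system \<Rightarrow> (nat \<Rightarrow> nat \<Rightarrow> complex) \<Rightarrow> (real \<Rightarrow> real) \<Rightarrow> real
      \<Rightarrow> ('a \<Rightarrow> complex) \<Rightarrow> 'a \<Rightarrow> complex"
  where "tensor_op \<Xi>1 \<Xi>2 \<Gamma> h n f x1 = (LINT x2|msr \<Xi>2. f x2 * tensor_kernel \<Xi>1 \<Xi>2 \<Gamma> h n x1 x2)"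

text \<open>\<open>F\<close> is (a representative of) the limit of \<open>\<sigma>\<^bsub>2^n\<^esub>(f)\<close> in \<open>L\<^sup>p(\<mu>\<^sub>1\<^sup>*)\<close>; it is unique up to
  null sets.\<close>

definition is_tensor_limit ::
    "ennreal \<Rightarrow> 'a spectral_system \<Rightarrow> 'a spectral_system \<Rightarrow> (nat \<Rightarrow> nat \<Rightarrow> complex) \<Rightarrow> (real \<Rightarrow> real)
      \<Rightarrow> ('a \<Rightarrow> complex) \<Rightarrow> ('a \<Rightarrow> complex) \<Rightarrow> bool"
  where "is_tensor_limit p \<Xi>1 \<Xi>2 \<Gamma> h f F \<longleftrightarrow> F \<in> Lp p (msr \<Xi>1) \<and>
    (\<lambda>n. Lp_norm p (msr \<Xi>1) (\<lambda>x. tensor_op \<Xi>1 \<Xi>2 \<Gamma> h (2 ^ n) f x - F x)) \<longlonglongrightarrow> 0"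


section \<open>Approximation spaces\<close>

definition diff_poly :: "'a spectral_system \<Rightarrow> real \<Rightarrow> ('a \<Rightarrow> complex) set"
  where "diff_poly \<Xi> n =
    {\<lambda>x. \<Sum>k\<in>K. a k * phi \<Xi> k x | K a. finite K \<and> K \<subseteq> {k. lam \<Xi> k < n}}"

definition approx_err :: "ennreal \<Rightarrow> 'a spectral_system \<Rightarrow> real \<Rightarrow> ('a \<Rightarrow> complex) \<Rightarrow> ennreal"
  where "approx_err p \<Xi> n g = (INF P\<in>diff_poly \<Xi> n. Lp_norm p (msr \<Xi>) (\<lambda>x. g x - P x))"

definition approx_space :: "ennreal \<Rightarrow> 'a spectral_system \<Rightarrow> ('a \<Rightarrow> complex) set"
  where "approx_space p \<Xi> = {g \<in> Lp p (msr \<Xi>). ((\<lambda>n. approx_err p \<Xi> n g) \<longlongrightarrow> 0) at_top}"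

definition besov ::
    "ennreal \<Rightarrow> ennreal \<Rightarrow> real \<Rightarrow> 'a spectral_system \<Rightarrow> ('a \<Rightarrow> complex) set"
  where "besov p \<rho> \<gamma> \<Xi> = {g \<in> approx_space p \<Xi>.
    (if \<rho> = \<infinity> then (SUP j::nat. ennreal (2 powr (\<gamma> * real j)) * approx_err p \<Xi> (2 ^ j) g)
     else enn_powr
       (\<Sum>j. ennreal (2 powr (\<gamma> * enn2real \<rho> * real j)) * enn_powr (approx_err p \<Xi> (2 ^ j) g) (enn2real \<rho>))
       (1 / enn2real \<rho>)) < \<infinity>}"

definition loss_exponent :: "real \<Rightarrow> real \<Rightarrow> ennreal \<Rightarrow> real"
  where "loss_exponent q1 q2 p = q1 + (q2 - q1) * enn2real (1 / p)"

end

theory Submission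
  imports Defs
begin

text \<open>
  A Gaussian upper bound for the heat kernel forces finite speed of propagation: the heat sum
  $\sum_k e^{-t\lambda_k^2}\phi_k(x)\overline{\phi_k(y)}$ is the Laplace transform of a spectral sum with band-limited
  multiplier, and a Laplace transform of size $e^{-as}$ belongs to a function vanishing on $[0,a)$. Hence band-limited
  approximants of the filter $h$ do not contribute to $\Phi_n(x,y) = \sum_k h(\lambda_k/n)\phi_k(x)\overline{\phi_k(y)}$
  when $d(x,y)$ is large compared with band/$n$. This localization yields $\int |\Phi_n(x,\cdot)|\,d\mu^* \le C$, and the
  heat kernel on the diagonal gives $|\Phi_n| \le C n^q$.

  The joint kernel is $\int \Phi_n(\Xi_1;x_1,y)\,\Phi_n(\Xi_2;y,x_2)\,d\nu^*(y)$, so Schur's test bounds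
  $\sigma_{n,\otimes}$ on $L^p$ by $C n^Q$ with $Q = q_1 + (q_2-q_1)/p$. With near-best approximants $P_m$ of $f$ from
  $\Pi_{2^m}(\Xi_2)$, the step $\sigma_{2^{m+1}}f - \sigma_{2^m}f$ is split into its action on $f - P_m$, controlled by this
  bound, and on $P_m = P_n + \sum_{n \le k < m}(P_{k+1} - P_k)$, controlled by the hypothesis with gain $2^{-m\beta}$. The
  steps sum to the claimed bound, and the Besov statement follows by a discrete Hardy inequality.
\<close>

section \<open>Oscillatory integrals\<close>

text \<open>The spectral sums are controlled by the heat kernel only, and the sums of cos(z lam_k)
  phi_k(x) conj(phi_k(y)) have no reason to converge, so the wave kernel cannot be used directly.
  The cosine is therefore averaged against (1 - z^2)^r. The resulting multiplier \<open>jr\<close>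
  decays like (1 + u^2)^(-L), and with this weight the heat kernel on the diagonal makes the
  spectral sums absolutely convergent. The speed comes from a change of variable: a bound exp(-A/t)
  read at t = 1/(4s) is exp(-4 A s), so the inverse Laplace transform vanishes below 4 A. Only even
  multipliers are reached in this way, hence the symmetric pairs of shifts. The smoothness of h
  enters through finite differences alone. An order a above q/2 lets the approximation error 2^(-ja)
  beat the square root of the volume of a ball of radius comparable to 2^j/n. Closed quasi-metric
  balls may fail to be Borel, so these volumes are measured on measurable hulls.\<close>

definition osc :: "nat \<Rightarrow> nat \<Rightarrow> nat \<Rightarrow> real \<Rightarrow> real \<Rightarrow> real"
  where "osc a b m u \<theta> = integral {-1..1} (\<lambda>x. (1 - x) ^ a * (1 + x) ^ b * x ^ m * cos (x * u + \<theta>))"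

lemma osc_integrable:
  "(\<lambda>x. (1 - x) ^ a * (1 + x) ^ b * x ^ m * cos (x * u + \<theta>)) integrable_on {-1..1::real}"
  by (intro integrable_continuous_real continuous_intros)

lemma osc_bound_0: "\<bar>osc a b m u \<theta>\<bar> \<le> 4 ^ (a + b + m + 1)"
proof -
  have "norm (osc a b m u \<theta>) \<le> 4 ^ (a + b + m) * (1 - (-1))"
    unfolding osc_def
  proof (rule integral_bound)
    show "continuous_on {-1..1} (\<lambda>x. (1 - x) ^ a * (1 + x) ^ b * x ^ m * cos (x * u + \<theta>))"
      by (intro continuous_intros)
    fix t :: real assume t: "t \<in> {-1..1}"
    have "\<bar>1 - t\<bar> ^ a \<le> 4 ^ a" "\<bar>1 + t\<bar> ^ b \<le> 4 ^ b" "\<bar>t\<bar> ^ m \<le> 4 ^ m"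
      using t by (auto intro!: power_mono)
    then have "\<bar>1 - t\<bar> ^ a * \<bar>1 + t\<bar> ^ b * \<bar>t\<bar> ^ m * \<bar>cos (t * u + \<theta>)\<bar> \<le> 4 ^ a * 4 ^ b * 4 ^ m * 1"
      by (intro mult_mono) auto
    then show "norm ((1 - t) ^ a * (1 + t) ^ b * t ^ m * cos (t * u + \<theta>)) \<le> 4 ^ (a + b + m)"
      by (simp add: abs_mult power_abs power_add)
  qed auto
  also have "\<dots> \<le> 4 ^ (a + b + m + 1)" by simp
  finally show ?thesis by simp
qed

text \<open>The boundary terms vanish because both endpoint factors occur at least once. The shift
  of the phase by pi/2 rewrites the sine as a cosine, so the three resulting integrals belong to the
  same family. For m = 0 the truncated exponent m - 1 comes with the coefficient 0.\<close>

lemma osc_by_parts: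
  assumes "u \<noteq> 0"
  shows "osc (Suc a) (Suc b) m u \<theta> =
    (real (Suc a) * osc a (Suc b) m u (\<theta> - pi/2) - real (Suc b) * osc (Suc a) b m u (\<theta> - pi/2)
      - real m * osc (Suc a) (Suc b) (m - 1) u (\<theta> - pi/2)) / u"
proof -
  let ?p = "\<lambda>x::real. (1 - x) ^ Suc a * (1 + x) ^ Suc b * x ^ m"
  let ?p' = "\<lambda>x::real. - (real (Suc a) * ((1 - x) ^ a * (1 + x) ^ Suc b * x ^ m))
       + real (Suc b) * ((1 - x) ^ Suc a * (1 + x) ^ b * x ^ m)
       + real m * ((1 - x) ^ Suc a * (1 + x) ^ Suc b * x ^ (m - 1))"
  have dp: "(?p has_real_derivative ?p' x) (at x)" for x
  proof -
    have 1: "((\<lambda>x. (1 - x) ^ Suc a) has_real_derivative - (real (Suc a) * (1 - x) ^ a)) (at x)"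
      by (rule DERIV_cong[OF DERIV_power[OF DERIV_diff[OF DERIV_const DERIV_ident]]]) simp
    have 2: "((\<lambda>x. (1 + x) ^ Suc b) has_real_derivative (real (Suc b) * (1 + x) ^ b)) (at x)"
      by (rule DERIV_cong[OF DERIV_power[OF DERIV_add[OF DERIV_const DERIV_ident]]]) simp
    have 3: "((\<lambda>x. x ^ m) has_real_derivative (real m * x ^ (m - 1))) (at x)"
      using DERIV_pow[of m x] by simp
    show ?thesis
      by (rule DERIV_cong[OF DERIV_mult[OF DERIV_mult[OF 1 2] 3]]) (simp only: ring_distribs mult_ac minus_mult_left minus_mult_right add_ac)
  qed
  have "((\<lambda>x. ?p x * cos (x * u + \<theta>) * u + ?p' x * sin (x * u + \<theta>)) has_integral
      (?p 1 * sin (1 * u + \<theta>) - ?p (-1) * sin ((-1) * u + \<theta>))) {-1..1}"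
  proof (rule fundamental_theorem_of_calculus)
    fix x :: real
    have "((\<lambda>x. ?p x * sin (x * u + \<theta>)) has_real_derivative
         (?p x * cos (x * u + \<theta>) * u + ?p' x * sin (x * u + \<theta>))) (at x)"
    proof -
      have "((\<lambda>x. sin (x * u + \<theta>)) has_real_derivative (cos (x * u + \<theta>) * u)) (at x)"
        by (auto intro!: derivative_eq_intros)
      from DERIV_mult[OF dp this] show ?thesis
        by (rule DERIV_cong) (simp only: mult_ac add_ac)
    qed
    then show "((\<lambda>x. ?p x * sin (x * u + \<theta>)) has_vector_derivative
         (?p x * cos (x * u + \<theta>) * u + ?p' x * sin (x * u + \<theta>))) (at x within {-1..1})"
      by (simp add: has_real_derivative_iff_has_vector_derivative has_vector_derivative_at_within)
  qed simp
  then have 1: "((\<lambda>x. ?p x * cos (x * u + \<theta>) * u + ?p' x * sin (x * u + \<theta>)) has_integral 0) {-1..1}"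
    by simp
  have s: "sin (x * u + \<theta>) = cos (x * u + (\<theta> - pi/2))" for x
    by (simp add: cos_diff add_diff_eq)
  have "((\<lambda>x. ?p x * cos (x * u + \<theta>)) has_integral osc (Suc a) (Suc b) m u \<theta>) {-1..1}"
    unfolding osc_def by (intro integrable_integral osc_integrable)
  then have 2: "((\<lambda>x. ?p x * cos (x * u + \<theta>) * u) has_integral osc (Suc a) (Suc b) m u \<theta> * u) {-1..1}"
    by (rule has_integral_mult_left)
  have o: "((\<lambda>x. (1 - x) ^ a * (1 + x) ^ b * x ^ m * sin (x * u + \<theta>)) has_integral osc a b m u (\<theta> - pi/2)) {-1..1}" for a b m
    unfolding osc_def s by (intro integrable_integral osc_integrable)
  have 3: "((\<lambda>x. - (real (Suc a) * ((1 - x) ^ a * (1 + x) ^ Suc b * x ^ m * sin (x * u + \<theta>)))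
       + real (Suc b) * ((1 - x) ^ Suc a * (1 + x) ^ b * x ^ m * sin (x * u + \<theta>))
       + real m * ((1 - x) ^ Suc a * (1 + x) ^ Suc b * x ^ (m - 1) * sin (x * u + \<theta>))) has_integral
     (- (real (Suc a) * osc a (Suc b) m u (\<theta> - pi/2)) + real (Suc b) * osc (Suc a) b m u (\<theta> - pi/2)
      + real m * osc (Suc a) (Suc b) (m - 1) u (\<theta> - pi/2))) {-1..1}"
    by (intro has_integral_add has_integral_neg has_integral_mult_right o)
  have "((\<lambda>x. ?p x * cos (x * u + \<theta>) * u + ?p' x * sin (x * u + \<theta>)) has_integral
     (osc (Suc a) (Suc b) m u \<theta> * u + (- (real (Suc a) * osc a (Suc b) m u (\<theta> - pi/2)) + real (Suc b) * osc (Suc a) b m u (\<theta> - pi/2)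
      + real m * osc (Suc a) (Suc b) (m - 1) u (\<theta> - pi/2)))) {-1..1}"
    using has_integral_add[OF 2 3] by (simp add: algebra_simps)
  from has_integral_unique[OF this 1] show ?thesis
    using assms by (simp add: field_simps)
qed

text \<open>Integrating by parts l times: each round gains 1/|u| and costs at most a + b + m, the
  sum of the coefficients. The conditions on l keep both endpoint factors present in every
  round.\<close>

lemma osc_bound:
  assumes "u \<noteq> 0"
  shows "l \<le> a \<Longrightarrow> l \<le> b \<Longrightarrow> \<bar>osc a b m u \<theta>\<bar> \<le> real (a + b + m) ^ l * 4 ^ (a + b + m + 1) / \<bar>u\<bar> ^ l"
proof (induction l arbitrary: a b m \<theta>)
  case 0
  then show ?case using osc_bound_0 by simp
next
  case (Suc l)
  then obtain a' b' where ab: "a = Suc a'" "b = Suc b'" by (meson Suc_le_D)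
  define M where "M = real (a + b + m) ^ l * 4 ^ (a + b + m + 1) / \<bar>u\<bar> ^ l"
  have mono: "real s ^ l * 4 ^ (s + 1) / \<bar>u\<bar> ^ l \<le> M" if "s \<le> a + b + m" for s
    unfolding M_def using that by (intro divide_right_mono mult_mono power_mono power_increasing) auto
  have 1: "\<bar>osc a' b m u (\<theta> - pi/2)\<bar> \<le> M"
    by (rule order_trans[OF Suc.IH mono]) (use Suc.prems ab in auto)
  have 2: "\<bar>osc a b' m u (\<theta> - pi/2)\<bar> \<le> M"
    by (rule order_trans[OF Suc.IH mono]) (use Suc.prems ab in auto)
  have 3: "\<bar>osc a b (m - 1) u (\<theta> - pi/2)\<bar> \<le> M"
    by (rule order_trans[OF Suc.IH mono]) (use Suc.prems ab in auto)
  have "\<bar>osc a b m u \<theta>\<bar> = \<bar>real a * osc a' b m u (\<theta> - pi/2) - real b * osc a b' m u (\<theta> - pi/2)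
      - real m * osc a b (m - 1) u (\<theta> - pi/2)\<bar> / \<bar>u\<bar>"
    using osc_by_parts[OF assms, of a' b' m \<theta>] by (simp only: ab abs_divide)
  also have "\<dots> \<le> (real a * M + real b * M + real m * M) / \<bar>u\<bar>"
  proof (intro divide_right_mono)
    have "\<bar>real a * osc a' b m u (\<theta> - pi/2)\<bar> \<le> real a * M" "\<bar>real b * osc a b' m u (\<theta> - pi/2)\<bar> \<le> real b * M"
      "\<bar>real m * osc a b (m - 1) u (\<theta> - pi/2)\<bar> \<le> real m * M"
      unfolding abs_mult using 1 2 3 by (auto intro!: mult_left_mono)
    then show "\<bar>real a * osc a' b m u (\<theta> - pi/2) - real b * osc a b' m u (\<theta> - pi/2)
      - real m * osc a b (m - 1) u (\<theta> - pi/2)\<bar> \<le> real a * M + real b * M + real m * M" by linarith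
  qed simp
  also have "\<dots> = real (a + b + m) * M / \<bar>u\<bar>"
    by (simp add: ring_distribs)
  also have "\<dots> = real (a + b + m) ^ Suc l * 4 ^ (a + b + m + 1) / \<bar>u\<bar> ^ Suc l"
    by (simp only: M_def power_Suc times_divide_eq_right divide_divide_eq_left mult_ac)
  finally show ?case .
qed

section \<open>Polynomial weights in the frequency variable\<close>

lemma one_plus_sq_nonzero [simp]: "1 + x\<^sup>2 \<noteq> 0" for x :: real
  by (smt (verit) zero_le_power2)

lemma one_plus_sq_power_pos [simp]: "0 < (1 + x\<^sup>2) ^ L" for x :: real
  by (intro zero_less_power add_pos_nonneg) auto

lemma one_plus_sq_power_le:
  fixes x :: real
  shows "(1 + x\<^sup>2) ^ L \<le> 2 ^ L * (1 + \<bar>x\<bar> ^ (2 * L))"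
proof -
  have "1 + x\<^sup>2 \<le> 2 * max 1 (x\<^sup>2)" by simp
  then have "(1 + x\<^sup>2) ^ L \<le> (2 * max 1 (x\<^sup>2)) ^ L" by (intro power_mono) auto
  also have "\<dots> = 2 ^ L * (max 1 (x\<^sup>2)) ^ L" by (simp add: power_mult_distrib)
  also have "(max 1 (x\<^sup>2)) ^ L \<le> 1 + \<bar>x\<bar> ^ (2 * L)"
    by (cases "x\<^sup>2 \<le> 1") (auto simp: max_def power_mult)
  finally show ?thesis by simp
qed

text \<open>The trivial bound serves small u and 2L integrations by parts serve large u; their sum
  gives the inhomogeneous weight. The summand 1 in the base makes that factor at least 1, so it also
  dominates the trivial bound.\<close>

lemma osc_weight_bound:
  assumes "2 * L \<le> r"
  shows "\<bar>osc r r m u \<theta>\<bar> \<le> 2 ^ L * real (1 + 2 * r + m) ^ (2 * L) * (2 * 4 ^ (2 * r + m + 1)) / (1 + u\<^sup>2) ^ L"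
proof -
  define K where "K = (4 ^ (2 * r + m + 1) :: real)"
  define N where "N = real (1 + 2 * r + m) ^ (2 * L)"
  define f where "f = \<bar>osc r r m u \<theta>\<bar>"
  have K: "K \<ge> 0" and N: "N \<ge> 1" unfolding K_def N_def by (auto intro: one_le_power)
  have f0: "f \<le> K" using osc_bound_0[of r r m u \<theta>] by (simp add: K_def f_def mult_2)
  have f1: "f * \<bar>u\<bar> ^ (2 * L) \<le> N * K"
  proof (cases "u = 0")
    case True
    have "f * \<bar>u\<bar> ^ (2 * L) \<le> f" using True by (cases "L = 0") (simp_all add: f_def zero_power)
    also have "\<dots> \<le> 1 * K" using f0 by simp
    also have "\<dots> \<le> N * K" using K N by (intro mult_right_mono)
    finally show ?thesis .
  next
    case False
    then have "f \<le> real (r + r + m) ^ (2 * L) * 4 ^ (r + r + m + 1) / \<bar>u\<bar> ^ (2 * L)"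
      unfolding f_def using osc_bound[of u "2 * L" r r m \<theta>] assms by simp
    moreover have "\<bar>u\<bar> ^ (2 * L) > 0" using False by simp
    ultimately have "f * \<bar>u\<bar> ^ (2 * L) \<le> real (r + r + m) ^ (2 * L) * 4 ^ (r + r + m + 1)"
      by (simp only: pos_le_divide_eq)
    also have "\<dots> = real (2 * r + m) ^ (2 * L) * K" by (simp only: K_def mult_2)
    also have "\<dots> \<le> N * K"
      unfolding N_def using K by (intro mult_right_mono power_mono) auto
    finally show ?thesis .
  qed
  have "f * (1 + u\<^sup>2) ^ L \<le> f * (2 ^ L * (1 + \<bar>u\<bar> ^ (2 * L)))"
    by (intro mult_left_mono one_plus_sq_power_le) (simp add: f_def)
  also have "\<dots> = 2 ^ L * (f + f * \<bar>u\<bar> ^ (2 * L))" by (simp add: algebra_simps)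
  also have "\<dots> \<le> 2 ^ L * (1 * K + N * K)"
    using f0 f1 by (intro mult_left_mono add_mono) auto
  also have "\<dots> \<le> 2 ^ L * (N * K + N * K)"
    using K N by (intro mult_left_mono add_mono mult_right_mono) auto
  finally have "f * (1 + u\<^sup>2) ^ L \<le> 2 ^ L * N * (2 * K)" by (simp add: algebra_simps)
  moreover have "(1 + u\<^sup>2) ^ L > 0" by (intro zero_less_power add_pos_nonneg) auto
  ultimately have "f \<le> 2 ^ L * N * (2 * K) / (1 + u\<^sup>2) ^ L" by (simp only: pos_le_divide_eq)
  then show ?thesis by (simp only: f_def N_def K_def)
qed

section \<open>Functions with exponentially small Laplace transform\<close>

lemma exp_minus_one_sums:
  fixes x :: real
  shows "(\<lambda>k. x ^ Suc k / fact (Suc k)) sums (exp x - 1)"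
proof -
  have "(\<lambda>k. x ^ Suc k /\<^sub>R fact (Suc k)) sums (exp x - 1)"
    using exp_converges[of x] sums_Suc_iff[of "\<lambda>n. x ^ n /\<^sub>R fact n" "exp x - 1"] by simp
  then show ?thesis by (simp only: divide_inverse real_scaleR_def mult.commute)
qed

lemma one_minus_exp_sums:
  fixes x :: real
  shows "(\<lambda>k. (-1) ^ k * x ^ Suc k / fact (Suc k)) sums (1 - exp (- x))"
proof -
  have "(\<lambda>k. - ((- x) ^ Suc k / fact (Suc k))) sums (- (exp (- x) - 1))"
    by (intro sums_minus exp_minus_one_sums)
  moreover have "- ((- x) ^ Suc k / fact (Suc k)) = (-1) ^ k * x ^ Suc k / fact (Suc k)" for k
    unfolding power_minus[of x "Suc k"] by simp
  ultimately show ?thesis by (simp only: minus_diff_eq)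
qed

lemma one_minus_exp_le: fixes x :: real assumes "x \<ge> 0" shows "0 \<le> 1 - exp (- x)" "1 - exp (- x) \<le> 1" "1 - exp (- x) \<le> x"
  using assms exp_ge_add_one_self[of "- x"] by auto

text \<open>
  The double exponential $1 - \exp(-e^{n(t-y)})$ tends to the indicator of $y < t$, while its power series
  expresses the integral against \<open>w\<close> through the values of the Laplace transform at the multiples of $n$.
\<close>

lemma mikusinski:
  fixes w :: "real \<Rightarrow> complex"
  assumes int: "integrable lborel (\<lambda>y. exp (- s0 * y) *\<^sub>R w y)" and s0: "s0 > 0"
    and w0: "\<And>y. y \<le> 0 \<Longrightarrow> w y = 0"
    and bound: "\<And>s. s \<ge> s0 \<Longrightarrow> cmod (\<integral>y. exp (- s * y) *\<^sub>R w y \<partial>lborel) \<le> C * exp (- a * s)"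
    and t: "t < a"
  shows "(\<integral>y. indicator {..<t} y *\<^sub>R w y \<partial>lborel) = 0"
proof -
  have [measurable]: "w \<in> borel_measurable borel"
  proof -
    have "(\<lambda>y. exp (s0 * y) *\<^sub>R (exp (- s0 * y) *\<^sub>R w y)) \<in> borel_measurable borel"
      using borel_measurable_integrable[OF int] by measurable
    then show ?thesis by (simp add: exp_minus)
  qed
  have int': "integrable lborel (\<lambda>y. norm (exp (- s0 * y) *\<^sub>R w y))"
    using int by (rule integrable_norm)
  define W where "W = (\<integral>y. norm (exp (- s0 * y) *\<^sub>R w y) \<partial>lborel)"
  have le: "norm (exp (- s * y) *\<^sub>R w y) \<le> norm (exp (- s0 * y) *\<^sub>R w y)" if "s \<ge> s0" for s y
  proof (cases "y \<le> 0")
    case True then show ?thesis using w0 by simp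
  next
    case False
    then have "s0 * y \<le> s * y" using that by (intro mult_right_mono) auto
    then show ?thesis by (simp add: mult_right_mono)
  qed
  have ints: "integrable lborel (\<lambda>y. exp (- s * y) *\<^sub>R w y)" if "s \<ge> s0" for s
    by (rule Bochner_Integration.integrable_bound[OF int']) (use le[OF that] in auto)
  define g where "g = (\<lambda>n::nat. \<lambda>y::real. 1 - exp (- exp (real n * (t - y))))"
  \<comment> \<open>Only Laplace values at n(k+1) occur. Against the factors exp(nt(k+1)) their size
    exp(-an(k+1)) leaves powers of exp(-(a-t)n), which form the series of exp - 1 and vanish in the
    limit since t < a.\<close>
  have series: "cmod (\<integral>y. g n y *\<^sub>R w y \<partial>lborel) \<le> C * (exp (exp (- (a - t) * real n)) - 1)"
    if n: "real n \<ge> s0" for n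
  proof -
    have npos: "real n > 0" using n s0 by linarith
    define x where "x = (\<lambda>y. exp (real n * (t - y)))"
    define f where "f = (\<lambda>k::nat. \<lambda>y. ((-1) ^ k * x y ^ Suc k / fact (Suc k)) *\<^sub>R w y)"
    have sn: "real n * real (Suc k) \<ge> s0" for k
    proof -
      have "real n * 1 \<le> real n * real (Suc k)" using npos by (intro mult_left_mono) auto
      then show ?thesis using n by simp
    qed
    have xk: "x y ^ Suc k = exp (real n * t) ^ Suc k * exp (- (real n * real (Suc k)) * y)" for k y
      unfolding x_def exp_of_nat_mult[symmetric] exp_add[symmetric] by (simp add: algebra_simps)
    have f_eq: "f k y = ((-1) ^ k * exp (real n * t) ^ Suc k / fact (Suc k)) *\<^sub>R (exp (- (real n * real (Suc k)) * y) *\<^sub>R w y)" for k y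
      unfolding f_def xk by simp
    have f_int: "integrable lborel (f k)" for k
      unfolding f_eq[abs_def] by (intro integrable_scaleR_right ints sn)
    have absc: "\<bar>(-1) ^ k * exp (real n * t) ^ Suc k / fact (Suc k)\<bar> = exp (real n * t) ^ Suc k / fact (Suc k)" for k
      by (simp add: abs_mult power_abs)
    have nf: "norm (f k y) = exp (real n * t) ^ Suc k / fact (Suc k) * norm (exp (- (real n * real (Suc k)) * y) *\<^sub>R w y)" for k y
      unfolding f_eq norm_scaleR[of "(-1) ^ k * exp (real n * t) ^ Suc k / fact (Suc k)"]
      by (simp only: absc)
    have exps: "summable (\<lambda>k. z ^ Suc k / fact (Suc k))" "(\<Sum>k. z ^ Suc k / fact (Suc k)) = exp z - 1" for z :: real
      using exp_minus_one_sums[of z] by (auto simp: sums_iff)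
    have sums_g: "(\<lambda>k. f k y) sums (g n y *\<^sub>R w y)" for y
      unfolding f_def g_def x_def by (intro sums_scaleR_left one_minus_exp_sums)
    have norm_int: "(\<integral>y. norm (f k y) \<partial>lborel) \<le> exp (real n * t) ^ Suc k / fact (Suc k) * W" for k
    proof -
      have "(\<integral>y. norm (f k y) \<partial>lborel) = exp (real n * t) ^ Suc k / fact (Suc k) * (\<integral>y. norm (exp (- (real n * real (Suc k)) * y) *\<^sub>R w y) \<partial>lborel)"
        unfolding nf by (rule integral_mult_right_zero)
      also have "\<dots> \<le> exp (real n * t) ^ Suc k / fact (Suc k) * W"
        unfolding W_def by (intro mult_left_mono integral_mono integrable_norm ints sn int int' le) auto
      finally show ?thesis .
    qed
    have sum_int: "summable (\<lambda>k. \<integral>y. norm (f k y) \<partial>lborel)"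
      by (rule summable_comparison_test'[OF summable_mult2[OF exps(1)[of "exp (real n * t)"], of W], of 0])
         (use norm_int in simp)
    have sum_ae: "AE y in lborel. summable (\<lambda>k. norm (f k y))"
    proof (rule AE_I2)
      fix y
      have "summable (\<lambda>k. x y ^ Suc k / fact (Suc k) * norm (w y))" by (intro summable_mult2 exps)
      moreover have "norm (f k y) = x y ^ Suc k / fact (Suc k) * norm (w y)" for k
        unfolding f_def norm_scaleR by (simp add: abs_mult power_abs x_def)
      ultimately show "summable (\<lambda>k. norm (f k y))" by simp
    qed
    have "(\<integral>y. (\<Sum>k. f k y) \<partial>lborel) = (\<Sum>k. \<integral>y. f k y \<partial>lborel)"
      by (rule integral_suminf[OF f_int sum_ae sum_int])
    then have eq: "(\<integral>y. g n y *\<^sub>R w y \<partial>lborel) = (\<Sum>k. \<integral>y. f k y \<partial>lborel)"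
      using sums_g by (simp add: sums_iff)
    have tm: "norm (\<integral>y. f k y \<partial>lborel) \<le> C * (exp (- (a - t) * real n) ^ Suc k / fact (Suc k))" for k
    proof -
      have "norm (\<integral>y. f k y \<partial>lborel) = exp (real n * t) ^ Suc k / fact (Suc k) * norm (\<integral>y. exp (- (real n * real (Suc k)) * y) *\<^sub>R w y \<partial>lborel)"
        unfolding f_eq integral_scaleR_right norm_scaleR[of "(-1) ^ k * exp (real n * t) ^ Suc k / fact (Suc k)"]
        by (simp only: absc)
      also have "\<dots> \<le> exp (real n * t) ^ Suc k / fact (Suc k) * (C * exp (- a * (real n * real (Suc k))))"
        by (intro mult_left_mono bound sn) auto
      also have "\<dots> = C * ((exp (real n * t) ^ Suc k * exp (- a * (real n * real (Suc k)))) / fact (Suc k))"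
        by simp
      also have "exp (real n * t) ^ Suc k * exp (- a * (real n * real (Suc k))) = exp (- (a - t) * real n) ^ Suc k"
        unfolding exp_of_nat_mult[symmetric] exp_add[symmetric] by (simp add: algebra_simps)
      finally show ?thesis .
    qed
    have s2: "summable (\<lambda>k. C * (exp (- (a - t) * real n) ^ Suc k / fact (Suc k)))"
      by (intro summable_mult exps)
    have "norm (\<Sum>k. \<integral>y. f k y \<partial>lborel) \<le> (\<Sum>k. C * (exp (- (a - t) * real n) ^ Suc k / fact (Suc k)))"
      by (rule norm_suminf_le[OF tm s2])
    also have "\<dots> = C * (exp (exp (- (a - t) * real n)) - 1)"
      using suminf_mult[OF exps(1)[of "exp (- (a - t) * real n)"], of C] exps(2)[of "exp (- (a - t) * real n)"] by simp
    finally show ?thesis using eq by simp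
  qed
  obtain N :: nat where N: "real N \<ge> s0" using real_arch_simple by blast
  have lim0: "(\<lambda>n. \<integral>y. g n y *\<^sub>R w y \<partial>lborel) \<longlonglongrightarrow> 0"
  proof (rule Lim_null_comparison)
    show "\<forall>\<^sub>F n in sequentially. norm (\<integral>y. g n y *\<^sub>R w y \<partial>lborel) \<le> C * (exp (exp (- (a - t) * real n)) - 1)"
      using eventually_ge_at_top[of N] by eventually_elim (rule series, use N in linarith)
    have "(\<lambda>n. - (a - t) * real n) = (\<lambda>n. (t - a) * real n)" by auto
    moreover have "filterlim (\<lambda>n. (t - a) * real n) at_bot sequentially"
      by (rule filterlim_tendsto_neg_mult_at_bot[OF tendsto_const _ filterlim_real_sequentially]) (use t in simp)
    ultimately have "filterlim (\<lambda>n. - (a - t) * real n) at_bot sequentially" by metis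
    then have "(\<lambda>n. exp (- (a - t) * real n)) \<longlonglongrightarrow> 0"
      by (rule filterlim_compose[OF exp_at_bot])
    from tendsto_mult[OF tendsto_const[of C] tendsto_diff[OF tendsto_exp[OF this] tendsto_const[of 1]]]
    show "(\<lambda>n. C * (exp (exp (- (a - t) * real n)) - 1)) \<longlonglongrightarrow> 0" by simp
  qed
  \<comment> \<open>The index is shifted so that n + N is at least s0: for y beyond t this gives the
    dominating function with the rate \<open>s0\<close>, the only one known to be integrable from
    the start.\<close>
  have lim1: "(\<lambda>n. \<integral>y. g (n + N) y *\<^sub>R w y \<partial>lborel) \<longlonglongrightarrow> (\<integral>y. indicator {..<t} y *\<^sub>R w y \<partial>lborel)"
  proof (rule integral_dominated_convergence[where w = "\<lambda>y. exp (s0 * t) * norm (exp (- s0 * y) *\<^sub>R w y)"])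
    show "(\<lambda>y. indicator {..<t} y *\<^sub>R w y) \<in> borel_measurable lborel" by measurable
    show "(\<lambda>y. g (n + N) y *\<^sub>R w y) \<in> borel_measurable lborel" for n unfolding g_def by measurable
    show "integrable lborel (\<lambda>y. exp (s0 * t) * norm (exp (- s0 * y) *\<^sub>R w y))"
      by (intro integrable_mult_right int')
    show "AE y in lborel. norm (g (n + N) y *\<^sub>R w y) \<le> exp (s0 * t) * norm (exp (- s0 * y) *\<^sub>R w y)" for n
    proof (rule AE_I2)
      fix y
      let ?x = "exp (real (n + N) * (t - y))"
      have "\<bar>g (n + N) y\<bar> \<le> exp (s0 * (t - y))"
      proof (cases "y < t")
        case True
        then have "1 \<le> exp (s0 * (t - y))" using s0 by simp
        then show ?thesis using one_minus_exp_le[of ?x, OF exp_ge_zero] unfolding g_def by linarith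
      next
        case False
        have "real (n + N) * (t - y) \<le> s0 * (t - y)"
          by (rule mult_right_mono_neg) (use N False in auto)
        then have "?x \<le> exp (s0 * (t - y))" by simp
        then show ?thesis using one_minus_exp_le[of ?x, OF exp_ge_zero] unfolding g_def by linarith
      qed
      then have "\<bar>g (n + N) y\<bar> * norm (w y) \<le> exp (s0 * (t - y)) * norm (w y)" by (intro mult_right_mono) auto
      also have "\<dots> = exp (s0 * t) * norm (exp (- s0 * y) *\<^sub>R w y)"
        by (simp add: algebra_simps exp_diff exp_minus divide_inverse)
      finally show "norm (g (n + N) y *\<^sub>R w y) \<le> exp (s0 * t) * norm (exp (- s0 * y) *\<^sub>R w y)" by simp
    qed
    \<comment> \<open>At y = t the double exponential has the constant value 1 - 1/e, so this point
      has to be excluded.\<close>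
    have "AE y in lborel. y \<noteq> t" by (rule AE_lborel_singleton)
    then show "AE y in lborel. (\<lambda>n. g (n + N) y *\<^sub>R w y) \<longlonglongrightarrow> indicator {..<t} y *\<^sub>R w y"
    proof eventually_elim
      case (elim y)
      have "(\<lambda>n. g n y) \<longlonglongrightarrow> indicator {..<t} y"
      proof (cases "y < t")
        case True
        have "filterlim (\<lambda>n. (t - y) * real n) at_top sequentially"
          by (rule filterlim_tendsto_pos_mult_at_top[OF tendsto_const _ filterlim_real_sequentially]) (use True in simp)
        then have "filterlim (\<lambda>n. exp (real n * (t - y))) at_top sequentially"
          by (intro filterlim_compose[OF exp_at_top]) (simp add: mult.commute)
        then have "filterlim (\<lambda>n. - exp (real n * (t - y))) at_bot sequentially"
          by (simp add: filterlim_uminus_at_top)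
        then have "(\<lambda>n. exp (- exp (real n * (t - y)))) \<longlonglongrightarrow> 0" by (rule filterlim_compose[OF exp_at_bot])
        from tendsto_diff[OF tendsto_const[of 1] this] show ?thesis using True by (simp add: g_def)
      next
        case False
        have "filterlim (\<lambda>n. (t - y) * real n) at_bot sequentially"
          by (rule filterlim_tendsto_neg_mult_at_bot[OF tendsto_const _ filterlim_real_sequentially]) (use False elim in simp)
        then have "(\<lambda>n. exp (real n * (t - y))) \<longlonglongrightarrow> 0"
          by (intro filterlim_compose[OF exp_at_bot]) (simp add: mult.commute)
        from tendsto_diff[OF tendsto_const[of 1] tendsto_exp[OF tendsto_minus[OF this]]]
        show ?thesis using False by (simp add: g_def)
      qed
      then show ?case by (intro tendsto_scaleR tendsto_const LIMSEQ_ignore_initial_segment)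
    qed
  qed
  from LIMSEQ_unique[OF lim1 LIMSEQ_ignore_initial_segment[OF lim0]] show ?thesis .
qed

section \<open>Bessel-type kernels\<close>

text \<open>
  \<open>jr r u\<close> is a constant multiple of $J_{r+1/2}(u)/u^{r+1/2}$, and as the Fourier transform of a function
  supported in $[-1,1]$ it is band-limited.
\<close>

definition jr :: "nat \<Rightarrow> real \<Rightarrow> real" where "jr r u = osc r r 0 u 0"

lemma jr_eq: "jr r u = integral {-1..1} (\<lambda>z. (1 - z\<^sup>2) ^ r * cos (z * u))"
proof -
  have "(1 - z) ^ r * (1 + z) ^ r = (1 - z\<^sup>2) ^ r" for z :: real
    by (simp add: power_mult_distrib[symmetric] algebra_simps power2_eq_square)
  then show ?thesis unfolding jr_def osc_def by simp
qed

lemma jr_lebesgue: "jr r u = (\<integral>z. indicator {-1..1} z * ((1 - z\<^sup>2) ^ r * cos (z * u)) \<partial>lborel)"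
proof -
  have "set_integrable lborel {-1..1} (\<lambda>z::real. (1 - z\<^sup>2) ^ r * cos (z * u))"
    by (intro borel_integrable_atLeastAtMost') (intro continuous_intros)
  from set_borel_integral_eq_integral(2)[OF this] show ?thesis
    by (simp add: jr_eq set_lebesgue_integral_def)
qed

lemma jr_continuous: "continuous_on UNIV (jr r)"
proof -
  have "continuous_on UNIV (\<lambda>u. integral (cbox (-1) 1) (\<lambda>z::real. (1 - z\<^sup>2) ^ r * cos (z * u)))"
    by (intro integral_continuous_on_param) (auto intro!: continuous_intros simp: split_beta)
  then show ?thesis by (simp add: jr_eq[abs_def])
qed

lemma jr_measurable [measurable]: "jr r \<in> borel_measurable borel"
  using jr_continuous by (rule borel_measurable_continuous_onI)

lemma jr_minus: "jr r (- u) = jr r u"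
  by (simp add: jr_eq)

lemma jr_bound:
  assumes "2 * L \<le> r"
  obtains C where "C > 0" "\<And>u. \<bar>jr r u\<bar> \<le> C / (1 + u\<^sup>2) ^ L"
proof (rule that)
  show "2 ^ L * real (1 + 2 * r + 0) ^ (2 * L) * (2 * 4 ^ (2 * r + 0 + 1)) > (0::real)" by simp
  show "\<bar>jr r u\<bar> \<le> 2 ^ L * real (1 + 2 * r + 0) ^ (2 * L) * (2 * 4 ^ (2 * r + 0 + 1)) / (1 + u\<^sup>2) ^ L" for u
    unfolding jr_def by (rule osc_weight_bound[OF assms])
qed

section \<open>Gamma, Gaussian and Laplace integrals\<close>

lemma integral_power_exp:
  assumes s: "s > 0"
  shows "integrable lborel (\<lambda>x::real. indicator {0..} x * (exp (- s * x) * x ^ r))"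
    "(\<integral>x. indicator {0::real..} x * (exp (- s * x) * x ^ r) \<partial>lborel) = fact r / s ^ Suc r"
proof -
  interpret prob_space "density lborel (erlang_density r s)" using s by (rule prob_space_erlang_density)
  have 1: "(\<integral>\<^sup>+x. ennreal (erlang_density r s x) \<partial>lborel) = 1"
    using emeasure_space_1 by (simp add: emeasure_density)
  have hb: "has_bochner_integral lborel (erlang_density r s) 1"
    by (intro has_bochner_integral_nn_integral) (use s 1 in auto)
  have eq: "indicator {0..} x * (exp (- s * x) * x ^ r) = (fact r / s ^ Suc r) * erlang_density r s x" for x :: real
    using s by (auto simp: erlang_density_def field_simps split: split_indicator)
  have "has_bochner_integral lborel (\<lambda>x. (fact r / s ^ Suc r) * erlang_density r s x) ((fact r / s ^ Suc r) * 1)"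
    by (intro has_bochner_integral_mult_right hb)
  then have "has_bochner_integral lborel (\<lambda>x::real. indicator {0..} x * (exp (- s * x) * x ^ r)) (fact r / s ^ Suc r)"
    unfolding eq by simp
  then show "integrable lborel (\<lambda>x::real. indicator {0..} x * (exp (- s * x) * x ^ r))"
    "(\<integral>x. indicator {0::real..} x * (exp (- s * x) * x ^ r) \<partial>lborel) = fact r / s ^ Suc r"
    by (auto simp: has_bochner_integral_iff)
qed

text \<open>The real part of the characteristic function of the standard normal law, after the
  substitution that scales by sqrt(2s).\<close>

lemma integral_gauss_cos:
  assumes s: "s > 0"
  shows "integrable lborel (\<lambda>x::real. exp (- s * x\<^sup>2))"
    "(\<integral>x. cos (x * u) * exp (- s * x\<^sup>2) \<partial>lborel) = sqrt (pi / s) * exp (- u\<^sup>2 / (4 * s))"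
proof -
  define c where "c = sqrt (2 * s)"
  have c: "c > 0" "c\<^sup>2 = 2 * s" using s by (auto simp: c_def)
  have e: "std_normal_density (0 + c * x) = exp (- s * x\<^sup>2) / sqrt (2 * pi)" for x
    unfolding std_normal_density_def using c by (simp add: power_mult_distrib)
  have "integrable lborel (\<lambda>x. std_normal_density (0 + c * x))"
    by (rule lborel_integrable_real_affine) (use c in auto)
  then have "integrable lborel (\<lambda>x. sqrt (2 * pi) * (exp (- s * x\<^sup>2) / sqrt (2 * pi)))"
    unfolding e by (rule integrable_mult_right)
  then show int: "integrable lborel (\<lambda>x::real. exp (- s * x\<^sup>2))" by simp
  have ch: "char std_normal_distribution v = exp (- v\<^sup>2 / 2)" for v
    by (simp add: char_std_normal_distribution)
  have "char std_normal_distribution v = (CLINT x|lborel. std_normal_density x *\<^sub>R iexp (v * x))" for v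
    unfolding char_def by (subst integral_density) auto
  moreover have icis: "integrable lborel (\<lambda>x. std_normal_density x *\<^sub>R iexp (v * x))" for v
    by (rule Bochner_Integration.integrable_bound[of _ "std_normal_density"]) auto
  ultimately have "(\<integral>x. Re (std_normal_density x *\<^sub>R iexp (v * x)) \<partial>lborel) = Re (complex_of_real (exp (- v\<^sup>2 / 2)))" for v
    using ch[of v] integral_Re[OF icis[of v]] by metis
  then have R: "(\<integral>x. std_normal_density x * cos (v * x) \<partial>lborel) = exp (- v\<^sup>2 / 2)" for v
    by (simp add: Re_exp)
  have "(\<integral>x. std_normal_density x * cos (u / c * x) \<partial>lborel) = c * (\<integral>x. std_normal_density (0 + c * x) * cos (u / c * (0 + c * x)) \<partial>lborel)"
    using c by (subst lborel_integral_real_affine[of c _ 0]) auto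
  also have "(\<lambda>x. std_normal_density (0 + c * x) * cos (u / c * (0 + c * x))) = (\<lambda>x. (1 / sqrt (2 * pi)) * (cos (x * u) * exp (- s * x\<^sup>2)))"
    unfolding e using c by (auto simp: mult.commute)
  finally have "exp (- (u / c)\<^sup>2 / 2) = c / sqrt (2 * pi) * (\<integral>x. cos (x * u) * exp (- s * x\<^sup>2) \<partial>lborel)"
    unfolding R by simp
  moreover have "(u / c)\<^sup>2 / 2 = u\<^sup>2 / (4 * s)" using c by (simp add: power_divide)
  moreover have "c / sqrt (2 * pi) = 1 / sqrt (pi / s)"
    unfolding c_def using s by (simp add: real_sqrt_divide real_sqrt_mult field_simps)
  ultimately have "exp (- u\<^sup>2 / (4 * s)) = 1 / sqrt (pi / s) * (\<integral>x. cos (x * u) * exp (- s * x\<^sup>2) \<partial>lborel)" by simp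
  moreover have "1 / q * I = E \<Longrightarrow> q > 0 \<Longrightarrow> I = q * E" for q I E :: real by auto
  moreover have "sqrt (pi / s) > 0" using s by simp
  ultimately show "(\<integral>x. cos (x * u) * exp (- s * x\<^sup>2) \<partial>lborel) = sqrt (pi / s) * exp (- u\<^sup>2 / (4 * s))"
    by metis
qed

text \<open>
  The Laplace transform of \<open>wk r u\<close> is a multiple of $s^{-r-3/2} e^{-u^2/(4s)}$, so that a heat sum at time
  $1/(4s)$ is the Laplace transform of the corresponding sum of kernels \<open>wk r\<close>.
\<close>

definition wk :: "nat \<Rightarrow> real \<Rightarrow> real \<Rightarrow> real"
  where "wk r u y = indicator {0<..} y * (sqrt y * y ^ r * jr r (sqrt y * u))"

lemma wk_measurable [measurable]: "(\<lambda>(u, y). wk r u y) \<in> borel_measurable (borel \<Otimes>\<^sub>M borel)"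
  unfolding wk_def by measurable

lemma wk_measurable' [measurable]: "wk r u \<in> borel_measurable borel"
  unfolding wk_def by measurable

lemma wk_slice:
  "(\<integral>x. indicator {x. x\<^sup>2 \<le> y} x * ((y - x\<^sup>2) ^ r * cos (x * u)) \<partial>lborel) = wk r u y" if "y > 0"
proof -
  define c where "c = sqrt y"
  have c: "c > 0" "c\<^sup>2 = y" using that by (auto simp: c_def)
  have sq: "x\<^sup>2 \<le> 1 \<longleftrightarrow> x \<in> {-1..1}" for x :: real
    using abs_le_square_iff[of x 1] by auto
  have "(\<integral>x. indicator {x. x\<^sup>2 \<le> y} x * ((y - x\<^sup>2) ^ r * cos (x * u)) \<partial>lborel) =
    c * (\<integral>x. indicator {x. x\<^sup>2 \<le> y} (0 + c * x) * ((y - (0 + c * x)\<^sup>2) ^ r * cos ((0 + c * x) * u)) \<partial>lborel)"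
    using c by (subst lborel_integral_real_affine[of c _ 0]) auto
  also have "(\<lambda>x. indicator {x. x\<^sup>2 \<le> y} (0 + c * x) * ((y - (0 + c * x)\<^sup>2) ^ r * cos ((0 + c * x) * u)))
     = (\<lambda>x. y ^ r * (indicator {-1..1} x * ((1 - x\<^sup>2) ^ r * cos (x * (c * u)))))"
  proof
    fix x :: real
    have "indicator {x. x\<^sup>2 \<le> y} (0 + c * x) = (indicator {-1..1} x :: real)"
      using that sq[of x] c by (auto simp: power_mult_distrib split: split_indicator)
    moreover have "(y - (0 + c * x)\<^sup>2) ^ r = y ^ r * (1 - x\<^sup>2) ^ r"
      using c by (simp add: power_mult_distrib[symmetric] algebra_simps)
    ultimately show "indicator {x. x\<^sup>2 \<le> y} (0 + c * x) * ((y - (0 + c * x)\<^sup>2) ^ r * cos ((0 + c * x) * u)) =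
       y ^ r * (indicator {-1..1} x * ((1 - x\<^sup>2) ^ r * cos (x * (c * u))))"
      by (simp add: mult_ac)
  qed
  also have "c * (\<integral>x. y ^ r * (indicator {-1..1} x * ((1 - x\<^sup>2) ^ r * cos (x * (c * u)))) \<partial>lborel) = wk r u y"
    using that by (simp add: wk_def jr_lebesgue c_def)
  finally show ?thesis .
qed

text \<open>Fubini for exp(-sy) (y - x^2)^r cos(xu) on the region x^2 \<le> y. Integrating over x
  first gives \<open>wk\<close> by \<open>wk_slice\<close>. Integrating over y first, shifted by
  x^2, gives a Gamma integral times exp(-s x^2), and what remains is the Fourier transform of a
  Gaussian.\<close>

lemma wk_laplace:
  assumes s: "s > 0"
  shows "(\<integral>y. exp (- s * y) * wk r u y \<partial>lborel) = fact r / s ^ Suc r * (sqrt (pi / s) * exp (- u\<^sup>2 / (4 * s)))"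
proof -
  define f where "f = (\<lambda>(x::real, y::real). indicator {p::real\<times>real. fst p ^ 2 \<le> snd p} (x, y) * (exp (- s * y) * ((y - x\<^sup>2) ^ r * cos (x * u))))"
  have [measurable]: "f \<in> borel_measurable (lborel \<Otimes>\<^sub>M lborel)"
    unfolding f_def by measurable
  have sh: "(\<lambda>y. indicator {p. fst p ^ 2 \<le> snd p} (x, y) * (exp (- s * y) * ((y - x\<^sup>2) ^ r * c)))
     = (\<lambda>y. (c * exp (- s * x\<^sup>2)) * (indicator {0..} (- x\<^sup>2 + 1 * y) * (exp (- s * (- x\<^sup>2 + 1 * y)) * (- x\<^sup>2 + 1 * y) ^ r)))" for x c :: real
  proof
    fix y
    have "exp (- s * y) = exp (- s * x\<^sup>2) * exp (- s * (- x\<^sup>2 + 1 * y))"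
      unfolding exp_add[symmetric] by (simp add: algebra_simps)
    moreover have "indicator {p. fst p ^ 2 \<le> snd p} (x, y) = (indicator {0..} (- x\<^sup>2 + 1 * y) :: real)"
      by (auto split: split_indicator)
    ultimately show "indicator {p. fst p ^ 2 \<le> snd p} (x, y) * (exp (- s * y) * ((y - x\<^sup>2) ^ r * c)) =
       (c * exp (- s * x\<^sup>2)) * (indicator {0..} (- x\<^sup>2 + 1 * y) * (exp (- s * (- x\<^sup>2 + 1 * y)) * (- x\<^sup>2 + 1 * y) ^ r))"
      by (simp add: mult_ac)
  qed
  have shI: "integrable lborel (\<lambda>y. indicator {p. fst p ^ 2 \<le> snd p} (x, y) * (exp (- s * y) * ((y - x\<^sup>2) ^ r * c)))"
    "(\<integral>y. indicator {p. fst p ^ 2 \<le> snd p} (x, y) * (exp (- s * y) * ((y - x\<^sup>2) ^ r * c)) \<partial>lborel) = c * exp (- s * x\<^sup>2) * (fact r / s ^ Suc r)" for x c :: real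
  proof -
    show "integrable lborel (\<lambda>y. indicator {p. fst p ^ 2 \<le> snd p} (x, y) * (exp (- s * y) * ((y - x\<^sup>2) ^ r * c)))"
      unfolding sh by (intro integrable_mult_right lborel_integrable_real_affine[OF integral_power_exp(1)[OF s]]) simp
    have "(\<integral>x. indicator {0::real..} x * (exp (- s * x) * x ^ r) \<partial>lborel) = \<bar>1\<bar> *\<^sub>R (\<integral>y. (indicator {0..} (- x\<^sup>2 + 1 * y) * (exp (- s * (- x\<^sup>2 + 1 * y)) * (- x\<^sup>2 + 1 * y) ^ r)) \<partial>lborel)"
      by (rule lborel_integral_real_affine) simp
    then show "(\<integral>y. indicator {p. fst p ^ 2 \<le> snd p} (x, y) * (exp (- s * y) * ((y - x\<^sup>2) ^ r * c)) \<partial>lborel) = c * exp (- s * x\<^sup>2) * (fact r / s ^ Suc r)"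
      unfolding sh integral_mult_right_zero integral_power_exp(2)[OF s] by simp
  qed
  have nf: "norm (f (x, y)) = indicator {p. fst p ^ 2 \<le> snd p} (x, y) * (exp (- s * y) * ((y - x\<^sup>2) ^ r * \<bar>cos (x * u)\<bar>))" for x y
    unfolding f_def by (auto simp: abs_mult power_abs split: split_indicator)
  have int: "integrable (lborel \<Otimes>\<^sub>M lborel) f"
  proof (rule lborel_pair.Fubini_integrable)
    show "integrable lborel (\<lambda>x. \<integral>y. norm (f (x, y)) \<partial>lborel)"
      unfolding nf shI
      by (rule Bochner_Integration.integrable_bound[OF integrable_mult_left[OF integral_gauss_cos(1)[OF s]], of _ "fact r / s ^ Suc r"])
         (use s in \<open>auto simp: abs_mult intro!: divide_right_mono mult_right_mono mult_left_le_one_le AE_I2\<close>)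
    show "AE x in lborel. integrable lborel (\<lambda>y. f (x, y))"
      by (rule AE_I2) (simp only: f_def prod.case shI)
  qed simp
  have "(\<integral>y. (\<integral>x. f (x, y) \<partial>lborel) \<partial>lborel) = (\<integral>x. (\<integral>y. f (x, y) \<partial>lborel) \<partial>lborel)"
    by (rule lborel_pair.Fubini_integral) (use int in simp)
  also have "\<dots> = (\<integral>x. cos (x * u) * exp (- s * x\<^sup>2) * (fact r / s ^ Suc r) \<partial>lborel)"
    by (simp only: f_def prod.case shI)
  also have "\<dots> = (\<integral>x. cos (x * u) * exp (- s * x\<^sup>2) \<partial>lborel) * (fact r / s ^ Suc r)"
    by (rule integral_mult_left_zero)
  also have "\<dots> = fact r / s ^ Suc r * (sqrt (pi / s) * exp (- u\<^sup>2 / (4 * s)))"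
    unfolding integral_gauss_cos(2)[OF s] by (rule mult.commute)
  also have "(\<integral>y. (\<integral>x. f (x, y) \<partial>lborel) \<partial>lborel) = (\<integral>y. exp (- s * y) * wk r u y \<partial>lborel)"
  proof (rule integral_cong_AE)
    have "AE y in lborel. y \<noteq> (0::real)" by (rule AE_lborel_singleton)
    then show "AE y in lborel. (\<integral>x. f (x, y) \<partial>lborel) = exp (- s * y) * wk r u y"
    proof eventually_elim
      case (elim y)
      show ?case
      proof (cases "y > 0")
        case True
        have "(\<integral>x. f (x, y) \<partial>lborel) = (\<integral>x. exp (- s * y) * (indicator {x. x\<^sup>2 \<le> y} x * ((y - x\<^sup>2) ^ r * cos (x * u))) \<partial>lborel)"
          unfolding f_def by (intro Bochner_Integration.integral_cong) (auto split: split_indicator)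
        then show ?thesis by (simp only: integral_mult_right_zero wk_slice[OF True])
      next
        case False
        then have "f (x, y) = 0" for x
        proof -
          have "\<not> x\<^sup>2 \<le> y" using False elim zero_le_power2[of x] by linarith
          then show ?thesis unfolding f_def by simp
        qed
        then show ?thesis using False by (simp add: wk_def)
      qed
    qed
  qed (auto simp: lborel_pair.borel_measurable_lebesgue_integral)
  finally show ?thesis .
qed

lemma integrable_inverse_one_plus_sq: "integrable lborel (\<lambda>x::real. 1 / (1 + x\<^sup>2))"
  using integrable_inverse_1_plus_square by (simp add: set_integrable_def divide_inverse)

lemma jr_integrable:
  assumes "2 \<le> r"
  shows "integrable lborel (jr r)"
proof -
  obtain C where C: "C > 0" "\<And>u. \<bar>jr r u\<bar> \<le> C / (1 + u\<^sup>2) ^ 1" using jr_bound[of 1 r] assms by auto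
  show ?thesis
    by (rule Bochner_Integration.integrable_bound[OF integrable_mult_right[OF integrable_inverse_one_plus_sq, of C]])
       (use C in \<open>auto intro!: AE_I2\<close>)
qed

text \<open>The factor sqrt y in \<open>wk\<close> is the Jacobian of u to sqrt y * u, so the
  integral over u leaves a pure power of y.\<close>

lemma wk_exp_mass:
  fixes y c :: real and g :: "real \<Rightarrow> real"
  assumes "integrable lborel g"
  shows "(\<integral>u. c * (indicator {0<..} y * (sqrt y * y ^ r * g (sqrt y * u))) \<partial>lborel)
     = c * (indicator {0<..} y * (y ^ r * (\<integral>u. g u \<partial>lborel)))"
proof (cases "y > 0")
  case True
  have "(\<integral>u. g u \<partial>lborel) = \<bar>sqrt y\<bar> *\<^sub>R (\<integral>u. g (0 + sqrt y * u) \<partial>lborel)"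
    by (rule lborel_integral_real_affine) (use True in auto)
  then show ?thesis using True by (simp add: mult_ac)
qed simp

text \<open>This is Fourier inversion at 0 for (1 - z^2)^r, whose value there is 1. It is obtained
  by integrating exp(-y) \<open>wk r u y\<close> in both orders: u first gives r! times the integral
  sought, y first gives r! sqrt(pi) exp(-u^2/4), whose integral is 2 pi r!.\<close>

lemma jr_integral:
  assumes "2 \<le> r"
  shows "(\<integral>u. jr r u \<partial>lborel) = 2 * pi"
proof -
  define f where "f = (\<lambda>(y, u). exp (- 1 * y) * wk r u y)"
  have [measurable]: "f \<in> borel_measurable (lborel \<Otimes>\<^sub>M lborel)"
    unfolding f_def wk_def by measurable
  have nf: "norm (f (y, u)) = exp (- 1 * y) * (indicator {0<..} y * (sqrt y * y ^ r * \<bar>jr r (sqrt y * u)\<bar>))" for y u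
    unfolding f_def wk_def by (auto simp: abs_mult split: split_indicator)
  have ind: "AE y in lborel. exp (- 1 * y) * (indicator {0<..} y * (y ^ r * c)) = (indicator {0..} y * (exp (- 1 * y) * y ^ r)) * c" for c :: real
  proof -
    have "AE y in lborel. y \<noteq> (0::real)" by (rule AE_lborel_singleton)
    then show ?thesis by eventually_elim (auto split: split_indicator)
  qed
  have int1: "integrable lborel (\<lambda>y. exp (- 1 * y) * (indicator {0<..} y * (y ^ r * c)))" for c :: real
    by (subst integrable_cong_AE[OF _ _ ind]) (auto intro!: integrable_mult_left integral_power_exp(1)[of 1, simplified])
  have val: "(\<integral>y. exp (- 1 * y) * (indicator {0<..} y * (y ^ r * c)) \<partial>lborel) = fact r * c" for c :: real
    by (subst integral_cong_AE[OF _ _ ind]) (use integral_power_exp(2)[of 1 r] in simp_all)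
  have int: "integrable (lborel \<Otimes>\<^sub>M lborel) f"
  proof (rule lborel_pair.Fubini_integrable)
    show "integrable lborel (\<lambda>y. \<integral>u. norm (f (y, u)) \<partial>lborel)"
      unfolding nf wk_exp_mass[OF integrable_abs[OF jr_integrable[OF assms]]] by (rule int1)
    show "AE y in lborel. integrable lborel (\<lambda>u. f (y, u))"
    proof (rule AE_I2)
      fix y :: real
      show "integrable lborel (\<lambda>u. f (y, u))"
      proof (cases "y > 0")
        case True
        have "integrable lborel (\<lambda>u. jr r (0 + sqrt y * u))"
          by (rule lborel_integrable_real_affine[OF jr_integrable[OF assms]]) (use True in simp)
        then show ?thesis unfolding f_def wk_def by simp
      qed (simp add: f_def wk_def)
    qed
  qed simp
  have "(\<integral>u. (\<integral>y. f (y, u) \<partial>lborel) \<partial>lborel) = (\<integral>y. (\<integral>u. f (y, u) \<partial>lborel) \<partial>lborel)"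
    by (rule lborel_pair.Fubini_integral) (use int in simp)
  also have "\<dots> = (\<integral>y. exp (- 1 * y) * (indicator {0<..} y * (y ^ r * (\<integral>u. jr r u \<partial>lborel))) \<partial>lborel)"
    unfolding f_def prod.case wk_def wk_exp_mass[OF jr_integrable[OF assms]] by simp
  also have "\<dots> = fact r * (\<integral>u. jr r u \<partial>lborel)" by (rule val)
  also have "(\<integral>u. (\<integral>y. f (y, u) \<partial>lborel) \<partial>lborel) = (\<integral>u. fact r * sqrt pi * (cos (u * 0) * exp (- (1/4) * u\<^sup>2)) \<partial>lborel)"
    unfolding f_def prod.case by (subst wk_laplace) (simp_all add: mult.assoc)
  also have "\<dots> = fact r * sqrt pi * (sqrt (pi / (1/4)) * exp (- 0\<^sup>2 / (4 * (1/4))))"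
    by (subst integral_mult_right_zero, subst integral_gauss_cos(2)) simp_all
  also have "\<dots> = fact r * (2 * pi)" by (simp add: real_sqrt_mult)
  finally show ?thesis by simp
qed

section \<open>Finite speed of propagation\<close>

text \<open>One term of the exponential series of s x. It trades polynomial growth for an
  exponential of arbitrarily small rate.\<close>

lemma power_le_fact_exp:
  fixes x s :: real
  assumes "x \<ge> 0" "s > 0"
  shows "x ^ n \<le> fact n / s ^ n * exp (s * x)"
proof -
  have "(s * x) ^ n / fact n \<le> (\<Sum>k. (s * x) ^ k /\<^sub>R fact k)"
  proof -
    have "sum (\<lambda>k. (s * x) ^ k /\<^sub>R fact k) {n} \<le> (\<Sum>k. (s * x) ^ k /\<^sub>R fact k)"
      using assms by (intro sum_le_suminf summable_exp_generic) auto
    then show ?thesis by (simp add: divide_inverse mult.commute)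
  qed
  also have "\<dots> = exp (s * x)" by (simp add: exp_def)
  finally show ?thesis using assms by (simp add: field_simps power_mult_distrib)
qed

text \<open>The decay of \<open>jr\<close> is expressed in sqrt y * u. The inequality y (1 + u^2)
  \<le> (1 + y)(1 + y u^2) moves it to u at the price of y^L, which is taken from the factor
  y^r.\<close>

lemma wk_bound:
  assumes "2 * L \<le> r"
  obtains C where "C > 0" "\<And>u y. \<bar>wk r u y\<bar> \<le> indicator {0<..} y * (C * (1 + y) ^ Suc r) / (1 + u\<^sup>2) ^ L"
proof -
  obtain C where C: "C > 0" "\<And>u. \<bar>jr r u\<bar> \<le> C / (1 + u\<^sup>2) ^ L" using jr_bound[OF assms] by metis
  show thesis
  proof (rule that[OF C(1)])
    fix u y :: real
    show "\<bar>wk r u y\<bar> \<le> indicator {0<..} y * (C * (1 + y) ^ Suc r) / (1 + u\<^sup>2) ^ L"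
    proof (cases "y > 0")
      case True
      have "y * (1 + u\<^sup>2) \<le> (1 + y) * (1 + (sqrt y * u)\<^sup>2)"
        using True by (simp add: power_mult_distrib algebra_simps)
      then have "(y * (1 + u\<^sup>2)) ^ L \<le> ((1 + y) * (1 + (sqrt y * u)\<^sup>2)) ^ L"
        using True by (intro power_mono) auto
      then have 1: "y ^ L / (1 + (sqrt y * u)\<^sup>2) ^ L \<le> (1 + y) ^ L / (1 + u\<^sup>2) ^ L"
      proof -
        have "a * c \<le> b * d \<Longrightarrow> c > 0 \<Longrightarrow> d > 0 \<Longrightarrow> a / d \<le> b / c" for a b c d :: real
          by (simp add: field_simps)
        then show ?thesis
          using \<open>(y * (1 + u\<^sup>2)) ^ L \<le> _\<close> unfolding power_mult_distrib[of y] power_mult_distrib[of "1 + y"]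
          by (blast intro: one_plus_sq_power_pos)
      qed
      have s: "sqrt y \<le> 1 + y" using True sqrt_le_D[of y "1 + y"] by (intro real_le_lsqrt) (auto simp: power2_eq_square algebra_simps)
      have "\<bar>wk r u y\<bar> = sqrt y * y ^ r * \<bar>jr r (sqrt y * u)\<bar>"
        using True by (simp add: wk_def abs_mult)
      also have "\<dots> \<le> sqrt y * y ^ r * (C / (1 + (sqrt y * u)\<^sup>2) ^ L)"
        using True C by (intro mult_left_mono) auto
      also have "\<dots> = sqrt y * C * y ^ (r - L) * (y ^ L / (1 + (sqrt y * u)\<^sup>2) ^ L)"
        using assms by (simp add: power_add[symmetric])
      also have "\<dots> \<le> (1 + y) * C * (1 + y) ^ (r - L) * ((1 + y) ^ L / (1 + u\<^sup>2) ^ L)"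
        using True C s 1 by (intro mult_mono power_mono) auto
      also have "\<dots> = C * ((1 + y) * ((1 + y) ^ (r - L) * (1 + y) ^ L)) / (1 + u\<^sup>2) ^ L" by (simp add: mult_ac)
      also have "(1 + y) ^ (r - L) * (1 + y) ^ L = (1 + y) ^ r"
        using assms by (simp add: power_add[symmetric])
      finally show ?thesis using True by simp
    qed (simp add: wk_def)
  qed
qed

lemma wk_continuous: "continuous_on {0<..} (\<lambda>y. wk r u y)"
proof -
  have "continuous_on {0<..} (\<lambda>y. sqrt y * y ^ r * jr r (sqrt y * u))"
    by (intro continuous_intros continuous_on_compose2[OF jr_continuous]) auto
  then show ?thesis
    by (rule continuous_on_eq) (simp add: wk_def)
qed

text \<open>The primitive of w from a point p > 0 vanishes near x, and by continuity its derivative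
  there is w x. The base point is x/2 because continuity is known on the open half line
  only.\<close>

lemma laplace_null_imp_zero:
  fixes w :: "real \<Rightarrow> complex"
  assumes null: "\<And>t. t < a \<Longrightarrow> (\<integral>y. indicator {..<t} y *\<^sub>R w y \<partial>lborel) = 0"
    and cont: "continuous_on {0<..} w" and int: "\<And>t. integrable lborel (\<lambda>y. indicator {..<t} y *\<^sub>R w y)"
    and x: "0 < x" "x < a"
  shows "w x = 0"
proof -
  define p where "p = x / 2"
  define q where "q = (x + a) / 2"
  have pq: "0 < p" "p < x" "x < q" "q < a" using x by (auto simp: p_def q_def)
  have z: "integral {p..u} w = 0" if u: "u \<in> {p..q}" for u
  proof -
    have cu: "continuous_on {p..u} w" by (rule continuous_on_subset[OF cont]) (use pq in auto)
    have si: "set_integrable lborel {p..u} w" by (intro borel_integrable_atLeastAtMost' cu)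
    have "integral {p..u} w = (\<integral>y. indicator {p..u} y *\<^sub>R w y \<partial>lborel)"
      using set_borel_integral_eq_integral(2)[OF si] by (simp add: set_lebesgue_integral_def)
    also have "\<dots> = (\<integral>y. indicator {..<u} y *\<^sub>R w y - indicator {..<p} y *\<^sub>R w y \<partial>lborel)"
    proof (rule integral_cong_AE)
      have "AE y in lborel. y \<noteq> u" by (rule AE_lborel_singleton)
      then show "AE y in lborel. indicator {p..u} y *\<^sub>R w y = indicator {..<u} y *\<^sub>R w y - indicator {..<p} y *\<^sub>R w y"
        by eventually_elim (use u in \<open>auto split: split_indicator\<close>)
      show "(\<lambda>y. indicator {p..u} y *\<^sub>R w y) \<in> borel_measurable lborel"
        using si unfolding set_integrable_def by (rule borel_measurable_integrable)
      show "(\<lambda>y. indicator {..<u} y *\<^sub>R w y - indicator {..<p} y *\<^sub>R w y) \<in> borel_measurable lborel"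
        by (intro borel_measurable_diff borel_measurable_integrable[OF int])
    qed
    also have "\<dots> = 0" using u pq null[of u] null[of p] by (subst Bochner_Integration.integral_diff[OF int int]) simp
    finally show ?thesis .
  qed
  have cq: "continuous_on {p..q} w" by (rule continuous_on_subset[OF cont]) (use pq in auto)
  have "((\<lambda>u. integral {p..u} w) has_vector_derivative w x) (at x within {p..q})"
    by (rule integral_has_vector_derivative[OF cq]) (use pq in auto)
  then have "((\<lambda>u. 0) has_vector_derivative w x) (at x within {p..q})"
    by (rule has_vector_derivative_transform[rotated 2]) (use z pq in auto)
  moreover have "((\<lambda>u. 0) has_vector_derivative (0::complex)) (at x within {p..q})" by (rule has_vector_derivative_const)
  moreover have "at x within {p..q} \<noteq> bot" using pq by (simp add: at_within_Icc_at)
  ultimately show ?thesis by (metis vector_derivative_unique_within)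
qed

text \<open>Summing \<open>wk\<close> over the spectrum gives a function w whose Laplace transform
  at s is, up to a power of s, the heat sum at time 1/(4s), hence of order exp(-4 A s) up to powers.
  So w vanishes below 4A, in particular at 1, where \<open>wk\<close> equals \<open>jr\<close>; this
  is the condition 1/4 < A.\<close>

lemma finite_speed_0:
  fixes a :: "nat \<Rightarrow> complex" and l :: "nat \<Rightarrow> real"
  assumes Lr: "2 * L \<le> r" and sm: "summable (\<lambda>k. cmod (a k) / (1 + (l k)\<^sup>2) ^ L)"
    and t0: "t0 > 0" and A: "A > 1/4"
    and heat: "\<And>t. 0 < t \<Longrightarrow> t \<le> t0 \<Longrightarrow> cmod (\<Sum>k. a k * exp (- (t * (l k)\<^sup>2))) \<le> C * t powr (- b) * exp (- A / t)"
  shows "(\<Sum>k. a k * jr r (l k)) = 0"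
proof -
  obtain D where D: "D > 0" "\<And>u y. \<bar>wk r u y\<bar> \<le> indicator {0<..} y * (D * (1 + y) ^ Suc r) / (1 + u\<^sup>2) ^ L"
    using wk_bound[OF Lr] by metis
  define W where "W = (\<Sum>k. cmod (a k) / (1 + (l k)\<^sup>2) ^ L)"
  define w where "w = (\<lambda>y. \<Sum>k. a k * complex_of_real (wk r (l k) y))"
  have tb: "norm (a k * complex_of_real (wk r (l k) y)) \<le> indicator {0<..} y * (D * (1 + y) ^ Suc r) * (cmod (a k) / (1 + (l k)\<^sup>2) ^ L)" for k y
  proof -
    have "norm (a k * complex_of_real (wk r (l k) y)) \<le> cmod (a k) * (indicator {0<..} y * (D * (1 + y) ^ Suc r) / (1 + (l k)\<^sup>2) ^ L)"
      unfolding norm_mult norm_of_real by (intro mult_left_mono D) auto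
    then show ?thesis by (simp add: mult_ac)
  qed
  have sn: "summable (\<lambda>k. norm (a k * complex_of_real (wk r (l k) y)))" for y
    by (rule summable_comparison_test'[OF summable_mult[OF sm, of "indicator {0<..} y * (D * (1 + y) ^ Suc r)"], of 0])
       (use tb in simp)
  have wb: "norm (w y) \<le> indicator {0<..} y * (D * (1 + y) ^ Suc r) * W" for y
    unfolding w_def W_def using norm_suminf_le[OF tb summable_mult[OF sm]] suminf_mult[OF sm] by simp
  have [measurable]: "w \<in> borel_measurable borel" unfolding w_def by measurable
  have poly: "indicator {0<..} y * (D * (1 + y) ^ Suc r) \<le> E * exp (s * y)"
    if s: "s > 0" and E: "E = D * (fact (Suc r) / s ^ Suc r * exp s)" for s E y :: real
  proof (cases "y > 0")
    case True
    have "(1 + y) ^ Suc r \<le> fact (Suc r) / s ^ Suc r * exp (s * (1 + y))" by (rule power_le_fact_exp) (use True s in auto)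
    also have "\<dots> = fact (Suc r) / s ^ Suc r * exp s * exp (s * y)" by (simp add: exp_add algebra_simps)
    finally have "D * (1 + y) ^ Suc r \<le> D * (fact (Suc r) / s ^ Suc r * exp s * exp (s * y))" using D(1) by (intro mult_left_mono) auto
    then show ?thesis using True E by (simp add: mult_ac)
  next
    case False
    have "E \<ge> 0" unfolding E using D(1) s by auto
    then show ?thesis using False by simp
  qed
  have expint: "integrable lborel (\<lambda>y. exp (- s * y) * (indicator {0<..} y * (D * (1 + y) ^ Suc r)))" if s: "s > 0" for s
  proof -
    define E where "E = D * (fact (Suc r) / (s/2) ^ Suc r * exp (s/2))"
    have i: "integrable lborel (\<lambda>y. E * (indicator {0::real..} y * (exp (- (s/2) * y) * y ^ 0)))"
      by (intro integrable_mult_right integral_power_exp) (use s in simp)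
    show ?thesis
    proof (rule Bochner_Integration.integrable_bound[OF i])
      show "AE y in lborel. norm (exp (- s * y) * (indicator {0<..} y * (D * (1 + y) ^ Suc r)))
          \<le> norm (E * (indicator {0::real..} y * (exp (- (s/2) * y) * y ^ 0)))"
      proof (rule AE_I2)
        fix y :: real
        show "norm (exp (- s * y) * (indicator {0<..} y * (D * (1 + y) ^ Suc r)))
          \<le> norm (E * (indicator {0::real..} y * (exp (- (s/2) * y) * y ^ 0)))"
        proof (cases "y > 0")
          case True
          have E0: "E \<ge> 0" unfolding E_def using D(1) s by auto
          have "exp (- s * y) * (indicator {0<..} y * (D * (1 + y) ^ Suc r)) \<le> exp (- s * y) * (E * exp (s/2 * y))"
            using poly[OF _ E_def, of y] s by (intro mult_left_mono) auto
          also have "\<dots> = E * exp (- (s/2) * y)" by (simp add: exp_add[symmetric])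
          finally show ?thesis using True E0 D(1) by (simp add: abs_mult)
        qed simp
      qed
    qed measurable
  qed
  have wint: "integrable lborel (\<lambda>y. exp (- s * y) *\<^sub>R w y)" if s: "s > 0" for s
  proof (rule Bochner_Integration.integrable_bound[OF integrable_mult_left[OF expint[OF s], of W]])
    show "AE y in lborel. norm (exp (- s * y) *\<^sub>R w y) \<le> norm (exp (- s * y) * (indicator {0<..} y * (D * (1 + y) ^ Suc r)) * W)"
    proof (rule AE_I2)
      fix y
      have "norm (exp (- s * y) *\<^sub>R w y) \<le> exp (- s * y) * (indicator {0<..} y * (D * (1 + y) ^ Suc r) * W)"
        unfolding norm_scaleR abs_exp_cancel by (intro mult_left_mono wb) simp
      then show "norm (exp (- s * y) *\<^sub>R w y) \<le> norm (exp (- s * y) * (indicator {0<..} y * (D * (1 + y) ^ Suc r)) * W)"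
        unfolding real_norm_def mult.assoc by (rule order_trans[OF _ abs_ge_self])
    qed
  qed measurable
  have lap: "(\<integral>y. exp (- s * y) *\<^sub>R w y \<partial>lborel) =
      complex_of_real (fact r / s ^ Suc r * sqrt (pi / s)) * (\<Sum>k. a k * exp (- (1 / (4 * s) * (l k)\<^sup>2)))" if s: "s > 0" for s
  proof -
    define f where "f = (\<lambda>k y. exp (- s * y) *\<^sub>R (a k * complex_of_real (wk r (l k) y)))"
    have fb: "norm (f k y) \<le> (exp (- s * y) * (indicator {0<..} y * (D * (1 + y) ^ Suc r))) * (cmod (a k) / (1 + (l k)\<^sup>2) ^ L)" for k y
      unfolding f_def norm_scaleR abs_exp_cancel using mult_left_mono[OF tb[of k y], of "exp (- s * y)"] by (simp only: mult.assoc) simp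
    have [measurable]: "f k \<in> borel_measurable borel" for k unfolding f_def by measurable
    have fi: "integrable lborel (f k)" for k
      by (rule Bochner_Integration.integrable_bound[OF integrable_mult_left[OF expint[OF s], of "cmod (a k) / (1 + (l k)\<^sup>2) ^ L"]])
         (measurable, rule AE_I2, unfold real_norm_def, rule order_trans[OF fb abs_ge_self])
    have "(\<integral>y. exp (- s * y) *\<^sub>R w y \<partial>lborel) = (\<integral>y. (\<Sum>k. f k y) \<partial>lborel)"
      unfolding f_def w_def using summable_norm_cancel[OF sn] by (subst suminf_scaleR_right) auto
    also have "\<dots> = (\<Sum>k. \<integral>y. f k y \<partial>lborel)"
    proof (rule integral_suminf[OF fi])
      show "AE y in lborel. summable (\<lambda>k. norm (f k y))"
        unfolding f_def norm_scaleR by (intro AE_I2 summable_mult sn)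
      have "(\<integral>y. norm (f k y) \<partial>lborel) \<le> (\<integral>y. exp (- s * y) * (indicator {0<..} y * (D * (1 + y) ^ Suc r)) \<partial>lborel) * (cmod (a k) / (1 + (l k)\<^sup>2) ^ L)" for k
        unfolding integral_mult_left_zero[symmetric]
        by (intro integral_mono integrable_norm fi integrable_mult_left expint s fb)
      then show "summable (\<lambda>k. \<integral>y. norm (f k y) \<partial>lborel)"
        by (intro summable_comparison_test'[OF summable_mult[OF sm, of "\<integral>y. exp (- s * y) * (indicator {0<..} y * (D * (1 + y) ^ Suc r)) \<partial>lborel"], of 0]) simp
    qed
    also have "\<dots> = (\<Sum>k. complex_of_real (fact r / s ^ Suc r * sqrt (pi / s)) * (a k * exp (- (1 / (4 * s) * (l k)\<^sup>2))))"
    proof (rule suminf_cong)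
      fix k
      show "(\<integral>y. f k y \<partial>lborel) = complex_of_real (fact r / s ^ Suc r * sqrt (pi / s)) * (a k * exp (- (1 / (4 * s) * (l k)\<^sup>2)))"
      proof -
      have "f k = (\<lambda>y. a k * complex_of_real (exp (- s * y) * wk r (l k) y))"
        unfolding f_def by (auto simp: scaleR_conv_of_real)
      then have "(\<integral>y. f k y \<partial>lborel) = a k * complex_of_real (\<integral>y. exp (- s * y) * wk r (l k) y \<partial>lborel)"
        by (simp only: integral_mult_right_zero integral_complex_of_real)
      then show ?thesis unfolding wk_laplace[OF s] by simp
      qed
    qed
    also have "(\<Sum>k. complex_of_real (fact r / s ^ Suc r * sqrt (pi / s)) * (a k * exp (- (1 / (4 * s) * (l k)\<^sup>2)))) =
       complex_of_real (fact r / s ^ Suc r * sqrt (pi / s)) * (\<Sum>k. a k * exp (- (1 / (4 * s) * (l k)\<^sup>2)))"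
    proof (rule suminf_mult)
      obtain K where K: "\<And>u::real. (1 + u\<^sup>2) ^ L * exp (- (1 / (4 * s) * u\<^sup>2)) \<le> K"
      proof
        fix u :: real
        have "(1 + u\<^sup>2) ^ L \<le> fact L / (1/(4 * s)) ^ L * exp (1/(4 * s) * (1 + u\<^sup>2))"
          by (rule power_le_fact_exp) (use s in auto)
        then have "(1 + u\<^sup>2) ^ L * exp (- (1 / (4 * s) * u\<^sup>2)) \<le> fact L / (1/(4 * s)) ^ L * exp (1/(4 * s) * (1 + u\<^sup>2)) * exp (- (1 / (4 * s) * u\<^sup>2))"
          by (intro mult_right_mono) auto
        also have "\<dots> = fact L / (1/(4 * s)) ^ L * exp (1/(4 * s))"
          by (simp add: mult.assoc exp_add[symmetric] algebra_simps add_divide_distrib)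
        finally show "(1 + u\<^sup>2) ^ L * exp (- (1 / (4 * s) * u\<^sup>2)) \<le> fact L / (1/(4 * s)) ^ L * exp (1/(4 * s))" .
      qed
      have "norm (a k * exp (- (1 / (4 * s) * (l k)\<^sup>2))) \<le> K * (cmod (a k) / (1 + (l k)\<^sup>2) ^ L)" for k
      proof -
        note p = one_plus_sq_power_pos[of "l k" L]
        have "norm (a k * exp (- (1 / (4 * s) * (l k)\<^sup>2))) = ((1 + (l k)\<^sup>2) ^ L * exp (- (1 / (4 * s) * (l k)\<^sup>2))) * (cmod (a k) / (1 + (l k)\<^sup>2) ^ L)"
          using less_imp_neq[OF p] by (simp add: norm_mult)
        also have "\<dots> \<le> K * (cmod (a k) / (1 + (l k)\<^sup>2) ^ L)" using p by (intro mult_right_mono K) auto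
        finally show ?thesis .
      qed
      then show "summable (\<lambda>k. a k * exp (- (1 / (4 * s) * (l k)\<^sup>2)))"
        by (intro summable_norm_cancel[OF summable_comparison_test'[OF summable_mult[OF sm, of K], of 0]]) simp
    qed
    finally show ?thesis .
  qed
  \<comment> \<open>The midpoint of 1 and 4A. It still lies to the right of the evaluation point 1,
    and the surplus \<delta> in the exponent absorbs the power of t in the heat bound.\<close>
  define a' where "a' = (1 + 4 * A) / 2"
  define \<delta> where "\<delta> = 4 * A - a'"
  have d: "\<delta> > 0" "a' > 1" using A by (auto simp: \<delta>_def a'_def field_simps)
  \<comment> \<open>For s beyond 1/(4 t0) the time 1/(4s) lies in the range of the heat bound; s
    \<ge> 1 keeps the prefactor of the Laplace transform below its value at s = 1.\<close>
  define s0 where "s0 = max 1 (1 / (4 * t0))"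
  have s0: "s0 \<ge> 1" by (simp add: s0_def)
  obtain n :: nat where n: "b \<le> real n" using real_arch_simple by blast
  define K where "K = fact r * sqrt pi * (\<bar>C\<bar> * (fact n / (\<delta>/4) ^ n))"
  have bnd: "cmod (\<integral>y. exp (- s * y) *\<^sub>R w y \<partial>lborel) \<le> K * exp (- a' * s)" if s: "s \<ge> s0" for s
  proof -
    have s1: "s \<ge> 1" "s \<ge> 1 / (4 * t0)" using s by (auto simp: s0_def)
    then have tt: "0 < 1 / (4 * s)" "1 / (4 * s) \<le> t0" using t0 by (auto simp: field_simps)
    have h: "cmod (\<Sum>k. a k * exp (- (1 / (4 * s) * (l k)\<^sup>2))) \<le> C * (1 / (4 * s)) powr (- b) * exp (- A / (1 / (4 * s)))"
      by (rule heat[OF tt])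
    also have "\<dots> \<le> \<bar>C\<bar> * (fact n / (\<delta>/4) ^ n * exp (\<delta> * s)) * exp (- A / (1 / (4 * s)))"
    proof -
      have "(1 / (4 * s)) powr (- b) = (4 * s) powr b"
        using s1 by (simp add: powr_minus powr_divide)
      also have "\<dots> \<le> (4 * s) powr real n" using s1 n by (intro powr_mono) auto
      also have "\<dots> = (4 * s) ^ n" using s1 by (simp add: powr_realpow)
      also have "\<dots> \<le> fact n / (\<delta>/4) ^ n * exp (\<delta>/4 * (4 * s))" by (rule power_le_fact_exp) (use s1 d in auto)
      finally have *: "(1 / (4 * s)) powr (- b) \<le> fact n / (\<delta>/4) ^ n * exp (\<delta> * s)" by simp
      show ?thesis by (intro mult_right_mono mult_mono *) auto
    qed
    also have "\<dots> = \<bar>C\<bar> * (fact n / (\<delta>/4) ^ n) * exp (- a' * s)"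
    proof -
      have "exp (\<delta> * s) * exp (- A / (1 / (4 * s))) = exp (- a' * s)"
        unfolding exp_add[symmetric] \<delta>_def by (simp add: algebra_simps)
      then show ?thesis by (simp only: mult.assoc)
    qed
    finally have h2: "cmod (\<Sum>k. a k * exp (- (1 / (4 * s) * (l k)\<^sup>2))) \<le> \<bar>C\<bar> * (fact n / (\<delta>/4) ^ n) * exp (- a' * s)" .
    have c: "0 \<le> fact r / s ^ Suc r * sqrt (pi / s)" "fact r / s ^ Suc r * sqrt (pi / s) \<le> fact r * sqrt pi"
    proof -
      show "0 \<le> fact r / s ^ Suc r * sqrt (pi / s)" using s1 by simp
      have 1: "fact r / s ^ Suc r \<le> fact r / 1" using s1 one_le_power[of s "Suc r"] by (intro divide_left_mono) auto
      have "pi / s \<le> pi / 1" using s1 by (intro divide_left_mono) auto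
      then have 2: "sqrt (pi / s) \<le> sqrt (pi / 1)" by (rule real_sqrt_le_mono)
      have "fact r / s ^ Suc r * sqrt (pi / s) \<le> fact r / 1 * sqrt (pi / 1)"
        by (rule mult_mono[OF 1 2]) (use s1 in simp_all)
      then show "fact r / s ^ Suc r * sqrt (pi / s) \<le> fact r * sqrt pi" by simp
    qed
    have "cmod (\<integral>y. exp (- s * y) *\<^sub>R w y \<partial>lborel) = (fact r / s ^ Suc r * sqrt (pi / s)) * cmod (\<Sum>k. a k * exp (- (1 / (4 * s) * (l k)\<^sup>2)))"
    proof -
      have "s > 0" using s1 by linarith
      then show ?thesis by (simp only: lap norm_mult norm_of_real abs_of_nonneg[OF c(1)])
    qed
    also have "\<dots> \<le> (fact r * sqrt pi) * (\<bar>C\<bar> * (fact n / (\<delta>/4) ^ n) * exp (- a' * s))"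
      by (rule mult_mono[OF c(2) h2]) auto
    finally show ?thesis by (simp add: K_def mult_ac)
  qed
  have null: "(\<integral>y. indicator {..<t} y *\<^sub>R w y \<partial>lborel) = 0" if "t < a'" for t
    using that s0 by (intro mikusinski[OF wint _ _ bnd]) (auto simp: w_def wk_def)
  have cont: "continuous_on {0<..} w"
  proof (rule continuous_on_open_UN[of UNIV "\<lambda>n::nat. {0<..<real n}", simplified, THEN continuous_on_subset])
    fix n :: nat
    \<comment> \<open>The bound on the terms grows polynomially in y, so convergence is uniform on
      bounded intervals only; these exhaust the half line.\<close>
    have "uniform_limit {0<..<real n} (\<lambda>N y. \<Sum>k<N. a k * complex_of_real (wk r (l k) y)) w sequentially"
      unfolding w_def
    proof (rule Weierstrass_m_test)
      show "norm (a k * complex_of_real (wk r (l k) y)) \<le> (D * (1 + real n) ^ Suc r) * (cmod (a k) / (1 + (l k)\<^sup>2) ^ L)" if "y \<in> {0<..<real n}" for k y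
      proof (rule order_trans[OF tb])
        have "D * (1 + y) ^ Suc r \<le> D * (1 + real n) ^ Suc r" using that D(1) by (intro mult_left_mono power_mono) auto
        then show "indicator {0<..} y * (D * (1 + y) ^ Suc r) * (cmod (a k) / (1 + (l k)\<^sup>2) ^ L) \<le> (D * (1 + real n) ^ Suc r) * (cmod (a k) / (1 + (l k)\<^sup>2) ^ L)"
          using that by (intro mult_right_mono) auto
      qed
    qed (intro summable_mult sm)
    then show "continuous_on {0<..<real n} w"
      by (rule uniform_limit_theorem[rotated])
         (auto intro!: always_eventually continuous_intros continuous_on_subset[OF wk_continuous])
  next
    show "{0<..} \<subseteq> (\<Union>n. {0<..<real n})" by (auto simp: reals_Archimedean2)
  qed
  have wint2: "integrable lborel (\<lambda>y. indicator {..<t} y *\<^sub>R w y)" for t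
  proof (rule Bochner_Integration.integrable_bound[OF integrable_scaleR_right[OF wint[of 1], of "exp \<bar>t\<bar>"]])
    show "AE y in lborel. norm (indicator {..<t} y *\<^sub>R w y) \<le> norm (exp \<bar>t\<bar> *\<^sub>R (exp (- 1 * y) *\<^sub>R w y))"
    proof (rule AE_I2)
      fix y
      show "norm (indicator {..<t} y *\<^sub>R w y) \<le> norm (exp \<bar>t\<bar> *\<^sub>R (exp (- 1 * y) *\<^sub>R w y))"
      proof (cases "y < t")
        case True
        have "1 \<le> exp \<bar>t\<bar> * exp (- 1 * y)" unfolding exp_add[symmetric] using True by simp
        then have "1 * norm (w y) \<le> (exp \<bar>t\<bar> * exp (- 1 * y)) * norm (w y)" by (intro mult_right_mono) auto
        then show ?thesis using True by simp
      qed simp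
    qed
  qed simp_all
  have "w 1 = 0"
    by (rule laplace_null_imp_zero[OF null cont wint2]) (use d in auto)
  then show ?thesis by (simp add: w_def wk_def)
qed

section \<open>Even moments and shifts of the frequency\<close>

lemma osc_Suc_Suc: "osc r r (Suc (Suc m)) u \<theta> = osc r r m u \<theta> - osc (Suc r) (Suc r) m u \<theta>"
proof -
  have "(1 - x) ^ r * (1 + x) ^ r * x ^ Suc (Suc m) * cos (x * u + \<theta>) =
      (1 - x) ^ r * (1 + x) ^ r * x ^ m * cos (x * u + \<theta>) - (1 - x) ^ Suc r * (1 + x) ^ Suc r * x ^ m * cos (x * u + \<theta>)" for x :: real
    by (simp add: algebra_simps)
  then show ?thesis
    unfolding osc_def by (simp only: Henstock_Kurzweil_Integration.integral_diff[OF osc_integrable osc_integrable])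
qed

lemma summable_osc:
  fixes a :: "nat \<Rightarrow> complex" and l :: "nat \<Rightarrow> real"
  assumes Lr: "2 * L \<le> r" and sm: "summable (\<lambda>k. cmod (a k) / (1 + (l k)\<^sup>2) ^ L)"
  shows "summable (\<lambda>k. a k * osc r r m (l k) 0)"
proof -
  define K where "K = 2 ^ L * real (1 + 2 * r + m) ^ (2 * L) * (2 * 4 ^ (2 * r + m + 1))"
  have "norm (a k * osc r r m (l k) 0) \<le> K * (cmod (a k) / (1 + (l k)\<^sup>2) ^ L)" for k
    using mult_left_mono[OF osc_weight_bound[OF Lr, of m "l k" 0], of "cmod (a k)"]
    unfolding norm_mult norm_of_real by (simp add: K_def mult_ac)
  then show ?thesis
    by (intro summable_norm_cancel[OF summable_comparison_test'[OF summable_mult[OF sm, of K], of 0]]) simp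
qed

text \<open>
  Since $z^2 = 1 - (1 - z^2)$, the case of $z^{2m}$ reduces to \<open>finite_speed_0\<close> with larger \<open>r\<close>.
\<close>

lemma finite_speed_even:
  fixes a :: "nat \<Rightarrow> complex" and l :: "nat \<Rightarrow> real"
  assumes Lr: "2 * L \<le> r" and sm: "summable (\<lambda>k. cmod (a k) / (1 + (l k)\<^sup>2) ^ L)"
    and t0: "t0 > 0" and A: "A > 1/4"
    and heat: "\<And>t. 0 < t \<Longrightarrow> t \<le> t0 \<Longrightarrow> cmod (\<Sum>k. a k * exp (- (t * (l k)\<^sup>2))) \<le> C * t powr (- b) * exp (- A / t)"
  shows "(\<Sum>k. a k * osc r r (2 * m) (l k) 0) = 0"
  using Lr
proof (induction m arbitrary: r)
  case 0
  from finite_speed_0[OF 0 sm t0 A heat] show ?case by (simp add: jr_def)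
next
  case (Suc m)
  have "(\<Sum>k. a k * osc r r (2 * Suc m) (l k) 0) = (\<Sum>k. a k * osc r r (2 * m) (l k) 0 - a k * osc (Suc r) (Suc r) (2 * m) (l k) 0)"
    by (simp add: osc_Suc_Suc algebra_simps)
  also have "\<dots> = (\<Sum>k. a k * osc r r (2 * m) (l k) 0) - (\<Sum>k. a k * osc (Suc r) (Suc r) (2 * m) (l k) 0)"
    by (intro suminf_diff[symmetric] summable_osc[OF _ sm]) (use Suc.prems in auto)
  also have "\<dots> = 0" using Suc.IH[of r] Suc.IH[of "Suc r"] Suc.prems by simp
  finally show ?case .
qed

text \<open>The mean of the two shifts is the integral of (1 - z^2)^r cos(zu) cos(zv). Expanding
  cos(zv) produces the moments \<open>osc r r m\<close>, and for |z| \<le> 1 the Taylor remainder is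
  at most |v|^n / n!.\<close>

lemma osc_cos_series_error:
  "\<bar>(jr r (u + v) + jr r (u - v)) / 2 - (\<Sum>m<n. cos_coeff m * v ^ m * osc r r m u 0)\<bar> \<le> 4 ^ (r + r + 1) * (\<bar>v\<bar> ^ n / fact n)"
proof -
  let ?g = "\<lambda>z::real. (1 - z) ^ r * (1 + z) ^ r * z ^ 0"
  have int: "(\<lambda>z. ?g z * cos (z * u + 0) * cos (z * v)) integrable_on {-1..1}"
    by (intro integrable_continuous_real continuous_intros)
  have e: "(jr r (u + v) + jr r (u - v)) / 2 = integral {-1..1} (\<lambda>z. ?g z * cos (z * u + 0) * cos (z * v))"
  proof -
    have "jr r (u + v) + jr r (u - v) = integral {-1..1} (\<lambda>z. ?g z * cos (z * (u + v) + 0) + ?g z * cos (z * (u - v) + 0))"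
      unfolding jr_def osc_def by (rule Henstock_Kurzweil_Integration.integral_add[symmetric]) (rule osc_integrable)+
    also have "\<dots> = integral {-1..1} (\<lambda>z. 2 * (?g z * cos (z * u + 0) * cos (z * v)))"
      by (rule Henstock_Kurzweil_Integration.integral_cong) (simp add: distrib_left right_diff_distrib cos_add cos_diff algebra_simps)
    also have "\<dots> = 2 * integral {-1..1} (\<lambda>z. ?g z * cos (z * u + 0) * cos (z * v))" by simp
    finally show ?thesis by simp
  qed
  have s: "(\<Sum>m<n. cos_coeff m * v ^ m * osc r r m u 0) = integral {-1..1} (\<lambda>z. ?g z * cos (z * u + 0) * (\<Sum>m<n. cos_coeff m * (z * v) ^ m))"
    and int2: "(\<lambda>z. ?g z * cos (z * u + 0) * (\<Sum>m<n. cos_coeff m * (z * v) ^ m)) integrable_on {-1..1}"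
  proof -
    have "((\<lambda>z. \<Sum>m<n. (cos_coeff m * v ^ m) * ((1 - z) ^ r * (1 + z) ^ r * z ^ m * cos (z * u + 0))) has_integral
       (\<Sum>m<n. (cos_coeff m * v ^ m) * osc r r m u 0)) {-1..1}"
      unfolding osc_def by (intro has_integral_sum has_integral_mult_right integrable_integral osc_integrable) auto
    moreover have "(\<lambda>z. \<Sum>m<n. (cos_coeff m * v ^ m) * ((1 - z) ^ r * (1 + z) ^ r * z ^ m * cos (z * u + 0))) =
      (\<lambda>z. ?g z * cos (z * u + 0) * (\<Sum>m<n. cos_coeff m * (z * v) ^ m))"
      by (simp add: sum_distrib_left power_mult_distrib mult_ac)
    ultimately have h: "((\<lambda>z. ?g z * cos (z * u + 0) * (\<Sum>m<n. cos_coeff m * (z * v) ^ m)) has_integral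
       (\<Sum>m<n. (cos_coeff m * v ^ m) * osc r r m u 0)) {-1..1}" by simp
    show "(\<Sum>m<n. cos_coeff m * v ^ m * osc r r m u 0) = integral {-1..1} (\<lambda>z. ?g z * cos (z * u + 0) * (\<Sum>m<n. cos_coeff m * (z * v) ^ m))"
      using integral_unique[OF h] by simp
    show "(\<lambda>z. ?g z * cos (z * u + 0) * (\<Sum>m<n. cos_coeff m * (z * v) ^ m)) integrable_on {-1..1}" using h by blast
  qed
  have "norm (integral {-1..1} (\<lambda>z. ?g z * cos (z * u + 0) * cos (z * v) - ?g z * cos (z * u + 0) * (\<Sum>m<n. cos_coeff m * (z * v) ^ m)))
     \<le> (4 ^ (r + r) * (\<bar>v\<bar> ^ n / fact n)) * (1 - (-1))"
  proof (rule integral_bound)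
    show "continuous_on {-1..1} (\<lambda>z. ?g z * cos (z * u + 0) * cos (z * v) - ?g z * cos (z * u + 0) * (\<Sum>m<n. cos_coeff m * (z * v) ^ m))"
      by (intro continuous_intros)
    fix z :: real assume z: "z \<in> {-1..1}"
    obtain t where "cos (z * v) = (\<Sum>m<n. cos_coeff m * (z * v) ^ m) + cos (t + 1/2 * real n * pi) / fact n * (z * v) ^ n"
      using Maclaurin_cos_expansion by blast
    then have "?g z * cos (z * u + 0) * cos (z * v) - ?g z * cos (z * u + 0) * (\<Sum>m<n. cos_coeff m * (z * v) ^ m)
       = (?g z * cos (z * u + 0)) * (cos (t + 1/2 * real n * pi) / fact n * (z * v) ^ n)"
      by (simp add: algebra_simps)
    also have "norm \<dots> = (\<bar>1 - z\<bar> ^ r * \<bar>1 + z\<bar> ^ r * \<bar>cos (z * u + 0)\<bar>) * (\<bar>cos (t + 1/2 * real n * pi)\<bar> / fact n * (\<bar>z\<bar> ^ n * \<bar>v\<bar> ^ n))"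
      by (simp add: abs_mult power_abs power_mult_distrib)
    also have "\<dots> \<le> (4 ^ r * 4 ^ r * 1) * (1 / fact n * (1 ^ n * \<bar>v\<bar> ^ n))"
      using z by (intro mult_mono divide_right_mono power_mono) auto
    finally show "norm (?g z * cos (z * u + 0) * cos (z * v) - ?g z * cos (z * u + 0) * (\<Sum>m<n. cos_coeff m * (z * v) ^ m)) \<le> 4 ^ (r + r) * (\<bar>v\<bar> ^ n / fact n)"
      by (simp add: power_add)
  qed auto
  also have "\<dots> \<le> 4 ^ (r + r + 1) * (\<bar>v\<bar> ^ n / fact n)"
  proof -
    have "2 * (4 ^ (r + r) * (\<bar>v\<bar> ^ n / fact n)) \<le> 4 * (4 ^ (r + r) * (\<bar>v\<bar> ^ n / fact n))"
      by (rule mult_right_mono) simp_all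
    then show ?thesis by (simp add: mult_ac)
  qed
  finally show ?thesis
    unfolding e s Henstock_Kurzweil_Integration.integral_diff[OF int int2] by simp
qed

lemma cos_coeff_abs_le: "\<bar>cos_coeff m\<bar> \<le> 1 / fact m"
  by (simp add: cos_coeff_def abs_mult power_abs)

text \<open>The free shift v makes it possible to synthesize other multipliers by superposition.
  Symmetrizing in v leaves only even powers of z, which \<open>finite_speed_even\<close>
  annihilates; the cosine series is then summed by Tannery's theorem under a majorant uniform in the
  truncation.\<close>

theorem finite_speed:
  fixes a :: "nat \<Rightarrow> complex" and l :: "nat \<Rightarrow> real"
  assumes Lr: "2 * L \<le> r" and sm: "summable (\<lambda>k. cmod (a k) / (1 + (l k)\<^sup>2) ^ L)"
    and t0: "t0 > 0" and A: "A > 1/4"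
    and heat: "\<And>t. 0 < t \<Longrightarrow> t \<le> t0 \<Longrightarrow> cmod (\<Sum>k. a k * exp (- (t * (l k)\<^sup>2))) \<le> C * t powr (- b) * exp (- A / t)"
  shows "(\<Sum>k. a k * (jr r (l k + v) + jr r (l k - v))) = 0"
proof -
  define S where "S = (\<lambda>n u. \<Sum>m<n. cos_coeff m * v ^ m * osc r r m u 0)"
  \<comment> \<open>The polynomial growth in m of the moment bounds is majorized by exp(m), by
    \<open>power_le_fact_exp\<close>. Together with 4^m and the 1/m! of the cosine series it sums to
    the last factor.\<close>
  define K where "K = 2 ^ L * (fact (2 * L) * exp (real (1 + 2 * r))) * (2 * 4 ^ (2 * r + 1)) * exp (4 * exp 1 * \<bar>v\<bar>)"
  have lim: "(\<lambda>n. S n u) \<longlonglongrightarrow> (jr r (u + v) + jr r (u - v)) / 2" for u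
  proof -
    have "(\<lambda>n. (\<bar>v\<bar> ^ n / fact n)) \<longlonglongrightarrow> 0"
      using summable_LIMSEQ_zero[OF summable_exp[of "\<bar>v\<bar>"]] by (simp add: divide_inverse mult.commute)
    from tendsto_mult_right_zero[OF this, of "4 ^ (r + r + 1)"]
    have "(\<lambda>n. (jr r (u + v) + jr r (u - v)) / 2 - S n u) \<longlonglongrightarrow> 0"
      by (rule Lim_null_comparison[rotated]) (intro always_eventually allI, unfold S_def real_norm_def, rule osc_cos_series_error)
    from tendsto_diff[OF tendsto_const[of "(jr r (u + v) + jr r (u - v)) / 2"] this] show ?thesis by simp
  qed
  have bound: "\<bar>S n u\<bar> \<le> K / (1 + u\<^sup>2) ^ L" for n u
  proof -
    define c where "c = 2 ^ L * (fact (2 * L) * exp (real (1 + 2 * r))) * (2 * 4 ^ (2 * r + 1))"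
    define z where "z = 4 * exp 1 * \<bar>v\<bar>"
    have tm: "\<bar>cos_coeff m * v ^ m * osc r r m u 0\<bar> \<le> (c / (1 + u\<^sup>2) ^ L) * (z ^ m /\<^sub>R fact m)" for m
    proof -
      have "real (1 + 2 * r + m) ^ (2 * L) \<le> fact (2 * L) / 1 ^ (2 * L) * exp (1 * real (1 + 2 * r + m))"
        by (rule power_le_fact_exp) auto
      also have "\<dots> = fact (2 * L) * exp (real (1 + 2 * r)) * exp 1 ^ m"
        by (simp add: exp_add exp_of_nat_mult[symmetric] mult_ac)
      finally have p: "real (1 + 2 * r + m) ^ (2 * L) \<le> fact (2 * L) * exp (real (1 + 2 * r)) * exp 1 ^ m" .
      have "\<bar>cos_coeff m * v ^ m * osc r r m u 0\<bar> = \<bar>cos_coeff m\<bar> * \<bar>v\<bar> ^ m * \<bar>osc r r m u 0\<bar>"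
        by (simp add: abs_mult power_abs)
      also have "\<dots> \<le> (1 / fact m) * \<bar>v\<bar> ^ m * (2 ^ L * real (1 + 2 * r + m) ^ (2 * L) * (2 * 4 ^ (2 * r + m + 1)) / (1 + u\<^sup>2) ^ L)"
        by (intro mult_mono cos_coeff_abs_le osc_weight_bound[OF Lr]) auto
      also have "\<dots> \<le> (1 / fact m) * \<bar>v\<bar> ^ m * (2 ^ L * (fact (2 * L) * exp (real (1 + 2 * r)) * exp 1 ^ m) * (2 * 4 ^ (2 * r + m + 1)) / (1 + u\<^sup>2) ^ L)"
        by (intro mult_left_mono divide_right_mono mult_right_mono p) auto
      also have "\<dots> = (c / (1 + u\<^sup>2) ^ L) * (z ^ m /\<^sub>R fact m)"
        by (simp add: c_def z_def power_mult_distrib power_add field_simps)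
      finally show ?thesis .
    qed
    have c0: "c / (1 + u\<^sup>2) ^ L \<ge> 0" unfolding c_def by (intro divide_nonneg_pos) auto
    have "\<bar>S n u\<bar> \<le> (\<Sum>m<n. (c / (1 + u\<^sup>2) ^ L) * (z ^ m /\<^sub>R fact m))"
      unfolding S_def by (rule order_trans[OF sum_abs sum_mono[OF tm]])
    also have "\<dots> = (c / (1 + u\<^sup>2) ^ L) * (\<Sum>m<n. z ^ m /\<^sub>R fact m)" by (simp only: sum_distrib_left)
    also have "\<dots> \<le> (c / (1 + u\<^sup>2) ^ L) * exp z"
      unfolding exp_def by (intro mult_left_mono c0 sum_le_suminf summable_exp_generic) (auto simp: z_def)
    finally show ?thesis by (simp add: K_def c_def z_def)
  qed
  have zero: "(\<Sum>k. a k * S n (l k)) = 0" for n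
  proof -
    have "(\<Sum>k. a k * S n (l k)) = (\<Sum>k. \<Sum>m<n. complex_of_real (cos_coeff m * v ^ m) * (a k * osc r r m (l k) 0))"
      unfolding S_def by (simp add: sum_distrib_left mult_ac)
    also have "\<dots> = (\<Sum>m<n. \<Sum>k. complex_of_real (cos_coeff m * v ^ m) * (a k * osc r r m (l k) 0))"
      by (intro suminf_sum summable_mult summable_osc[OF Lr sm])
    also have "\<dots> = (\<Sum>m<n. complex_of_real (cos_coeff m * v ^ m) * (\<Sum>k. a k * osc r r m (l k) 0))"
      by (intro sum.cong refl suminf_mult summable_osc[OF Lr sm])
    also have "\<dots> = 0"
    proof (rule sum.neutral, rule ballI)
      fix m
      show "complex_of_real (cos_coeff m * v ^ m) * (\<Sum>k. a k * osc r r m (l k) 0) = 0"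
      proof (cases "even m")
        case True
        then obtain m' where "m = 2 * m'" by blast
        then show ?thesis using finite_speed_even[OF Lr sm t0 A heat, of m'] by simp
      qed (simp add: cos_coeff_def)
    qed
    finally show ?thesis .
  qed
  have "(\<lambda>n. \<Sum>k. a k * complex_of_real (S n (l k))) \<longlonglongrightarrow> (\<Sum>k. a k * complex_of_real ((jr r (l k + v) + jr r (l k - v)) / 2))"
  proof (rule tannerys_theorem[THEN conjunct2, THEN conjunct2])
    show "(\<lambda>n. a k * complex_of_real (S n (l k))) \<longlonglongrightarrow> a k * complex_of_real ((jr r (l k + v) + jr r (l k - v)) / 2)" for k
      by (intro tendsto_mult tendsto_const tendsto_of_real lim)
    show "\<forall>\<^sub>F (k, n) in sequentially \<times>\<^sub>F sequentially. norm (a k * complex_of_real (S n (l k))) \<le> K * (cmod (a k) / (1 + (l k)\<^sup>2) ^ L)"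
    proof (intro always_eventually allI, clarify)
      fix k n
      have "cmod (a k) * \<bar>S n (l k)\<bar> \<le> cmod (a k) * (K / (1 + (l k)\<^sup>2) ^ L)" by (intro mult_left_mono bound) auto
      then show "norm (a k * complex_of_real (S n (l k))) \<le> K * (cmod (a k) / (1 + (l k)\<^sup>2) ^ L)"
        by (simp add: norm_mult mult_ac)
    qed
  qed (rule summable_mult[OF sm], simp)
  then have z: "(\<Sum>k. a k * complex_of_real ((jr r (l k + v) + jr r (l k - v)) / 2)) = 0"
    unfolding zero by (simp add: LIMSEQ_const_iff)
  have "summable (\<lambda>k. a k * complex_of_real ((jr r (l k + v) + jr r (l k - v)) / 2))"
  proof (rule summable_norm_cancel[OF summable_comparison_test'[OF summable_mult[OF sm, of K], of 0]])
    fix k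
    have "\<bar>(jr r (l k + v) + jr r (l k - v)) / 2\<bar> \<le> K / (1 + (l k)\<^sup>2) ^ L"
      by (rule LIMSEQ_le_const2[OF tendsto_rabs[OF lim]]) (use bound in auto)
    then have "cmod (a k) * \<bar>(jr r (l k + v) + jr r (l k - v)) / 2\<bar> \<le> cmod (a k) * (K / (1 + (l k)\<^sup>2) ^ L)"
      by (rule mult_left_mono) simp
    then show "norm (norm (a k * complex_of_real ((jr r (l k + v) + jr r (l k - v)) / 2))) \<le> K * (cmod (a k) / (1 + (l k)\<^sup>2) ^ L)"
      unfolding norm_mult norm_of_real real_norm_def by (simp only: abs_mult abs_idempotent abs_norm_cancel mult_ac times_divide_eq_right)
  qed
  from suminf_mult[OF this, of 2] z
  have "(\<Sum>k. 2 * (a k * complex_of_real ((jr r (l k + v) + jr r (l k - v)) / 2))) = 0" by simp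
  moreover have "2 * (a k * complex_of_real ((jr r (l k + v) + jr r (l k - v)) / 2)) = a k * (jr r (l k + v) + jr r (l k - v))" for k
    by simp
  ultimately show ?thesis by simp
qed

section \<open>Finite differences of a smooth filter\<close>

fun fd :: "nat \<Rightarrow> real \<Rightarrow> (real \<Rightarrow> real) \<Rightarrow> real \<Rightarrow> real" where
  "fd 0 d f u = f u"
| "fd (Suc n) d f u = fd n d f (u + d) - fd n d f u"

text \<open>The coefficients depend on n alone, so the difference can be integrated node by node.
  The value of \<open>c 0\<close> is what allows the undisplaced value of f to be isolated.\<close>

lemma fd_coeffs:
  obtains c :: "nat \<Rightarrow> real" where "c 0 = (-1) ^ n" "\<And>f d u. fd n d f u = (\<Sum>i\<le>n. c i * f (u + real i * d))"
proof -
  have "\<exists>c :: nat \<Rightarrow> real. c 0 = (-1) ^ n \<and> (\<forall>f d u. fd n d f u = (\<Sum>i\<le>n. c i * f (u + real i * d)))"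
  proof (induction n)
    case 0
    show ?case by (intro exI[of _ "\<lambda>_. 1"]) simp
  next
    case (Suc n)
    then obtain c :: "nat \<Rightarrow> real" where c: "c 0 = (-1) ^ n" "\<And>f d u. fd n d f u = (\<Sum>i\<le>n. c i * f (u + real i * d))" by blast
    define c' where "c' = (\<lambda>i. (if i = 0 then 0 else c (i - 1)) - (if i \<le> n then c i else 0))"
    have "fd (Suc n) d f u = (\<Sum>i\<le>Suc n. c' i * f (u + real i * d))" for f d u
    proof -
      have 1: "(\<Sum>i\<le>n. c i * f (u + d + real i * d)) = (\<Sum>i\<le>Suc n. (if i = 0 then 0 else c (i - 1)) * f (u + real i * d))"
        by (subst sum.atMost_Suc_shift) (simp add: algebra_simps)
      have 2: "(\<Sum>i\<le>n. c i * f (u + real i * d)) = (\<Sum>i\<le>Suc n. (if i \<le> n then c i else 0) * f (u + real i * d))"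
        by simp
      show ?thesis unfolding fd.simps c(2) 1 2 c'_def left_diff_distrib sum_subtractf ..
    qed
    moreover have "c' 0 = (-1) ^ Suc n" by (simp add: c'_def c(1))
    ultimately show ?case by blast
  qed
  then show thesis using that by blast
qed

lemma fd_cmult: "fd n d (\<lambda>u. k * f u) u = k * fd n d f u"
  by (induction n arbitrary: u) (auto simp: algebra_simps)

lemma fd_diff: "fd n d (\<lambda>u. f u - g u) u = fd n d f u - fd n d g u"
  by (induction n arbitrary: u) (auto simp: algebra_simps)

lemma fd_deriv:
  assumes "\<And>u. (f has_real_derivative f' u) (at u)"
  shows "(fd n d f has_real_derivative fd n d f' u) (at u)"
proof (induction n arbitrary: u)
  case 0
  have "fd 0 d f = f" "fd 0 d f' u = f' u" by auto
  then show ?case using assms by simp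
next
  case (Suc n)
  have e: "fd (Suc n) d f = (\<lambda>u. fd n d f (u + d) - fd n d f u)" by auto
  have "((\<lambda>u. fd n d f (u + d)) has_real_derivative fd n d f' (u + d)) (at u)"
    using Suc.IH[of "u + d"] by (simp add: DERIV_shift)
  from DERIV_diff[OF this Suc.IH[of u]] show ?case unfolding e by simp
qed

text \<open>One difference is estimated by the mean value inequality; the other n fall on the
  derivative.\<close>

lemma fd_Suc_bound:
  assumes der: "\<And>u. (f has_real_derivative f' u) (at u)" and M: "\<And>u. \<bar>fd n d f' u\<bar> \<le> M"
  shows "\<bar>fd (Suc n) d f u\<bar> \<le> M * \<bar>d\<bar>"
proof -
  have "norm (fd n d f (u + d) - fd n d f u) \<le> M * norm (u + d - u)"
    by (rule field_differentiable_bound[where S = UNIV and f' = "fd n d f'"])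
       (use M in \<open>auto intro: fd_deriv[OF der]\<close>)
  then show ?thesis by simp
qed

text \<open>
  For $v \ge 0$ the truncated power $(v^2-u^2)_+^S$ is \<open>trunc_prod v S S u\<close>, and unlike the truncated powers
  themselves these products are closed under differentiation, up to linear combinations.
\<close>

definition trunc_prod :: "real \<Rightarrow> nat \<Rightarrow> nat \<Rightarrow> real \<Rightarrow> real"
  where "trunc_prod v i j u = max 0 (v - u) ^ i * max 0 (v + u) ^ j"

lemma max0_power_deriv:
  assumes "n \<ge> 1"
  shows "((\<lambda>x::real. max 0 x ^ Suc n) has_real_derivative real (Suc n) * max 0 x ^ n) (at x)"
proof (cases "x = 0")
  case False
  show ?thesis
  proof (cases "x > 0")
    case True
    have "((\<lambda>x::real. x ^ Suc n) has_real_derivative real (Suc n) * x ^ n) (at x)"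
      using DERIV_pow[of "Suc n" x] by simp
    then have "((\<lambda>x::real. max 0 x ^ Suc n) has_real_derivative real (Suc n) * x ^ n) (at x)"
      by (rule has_field_derivative_transform_within_open[where S = "{0<..}"]) (use True in auto)
    then show ?thesis using True by simp
  next
    case False
    have "((\<lambda>x::real. 0) has_real_derivative 0) (at x)" by simp
    then have "((\<lambda>x::real. max 0 x ^ Suc n) has_real_derivative 0) (at x)"
      by (rule has_field_derivative_transform_within_open[where S = "{..<0}"]) (use False \<open>x \<noteq> 0\<close> in auto)
    moreover have "real (Suc n) * max 0 x ^ n = 0" using False assms by (simp add: max_absorb1)
    ultimately show ?thesis by (simp only:)
  qed
next
  case True
  have z: "max 0 (0::real) ^ n = 0" using assms by simp
  \<comment> \<open>At the kink the difference quotient is x^n to the right and 0 to the left, so it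
    tends to 0 because n is positive.\<close>
  have "((\<lambda>x::real. max 0 x ^ Suc n / x) \<longlongrightarrow> 0) (at 0)"
  proof (rule Lim_null_comparison)
    show "\<forall>\<^sub>F x in at 0. norm (max 0 x ^ Suc n / x :: real) \<le> max 0 x ^ n"
      by (auto simp: eventually_at_filter max_def)
    have "continuous (at 0) (\<lambda>x::real. max 0 x ^ n)" by (intro continuous_intros)
    then show "((\<lambda>x::real. max 0 x ^ n) \<longlongrightarrow> 0) (at 0)" unfolding continuous_within z .
  qed
  then show ?thesis unfolding True z has_field_derivative_iff by simp
qed

lemma trunc_prod_deriv:
  assumes "i \<ge> 1" "j \<ge> 1"
  shows "(trunc_prod v (Suc i) (Suc j) has_real_derivative
    (real (Suc j) * trunc_prod v (Suc i) j u - real (Suc i) * trunc_prod v i (Suc j) u)) (at u)"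
proof -
  have 1: "((\<lambda>u. max 0 (v - u) ^ Suc i) has_real_derivative (real (Suc i) * max 0 (v - u) ^ i) * (-1)) (at u)"
    by (rule DERIV_chain2[OF max0_power_deriv[OF assms(1)]]) (auto intro!: derivative_eq_intros)
  have 2: "((\<lambda>u. max 0 (v + u) ^ Suc j) has_real_derivative (real (Suc j) * max 0 (v + u) ^ j) * 1) (at u)"
    by (rule DERIV_chain2[OF max0_power_deriv[OF assms(2)]]) (auto intro!: derivative_eq_intros)
  show ?thesis
    unfolding trunc_prod_def[abs_def]
    by (rule DERIV_cong[OF DERIV_mult[OF 1 2]]) (simp add: algebra_simps)
qed

text \<open>Each difference is turned into a derivative, which lowers one of the exponents by one;
  the strict inequalities keep every function differentiated on the way continuously differentiable.
  After n rounds the product is supported in |u| \<le> v and homogeneous of degree i + j - n, whence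
  the power of v.\<close>

lemma trunc_prod_fd_bound:
  assumes v: "v \<ge> 0"
  shows "n < i \<Longrightarrow> n < j \<Longrightarrow> \<bar>fd n d (trunc_prod v i j) u\<bar> \<le> real (i + j) ^ n * 2 ^ (i + j) * v ^ (i + j - n) * \<bar>d\<bar> ^ n"
proof (induction n arbitrary: i j u)
  case 0
  have "\<bar>trunc_prod v i j u\<bar> \<le> (2 * v) ^ i * (2 * v) ^ j"
  proof (cases "\<bar>u\<bar> \<le> v")
    case True
    then show ?thesis unfolding trunc_prod_def abs_mult power_abs by (intro mult_mono power_mono) auto
  next
    case False
    then have "trunc_prod v i j u = 0" using 0 unfolding trunc_prod_def by (auto simp: max_def)
    then show ?thesis using v by simp
  qed
  then show ?case by (simp add: power_add power_mult_distrib mult_ac)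
next
  case (Suc n)
  obtain i' j' where ij: "i = Suc i'" "j = Suc j'" "i' \<ge> 1" "j' \<ge> 1" "n < i'" "n < j'"
    using Suc.prems by (cases i; cases j) auto
  define M where "M = real (i + j) ^ n * 2 ^ (i + j) * v ^ (i + j - Suc n) * \<bar>d\<bar> ^ n"
  have b: "\<bar>fd n d (trunc_prod v k m) u\<bar> \<le> M" if "n < k" "n < m" "Suc (k + m) = i + j" for k m u
  proof -
    have "\<bar>fd n d (trunc_prod v k m) u\<bar> \<le> real (k + m) ^ n * 2 ^ (k + m) * v ^ (k + m - n) * \<bar>d\<bar> ^ n"
      by (rule Suc.IH) (use that in auto)
    also have "\<dots> \<le> real (i + j) ^ n * 2 ^ (i + j) * v ^ (k + m - n) * \<bar>d\<bar> ^ n"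
      using v that by (intro mult_right_mono mult_mono power_mono power_increasing) auto
    also have "k + m - n = i + j - Suc n" using that by simp
    finally show ?thesis unfolding M_def .
  qed
  have "\<bar>fd (Suc n) d (trunc_prod v i j) u\<bar> \<le> (real (i + j) * M) * \<bar>d\<bar>"
  proof (rule fd_Suc_bound)
    show "(trunc_prod v i j has_real_derivative (real j * trunc_prod v i j' u - real i * trunc_prod v i' j u)) (at u)" for u
      unfolding ij by (rule trunc_prod_deriv) (use ij in auto)
    fix u
    have "fd n d (\<lambda>u. real j * trunc_prod v i j' u - real i * trunc_prod v i' j u) u
        = real j * fd n d (trunc_prod v i j') u - real i * fd n d (trunc_prod v i' j) u"
      by (simp only: fd_diff fd_cmult)
    moreover have "\<bar>real j * fd n d (trunc_prod v i j') u\<bar> \<le> real j * M" "\<bar>real i * fd n d (trunc_prod v i' j) u\<bar> \<le> real i * M"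
      unfolding abs_mult using ij Suc.prems by (auto intro!: mult_left_mono b)
    ultimately show "\<bar>fd n d (\<lambda>u. real j * trunc_prod v i j' u - real i * trunc_prod v i' j u) u\<bar> \<le> real (i + j) * M"
      by (simp add: algebra_simps)
  qed
  then show ?case by (simp add: M_def mult_ac)
qed

lemma trunc_power_eq: "v \<ge> 0 \<Longrightarrow> max 0 (v\<^sup>2 - u\<^sup>2) ^ S = trunc_prod v S S u" for v u :: real
proof -
  assume v: "v \<ge> 0"
  have "v\<^sup>2 - u\<^sup>2 = (v - u) * (v + u)" by (simp add: power2_eq_square algebra_simps)
  then have "max 0 (v\<^sup>2 - u\<^sup>2) = max 0 (v - u) * max 0 (v + u)"
    using v by (auto simp: max_def mult_le_0_iff zero_le_mult_iff)
  then show ?thesis by (simp add: trunc_prod_def power_mult_distrib)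
qed

lemma integrable_fd:
  fixes f :: "'b \<Rightarrow> real \<Rightarrow> real"
  assumes "\<And>u. integrable M (\<lambda>v. f v u)"
  shows "integrable M (\<lambda>v. fd n d (f v) u)" "(\<integral>v. fd n d (f v) u \<partial>M) = fd n d (\<lambda>u. \<integral>v. f v u \<partial>M) u"
proof -
  have "integrable M (\<lambda>v. fd n d (f v) u) \<and> (\<integral>v. fd n d (f v) u \<partial>M) = fd n d (\<lambda>u. \<integral>v. f v u \<partial>M) u"
    by (induction n arbitrary: u) (use assms in auto)
  then show "integrable M (\<lambda>v. fd n d (f v) u)" "(\<integral>v. fd n d (f v) u \<partial>M) = fd n d (\<lambda>u. \<integral>v. f v u \<partial>M) u"
    by auto
qed

text \<open>Taking S - 1 differences under the integral leaves v^(S+1), since 2S - (S-1) = S + 1.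
  This power lies between v^S and v^(2S), so the moment condition on the measure makes it
  integrable.\<close>

lemma trunc_moment_fd_bound:
  fixes P :: "real measure"
  assumes sets: "sets P = sets (restrict_space borel {0..})" and S: "S \<ge> 1" and q: "q \<ge> 0"
    and int: "\<And>u. integrable P (\<lambda>v. max 0 (v\<^sup>2 - u\<^sup>2) ^ S)"
    and fin: "(\<integral>\<^sup>+v. ennreal ((v + 2) powr q * (v ^ S + v ^ (2 * S))) \<partial>P) < \<infinity>"
  obtains C where "C \<ge> 0" "\<And>d u. \<bar>fd (S - 1) d (\<lambda>u. LINT v|P. max 0 (v\<^sup>2 - u\<^sup>2) ^ S) u\<bar> \<le> C * \<bar>d\<bar> ^ (S - 1)"
proof -
  have sp: "space P = {0..}" using sets_eq_imp_space_eq[OF sets] by (simp add: space_restrict_space)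
  have mP: "f \<in> borel_measurable P" if "f \<in> borel_measurable borel" for f :: "real \<Rightarrow> real"
    using that by (simp add: measurable_cong_sets[OF sets refl] measurable_restrict_space1)
  define K where "K = real (S + S) ^ (S - 1) * 2 ^ (S + S)"
  have i1: "integrable P (\<lambda>v. v ^ (S + 1))"
  proof (rule integrableI_bounded)
    show "(\<lambda>v. v ^ (S + 1)) \<in> borel_measurable P" by (rule mP) measurable
    have "(\<integral>\<^sup>+v. ennreal (norm (v ^ (S + 1))) \<partial>P) \<le> (\<integral>\<^sup>+v. ennreal ((v + 2) powr q * (v ^ S + v ^ (2 * S))) \<partial>P)"
    proof (intro nn_integral_mono ennreal_leI)
      fix v assume "v \<in> space P"
      then have v: "v \<ge> 0" by (simp add: sp)
      have "v ^ (S + 1) \<le> v ^ S + v ^ (2 * S)"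
      proof (cases "v \<le> 1")
        case True
        then have "v ^ (S + 1) \<le> v ^ S" using v by (intro power_decreasing) auto
        then show ?thesis by (rule order_trans) (use v in auto)
      next
        case False
        then have "v ^ (S + 1) \<le> v ^ (2 * S)" using S by (intro power_increasing) auto
        then show ?thesis by (rule order_trans) (use v in auto)
      qed
      also have "\<dots> \<le> (v + 2) powr q * (v ^ S + v ^ (2 * S))"
        using mult_right_mono[OF ge_one_powr_ge_zero[of "v + 2" q], of "v ^ S + v ^ (2 * S)"] v q by simp
      finally show "norm (v ^ (S + 1)) \<le> (v + 2) powr q * (v ^ S + v ^ (2 * S))" using v by simp
    qed
    then show "(\<integral>\<^sup>+v. ennreal (norm (v ^ (S + 1))) \<partial>P) < \<infinity>" using fin by (rule order.strict_trans1)
  qed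
  show thesis
  proof (rule that)
    show "K * (LINT v|P. v ^ (S + 1)) \<ge> 0"
      unfolding K_def by (intro mult_nonneg_nonneg integral_nonneg_AE) (auto simp: sp intro!: AE_I2)
    fix d u
    have pb: "norm (fd (S - 1) d (\<lambda>u. max 0 (v\<^sup>2 - u\<^sup>2) ^ S) u) \<le> (K * \<bar>d\<bar> ^ (S - 1)) * v ^ (S + 1)" if "v \<in> space P" for v
    proof -
      have v: "v \<ge> 0" using that by (simp add: sp)
      have "(\<lambda>u. max 0 (v\<^sup>2 - u\<^sup>2) ^ S) = trunc_prod v S S" using trunc_power_eq[OF v] by auto
      moreover have "S + S - (S - 1) = S + 1" using S by simp
      ultimately show ?thesis using trunc_prod_fd_bound[OF v, of "S - 1" S S d u] S by (simp add: K_def mult_ac)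
    qed
    have "\<bar>fd (S - 1) d (\<lambda>u. LINT v|P. max 0 (v\<^sup>2 - u\<^sup>2) ^ S) u\<bar> = norm (LINT v|P. fd (S - 1) d (\<lambda>u. max 0 (v\<^sup>2 - u\<^sup>2) ^ S) u)"
      unfolding integrable_fd(2)[OF int] by simp
    also have "\<dots> \<le> (LINT v|P. (K * \<bar>d\<bar> ^ (S - 1)) * v ^ (S + 1))"
      by (rule Bochner_Integration.integral_norm_bound_integral[OF integrable_fd(1)[OF int] integrable_mult_right[OF i1] pb])
    also have "\<dots> = K * (LINT v|P. v ^ (S + 1)) * \<bar>d\<bar> ^ (S - 1)" by simp
    finally show "\<bar>fd (S - 1) d (\<lambda>u. LINT v|P. max 0 (v\<^sup>2 - u\<^sup>2) ^ S) u\<bar> \<le> K * (LINT v|P. v ^ (S + 1)) * \<bar>d\<bar> ^ (S - 1)" .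
  qed
qed

text \<open>The integral representation extends from u \<ge> 0 to the whole line because both sides
  are even. The order of the differences is a = S - 1, so the lower bound on S becomes a >
  max(q1,q2).\<close>

lemma filter_fd_bound:
  assumes h: "low_pass_filter h" and sm: "sufficiently_smooth q1 q2 h" and q: "q1 > 0"
  obtains a :: nat and C :: real where "real a > q1" "real a > q2" "C \<ge> 0" "\<And>d u. \<bar>fd a d h u\<bar> \<le> C * \<bar>d\<bar> ^ a"
proof -
  obtain S :: nat and P N where S: "real S > max q1 q2 + 1" and PN: "jordan_pair P N"
    and rep: "\<And>u. u \<ge> 0 \<Longrightarrow> integrable P (\<lambda>v. max 0 (v\<^sup>2 - u\<^sup>2) ^ S) \<and> integrable N (\<lambda>v. max 0 (v\<^sup>2 - u\<^sup>2) ^ S) \<and>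
       h u = (LINT v|P. max 0 (v\<^sup>2 - u\<^sup>2) ^ S) - (LINT v|N. max 0 (v\<^sup>2 - u\<^sup>2) ^ S)"
    and fin: "(\<integral>\<^sup>+v. ennreal ((v + 2) powr max q1 q2 * (v ^ S + v ^ (2 * S))) \<partial>P) +
       (\<integral>\<^sup>+v. ennreal ((v + 2) powr max q1 q2 * (v ^ S + v ^ (2 * S))) \<partial>N) < \<infinity>"
    using sm unfolding sufficiently_smooth_def by blast
  have even: "h u = h \<bar>u\<bar>" for u using h unfolding low_pass_filter_def by (auto simp: abs_if)
  have int: "integrable P (\<lambda>v. max 0 (v\<^sup>2 - u\<^sup>2) ^ S)" "integrable N (\<lambda>v. max 0 (v\<^sup>2 - u\<^sup>2) ^ S)" for u
    using rep[of "\<bar>u\<bar>"] by auto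
  have hrep: "h = (\<lambda>u. (LINT v|P. max 0 (v\<^sup>2 - u\<^sup>2) ^ S) - (LINT v|N. max 0 (v\<^sup>2 - u\<^sup>2) ^ S))"
  proof
    fix u show "h u = (LINT v|P. max 0 (v\<^sup>2 - u\<^sup>2) ^ S) - (LINT v|N. max 0 (v\<^sup>2 - u\<^sup>2) ^ S)"
      using rep[of "\<bar>u\<bar>"] even[of u] by simp
  qed
  have S1: "S \<ge> 1" using S q by linarith
  have fP: "(\<integral>\<^sup>+v. ennreal ((v + 2) powr max q1 q2 * (v ^ S + v ^ (2 * S))) \<partial>P) < \<infinity>"
    and fN: "(\<integral>\<^sup>+v. ennreal ((v + 2) powr max q1 q2 * (v ^ S + v ^ (2 * S))) \<partial>N) < \<infinity>"
    using fin by (auto simp: ennreal_add_eq_top less_top)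
  have sP: "sets P = sets (restrict_space borel {0..})" and sN: "sets N = sets (restrict_space borel {0..})"
    using PN unfolding jordan_pair_def by blast+
  have q0: "max q1 q2 \<ge> 0" using q by simp
  obtain C1 where C1: "C1 \<ge> 0" "\<And>d u. \<bar>fd (S - 1) d (\<lambda>u. LINT v|P. max 0 (v\<^sup>2 - u\<^sup>2) ^ S) u\<bar> \<le> C1 * \<bar>d\<bar> ^ (S - 1)"
    using trunc_moment_fd_bound[OF sP S1 q0 int(1) fP] by metis
  obtain C2 where C2: "C2 \<ge> 0" "\<And>d u. \<bar>fd (S - 1) d (\<lambda>u. LINT v|N. max 0 (v\<^sup>2 - u\<^sup>2) ^ S) u\<bar> \<le> C2 * \<bar>d\<bar> ^ (S - 1)"
    using trunc_moment_fd_bound[OF sN S1 q0 int(2) fN] by metis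
  show thesis
  proof (rule that[of "S - 1" "C1 + C2"])
    show "real (S - 1) > q1" "real (S - 1) > q2" using S S1 by auto
    show "C1 + C2 \<ge> 0" using C1 C2 by simp
    fix d u
    have "fd (S - 1) d h u = fd (S - 1) d (\<lambda>u. LINT v|P. max 0 (v\<^sup>2 - u\<^sup>2) ^ S) u - fd (S - 1) d (\<lambda>u. LINT v|N. max 0 (v\<^sup>2 - u\<^sup>2) ^ S) u"
      unfolding hrep by (rule fd_diff)
    then show "\<bar>fd (S - 1) d h u\<bar> \<le> (C1 + C2) * \<bar>d\<bar> ^ (S - 1)"
      using C1(2)[of d u] C2(2)[of d u] unfolding distrib_right by linarith
  qed
qed

text \<open>A nonzero difference has a node u + i d in the support of h, so |u| is at most 1 + a|d|
  and the weight in u is controlled by the weight in d.\<close>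

lemma fd_weight_bound:
  assumes h: "\<And>u. \<bar>u\<bar> \<ge> 1 \<Longrightarrow> h u = 0" and C: "C \<ge> 0" and b: "\<And>d u. \<bar>fd a d h u\<bar> \<le> C * \<bar>d\<bar> ^ a"
  obtains C' where "C' \<ge> 0" "\<And>d u. \<bar>fd a d h u\<bar> * (1 + u\<^sup>2) ^ L \<le> C' * (\<bar>d\<bar> ^ a * (1 + d\<^sup>2) ^ L)"
proof (rule that)
  show "C * (3 + 2 * (real a)\<^sup>2) ^ L \<ge> 0" using C by simp
  fix d u :: real
  obtain c :: "nat \<Rightarrow> real" where c: "\<And>f d u. fd a d f u = (\<Sum>i\<le>a. c i * f (u + real i * d))" using fd_coeffs by metis
  show "\<bar>fd a d h u\<bar> * (1 + u\<^sup>2) ^ L \<le> C * (3 + 2 * (real a)\<^sup>2) ^ L * (\<bar>d\<bar> ^ a * (1 + d\<^sup>2) ^ L)"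
  proof (cases "\<exists>i\<le>a. h (u + real i * d) \<noteq> 0")
    case False
    then have "fd a d h u = 0" unfolding c by (intro sum.neutral) auto
    then show ?thesis using C by simp
  next
    case True
    then obtain i where i: "i \<le> a" "\<bar>u + real i * d\<bar> < 1" using h by force
    have "u\<^sup>2 \<le> 2 * (u + real i * d)\<^sup>2 + 2 * (real i * d)\<^sup>2"
    proof -
      have "0 \<le> (u + 2 * (real i * d))\<^sup>2" by simp
      then show ?thesis by (simp add: power2_eq_square algebra_simps)
    qed
    also have "(u + real i * d)\<^sup>2 \<le> 1" using i(2) by (simp add: abs_square_le_1)
    also have "(real i * d)\<^sup>2 \<le> (real a)\<^sup>2 * d\<^sup>2" using i by (simp add: power_mult_distrib mult_right_mono)
    finally have "1 + u\<^sup>2 \<le> (3 + 2 * (real a)\<^sup>2) * (1 + d\<^sup>2)" by (simp add: algebra_simps) (smt (verit) zero_le_power2 mult_nonneg_nonneg)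
    then have "(1 + u\<^sup>2) ^ L \<le> ((3 + 2 * (real a)\<^sup>2) * (1 + d\<^sup>2)) ^ L" by (intro power_mono) auto
    then have "\<bar>fd a d h u\<bar> * (1 + u\<^sup>2) ^ L \<le> (C * \<bar>d\<bar> ^ a) * ((3 + 2 * (real a)\<^sup>2) * (1 + d\<^sup>2)) ^ L"
      using C by (intro mult_mono b) auto
    then show ?thesis by (simp add: power_mult_distrib mult_ac)
  qed
qed

lemma low_pass_measurable:
  assumes "low_pass_filter h"
  shows "h \<in> borel_measurable borel"
proof -
  have "mono (\<lambda>x. - h (max 0 x))"
    using assms unfolding low_pass_filter_def monotone_on_def mono_def by (auto simp: max_def)
  then have "(\<lambda>x. - h (max 0 x)) \<in> borel_measurable borel" by (rule borel_measurable_mono)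
  then have [measurable]: "(\<lambda>x. h (max 0 x)) \<in> borel_measurable borel" by (simp add: borel_measurable_uminus_eq)
  have "h = (\<lambda>x. (\<lambda>x. h (max 0 x)) \<bar>x\<bar>)"
    using assms unfolding low_pass_filter_def by (auto simp: abs_if fun_eq_iff)
  moreover have "(\<lambda>x. (\<lambda>x. h (max 0 x)) \<bar>x\<bar>) \<in> borel_measurable borel" by measurable
  ultimately show ?thesis by simp
qed

section \<open>Band-limited approximation of the filter\<close>

text \<open>An average of h at scale 1/b, not normalized by the mass 2 pi of \<open>jr\<close>. As a
  function of u it is a convolution with \<open>jr\<close> scaled by b, hence band-limited to
  [-b,b].\<close>

definition smear :: "nat \<Rightarrow> (real \<Rightarrow> real) \<Rightarrow> real \<Rightarrow> real \<Rightarrow> real"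
  where "smear r h b u = (\<integral>z. jr r z * h (u + z / b) \<partial>lborel)"

lemma integrable_jr_mult:
  assumes r: "2 \<le> r" and [measurable]: "g \<in> borel_measurable borel" and g: "\<And>x. \<bar>g x\<bar> \<le> M"
  shows "integrable lborel (\<lambda>z. jr r z * g z)"
proof (rule Bochner_Integration.integrable_bound[OF integrable_mult_left[OF integrable_abs[OF jr_integrable[OF r]], of "\<bar>M\<bar>"]])
  show "AE z in lborel. norm (jr r z * g z) \<le> norm (\<bar>jr r z\<bar> * \<bar>M\<bar>)"
    using g by (auto intro!: AE_I2 mult_left_mono order_trans[OF g] simp: abs_mult)
qed measurable

text \<open>The substitution x = u + z/b and its mirror image agree because h is even. Their mean
  has exactly the symmetric pair of shifts that \<open>finite_speed\<close> annihilates, with v = b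
  x.\<close>

lemma smear_even:
  assumes r: "2 \<le> r" and h[measurable]: "h \<in> borel_measurable borel" and b1: "\<And>x. \<bar>h x\<bar> \<le> 1"
    and even: "\<And>x. h (- x) = h x" and b: "b > 0"
  shows "smear r h b u = b / 2 * (\<integral>x. h x * (jr r (b * u + b * x) + jr r (b * u - b * x)) \<partial>lborel)"
    and "integrable lborel (\<lambda>x. h x * (jr r (b * u + b * x) + jr r (b * u - b * x)))"
proof -
  have i: "integrable lborel (\<lambda>x. h x * jr r (b * u + c * x))" if "c = b \<or> c = - b" for c
  proof -
    have "integrable lborel (\<lambda>z. jr r z * h ((z - b * u) / c))"
      by (rule integrable_jr_mult[OF r _ b1]) measurable
    then have "integrable lborel (\<lambda>x. jr r (b * u + c * x) * h ((b * u + c * x - b * u) / c))"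
      by (rule lborel_integrable_real_affine) (use b that in auto)
    moreover have "(b * u + c * x - b * u) / c = x" for x using b that by auto
    ultimately show ?thesis by (simp add: mult.commute)
  qed
  have eq: "smear r h b u = b * (\<integral>x. h x * jr r (b * u + c * x) \<partial>lborel)" if c: "c = b \<or> c = - b" for c
  proof -
    have "smear r h b u = (\<integral>z. jr r z * h (u - z / b) \<partial>lborel)"
    proof -
      have "smear r h b u = \<bar>-1\<bar> *\<^sub>R (\<integral>z. jr r (0 + (-1) * z) * h (u + (0 + (-1) * z) / b) \<partial>lborel)"
        unfolding smear_def by (rule lborel_integral_real_affine) simp
      then show ?thesis by (simp add: jr_minus)
    qed
    also have "\<dots> = (\<integral>z. jr r z * h ((z - b * u) / c) \<partial>lborel)"
    proof (rule Bochner_Integration.integral_cong[OF refl])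
      fix z
      have "u - z / b = (z - b * u) / c \<or> u - z / b = - ((z - b * u) / c)" using b that by (auto simp: field_simps)
      then show "jr r z * h (u - z / b) = jr r z * h ((z - b * u) / c)" using even[of "(z - b * u) / c"] by auto
    qed
    also have "\<dots> = \<bar>c\<bar> *\<^sub>R (\<integral>x. jr r (b * u + c * x) * h ((b * u + c * x - b * u) / c) \<partial>lborel)"
      by (rule lborel_integral_real_affine) (use b that in auto)
    also have "(\<lambda>x. jr r (b * u + c * x) * h ((b * u + c * x - b * u) / c)) = (\<lambda>x. h x * jr r (b * u + c * x))"
      using b that by auto
    finally show ?thesis using b that by auto
  qed
  show "integrable lborel (\<lambda>x. h x * (jr r (b * u + b * x) + jr r (b * u - b * x)))"
    using Bochner_Integration.integrable_add[OF i[of b] i[of "- b"]] by (simp add: distrib_left)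
  have "(\<integral>x. h x * (jr r (b * u + b * x) + jr r (b * u - b * x)) \<partial>lborel) = (\<integral>x. h x * jr r (b * u + b * x) \<partial>lborel) + (\<integral>x. h x * jr r (b * u + (- b) * x) \<partial>lborel)"
    by (subst Bochner_Integration.integral_add[symmetric, OF i i]) (simp_all add: distrib_left)
  then show "smear r h b u = b / 2 * (\<integral>x. h x * (jr r (b * u + b * x) + jr r (b * u - b * x)) \<partial>lborel)"
    using eq[of b] eq[of "- b"] by (simp add: field_simps)
qed

text \<open>A scaled Peetre inequality: shifts with |x| \<le> 1 change the weight by a bounded
  factor only, so decay at b l + b x may be measured at l.\<close>

lemma weight_shift:
  fixes b l x :: real
  assumes b: "b > 0" and x: "\<bar>x\<bar> \<le> 1"
  shows "1 / (1 + (b * l + b * x)\<^sup>2) ^ L \<le> (3 + 2 / b\<^sup>2) ^ L / (1 + l\<^sup>2) ^ L"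
proof -
  define w where "w = b * l + b * x"
  have l: "l = w / b - x" using b by (simp add: w_def field_simps)
  have sq: "(y - x)\<^sup>2 \<le> 2 * y\<^sup>2 + 2 * x\<^sup>2" for y
  proof -
    have "0 \<le> (y + x)\<^sup>2" by simp
    then show ?thesis by (simp add: power2_eq_square algebra_simps)
  qed
  have "l\<^sup>2 \<le> 2 * (w / b)\<^sup>2 + 2 * x\<^sup>2" unfolding l by (rule sq)
  also have "2 * (w / b)\<^sup>2 = 2 / b\<^sup>2 * w\<^sup>2" by (simp add: power_divide)
  moreover have "x\<^sup>2 \<le> 1" using x by (simp add: abs_square_le_1)
  moreover have "0 \<le> 2 / b\<^sup>2" "0 \<le> w\<^sup>2" by auto
  moreover have "(3 + \<beta>) * (1 + w\<^sup>2) = 3 + 3 * w\<^sup>2 + \<beta> + \<beta> * w\<^sup>2" for \<beta> by (simp add: algebra_simps)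
  ultimately have "1 + l\<^sup>2 \<le> (3 + 2 / b\<^sup>2) * (1 + w\<^sup>2)" by (smt (verit))
  then have "(1 + l\<^sup>2) ^ L \<le> ((3 + 2 / b\<^sup>2) * (1 + w\<^sup>2)) ^ L" by (intro power_mono) auto
  then have "(1 + l\<^sup>2) ^ L \<le> (3 + 2 / b\<^sup>2) ^ L * (1 + w\<^sup>2) ^ L" by (simp only: power_mult_distrib)
  then show ?thesis
    using one_plus_sq_power_pos[of w L] one_plus_sq_power_pos[of l L] unfolding w_def[symmetric]
    by (simp only: pos_divide_le_eq pos_le_divide_eq times_divide_eq_left mult_1) 
qed

text \<open>The identity of \<open>finite_speed\<close> is integrated over x against h. The support
  of h confines x to [-1,1], where \<open>weight_shift\<close> supplies a summable majorant for
  exchanging sum and integral.\<close>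

lemma smear_annihilated:
  fixes a :: "nat \<Rightarrow> complex" and l :: "nat \<Rightarrow> real"
  assumes L: "1 \<le> L" and Lr: "2 * L \<le> r" and sm: "summable (\<lambda>k. cmod (a k) / (1 + (l k)\<^sup>2) ^ L)"
    and h[measurable]: "h \<in> borel_measurable borel" and b1: "\<And>x. \<bar>h x\<bar> \<le> 1"
    and even: "\<And>x. h (- x) = h x" and supp: "\<And>x. \<bar>x\<bar> \<ge> 1 \<Longrightarrow> h x = 0"
    and t0: "t0 > 0" and b: "b > 0" "b\<^sup>2 < 4 * A"
    and heat: "\<And>t. 0 < t \<Longrightarrow> t \<le> t0 \<Longrightarrow> cmod (\<Sum>k. a k * exp (- (t * (l k)\<^sup>2))) \<le> C * t powr (- \<kappa>) * exp (- A / t)"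
  shows "summable (\<lambda>k. a k * smear r h b (l k))" "(\<Sum>k. a k * smear r h b (l k)) = 0"
proof -
  have r2: "2 \<le> r" using L Lr by simp
  obtain D where D: "D > 0" "\<And>u. \<bar>jr r u\<bar> \<le> D / (1 + u\<^sup>2) ^ L" using jr_bound[OF Lr] by metis
  define E where "E = 2 * D * (3 + 2 / b\<^sup>2) ^ L"
  define f where "f = (\<lambda>k x. a k * complex_of_real (h x * (jr r (b * l k + b * x) + jr r (b * l k - b * x))))"
  have E0: "E \<ge> 0" unfolding E_def using D by auto
  have jb: "\<bar>h x * (jr r (b * l k + b * x) + jr r (b * l k - b * x))\<bar> \<le> indicator {-1..1} x * (E / (1 + (l k)\<^sup>2) ^ L)" for x k
  proof (cases "\<bar>x\<bar> < 1")
    case True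
    have "\<bar>jr r (b * l k + b * x)\<bar> \<le> D * (1 / (1 + (b * l k + b * x)\<^sup>2) ^ L)" using D(2)[of "b * l k + b * x"] by simp
    also have "\<dots> \<le> D * ((3 + 2 / b\<^sup>2) ^ L / (1 + (l k)\<^sup>2) ^ L)"
      using D(1) b True by (intro mult_left_mono weight_shift) auto
    finally have 1: "\<bar>jr r (b * l k + b * x)\<bar> \<le> D * ((3 + 2 / b\<^sup>2) ^ L / (1 + (l k)\<^sup>2) ^ L)" .
    have "\<bar>jr r (b * l k - b * x)\<bar> \<le> D * (1 / (1 + (b * l k + b * (- x))\<^sup>2) ^ L)" using D(2)[of "b * l k - b * x"] by simp
    also have "\<dots> \<le> D * ((3 + 2 / b\<^sup>2) ^ L / (1 + (l k)\<^sup>2) ^ L)"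
      using D(1) b True by (intro mult_left_mono weight_shift) auto
    finally have 2: "\<bar>jr r (b * l k - b * x)\<bar> \<le> D * ((3 + 2 / b\<^sup>2) ^ L / (1 + (l k)\<^sup>2) ^ L)" .
    have "\<bar>h x * (jr r (b * l k + b * x) + jr r (b * l k - b * x))\<bar> \<le> 1 * (\<bar>jr r (b * l k + b * x)\<bar> + \<bar>jr r (b * l k - b * x)\<bar>)"
      unfolding abs_mult by (intro mult_mono b1 abs_triangle_ineq) auto
    also have "\<dots> \<le> E / (1 + (l k)\<^sup>2) ^ L" using 1 2 unfolding E_def by simp
    moreover have "x \<in> {-1..1}" using True by auto
    ultimately show ?thesis by simp
  next
    case False
    then show ?thesis using supp[of x] E0 by simp
  qed
  have fb: "norm (f k x) \<le> indicator {-1..1} x * (E * (cmod (a k) / (1 + (l k)\<^sup>2) ^ L))" for k x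
    using mult_left_mono[OF jb[of x k], of "cmod (a k)"] unfolding f_def norm_mult norm_of_real by (simp add: mult_ac)
  have [measurable]: "f k \<in> borel_measurable borel" for k unfolding f_def by measurable
  have fi: "integrable lborel (f k)" for k
    unfolding f_def by (intro integrable_mult_right integrable_of_real smear_even(2)[OF r2 h b1 even b(1)])
  have nint: "(\<integral>x. norm (f k x) \<partial>lborel) \<le> 2 * (E * (cmod (a k) / (1 + (l k)\<^sup>2) ^ L))" for k
  proof -
    have "(\<integral>x. norm (f k x) \<partial>lborel) \<le> (\<integral>x. indicator {-1..1::real} x * (E * (cmod (a k) / (1 + (l k)\<^sup>2) ^ L)) \<partial>lborel)"
      by (intro integral_mono integrable_norm fi fb integrable_mult_left) simp
    then show ?thesis by simp
  qed
  have sI: "summable (\<lambda>k. \<integral>x. norm (f k x) \<partial>lborel)"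
    by (rule summable_comparison_test'[OF summable_mult[OF summable_mult[OF sm], of 2 E], of 0]) (use nint in simp)
  have sN: "summable (\<lambda>k. norm (f k x))" for x
  proof (rule summable_comparison_test'[OF summable_mult[OF sm, of E], of 0])
    fix k
    have "indicator {-1..1} x * (E * (cmod (a k) / (1 + (l k)\<^sup>2) ^ L)) \<le> 1 * (E * (cmod (a k) / (1 + (l k)\<^sup>2) ^ L))"
      using E0 less_imp_le[OF one_plus_sq_power_pos] by (intro mult_right_mono) (auto simp: indicator_def)
    then show "norm (norm (f k x)) \<le> E * (cmod (a k) / (1 + (l k)\<^sup>2) ^ L)"
      using fb[of k x] by simp
  qed
  have If: "(\<integral>x. f k x \<partial>lborel) = complex_of_real (2 / b) * (a k * smear r h b (l k))" for k
  proof -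
    have "(\<integral>x. f k x \<partial>lborel) = a k * complex_of_real (\<integral>x. h x * (jr r (b * l k + b * x) + jr r (b * l k - b * x)) \<partial>lborel)"
      unfolding f_def integral_mult_right_zero integral_complex_of_real ..
    also have "(\<integral>x. h x * (jr r (b * l k + b * x) + jr r (b * l k - b * x)) \<partial>lborel) = 2 / b * smear r h b (l k)"
      unfolding smear_even(1)[OF r2 h b1 even b(1), of "l k"] using b(1) by simp
    finally show ?thesis by simp
  qed
  have zero: "(\<Sum>k. f k x) = 0" for x
  proof -
    \<comment> \<open>The frequencies are b l, so the heat bound is read at time t b^2. The rate
      becomes A/b^2, and b^2 < 4A turns into the required 1/4 < A/b^2.\<close>
    have "(\<Sum>k. a k * (jr r (b * l k + b * x) + jr r (b * l k - b * x))) = 0"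
    proof (rule finite_speed[OF Lr, where A = "A / b\<^sup>2" and ?t0.0 = "t0 / b\<^sup>2" and C = "C * b powr (- 2 * \<kappa>)" and b = \<kappa>])
      show "t0 / b\<^sup>2 > 0" "1 / 4 < A / b\<^sup>2" using t0 b by (auto simp: field_simps)
      show "summable (\<lambda>k. cmod (a k) / (1 + (b * l k)\<^sup>2) ^ L)"
      proof (rule summable_comparison_test'[OF summable_mult[OF sm, of "(3 + 2 / b\<^sup>2) ^ L"], of 0])
        fix k
        have "cmod (a k) * (1 / (1 + (b * l k + b * 0)\<^sup>2) ^ L) \<le> cmod (a k) * ((3 + 2 / b\<^sup>2) ^ L / (1 + (l k)\<^sup>2) ^ L)"
          using b by (intro mult_left_mono weight_shift) auto
        then show "norm (cmod (a k) / (1 + (b * l k)\<^sup>2) ^ L) \<le> (3 + 2 / b\<^sup>2) ^ L * (cmod (a k) / (1 + (l k)\<^sup>2) ^ L)"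
          by (simp add: mult_ac)
      qed
      fix t :: real assume t: "0 < t" "t \<le> t0 / b\<^sup>2"
      have "cmod (\<Sum>k. a k * exp (- (t * b\<^sup>2 * (l k)\<^sup>2))) \<le> C * (t * b\<^sup>2) powr (- \<kappa>) * exp (- A / (t * b\<^sup>2))"
        by (rule heat) (use t b in \<open>auto simp: field_simps\<close>)
      also have "(t * b\<^sup>2) powr (- \<kappa>) = b powr (- 2 * \<kappa>) * t powr (- \<kappa>)"
      proof -
        have "b\<^sup>2 = b powr 2" using b by (simp add: powr_numeral)
        then show ?thesis using t b(1) by (simp only: powr_mult powr_powr powr_ge_zero less_imp_le) (simp add: mult.commute)
      qed
      finally show "cmod (\<Sum>k. a k * exp (- (t * (b * l k)\<^sup>2))) \<le> C * b powr (- 2 * \<kappa>) * t powr - \<kappa> * exp (- (A / b\<^sup>2) / t)"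
        by (simp add: power_mult_distrib mult_ac)
    qed
    moreover have "f k x = complex_of_real (h x) * (a k * (jr r (b * l k + b * x) + jr r (b * l k - b * x)))" for k
      unfolding f_def by simp
    \<comment> \<open>Moving the factor h x out of the series needs convergence of the unweighted
      series, which is recovered from that of \<open>f\<close> by dividing by h x where it is
      nonzero.\<close>
    moreover have "summable (\<lambda>k. a k * (jr r (b * l k + b * x) + jr r (b * l k - b * x))) \<or> h x = 0"
    proof (cases "h x = 0")
      case False
      have "summable (\<lambda>k. inverse (complex_of_real (h x)) * f k x)"
        by (intro summable_mult summable_norm_cancel[OF sN])
      moreover have "inverse (complex_of_real (h x)) * f k x = a k * (jr r (b * l k + b * x) + jr r (b * l k - b * x))" for k
        using False unfolding f_def by simp
      ultimately show ?thesis by simp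
    qed simp
    ultimately show ?thesis by (auto simp: suminf_mult)
  qed
  have "(\<lambda>k. \<integral>x. f k x \<partial>lborel) sums (\<integral>x. (\<Sum>k. f k x) \<partial>lborel)"
    by (rule sums_integral[OF fi AE_I2[OF sN] sI])
  then have "(\<lambda>k. complex_of_real (2 / b) * (a k * smear r h b (l k))) sums 0"
    unfolding zero If by simp
  from sums_mult[OF this, of "complex_of_real (b / 2)"]
  have "(\<lambda>k. a k * smear r h b (l k)) sums 0" using b(1) by simp
  then show "summable (\<lambda>k. a k * smear r h b (l k))" "(\<Sum>k. a k * smear r h b (l k)) = 0"
    by (auto simp: sums_iff)
qed

text \<open>
  The threshold \<open>B\<^sup>2 < 4 * A\<close> is the condition \<open>1/4 < A\<close> of \<open>finite_speed\<close> after rescaling the frequencies by \<open>B\<close>.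
\<close>

definition annihilated :: "nat \<Rightarrow> real \<Rightarrow> (real \<Rightarrow> real) \<Rightarrow> bool"
  where "annihilated L B H \<longleftrightarrow> (\<forall>(a :: nat \<Rightarrow> complex) l t0 A C \<kappa>.
     summable (\<lambda>k. cmod (a k) / (1 + (l k)\<^sup>2) ^ L) \<longrightarrow> t0 > 0 \<longrightarrow> B\<^sup>2 < 4 * A \<longrightarrow>
     (\<forall>t. 0 < t \<longrightarrow> t \<le> t0 \<longrightarrow> cmod (\<Sum>k. a k * exp (- (t * (l k)\<^sup>2))) \<le> C * t powr (- \<kappa>) * exp (- A / t)) \<longrightarrow>
     (\<lambda>k. a k * H (l k)) sums 0)"

text \<open>
  The approximant $H$ is a linear combination of averages of $h(u + iz/B)$, $1 \le i \le a$, against \<open>jr\<close>, chosen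
  such that $h - H$ is the average of the $a$-th differences of $h$ with step $z/B$.
\<close>

theorem band_limited_approximation:
  assumes h: "low_pass_filter h" and C: "C \<ge> 0" and b: "\<And>d u. \<bar>fd a d h u\<bar> \<le> C * \<bar>d\<bar> ^ a" and L: "L \<ge> 1"
  obtains C' where "C' \<ge> 0" "\<And>B. B \<ge> 1 \<Longrightarrow> \<exists>H. annihilated L B H \<and> (\<forall>u. \<bar>h u - H u\<bar> \<le> C' / B ^ a / (1 + u\<^sup>2) ^ L)"
proof -
  have even: "\<And>x. h (- x) = h x" and h01: "\<And>x. 0 \<le> h x \<and> h x \<le> 1" and supp: "\<And>x. \<bar>x\<bar> \<ge> 1 \<Longrightarrow> h x = 0"
    using h unfolding low_pass_filter_def by auto
  have h1: "\<bar>h x\<bar> \<le> 1" for x using h01[of x] by auto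
  note hm [measurable] = low_pass_measurable[OF h]
  obtain C1 where C1: "C1 \<ge> 0" "\<And>d u. \<bar>fd a d h u\<bar> * (1 + u\<^sup>2) ^ L \<le> C1 * (\<bar>d\<bar> ^ a * (1 + d\<^sup>2) ^ L)"
    using fd_weight_bound[OF supp C b, of L] by metis
  \<comment> \<open>The decay of \<open>jr\<close> has to absorb |z|^a and (1 + z^2)^L from the
    difference bound and still leave 1/(1 + z^2), which is integrable.\<close>
  define L' where "L' = L + a + 1"
  define r where "r = 2 * L'"
  have r: "2 \<le> r" "2 * L \<le> r" by (auto simp: r_def L'_def)
  obtain D where D: "D > 0" "\<And>u. \<bar>jr r u\<bar> \<le> D / (1 + u\<^sup>2) ^ L'" using jr_bound[of L' r] by (auto simp: r_def)
  obtain c :: "nat \<Rightarrow> real" where c: "c 0 = (-1) ^ a" "\<And>f d u. fd a d f u = (\<Sum>i\<le>a. c i * f (u + real i * d))" using fd_coeffs[of a] by metis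
  define J where "J = (\<integral>z. D / (1 + z\<^sup>2) \<partial>lborel)"
  have Ji: "integrable lborel (\<lambda>z. D / (1 + z\<^sup>2))"
    using integrable_mult_right[OF integrable_inverse_one_plus_sq, of D] by simp
  have J0: "J \<ge> 0" unfolding J_def using D(1) by (intro integral_nonneg_AE AE_I2) (auto intro!: divide_nonneg_pos add_pos_nonneg)
  show thesis
  proof (rule that)
    show "C1 * J / (2 * pi) \<ge> 0" using C1 J0 by simp
    fix B :: real assume B: "B \<ge> 1"
    \<comment> \<open>The term i = 0 of the averaged difference is (-1)^a 2 pi h(u). Solving for h
      determines the sign and the division by 2 pi.\<close>
    define H where "H = (\<lambda>u. (- ((-1) ^ a) / (2 * pi)) * (\<Sum>i\<in>{1..a}. c i * smear r h (B / real i) u))"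
    have int: "integrable lborel (\<lambda>z. jr r z * h (u + real i * (z / B)))" for u i
      by (rule integrable_jr_mult[OF r(1) _ h1]) measurable
    have fdint: "integrable lborel (\<lambda>z. jr r z * fd a (z / B) h u)" for u
      unfolding c(2) sum_distrib_left using int by (intro Bochner_Integration.integrable_sum) (simp add: mult.left_commute)
    have repr: "h u - H u = ((-1) ^ a / (2 * pi)) * (\<integral>z. jr r z * fd a (z / B) h u \<partial>lborel)" for u
    proof -
      have "(\<integral>z. jr r z * fd a (z / B) h u \<partial>lborel) = (\<integral>z. (\<Sum>i\<le>a. c i * (jr r z * h (u + real i * (z / B)))) \<partial>lborel)"
        unfolding c(2) sum_distrib_left by (simp add: mult.left_commute)
      also have "\<dots> = (\<Sum>i\<le>a. c i * (\<integral>z. jr r z * h (u + real i * (z / B)) \<partial>lborel))"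
        using int by (subst Bochner_Integration.integral_sum) auto
      also have "{..a} = insert 0 {1..a}" by auto
      also have "(\<Sum>i\<in>insert 0 {1..a}. c i * (\<integral>z. jr r z * h (u + real i * (z / B)) \<partial>lborel)) =
          (-1) ^ a * (2 * pi * h u) + (\<Sum>i\<in>{1..a}. c i * smear r h (B / real i) u)"
        using jr_integral[OF r(1)] by (subst sum.insert) (auto simp: c(1) smear_def intro!: sum.cong simp: mult.commute)
      finally have "(\<integral>z. jr r z * fd a (z / B) h u \<partial>lborel) = (-1) ^ a * (2 * pi * h u) + (\<Sum>i\<in>{1..a}. c i * smear r h (B / real i) u)" .
      moreover have "(-1) ^ a * (-1) ^ a = (1::real)" by (simp add: power_mult_distrib[symmetric])
      ultimately show ?thesis unfolding H_def by (simp add: distrib_left mult.assoc[symmetric])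
    qed
    have err: "\<bar>h u - H u\<bar> \<le> C1 * J / (2 * pi) / B ^ a / (1 + u\<^sup>2) ^ L" for u
    proof -
      have pw: "norm (jr r z * fd a (z / B) h u * (1 + u\<^sup>2) ^ L) \<le> (C1 / B ^ a) * (D / (1 + z\<^sup>2))" for z
      proof -
        have d: "\<bar>z / B\<bar> ^ a * (1 + (z / B)\<^sup>2) ^ L \<le> (1 + z\<^sup>2) ^ a / B ^ a * (1 + z\<^sup>2) ^ L"
        proof (intro mult_mono)
          have "\<bar>z\<bar> \<le> 1 + z\<^sup>2"
          proof -
            have "0 \<le> (\<bar>z\<bar> - 1/2)\<^sup>2" by simp
            then show ?thesis by (simp add: power2_eq_square algebra_simps)
          qed
          then have "\<bar>z\<bar> ^ a \<le> (1 + z\<^sup>2) ^ a" by (intro power_mono) auto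
          then show "\<bar>z / B\<bar> ^ a \<le> (1 + z\<^sup>2) ^ a / B ^ a" using B by (simp add: power_divide divide_right_mono abs_divide)
          have "(z / B)\<^sup>2 \<le> z\<^sup>2" using B by (simp add: power_divide divide_le_eq mult_le_cancel_left1 one_le_power)
          then show "(1 + (z / B)\<^sup>2) ^ L \<le> (1 + z\<^sup>2) ^ L" by (intro power_mono) auto
        qed (use B in auto)
        have "norm (jr r z * fd a (z / B) h u * (1 + u\<^sup>2) ^ L) = \<bar>jr r z\<bar> * (\<bar>fd a (z / B) h u\<bar> * (1 + u\<^sup>2) ^ L)"
          by (simp add: abs_mult)
        also have "\<dots> \<le> (D / (1 + z\<^sup>2) ^ L') * (C1 * ((1 + z\<^sup>2) ^ a / B ^ a * (1 + z\<^sup>2) ^ L))"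
          using D(1) less_imp_le[OF one_plus_sq_power_pos]
          by (intro mult_mono[OF D(2) order_trans[OF C1(2) mult_left_mono[OF d C1(1)]]]) auto
        also have "\<dots> = (C1 / B ^ a) * (D / (1 + z\<^sup>2))"
        proof -
          have e: "(1 + z\<^sup>2) ^ L' = (1 + z\<^sup>2) ^ a * (1 + z\<^sup>2) ^ L * (1 + z\<^sup>2)" by (simp add: L'_def power_add)
          have "D / (x * y * w) * (C1 * (x / B ^ a * y)) = (C1 / B ^ a) * (D / w)" if "x \<noteq> 0" "y \<noteq> 0" for x y w
            using that by (simp add: mult_ac)
          from this[of "(1 + z\<^sup>2) ^ a" "(1 + z\<^sup>2) ^ L" "1 + z\<^sup>2"] show ?thesis
            unfolding e by (simp only: power_not_zero one_plus_sq_nonzero not_False_eq_True simp_thms)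
        qed
        finally show ?thesis .
      qed
      have "\<bar>h u - H u\<bar> * (1 + u\<^sup>2) ^ L = 1 / (2 * pi) * norm ((\<integral>z. jr r z * fd a (z / B) h u \<partial>lborel) * (1 + u\<^sup>2) ^ L)"
        unfolding repr by (simp add: abs_mult power_abs)
      also have "(\<integral>z. jr r z * fd a (z / B) h u \<partial>lborel) * (1 + u\<^sup>2) ^ L = (\<integral>z. jr r z * fd a (z / B) h u * (1 + u\<^sup>2) ^ L \<partial>lborel)"
        by simp
      also have "1 / (2 * pi) * norm \<dots> \<le> 1 / (2 * pi) * (\<integral>z. (C1 / B ^ a) * (D / (1 + z\<^sup>2)) \<partial>lborel)"
        by (intro mult_left_mono Bochner_Integration.integral_norm_bound_integral[OF integrable_mult_left[OF fdint] integrable_mult_right[OF Ji] pw]) auto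
      also have "\<dots> = C1 * J / (2 * pi) / B ^ a" unfolding integral_mult_right_zero J_def[symmetric] by simp
      finally show ?thesis by (simp only: pos_le_divide_eq one_plus_sq_power_pos)
    qed
    have "annihilated L B H"
      unfolding annihilated_def
    proof (intro allI impI)
      fix s :: "nat \<Rightarrow> complex" and l :: "nat \<Rightarrow> real" and t0 A C \<kappa> :: real
      assume sm: "summable (\<lambda>k. cmod (s k) / (1 + (l k)\<^sup>2) ^ L)" and t0: "t0 > 0" and A: "B\<^sup>2 < 4 * A"
        and heat: "\<forall>t. 0 < t \<longrightarrow> t \<le> t0 \<longrightarrow> cmod (\<Sum>k. s k * exp (- (t * (l k)\<^sup>2))) \<le> C * t powr (- \<kappa>) * exp (- A / t)"
      have 1: "(\<lambda>k. s k * smear r h (B / real i) (l k)) sums 0" if "i \<in> {1..a}" for i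
      proof -
        have bi: "B / real i > 0" using B that by auto
        \<comment> \<open>The average of h(u + i z/B) has band B/i, which does not exceed B since i
          \<ge> 1. A single threshold therefore annihilates all terms of H.\<close>
        have "B / real i \<le> B" using B that by (simp add: divide_le_eq mult_le_cancel_left1)
        then have "(B / real i)\<^sup>2 \<le> B\<^sup>2" using bi by (intro power_mono) auto
        then have "(B / real i)\<^sup>2 < 4 * A" using A by linarith
        from smear_annihilated[OF L r(2) sm hm h1 even supp t0 bi this, of C \<kappa>] heat
        show ?thesis by (simp add: sums_iff)
      qed
      have "(\<lambda>k. \<Sum>i\<in>{1..a}. complex_of_real ((- ((-1) ^ a) / (2 * pi)) * c i) * (s k * smear r h (B / real i) (l k))) sums (\<Sum>i\<in>{1..a}. complex_of_real ((- ((-1) ^ a) / (2 * pi)) * c i) * 0)"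
        by (intro sums_sum sums_mult 1)
      moreover have "(\<Sum>i\<in>{1..a}. complex_of_real ((- ((-1) ^ a) / (2 * pi)) * c i) * (s k * smear r h (B / real i) (l k))) = s k * H (l k)" for k
        unfolding H_def by (simp add: sum_distrib_left mult_ac)
      ultimately show "(\<lambda>k. s k * H (l k)) sums 0" by simp
    qed
    then show "\<exists>H. annihilated L B H \<and> (\<forall>u. \<bar>h u - H u\<bar> \<le> C1 * J / (2 * pi) / B ^ a / (1 + u\<^sup>2) ^ L)"
      using err by blast
  qed
qed

section \<open>Localization of the spectral kernels\<close>

text \<open>A single term suffices: for 2^j \<le> 1 + z < 2^(j+1) the quotient z/2^j is at most 2,
  which exp 2 compensates. The index j depends on z, so the sum has to be long enough; keeping it
  finite allows it to be exchanged with finite sums over the spectrum.\<close>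

lemma inverse_power_le_dyadic_exp:
  fixes z :: real
  assumes z: "z \<ge> 0"
  obtains j0 :: nat where "\<And>J. J > j0 \<Longrightarrow> 1 / (1 + z) ^ L \<le> exp 2 * (\<Sum>j<J. (1/2) ^ (j * L) * exp (- (z / 2 ^ j)))"
proof -
  obtain m :: nat where m: "1 + z < 2 ^ m" using real_arch_pow[of 2 "1 + z"] by auto
  define j where "j = (LEAST m. 1 + z < 2 ^ Suc m)"
  have ex: "1 + z < 2 ^ Suc m" using m by (simp add: less_le_trans)
  have 1: "1 + z < 2 ^ Suc j" unfolding j_def by (rule LeastI[of "\<lambda>m. 1 + z < 2 ^ Suc m", OF ex])
  have 2: "2 ^ j \<le> 1 + z"
  proof (cases j)
    case 0 then show ?thesis using z by simp
  next
    case (Suc i)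
    then have "\<not> 1 + z < 2 ^ Suc i" using not_less_Least[of i "\<lambda>m. 1 + z < 2 ^ Suc m"] unfolding j_def by simp
    then show ?thesis using Suc by simp
  qed
  have "z / 2 ^ j \<le> 2" using 1 by (simp add: field_simps)
  then have e: "1 \<le> exp 2 * exp (- (z / 2 ^ j))" unfolding exp_add[symmetric] by simp
  have "1 / (1 + z) ^ L \<le> 1 / (2 ^ j) ^ L" using 2 z by (intro divide_left_mono power_mono) auto
  also have "\<dots> = (1/2) ^ (j * L) * 1" by (simp add: power_mult power_one_over)
  also have "\<dots> \<le> (1/2) ^ (j * L) * (exp 2 * exp (- (z / 2 ^ j)))" by (intro mult_left_mono e) auto
  finally have t: "1 / (1 + z) ^ L \<le> exp 2 * ((1/2) ^ (j * L) * exp (- (z / 2 ^ j)))" by (simp add: mult_ac)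
  show thesis
  proof (rule that[of j])
    fix J assume "J > j"
    then have "(1/2) ^ (j * L) * exp (- (z / 2 ^ j)) \<le> (\<Sum>j<J. (1/2) ^ (j * L) * exp (- (z / 2 ^ j)))"
      by (intro member_le_sum) auto
    then show "1 / (1 + z) ^ L \<le> exp 2 * (\<Sum>j<J. (1/2) ^ (j * L) * exp (- (z / 2 ^ j)))"
      by (intro order_trans[OF t] mult_left_mono) auto
  qed
qed

lemma borel_measurable_cnj [measurable (raw)]:
  "f \<in> borel_measurable M \<Longrightarrow> (\<lambda>x. cnj (f x)) \<in> borel_measurable M"
  by (rule borel_measurable_continuous_on[OF continuous_on_cnj[OF continuous_on_id]])

lemma ennreal_power2_le_cancel:
  assumes "X ^ 2 \<le> ennreal (M ^ 2)" "M \<ge> 0"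
  shows "X \<le> ennreal M"
proof (rule ccontr)
  assume "\<not> X \<le> ennreal M"
  then have lt: "ennreal M < X" by simp
  show False
  proof (cases X)
    case (real x)
    then have "M < x" using lt assms(2) by (simp add: ennreal_less_iff)
    then have "M ^ 2 < x ^ 2" using assms(2) by (intro power_strict_mono) auto
    moreover have "x ^ 2 \<le> M ^ 2" using assms real by (simp add: ennreal_power)
    ultimately show False by simp
  next
    case top
    then show False using assms(1) by (simp add: power2_eq_square ennreal_top_mult top_unique)
  qed
qed

lemma nn_integral_cauchy_set:
  assumes [measurable]: "f \<in> borel_measurable M" "E \<in> sets M"
    and F: "(\<integral>\<^sup>+y. ennreal ((cmod (f y))\<^sup>2) \<partial>M) \<le> ennreal (\<alpha>\<^sup>2)" and E: "emeasure M E \<le> ennreal (\<beta>\<^sup>2)"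
    and ab: "\<alpha> \<ge> 0" "\<beta> \<ge> 0"
  shows "(\<integral>\<^sup>+y. indicator E y * ennreal (cmod (f y)) \<partial>M) \<le> ennreal (\<alpha> * \<beta>)"
proof (rule ennreal_power2_le_cancel)
  have "(\<integral>\<^sup>+y. indicator E y * ennreal (cmod (f y)) \<partial>M)\<^sup>2 \<le> (\<integral>\<^sup>+y. (indicator E y)\<^sup>2 \<partial>M) * (\<integral>\<^sup>+y. (ennreal (cmod (f y)))\<^sup>2 \<partial>M)"
    by (rule Cauchy_Schwarz_nn_integral) measurable
  also have "(\<integral>\<^sup>+y. (indicator E y)\<^sup>2 \<partial>M) = emeasure M E"
    by (subst nn_integral_indicator[symmetric], simp, rule nn_integral_cong) (simp add: indicator_def)
  also have "(\<integral>\<^sup>+y. (ennreal (cmod (f y)))\<^sup>2 \<partial>M) = (\<integral>\<^sup>+y. ennreal ((cmod (f y))\<^sup>2) \<partial>M)"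
    by (simp add: ennreal_power)
  also have "emeasure M E * (\<integral>\<^sup>+y. ennreal ((cmod (f y))\<^sup>2) \<partial>M) \<le> ennreal (\<beta>\<^sup>2) * ennreal (\<alpha>\<^sup>2)"
    by (intro mult_mono E F) auto
  also have "\<dots> = ennreal ((\<alpha> * \<beta>)\<^sup>2)" by (simp add: ennreal_mult[symmetric] power_mult_distrib mult.commute)
  finally show "(\<integral>\<^sup>+y. indicator E y * ennreal (cmod (f y)) \<partial>M)\<^sup>2 \<le> ennreal ((\<alpha> * \<beta>)\<^sup>2)" .
qed (use ab in auto)

text \<open>The kernel Phi_n of a single system. For a filter vanishing from 1 on, cutting the sum
  at lam k < n discards only zero terms.\<close>

definition skern :: "'a spectral_system \<Rightarrow> (real \<Rightarrow> real) \<Rightarrow> real \<Rightarrow> 'a \<Rightarrow> 'a \<Rightarrow> complex"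
  where "skern \<Xi> h n x y = (\<Sum>k | lam \<Xi> k < n. complex_of_real (h (lam \<Xi> k / n)) * phi \<Xi> k x * cnj (phi \<Xi> k y))"

lemma admissible_finite: "admissible_system \<Xi> \<Longrightarrow> finite {k. lam \<Xi> k < n}"
proof -
  assume "admissible_system \<Xi>"
  then have "filterlim (lam \<Xi>) at_top sequentially" by (simp add: admissible_system_def)
  then have "\<forall>\<^sub>F k in sequentially. n \<le> lam \<Xi> k" by (simp add: filterlim_at_top)
  then have "finite {k. \<not> n \<le> lam \<Xi> k}" by (simp add: cofinite_eq_sequentially[symmetric] eventually_cofinite)
  then show "finite {k. lam \<Xi> k < n}" by (simp add: not_le)
qed

lemma admissible_lam_nonneg: "admissible_system \<Xi> \<Longrightarrow> 0 \<le> lam \<Xi> k"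
  unfolding admissible_system_def incseq_def by (metis le0)

lemma admissible_phi:
  assumes "admissible_system \<Xi>"
  shows "integrable (msr \<Xi>) (phi \<Xi> k)" "phi \<Xi> k \<in> borel_measurable (msr \<Xi>)" "\<exists>B\<ge>0. \<forall>x\<in>pts \<Xi>. cmod (phi \<Xi> k x) \<le> B"
proof -
  show i: "integrable (msr \<Xi>) (phi \<Xi> k)" using assms unfolding admissible_system_def by blast
  then show "phi \<Xi> k \<in> borel_measurable (msr \<Xi>)" by (rule borel_measurable_integrable)
  have "bounded (phi \<Xi> k ` pts \<Xi>)" using assms unfolding admissible_system_def by blast
  then show "\<exists>B\<ge>0. \<forall>x\<in>pts \<Xi>. cmod (phi \<Xi> k x) \<le> B" unfolding bounded_pos by (auto intro: less_imp_le)
qed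

section \<open>Kernel estimates for a single system\<close>

locale heat_system =
  fixes \<Xi> :: "'a spectral_system" and q c :: real
  assumes adm: "admissible_system \<Xi>" and gauss: "gaussian_upper_bound \<Xi> q"
    and orth: "orthonormal_system \<Xi>" and balls: "ball_growth \<Xi> q c" and c0: "c > 0"
begin

abbreviation "M \<equiv> msr \<Xi>"
abbreviation "\<phi> \<equiv> phi \<Xi>"
abbreviation "lm \<equiv> lam \<Xi>"

lemma phi_measurable [measurable]: "\<phi> k \<in> borel_measurable M" using admissible_phi(2)[OF adm] .

lemma q0: "q > 0" using gauss by (simp add: gaussian_upper_bound_def)

lemma qdist_refl: "x \<in> pts \<Xi> \<Longrightarrow> qdist \<Xi> x x = 0"
  using adm unfolding admissible_system_def quasi_metric_on_def by blast

lemma heat_summable: "0 < t \<Longrightarrow> t \<le> 1 \<Longrightarrow> x \<in> pts \<Xi> \<Longrightarrow> y \<in> pts \<Xi> \<Longrightarrow> summable (heat_term \<Xi> t x y)"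
  using gauss unfolding gaussian_upper_bound_def by blast

lemma gauss_consts:
  obtains c1 c2 where "c1 > 0" "c2 > 0" "\<And>t x y. 0 < t \<Longrightarrow> t \<le> 1 \<Longrightarrow> x \<in> pts \<Xi> \<Longrightarrow> y \<in> pts \<Xi> \<Longrightarrow>
       cmod (\<Sum>k. heat_term \<Xi> t x y k) \<le> c1 * t powr (- q / 2) * exp (- c2 * (qdist \<Xi> x y)\<^sup>2 / t)"
  using gauss unfolding gaussian_upper_bound_def by blast

text \<open>On the diagonal all terms are nonnegative, so the bound for the full sum holds for every
  partial sum.\<close>

lemma heat_diag:
  assumes c1: "\<And>t x y. 0 < t \<Longrightarrow> t \<le> 1 \<Longrightarrow> x \<in> pts \<Xi> \<Longrightarrow> y \<in> pts \<Xi> \<Longrightarrow>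
       cmod (\<Sum>k. heat_term \<Xi> t x y k) \<le> c1 * t powr (- q / 2) * exp (- c2 * (qdist \<Xi> x y)\<^sup>2 / t)"
    and t: "0 < t" "t \<le> 1" and x: "x \<in> pts \<Xi>"
  shows "(\<Sum>k<K. exp (- ((lm k)\<^sup>2 * t)) * (cmod (\<phi> k x))\<^sup>2) \<le> c1 * t powr (- q / 2)"
proof -
  define g where "g = (\<lambda>k. exp (- ((lm k)\<^sup>2 * t)) * (cmod (\<phi> k x))\<^sup>2)"
  have e: "heat_term \<Xi> t x x k = complex_of_real (g k)" for k
    unfolding heat_term_def g_def by (simp only: mult.assoc complex_norm_square[symmetric] of_real_mult)
  have sg: "summable g" using heat_summable[OF t x x] unfolding e[abs_def] by (simp add: summable_of_real_iff)
  have "(\<Sum>k<K. g k) \<le> suminf g" by (intro sum_le_suminf sg) (auto simp: g_def)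
  also have "suminf g = cmod (\<Sum>k. heat_term \<Xi> t x x k)"
    unfolding e suminf_of_real[OF sg, symmetric] using suminf_nonneg[OF sg] by (simp add: g_def)
  also have "\<dots> \<le> c1 * t powr (- q / 2)" using c1[OF t x x] qdist_refl[OF x] by simp
  finally show ?thesis unfolding g_def .
qed

text \<open>A Christoffel function at scale n with a smooth weight in place of the cutoff lam k < n,
  because the errors of band-limited approximants have tails that must be summed too. Summability is
  stated separately since \<open>suminf\<close> alone carries no information on convergence.\<close>

definition christoffel :: "nat \<Rightarrow> real \<Rightarrow> bool"
  where "christoffel L C \<longleftrightarrow> (\<forall>n\<ge>1. \<forall>x\<in>pts \<Xi>. summable (\<lambda>k. (cmod (\<phi> k x))\<^sup>2 / (1 + (lm k / n)\<^sup>2) ^ L) \<and>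
    (\<Sum>k. (cmod (\<phi> k x))\<^sup>2 / (1 + (lm k / n)\<^sup>2) ^ L) \<le> C * n powr q)"

lemma christoffelD:
  assumes "christoffel L C" "n \<ge> 1" "x \<in> pts \<Xi>"
  shows "summable (\<lambda>k. (cmod (\<phi> k x))\<^sup>2 / (1 + (lm k / n)\<^sup>2) ^ L)"
    "(\<Sum>k. (cmod (\<phi> k x))\<^sup>2 / (1 + (lm k / n)\<^sup>2) ^ L) \<le> C * n powr q"
  using assms unfolding christoffel_def by auto

text \<open>
  The weight $(1+u^2)^{-L}$ is dominated by a sum of dyadically scaled Gaussians; this reduces the claim to
  the heat kernel on the diagonal.
\<close>

lemma christoffel_bound:
  assumes L: "2 * real L > q"
  shows "\<exists>C>0. christoffel L C"
proof -
  obtain c1 c2 where c: "c1 > 0" "c2 > 0" "\<And>t x y. 0 < t \<Longrightarrow> t \<le> 1 \<Longrightarrow> x \<in> pts \<Xi> \<Longrightarrow> y \<in> pts \<Xi> \<Longrightarrow>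
       cmod (\<Sum>k. heat_term \<Xi> t x y k) \<le> c1 * t powr (- q / 2) * exp (- c2 * (qdist \<Xi> x y)\<^sup>2 / t)" using gauss_consts by metis
  \<comment> \<open>The heat kernel at time 1/(2^j n^2) costs 2^(jq/2) n^q, against the dyadic
    weight 2^(-jL). Their ratio is \<theta>^j, summable because 2L > q.\<close>
  define \<theta> where "\<theta> = 2 powr (q / 2 - real L)"
  have th: "0 < \<theta>" "\<theta> < 1" using L by (auto simp: \<theta>_def powr_less_one)
  define C where "C = exp 2 * c1 * (1 / (1 - \<theta>))"
  have part: "(\<Sum>k<K. (cmod (\<phi> k x))\<^sup>2 / (1 + (lm k / n)\<^sup>2) ^ L) \<le> C * n powr q" if n: "n \<ge> 1" and x: "x \<in> pts \<Xi>" for n x K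
  proof -
    have "\<forall>k. \<exists>j0::nat. \<forall>J>j0. 1 / (1 + (lm k / n)\<^sup>2) ^ L \<le> exp 2 * (\<Sum>j<J. (1/2) ^ (j * L) * exp (- ((lm k / n)\<^sup>2 / 2 ^ j)))"
    proof
      fix k
      show "\<exists>j0::nat. \<forall>J>j0. 1 / (1 + (lm k / n)\<^sup>2) ^ L \<le> exp 2 * (\<Sum>j<J. (1/2) ^ (j * L) * exp (- ((lm k / n)\<^sup>2 / 2 ^ j)))"
        by (rule inverse_power_le_dyadic_exp[OF zero_le_power2[of "lm k / n"], of L]) blast
    qed
    from choice[OF this] obtain j0 :: "nat \<Rightarrow> nat" where j0: "\<And>k J. J > j0 k \<Longrightarrow> 1 / (1 + (lm k / n)\<^sup>2) ^ L \<le> exp 2 * (\<Sum>j<J. (1/2) ^ (j * L) * exp (- ((lm k / n)\<^sup>2 / 2 ^ j)))"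
      by blast
    \<comment> \<open>Enough scales for all k < K at once; the geometric series makes the final
      bound independent of J and K.\<close>
    define J where "J = Suc (\<Sum>k<K. j0 k)"
    have J: "J > j0 k" if "k < K" for k
      using member_le_sum[of k "{..<K}" j0] that unfolding J_def by simp
    have "(\<Sum>k<K. (cmod (\<phi> k x))\<^sup>2 / (1 + (lm k / n)\<^sup>2) ^ L) = (\<Sum>k<K. (cmod (\<phi> k x))\<^sup>2 * (1 / (1 + (lm k / n)\<^sup>2) ^ L))" by simp
    also have "\<dots> \<le> (\<Sum>k<K. (cmod (\<phi> k x))\<^sup>2 * (exp 2 * (\<Sum>j<J. (1/2) ^ (j * L) * exp (- ((lm k / n)\<^sup>2 / 2 ^ j)))))"
      by (intro sum_mono mult_left_mono j0 J) auto
    also have "\<dots> = (\<Sum>j<J. \<Sum>k<K. exp 2 * (1/2) ^ (j * L) * (exp (- ((lm k / n)\<^sup>2 / 2 ^ j)) * (cmod (\<phi> k x))\<^sup>2))"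
      unfolding sum_distrib_left by (subst sum.swap) (simp add: mult_ac)
    also have "\<dots> = (\<Sum>j<J. exp 2 * (1/2) ^ (j * L) * (\<Sum>k<K. exp (- ((lm k)\<^sup>2 * (1 / (2 ^ j * n\<^sup>2)))) * (cmod (\<phi> k x))\<^sup>2))"
      unfolding sum_distrib_left by (simp add: power_divide mult_ac)
    also have "\<dots> \<le> (\<Sum>j<J. exp 2 * (1/2) ^ (j * L) * (c1 * (1 / (2 ^ j * n\<^sup>2)) powr (- q / 2)))"
    proof (intro sum_mono mult_left_mono heat_diag[OF c(3) _ _ x])
      fix j
      have "1 \<le> 2 ^ j * n\<^sup>2" using n by (intro mult_ge1_I one_le_power) auto
      then show "0 < 1 / (2 ^ j * n\<^sup>2)" "1 / (2 ^ j * n\<^sup>2) \<le> 1" by auto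
    qed auto
    also have "\<dots> = (\<Sum>j<J. (exp 2 * c1 * n powr q) * \<theta> ^ j)"
    proof (intro sum.cong refl)
      fix j
      have "(1 / (2 ^ j * n\<^sup>2)) powr (- q / 2) = (2 ^ j * n\<^sup>2) powr (q / 2)"
        using n by (simp add: powr_minus powr_divide)
      also have "\<dots> = (2 powr real j * n powr 2) powr (q / 2)" using n by (simp add: powr_realpow)
      also have "\<dots> = 2 powr (real j * (q / 2)) * n powr q" by (simp only: powr_mult powr_ge_zero powr_powr) simp
      finally have 1: "(1 / (2 ^ j * n\<^sup>2)) powr (- q / 2) = 2 powr (real j * (q / 2)) * n powr q" .
      have "(1/2::real) ^ (j * L) = 2 powr (- (real j * real L))"
      proof -
        have "(1/2::real) ^ (j * L) = inverse (2 powr real (j * L))"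
          by (simp only: powr_realpow[OF zero_less_numeral] power_one_over inverse_eq_divide)
        then show ?thesis by (simp only: powr_minus of_nat_mult)
      qed
      then have "(1/2) ^ (j * L) * 2 powr (real j * (q / 2)) = 2 powr (real j * (q / 2 - real L))"
        by (simp add: powr_add[symmetric] algebra_simps)
      also have "\<dots> = \<theta> ^ j" unfolding \<theta>_def by (simp add: powr_realpow[symmetric] powr_powr mult.commute)
      finally have 2: "(1/2) ^ (j * L) * 2 powr (real j * (q / 2)) = \<theta> ^ j" .
      show "exp 2 * (1/2) ^ (j * L) * (c1 * (1 / (2 ^ j * n\<^sup>2)) powr (- q / 2)) = (exp 2 * c1 * n powr q) * \<theta> ^ j"
        unfolding 1 2[symmetric] by (simp add: mult_ac)
    qed
    also have "\<dots> = (exp 2 * c1 * n powr q) * (\<Sum>j<J. \<theta> ^ j)" by (simp add: sum_distrib_left)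
    also have "\<dots> \<le> (exp 2 * c1 * n powr q) * (\<Sum>j. \<theta> ^ j)"
      using th c by (intro mult_left_mono sum_le_suminf summable_geometric) auto
    also have "(\<Sum>j. \<theta> ^ j) = 1 / (1 - \<theta>)" using th by (intro suminf_geometric) auto
    finally show ?thesis by (simp add: C_def mult_ac)
  qed
  show ?thesis
  unfolding christoffel_def
  proof (intro exI[of _ C] conjI allI ballI impI)
    show "C > 0" unfolding C_def using c th by auto
    fix n x assume n: "1 \<le> (n::real)" and x: "x \<in> pts \<Xi>"
    have nn: "0 \<le> (cmod (\<phi> k x))\<^sup>2 / (1 + (lm k / n)\<^sup>2) ^ L" for k
      using less_imp_le[OF one_plus_sq_power_pos] by (intro divide_nonneg_nonneg) auto
    show s: "summable (\<lambda>k. (cmod (\<phi> k x))\<^sup>2 / (1 + (lm k / n)\<^sup>2) ^ L)"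
      by (rule summableI_nonneg_bounded[OF nn part[OF n x]])
    show "(\<Sum>k. (cmod (\<phi> k x))\<^sup>2 / (1 + (lm k / n)\<^sup>2) ^ L) \<le> C * n powr q"
      by (rule suminf_le_const[OF s part[OF n x]])
  qed
qed

lemma phi_prod_integrable: "integrable M (\<lambda>x. \<phi> j x * cnj (\<phi> k x))"
proof -
  obtain B where B: "B \<ge> 0" "\<forall>x\<in>pts \<Xi>. cmod (\<phi> k x) \<le> B" using admissible_phi(3)[OF adm] by blast
  show ?thesis
    by (rule Bochner_Integration.integrable_bound[OF integrable_mult_left[OF integrable_norm[OF admissible_phi(1)[OF adm, of j]], of B]])
       (use B in \<open>auto intro!: AE_I2 mult_left_mono simp: norm_mult\<close>)
qed

text \<open>Orthonormality gives the norms of the partial sums exactly, and Fatou's lemma passes to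
  the pointwise limit. In this way the pointwise sum never has to be identified with a limit in
  L^2.\<close>

lemma bessel_series:
  fixes b :: "nat \<Rightarrow> complex"
  assumes lim: "\<And>y. y \<in> pts \<Xi> \<Longrightarrow> (\<lambda>k. b k * cnj (\<phi> k y)) sums F y"
    and b: "\<And>K. (\<Sum>k<K. (cmod (b k))\<^sup>2) \<le> S"
  shows "(\<integral>\<^sup>+y. ennreal ((cmod (F y))\<^sup>2) \<partial>M) \<le> ennreal S"
proof -
  define FK where "FK = (\<lambda>K y. \<Sum>k<K. b k * cnj (\<phi> k y))"
  have [measurable]: "FK K \<in> borel_measurable M" for K unfolding FK_def by measurable
  have part: "(\<integral>\<^sup>+y. ennreal ((cmod (FK K y))\<^sup>2) \<partial>M) \<le> ennreal S" for K
  proof -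
    have e: "complex_of_real ((cmod (FK K y))\<^sup>2) = (\<Sum>j<K. \<Sum>k<K. (cnj (b j) * b k) * (\<phi> j y * cnj (\<phi> k y)))" for y
    proof -
      have "complex_of_real ((cmod (FK K y))\<^sup>2) = cnj (FK K y) * FK K y" by (simp only: complex_norm_square mult.commute)
      also have "\<dots> = (\<Sum>j<K. \<Sum>k<K. (cnj (b j) * \<phi> j y) * (b k * cnj (\<phi> k y)))"
        unfolding FK_def by (simp add: sum_product)
      finally show ?thesis by (simp add: mult_ac)
    qed
    have int: "integrable M (\<lambda>y. complex_of_real ((cmod (FK K y))\<^sup>2))"
      unfolding e by (intro Bochner_Integration.integrable_sum integrable_mult_right phi_prod_integrable)
    have "(\<integral>y. complex_of_real ((cmod (FK K y))\<^sup>2) \<partial>M) = (\<Sum>j<K. \<Sum>k<K. (cnj (b j) * b k) * (if j = k then 1 else 0))"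
      unfolding e using orth by (simp add: Bochner_Integration.integral_sum phi_prod_integrable orthonormal_system_def)
    also have "\<dots> = complex_of_real (\<Sum>k<K. (cmod (b k))\<^sup>2)"
      unfolding of_real_sum complex_norm_square by (simp add: if_distrib[of "(*) _"] sum.delta' mult.commute cong: if_cong)
    finally have I: "(\<integral>y. (cmod (FK K y))\<^sup>2 \<partial>M) = (\<Sum>k<K. (cmod (b k))\<^sup>2)"
      unfolding integral_complex_of_real by (simp only: of_real_eq_iff)
    have "integrable M (\<lambda>y. (cmod (FK K y))\<^sup>2)" using integrable_Re[OF int] by (simp only: Re_complex_of_real)
    then have "(\<integral>\<^sup>+y. ennreal ((cmod (FK K y))\<^sup>2) \<partial>M) = ennreal (\<integral>y. (cmod (FK K y))\<^sup>2 \<partial>M)"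
      by (rule nn_integral_eq_integral) simp
    then show ?thesis unfolding I using b[of K] by (simp add: ennreal_leI)
  qed
  have "(\<integral>\<^sup>+y. ennreal ((cmod (F y))\<^sup>2) \<partial>M) = (\<integral>\<^sup>+y. liminf (\<lambda>K. ennreal ((cmod (FK K y))\<^sup>2)) \<partial>M)"
  proof (rule nn_integral_cong)
    fix y assume "y \<in> pts \<Xi>"
    then have "(\<lambda>K. FK K y) \<longlonglongrightarrow> F y" using lim unfolding sums_def FK_def by simp
    then have "(\<lambda>K. ennreal ((cmod (FK K y))\<^sup>2)) \<longlonglongrightarrow> ennreal ((cmod (F y))\<^sup>2)"
      by (intro tendsto_ennrealI tendsto_power tendsto_norm)
    from lim_imp_Liminf[OF _ this] show "ennreal ((cmod (F y))\<^sup>2) = liminf (\<lambda>K. ennreal ((cmod (FK K y))\<^sup>2))"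
      by simp
  qed
  also have "\<dots> \<le> liminf (\<lambda>K. \<integral>\<^sup>+y. ennreal ((cmod (FK K y))\<^sup>2) \<partial>M)"
    by (rule nn_integral_liminf) measurable
  also have "\<dots> \<le> ennreal S"
    using Liminf_mono[of "\<lambda>K. \<integral>\<^sup>+y. ennreal ((cmod (FK K y))\<^sup>2) \<partial>M" "\<lambda>_. ennreal S" sequentially] part by (simp add: Liminf_const)
  finally show ?thesis .
qed

lemma skern_sums:
  assumes n: "n > 0" and supp: "\<And>u. \<bar>u\<bar> \<ge> 1 \<Longrightarrow> h u = 0"
  shows "(\<lambda>k. complex_of_real (h (lm k / n)) * \<phi> k x * cnj (\<phi> k y)) sums skern \<Xi> h n x y"
  unfolding skern_def
proof (rule sums_finite[OF admissible_finite[OF adm]])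
  fix k assume "k \<notin> {k. lm k < n}"
  then have "\<bar>lm k / n\<bar> \<ge> 1" using n admissible_lam_nonneg[OF adm, of k] by (simp add: field_simps)
  then show "complex_of_real (h (lm k / n)) * \<phi> k x * cnj (\<phi> k y) = 0" using supp by simp
qed

lemma skern_swap: "skern \<Xi> h n y x = cnj (skern \<Xi> h n x y)"
  unfolding skern_def by (simp add: mult_ac)

lemma skern_measurable [measurable]: "(\<lambda>y. skern \<Xi> h n x y) \<in> borel_measurable M"
  unfolding skern_def by measurable

text \<open>Where h(lam k/n) is nonzero the Christoffel weight is at least 2^(-L), so the product of
  two eigenfunctions is controlled by the Christoffel sums at x and y.\<close>

lemma skern_sup:
  assumes h1: "\<And>u. \<bar>h u\<bar> \<le> 1" and supp: "\<And>u. \<bar>u\<bar> \<ge> 1 \<Longrightarrow> h u = 0"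
  obtains C where "C > 0" "\<And>n x y. n \<ge> 1 \<Longrightarrow> x \<in> pts \<Xi> \<Longrightarrow> y \<in> pts \<Xi> \<Longrightarrow> cmod (skern \<Xi> h n x y) \<le> C * n powr q"
proof -
  obtain L :: nat where L: "q < real L" using reals_Archimedean2 by blast
  then have "2 * real L > q" using q0 by simp
  obtain C where C0: "C > 0" "christoffel L C" using christoffel_bound[OF \<open>2 * real L > q\<close>] by blast
  note C = C0(1) christoffelD[OF C0(2)]
  show thesis
  proof (rule that[of "2 ^ L * C"])
    show "2 ^ L * C > 0" using C by simp
    fix n :: real and x y assume n: "n \<ge> 1" and x: "x \<in> pts \<Xi>" and y: "y \<in> pts \<Xi>"
    define f where "f = (\<lambda>x k. (cmod (\<phi> k x))\<^sup>2 / (1 + (lm k / n)\<^sup>2) ^ L)"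
    have tb: "norm (complex_of_real (h (lm k / n)) * \<phi> k x * cnj (\<phi> k y)) \<le> 2 ^ L / 2 * (f x k + f y k)" for k
    proof (cases "\<bar>lm k / n\<bar> < 1")
      case True
      have "(lm k / n)\<^sup>2 \<le> 1" using True by (simp only: abs_square_le_1)
      then have "(1 + (lm k / n)\<^sup>2) ^ L \<le> 2 ^ L" by (intro power_mono) auto
      then have "1 \<le> 2 ^ L / (1 + (lm k / n)\<^sup>2) ^ L" by (simp only: pos_le_divide_eq one_plus_sq_power_pos mult_1)
      then have "(cmod (\<phi> k z))\<^sup>2 * 1 \<le> (cmod (\<phi> k z))\<^sup>2 * (2 ^ L / (1 + (lm k / n)\<^sup>2) ^ L)" for z by (intro mult_left_mono) auto
      then have f: "(cmod (\<phi> k z))\<^sup>2 \<le> 2 ^ L * f z k" for z by (simp add: f_def mult_ac)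
      have "norm (complex_of_real (h (lm k / n)) * \<phi> k x * cnj (\<phi> k y)) \<le> 1 * (cmod (\<phi> k x) * cmod (\<phi> k y))"
        using mult_right_mono[OF h1, of "cmod (\<phi> k x) * cmod (\<phi> k y)" "lm k / n"] by (simp add: norm_mult mult.assoc)
      also have "\<dots> \<le> ((cmod (\<phi> k x))\<^sup>2 + (cmod (\<phi> k y))\<^sup>2) / 2"
        using sum_squares_bound[of "cmod (\<phi> k x)" "cmod (\<phi> k y)"] by simp
      also have "\<dots> \<le> 2 ^ L / 2 * (f x k + f y k)" using f[of x] f[of y] by (simp add: algebra_simps)
      finally show ?thesis .
    next
      case False
      have "f z k \<ge> 0" for z unfolding f_def using less_imp_le[OF one_plus_sq_power_pos] by (intro divide_nonneg_nonneg) auto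
      then show ?thesis using False supp[of "lm k / n"] by simp
    qed
    have sf: "summable (f x)" "summable (f y)" unfolding f_def using C(2) n x y by auto
    have "cmod (skern \<Xi> h n x y) = norm (\<Sum>k. complex_of_real (h (lm k / n)) * \<phi> k x * cnj (\<phi> k y))"
      using skern_sums[of n h x y, OF _ supp] n by (simp add: sums_iff)
    also have "\<dots> \<le> (\<Sum>k. 2 ^ L / 2 * (f x k + f y k))"
      by (rule norm_suminf_le[OF tb]) (intro summable_mult summable_add sf)
    also have "\<dots> = 2 ^ L / 2 * ((\<Sum>k. f x k) + (\<Sum>k. f y k))"
      by (simp only: suminf_mult[OF summable_add[OF sf]] suminf_add[OF sf])
    also have "\<dots> \<le> 2 ^ L / 2 * (C * n powr q + C * n powr q)"
      unfolding f_def using C(3) n x y by (intro mult_left_mono add_mono) auto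
    finally show "cmod (skern \<Xi> h n x y) \<le> 2 ^ L * C * n powr q" by simp
  qed
qed

text \<open>With frequencies lam k/n, the Gaussian bound at time t/n^2 is the hypothesis of
  \<open>annihilated\<close> with A = c2 n^2 d(x,y)^2. Beyond the corresponding distance the
  multiplier H contributes nothing, and only h - H remains.\<close>

lemma skern_far:
  assumes n: "n \<ge> 1" and x: "x \<in> pts \<Xi>" and y: "y \<in> pts \<Xi>" and L: "2 * real L > q" and supp: "\<And>u. \<bar>u\<bar> \<ge> 1 \<Longrightarrow> h u = 0"
    and H: "annihilated L B H"
    and gs: "\<And>t x y. 0 < t \<Longrightarrow> t \<le> 1 \<Longrightarrow> x \<in> pts \<Xi> \<Longrightarrow> y \<in> pts \<Xi> \<Longrightarrow>
       cmod (\<Sum>k. heat_term \<Xi> t x y k) \<le> c1 * t powr (- q / 2) * exp (- c2 * (qdist \<Xi> x y)\<^sup>2 / t)"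
    and far: "B\<^sup>2 < 4 * (c2 * n\<^sup>2 * (qdist \<Xi> x y)\<^sup>2)"
  shows "(\<lambda>k. complex_of_real (h (lm k / n) - H (lm k / n)) * \<phi> k x * cnj (\<phi> k y)) sums skern \<Xi> h n x y"
proof -
  define a where "a = (\<lambda>k. \<phi> k x * cnj (\<phi> k y))"
  define f where "f = (\<lambda>x k. (cmod (\<phi> k x))\<^sup>2 / (1 + (lm k / n)\<^sup>2) ^ L)"
  obtain C where C0: "C > 0" "christoffel L C" using christoffel_bound[OF L] by blast
  note C = C0(1) christoffelD[OF C0(2)]
  have sf: "summable (f x)" if "x \<in> pts \<Xi>" for x
    unfolding f_def by (rule C(2)[OF n that])
  have sm: "summable (\<lambda>k. cmod (a k) / (1 + (lm k / n)\<^sup>2) ^ L)"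
  proof (rule summable_comparison_test'[OF summable_add[OF sf[OF x] sf[OF y]], of 0])
    fix k
    have "cmod (a k) \<le> (cmod (\<phi> k x))\<^sup>2 + (cmod (\<phi> k y))\<^sup>2"
    proof -
      have "2 * (cmod (\<phi> k x) * cmod (\<phi> k y)) \<le> (cmod (\<phi> k x))\<^sup>2 + (cmod (\<phi> k y))\<^sup>2"
        using sum_squares_bound[of "cmod (\<phi> k x)" "cmod (\<phi> k y)"] by simp
      moreover have "0 \<le> cmod (\<phi> k x) * cmod (\<phi> k y)" by simp
      ultimately show ?thesis unfolding a_def norm_mult complex_mod_cnj by linarith
    qed
    then have "cmod (a k) / (1 + (lm k / n)\<^sup>2) ^ L \<le> ((cmod (\<phi> k x))\<^sup>2 + (cmod (\<phi> k y))\<^sup>2) / (1 + (lm k / n)\<^sup>2) ^ L"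
      by (rule divide_right_mono[OF _ less_imp_le[OF one_plus_sq_power_pos]])
    then show "norm (cmod (a k) / (1 + (lm k / n)\<^sup>2) ^ L) \<le> f x k + f y k"
      using less_imp_le[OF one_plus_sq_power_pos[of "lm k / n" L]] by (simp add: f_def add_divide_distrib)
  qed
  have "(\<lambda>k. a k * H (lm k / n)) sums 0"
  proof (rule H[unfolded annihilated_def, rule_format, OF sm, where ?t0.0 = 1 and A = "c2 * n\<^sup>2 * (qdist \<Xi> x y)\<^sup>2" and C = "c1 * n powr q" and \<kappa> = "q / 2"])
    fix t :: real assume t: "0 < t" "t \<le> 1"
    have n1: "n\<^sup>2 \<ge> 1" using n by (simp add: one_le_power)
    have tn: "0 < t / n\<^sup>2" "t / n\<^sup>2 \<le> 1" using t n n1 by (auto simp: divide_le_eq intro: order_trans[of t 1])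
    have "(\<Sum>k. a k * exp (- (t * (lm k / n)\<^sup>2))) = (\<Sum>k. heat_term \<Xi> (t / n\<^sup>2) x y k)"
      unfolding heat_term_def a_def by (simp add: power_divide mult_ac)
    also have "cmod \<dots> \<le> c1 * (t / n\<^sup>2) powr (- q / 2) * exp (- c2 * (qdist \<Xi> x y)\<^sup>2 / (t / n\<^sup>2))"
      by (rule gs[OF tn x y])
    also have "(t / n\<^sup>2) powr (- q / 2) = n powr q * t powr - (q / 2)"
    proof -
      have "t / n\<^sup>2 = t * n powr (- 2)" using n by (simp add: powr_minus powr_numeral divide_inverse)
      then show ?thesis by (simp only: powr_mult powr_ge_zero powr_powr) simp
    qed
    finally show "cmod (\<Sum>k. a k * exp (- (t * (lm k / n)\<^sup>2))) \<le> c1 * n powr q * t powr - (q / 2) * exp (- (c2 * n\<^sup>2 * (qdist \<Xi> x y)\<^sup>2) / t)"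
      by (simp add: mult_ac)
  qed (use far in auto)
  from sums_diff[OF skern_sums[of n h x y, OF _ supp] this] n
  have "(\<lambda>k. complex_of_real (h (lm k / n)) * \<phi> k x * cnj (\<phi> k y) - a k * H (lm k / n)) sums (skern \<Xi> h n x y - 0)" by simp
  then show ?thesis unfolding a_def by (simp add: algebra_simps)
qed

lemma skern_L2_tail:
  assumes n: "n \<ge> 1" and x: "x \<in> pts \<Xi>"
    and C: "summable (\<lambda>k. (cmod (\<phi> k x))\<^sup>2 / (1 + (lm k / n)\<^sup>2) ^ L)" "(\<Sum>k. (cmod (\<phi> k x))\<^sup>2 / (1 + (lm k / n)\<^sup>2) ^ L) \<le> C * n powr q"
    and D: "D \<ge> 0" "\<And>u. \<bar>g u\<bar> \<le> D / (1 + u\<^sup>2) ^ L"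
  shows "(\<Sum>k<K. (cmod (complex_of_real (g (lm k / n)) * \<phi> k x))\<^sup>2) \<le> D\<^sup>2 * (C * n powr q)"
proof -
  have "(cmod (complex_of_real (g (lm k / n)) * \<phi> k x))\<^sup>2 \<le> D\<^sup>2 * ((cmod (\<phi> k x))\<^sup>2 / (1 + (lm k / n)\<^sup>2) ^ L)" for k
  proof -
    let ?w = "(1 + (lm k / n)\<^sup>2) ^ L"
    \<comment> \<open>Squaring the bound on g squares the weight; since the weight is at least 1,
      one of the two factors may be dropped.\<close>
    have w: "?w \<ge> 1" by (intro one_le_power) simp
    have "(g (lm k / n))\<^sup>2 \<le> (D / ?w)\<^sup>2" by (rule power2_le_iff_abs_le[THEN iffD2, OF _ D(2)]) (use D w in simp)
    also have "\<dots> = D\<^sup>2 / (?w * ?w)"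
    proof -
      have "(D / w)\<^sup>2 = D\<^sup>2 / (w * w)" for w :: real by (simp add: power2_eq_square)
      then show ?thesis .
    qed
    also have "\<dots> \<le> D\<^sup>2 / ?w"
      using w mult_mono[OF w order_refl, of ?w] by (intro divide_left_mono) auto
    finally have "(g (lm k / n))\<^sup>2 * (cmod (\<phi> k x))\<^sup>2 \<le> D\<^sup>2 / ?w * (cmod (\<phi> k x))\<^sup>2" by (intro mult_right_mono) auto
    then show ?thesis by (simp add: norm_mult power_mult_distrib)
  qed
  then have "(\<Sum>k<K. (cmod (complex_of_real (g (lm k / n)) * \<phi> k x))\<^sup>2) \<le> (\<Sum>k<K. D\<^sup>2 * ((cmod (\<phi> k x))\<^sup>2 / (1 + (lm k / n)\<^sup>2) ^ L))"
    by (rule sum_mono)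
  also have "\<dots> = D\<^sup>2 * (\<Sum>k<K. (cmod (\<phi> k x))\<^sup>2 / (1 + (lm k / n)\<^sup>2) ^ L)" by (simp only: sum_distrib_left)
  also have "\<dots> \<le> D\<^sup>2 * (C * n powr q)"
    by (intro mult_left_mono order_trans[OF sum_le_suminf C(2)] C(1)) (auto intro: divide_nonneg_pos)
  finally show ?thesis .
qed

text \<open>
  On the annulus where the distance to \<open>x\<close> is about $2^j/n$, the kernel is unchanged when a filter approximant of
  band proportional to $2^j$ is subtracted from \<open>h\<close>. Cauchy--Schwarz and Bessel's inequality then yield a bound that is
  summable in $j$.
\<close>

lemma skern_L1:
  assumes h: "low_pass_filter h" and a: "real a > q / 2" and Cf: "Cf \<ge> 0" and fdb: "\<And>d u. \<bar>fd a d h u\<bar> \<le> Cf * \<bar>d\<bar> ^ a"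
  obtains C where "C > 0" "\<And>n x. n \<ge> 1 \<Longrightarrow> x \<in> pts \<Xi> \<Longrightarrow> (\<integral>\<^sup>+y. ennreal (cmod (skern \<Xi> h n x y)) \<partial>M) \<le> ennreal C"
proof -
  have supp: "\<And>u. \<bar>u\<bar> \<ge> 1 \<Longrightarrow> h u = 0" and h01: "\<And>u. 0 \<le> h u \<and> h u \<le> 1" using h unfolding low_pass_filter_def by auto
  obtain L :: nat where L: "max q 1 < real L" using reals_Archimedean2 by blast
  then have Lq: "2 * real L > q" and L1: "L \<ge> 1" using q0 by auto
  obtain c1 c2 where gc: "c1 > 0" "c2 > 0" "\<And>t x y. 0 < t \<Longrightarrow> t \<le> 1 \<Longrightarrow> x \<in> pts \<Xi> \<Longrightarrow> y \<in> pts \<Xi> \<Longrightarrow>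
       cmod (\<Sum>k. heat_term \<Xi> t x y k) \<le> c1 * t powr (- q / 2) * exp (- c2 * (qdist \<Xi> x y)\<^sup>2 / t)" using gauss_consts by metis
  obtain C where C0: "C > 0" "christoffel L C" using christoffel_bound[OF Lq] by blast
  note C = C0(1) christoffelD[OF C0(2)]
  obtain D where D: "D \<ge> 0" "\<And>B. B \<ge> 1 \<Longrightarrow> \<exists>H. annihilated L B H \<and> (\<forall>u. \<bar>h u - H u\<bar> \<le> D / B ^ a / (1 + u\<^sup>2) ^ L)"
    using band_limited_approximation[OF h Cf fdb L1] by metis
  have h0: "\<bar>h u\<bar> \<le> 2 ^ L / (1 + u\<^sup>2) ^ L" for u
  proof (cases "\<bar>u\<bar> < 1")
    case True
    then have "u\<^sup>2 \<le> 1" by (simp add: abs_square_le_1)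
    then have "(1 + u\<^sup>2) ^ L \<le> 2 ^ L" by (intro power_mono) auto
    then have "1 \<le> 2 ^ L / (1 + u\<^sup>2) ^ L" by (simp only: pos_le_divide_eq one_plus_sq_power_pos mult_1)
    moreover have "\<bar>h u\<bar> \<le> 1" using h01[of u] by auto
    ultimately show ?thesis by linarith
  next
    case False
    then show ?thesis using supp[of u] less_imp_le[OF one_plus_sq_power_pos[of u L]] by simp
  qed
  \<comment> \<open>Approximation with band 2^j has error 2^(-ja), and the square root of the volume
    of the j-th annulus contributes 2^(jq/2).\<close>
  define \<theta> where "\<theta> = 2 powr (q / 2 - real a)"
  have th: "0 < \<theta>" "\<theta> < 1" using a by (auto simp: \<theta>_def powr_less_one)
  define \<kappa> where "\<kappa> = sqrt (c * (1 / sqrt c2) powr q * C)"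
  define C' where "C' = 2 ^ L * \<kappa> + D * 2 powr (q / 2) * \<kappa> * (1 / (1 - \<theta>))"
  have kap: "\<kappa> > 0" unfolding \<kappa>_def using c0 C gc by simp
  show thesis
  proof (rule that[of C'])
    have "0 \<le> D * 2 powr (q / 2) * \<kappa> * (1 / (1 - \<theta>))" using D th kap by auto
    moreover have "0 < 2 ^ L * \<kappa>" using kap by simp
    ultimately show "C' > 0" unfolding C'_def by linarith
    fix n :: real and x assume n: "n \<ge> 1" and x: "x \<in> pts \<Xi>"
    \<comment> \<open>Chosen such that c2 n^2 (\<rho> j)^2 = (2^j)^2: outside the j-th ball a
      multiplier of band 2^j is annihilated.\<close>
    define \<rho> where "\<rho> = (\<lambda>j::nat. 2 ^ j / (n * sqrt c2))"
    have rho: "\<rho> j > 0" for j using n gc by (simp add: \<rho>_def)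
    \<comment> \<open>The ball itself may be non-measurable, so a measurable hull attaining its
      outer measure takes its place.\<close>
    have ball: "\<exists>E\<in>sets M. qball \<Xi> x (\<rho> j) \<subseteq> E \<and> emeasure M E \<le> ennreal (c * \<rho> j powr q)" for j
    proof -
      have "qball \<Xi> x (\<rho> j) \<subseteq> space M" by (auto simp: qball_def)
      from outer_measure_of_attain[OF this] obtain E where "E \<in> sets M" "qball \<Xi> x (\<rho> j) \<subseteq> E" "outer_measure_of M (qball \<Xi> x (\<rho> j)) = emeasure M E" by blast
      moreover have "outer_measure_of M (qball \<Xi> x (\<rho> j)) \<le> ennreal (c * \<rho> j powr q)"
        using balls x rho unfolding ball_growth_def by blast
      ultimately show ?thesis by auto
    qed
    then obtain E where E: "\<And>j. E j \<in> sets M" "\<And>j. qball \<Xi> x (\<rho> j) \<subseteq> E j" "\<And>j. emeasure M (E j) \<le> ennreal (c * \<rho> j powr q)"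
      by metis
    define S where "S = (\<lambda>j. E (Suc j) - E j)"
    have [measurable]: "E j \<in> sets M" "S j \<in> sets M" for j using E(1) by (auto simp: S_def)
    \<comment> \<open>The factor n^(-q) of the volume cancels the n^q of the Christoffel bound,
      which makes the final estimate uniform in n.\<close>
    have vol: "sqrt (c * \<rho> j powr q) * sqrt (C * n powr q) = \<kappa> * 2 powr (real j * (q / 2))" for j
    proof -
      have "\<rho> j powr q = 2 powr (real j * q) * (1 / sqrt c2) powr q * n powr - q"
      proof -
        have "\<rho> j = 2 powr real j * (1 / sqrt c2) * n powr - 1"
        proof -
          have 1: "2 powr real j = 2 ^ j" by (rule powr_realpow) simp
          have 2: "n powr - 1 = 1 / n" by (rule powr_neg_one) (use n in simp)
          show ?thesis unfolding \<rho>_def 1 2 by simp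
        qed
        then show ?thesis by (simp only: powr_mult powr_powr) simp
      qed
      moreover have "n powr - q * n powr q = 1" using n by (simp add: powr_minus)
      ultimately have "c * \<rho> j powr q * (C * n powr q) = (c * (1 / sqrt c2) powr q * C) * 2 powr (real j * q)"
        by (simp add: mult_ac)
      moreover have "sqrt (2 powr (real j * q)) = 2 powr (real j * (q / 2))"
        by (simp add: powr_half_sqrt[symmetric] powr_powr)
      ultimately show ?thesis unfolding \<kappa>_def
        using real_sqrt_mult[of "c * \<rho> j powr q" "C * n powr q"] real_sqrt_mult[of "c * (1 / sqrt c2) powr q * C" "2 powr (real j * q)"]
        by (simp only:)
    qed
    define Sk where "Sk = (\<lambda>y. skern \<Xi> h n x y)"
    have [measurable]: "Sk \<in> borel_measurable M" unfolding Sk_def by measurable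
    have near: "(\<integral>\<^sup>+y. indicator (E 0) y * ennreal (cmod (Sk y)) \<partial>M) \<le> ennreal (2 ^ L * \<kappa>)"
    proof -
      have "(\<integral>\<^sup>+y. indicator (E 0) y * ennreal (cmod (Sk y)) \<partial>M) \<le> ennreal ((2 ^ L * sqrt (C * n powr q)) * sqrt (c * \<rho> 0 powr q))"
      proof (rule nn_integral_cauchy_set)
        have "(\<integral>\<^sup>+y. ennreal ((cmod (Sk y))\<^sup>2) \<partial>M) \<le> ennreal ((2 ^ L)\<^sup>2 * (C * n powr q))"
          unfolding Sk_def
          by (rule bessel_series[where b = "\<lambda>k. complex_of_real (h (lm k / n)) * \<phi> k x"])
             (use n in \<open>auto intro!: skern_sums supp skern_L2_tail[OF n x C(2)[OF n x] C(3)[OF n x]] h0\<close>)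
        then show "(\<integral>\<^sup>+y. ennreal ((cmod (Sk y))\<^sup>2) \<partial>M) \<le> ennreal ((2 ^ L * sqrt (C * n powr q))\<^sup>2)"
          using C(1) by (simp add: power_mult_distrib)
        show "emeasure M (E 0) \<le> ennreal ((sqrt (c * \<rho> 0 powr q))\<^sup>2)" using E(3)[of 0] c0 by simp
      qed (use C c0 in auto)
      also have "(2 ^ L * sqrt (C * n powr q)) * sqrt (c * \<rho> 0 powr q) = 2 ^ L * \<kappa>" using vol[of 0] by (simp add: mult_ac)
      finally show ?thesis .
    qed
    have shell: "(\<integral>\<^sup>+y. indicator (S j) y * ennreal (cmod (Sk y)) \<partial>M) \<le> ennreal ((D * 2 powr (q / 2) * \<kappa>) * \<theta> ^ j)" for j
    proof -
      define B :: real where "B = 2 ^ j"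
      have B: "B \<ge> 1" by (simp add: B_def)
      obtain H where H: "annihilated L B H" "\<And>u. \<bar>h u - H u\<bar> \<le> D / B ^ a / (1 + u\<^sup>2) ^ L" using D(2)[OF B] by blast
      define b where "b = (\<lambda>k. complex_of_real (h (lm k / n) - H (lm k / n)) * \<phi> k x)"
      have D': "D / B ^ a \<ge> 0" using D(1) B by simp
      have bl2: "(\<Sum>k<K. (cmod (b k))\<^sup>2) \<le> (D / B ^ a)\<^sup>2 * (C * n powr q)" for K
        unfolding b_def by (rule skern_L2_tail[OF n x C(2)[OF n x] C(3)[OF n x] D' H(2)])
      have sumb: "summable (\<lambda>k. b k * cnj (\<phi> k y))" if y: "y \<in> pts \<Xi>" for y
      proof (rule summable_norm_cancel[OF summable_comparison_test'[OF summable_mult[OF summable_add[OF C(2)[OF n x] C(2)[OF n y]], of "D / B ^ a"], of 0]])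
        fix k
        let ?w = "(1 + (lm k / n)\<^sup>2) ^ L"
        have "2 * (cmod (\<phi> k x) * cmod (\<phi> k y)) \<le> (cmod (\<phi> k x))\<^sup>2 + (cmod (\<phi> k y))\<^sup>2"
          using sum_squares_bound[of "cmod (\<phi> k x)" "cmod (\<phi> k y)"] by simp
        moreover have "0 \<le> cmod (\<phi> k x) * cmod (\<phi> k y)" by simp
        ultimately have s: "cmod (\<phi> k x) * cmod (\<phi> k y) \<le> (cmod (\<phi> k x))\<^sup>2 + (cmod (\<phi> k y))\<^sup>2" by linarith
        have "norm (b k * cnj (\<phi> k y)) = \<bar>h (lm k / n) - H (lm k / n)\<bar> * (cmod (\<phi> k x) * cmod (\<phi> k y))"
          unfolding b_def norm_mult norm_of_real complex_mod_cnj by (rule mult.assoc)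
        also have "\<dots> \<le> (D / B ^ a / ?w) * ((cmod (\<phi> k x))\<^sup>2 + (cmod (\<phi> k y))\<^sup>2)"
          by (rule mult_mono[OF H(2) s divide_nonneg_pos[OF D' one_plus_sq_power_pos]]) simp
        also have "\<dots> = D / B ^ a * ((cmod (\<phi> k x))\<^sup>2 / ?w + (cmod (\<phi> k y))\<^sup>2 / ?w)"
        proof -
          have "(d / w) * (p + r) = d * (p / w + r / w)" for d w p r :: real by (simp add: add_divide_distrib ring_distribs)
          then show ?thesis .
        qed
        finally show "norm (norm (b k * cnj (\<phi> k y))) \<le> D / B ^ a * ((cmod (\<phi> k x))\<^sup>2 / ?w + (cmod (\<phi> k y))\<^sup>2 / ?w)"
          by simp
      qed
      define F where "F = (\<lambda>y. \<Sum>k. b k * cnj (\<phi> k y))"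
      have [measurable]: "F \<in> borel_measurable M" unfolding F_def by measurable
      have eqF: "indicator (S j) y * ennreal (cmod (Sk y)) = indicator (S j) y * ennreal (cmod (F y))" if y: "y \<in> pts \<Xi>" for y
      proof (cases "y \<in> S j")
        case True
        then have "y \<notin> qball \<Xi> x (\<rho> j)" using E(2)[of j] by (auto simp: S_def)
        then have d: "qdist \<Xi> x y > \<rho> j" using y by (simp add: qball_def)
        then have "(\<rho> j)\<^sup>2 < (qdist \<Xi> x y)\<^sup>2" using rho[of j] by (intro power_strict_mono) auto
        then have "c2 * n\<^sup>2 * (\<rho> j)\<^sup>2 < c2 * n\<^sup>2 * (qdist \<Xi> x y)\<^sup>2" using gc n by (intro mult_strict_left_mono) auto
        moreover have "c2 * n\<^sup>2 * (\<rho> j)\<^sup>2 = B\<^sup>2"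
          using gc n unfolding \<rho>_def B_def by (simp add: power_divide power_mult_distrib)
        moreover have "0 < B\<^sup>2" using B by simp
        ultimately have "B\<^sup>2 < 4 * (c2 * n\<^sup>2 * (qdist \<Xi> x y)\<^sup>2)" by linarith
        from skern_far[where h = h, OF n x y Lq supp H(1) gc(3) this]
        show ?thesis unfolding F_def b_def Sk_def by (simp add: sums_iff)
      qed simp
      have "(\<integral>\<^sup>+y. indicator (S j) y * ennreal (cmod (Sk y)) \<partial>M) = (\<integral>\<^sup>+y. indicator (S j) y * ennreal (cmod (F y)) \<partial>M)"
        by (rule nn_integral_cong[OF eqF])
      also have "\<dots> \<le> ennreal ((D / B ^ a * sqrt (C * n powr q)) * sqrt (c * \<rho> (Suc j) powr q))"
      proof (rule nn_integral_cauchy_set)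
        have "(\<integral>\<^sup>+y. ennreal ((cmod (F y))\<^sup>2) \<partial>M) \<le> ennreal ((D / B ^ a)\<^sup>2 * (C * n powr q))"
          by (rule bessel_series[OF _ bl2]) (simp add: F_def sumb summable_sums)
        then show "(\<integral>\<^sup>+y. ennreal ((cmod (F y))\<^sup>2) \<partial>M) \<le> ennreal ((D / B ^ a * sqrt (C * n powr q))\<^sup>2)"
        proof -
          have "(sqrt (C * n powr q))\<^sup>2 = C * n powr q" using C(1) by simp
          then have "(D / B ^ a * sqrt (C * n powr q))\<^sup>2 = (D / B ^ a)\<^sup>2 * (C * n powr q)" by (simp only: power_mult_distrib)
          then show ?thesis using \<open>(\<integral>\<^sup>+y. ennreal ((cmod (F y))\<^sup>2) \<partial>M) \<le> _\<close> by (simp only:)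
        qed
        have "emeasure M (S j) \<le> emeasure M (E (Suc j))" by (rule emeasure_mono) (auto simp: S_def)
        also note E(3)[of "Suc j"]
        finally show "emeasure M (S j) \<le> ennreal ((sqrt (c * \<rho> (Suc j) powr q))\<^sup>2)" using c0 by simp
        show "0 \<le> D / B ^ a * sqrt (C * n powr q)" by (rule mult_nonneg_nonneg[OF D']) (use C(1) in simp)
      qed (use c0 in auto)
      also have "(D / B ^ a * sqrt (C * n powr q)) * sqrt (c * \<rho> (Suc j) powr q) = D / B ^ a * (\<kappa> * 2 powr (real (Suc j) * (q / 2)))"
        using vol[of "Suc j"] by (simp add: mult_ac)
      also have "\<dots> = (D * 2 powr (q / 2) * \<kappa>) * \<theta> ^ j"
      proof -
        have "1 / B ^ a = 2 powr (- (real j * real a))"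
        proof -
          have "B ^ a = 2 powr (real (j * a))" unfolding B_def power_mult[symmetric] by (rule powr_realpow[symmetric]) simp
          then show ?thesis by (simp only: powr_minus_divide of_nat_mult)
        qed
        then have "1 / B ^ a * 2 powr (real (Suc j) * (q / 2)) = 2 powr (- (real j * real a) + real (Suc j) * (q / 2))"
          by (simp only: powr_add)
        also have "- (real j * real a) + real (Suc j) * (q / 2) = q / 2 + (q / 2 - real a) * real j"
          by (simp add: algebra_simps)
        also have "2 powr \<dots> = 2 powr (q / 2) * \<theta> ^ j"
          unfolding powr_add \<theta>_def by (simp add: powr_realpow[symmetric] powr_powr)
        finally have e: "1 / B ^ a * 2 powr (real (Suc j) * (q / 2)) = 2 powr (q / 2) * \<theta> ^ j" .
        have "D / B ^ a * (\<kappa> * 2 powr (real (Suc j) * (q / 2))) = D * \<kappa> * (1 / B ^ a * 2 powr (real (Suc j) * (q / 2)))"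
          by (simp only: divide_inverse mult_1 mult_ac)
        then show ?thesis unfolding e by (simp only: mult_ac)
      qed
      finally show ?thesis .
    qed
    have cover: "1 \<le> indicator (E 0) y + (\<Sum>j. indicator (S j) y :: ennreal)" if y: "y \<in> pts \<Xi>" for y
    proof -
      have "\<exists>j. y \<in> E j"
      proof -
        obtain j :: nat where j: "qdist \<Xi> x y * (n * sqrt c2) < 2 ^ j" using real_arch_pow[of 2] by auto
        have "qdist \<Xi> x y \<le> \<rho> j" unfolding \<rho>_def using j n gc by (simp add: pos_le_divide_eq)
        then have "y \<in> qball \<Xi> x (\<rho> j)" using y by (simp add: qball_def)
        then show ?thesis using E(2) by blast
      qed
      \<comment> \<open>The hulls need not increase with j. The least j with y in E j still puts y
        into E 0 or into the difference with index j - 1.\<close>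
      define j where "j = (LEAST j. y \<in> E j)"
      have yj: "y \<in> E j" unfolding j_def using \<open>\<exists>j. y \<in> E j\<close> by (rule LeastI_ex)
      show ?thesis
      proof (cases j)
        case 0
        then show ?thesis using yj by simp
      next
        case (Suc i)
        then have "y \<notin> E i" using not_less_Least[of i "\<lambda>j. y \<in> E j"] unfolding j_def by simp
        then have "y \<in> S i" using yj Suc by (simp add: S_def)
        then have "1 = (\<Sum>j\<in>{i}. indicator (S j) y :: ennreal)" by simp
        also have "\<dots> \<le> (\<Sum>j. indicator (S j) y)" by (intro sum_le_suminf) auto
        finally show ?thesis by (simp add: add_increasing)
      qed
    qed
    have "(\<integral>\<^sup>+y. ennreal (cmod (Sk y)) \<partial>M) \<le> (\<integral>\<^sup>+y. (indicator (E 0) y + (\<Sum>j. indicator (S j) y)) * ennreal (cmod (Sk y)) \<partial>M)"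
    proof (rule nn_integral_mono)
      fix y assume "y \<in> pts \<Xi>"
      from mult_right_mono[OF cover[OF this], of "ennreal (cmod (Sk y))"]
      show "ennreal (cmod (Sk y)) \<le> (indicator (E 0) y + (\<Sum>j. indicator (S j) y)) * ennreal (cmod (Sk y))" by simp
    qed
    also have "\<dots> = (\<integral>\<^sup>+y. indicator (E 0) y * ennreal (cmod (Sk y)) + (\<Sum>j. indicator (S j) y * ennreal (cmod (Sk y))) \<partial>M)"
      by (simp add: distrib_right)
    also have "\<dots> = (\<integral>\<^sup>+y. indicator (E 0) y * ennreal (cmod (Sk y)) \<partial>M) + (\<Sum>j. \<integral>\<^sup>+y. indicator (S j) y * ennreal (cmod (Sk y)) \<partial>M)"
      by (subst nn_integral_add, measurable, subst nn_integral_suminf, measurable)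
    also have "\<dots> \<le> ennreal (2 ^ L * \<kappa>) + (\<Sum>j. ennreal ((D * 2 powr (q / 2) * \<kappa>) * \<theta> ^ j))"
      by (intro add_mono near suminf_le shell) auto
    also have "(\<Sum>j. ennreal ((D * 2 powr (q / 2) * \<kappa>) * \<theta> ^ j)) = ennreal (\<Sum>j. (D * 2 powr (q / 2) * \<kappa>) * \<theta> ^ j)"
      using D(1) kap th by (intro suminf_ennreal2 summable_mult summable_geometric) auto
    also have "(\<Sum>j. (D * 2 powr (q / 2) * \<kappa>) * \<theta> ^ j) = D * 2 powr (q / 2) * \<kappa> * (1 / (1 - \<theta>))"
      using th by (subst suminf_mult) (auto simp: suminf_geometric)
    also have "ennreal (2 ^ L * \<kappa>) + ennreal (D * 2 powr (q / 2) * \<kappa> * (1 / (1 - \<theta>))) = ennreal C'"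
      unfolding C'_def using D(1) kap th by (intro ennreal_plus[symmetric]) auto
    finally show "(\<integral>\<^sup>+y. ennreal (cmod (skern \<Xi> h n x y)) \<partial>M) \<le> ennreal C'" unfolding Sk_def .
  qed
qed

end

section \<open>Lebesgue norms with values in the extended reals\<close>

lemma enn_powr_ennreal: "0 \<le> x \<Longrightarrow> enn_powr (ennreal x) a = ennreal (x powr a)"
  by (simp add: enn_powr_def)

lemma enn_powr_top: "enn_powr \<infinity> a = \<infinity>"
  by (simp add: enn_powr_def)

lemma enn_powr_zero [simp]: "enn_powr 0 a = 0"
  by (simp add: enn_powr_def)

lemma enn_powr_mono:
  assumes "x \<le> y" "a \<ge> 0"
  shows "enn_powr x a \<le> enn_powr y a"
proof (cases y)
  case (real r)
  then obtain s where "x = ennreal s" "0 \<le> s" using assms(1) by (cases x) (auto simp: top_unique)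
  then show ?thesis using real assms by (simp add: enn_powr_ennreal powr_mono2 ennreal_leI)
qed (use assms in \<open>simp add: enn_powr_def\<close>)

lemma enn_powr_inverse: "a \<noteq> 0 \<Longrightarrow> enn_powr (enn_powr x a) (1 / a) = x"
  by (cases x) (auto simp: enn_powr_ennreal enn_powr_top[unfolded infinity_ennreal_def] powr_powr)

lemma enn_powr_measurable [measurable]: "(\<lambda>x. enn_powr x a) \<in> borel_measurable borel"
  unfolding enn_powr_def by measurable

lemma enn_powr_le_iff:
  assumes "0 \<le> t" "a > 0"
  shows "enn_powr x (1 / a) \<le> ennreal t \<longleftrightarrow> x \<le> ennreal (t powr a)"
proof
  assume "enn_powr x (1 / a) \<le> ennreal t"
  then have "enn_powr (enn_powr x (1 / a)) (1 / (1 / a)) \<le> enn_powr (ennreal t) (1 / (1 / a))"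
    using assms by (intro enn_powr_mono) auto
  then show "x \<le> ennreal (t powr a)" using assms enn_powr_inverse[of "1 / a" x] by (simp add: enn_powr_ennreal)
next
  assume "x \<le> ennreal (t powr a)"
  then have "enn_powr x (1 / a) \<le> enn_powr (ennreal (t powr a)) (1 / a)" using assms by (intro enn_powr_mono) auto
  then show "enn_powr x (1 / a) \<le> ennreal t" using assms by (simp add: enn_powr_ennreal powr_powr)
qed

text \<open>The norm for functions with values in [0,\<infinity>]. It is applied to majorants and to
  series of moduli, which may be infinite at single points.\<close>

definition Lpn :: "ennreal \<Rightarrow> 'a measure \<Rightarrow> ('a \<Rightarrow> ennreal) \<Rightarrow> ennreal"
  where "Lpn p M g = (if p = \<infinity> then esssup M g else enn_powr (\<integral>\<^sup>+x. enn_powr (g x) (enn2real p) \<partial>M) (1 / enn2real p))"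

lemma Lp_norm_eq_Lpn: "Lp_norm p M f = Lpn p M (\<lambda>x. ennreal (cmod (f x)))"
  by (simp add: Lp_norm_def Lpn_def enn_powr_ennreal)

lemma exponent_ge_1: "1 \<le> p \<Longrightarrow> p \<noteq> \<infinity> \<Longrightarrow> 1 \<le> enn2real p"
  by (cases p) auto

lemma inverse_exponent:
  assumes "1 \<le> p" "p \<noteq> \<infinity>"
  shows "enn2real (1 / p) = 1 / enn2real p"
proof -
  have P: "1 \<le> enn2real p" by (rule exponent_ge_1[OF assms])
  have "p = ennreal (enn2real p)" using assms(2) by (simp add: ennreal_enn2real less_top[symmetric])
  then have "1 / p = ennreal (1 / enn2real p)" using P divide_ennreal[of 1 "enn2real p"] by simp
  then show ?thesis using P by simp
qed

lemma Lpn_le_iff_fin: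
  assumes "1 \<le> p" "p \<noteq> \<infinity>" "0 \<le> t"
  shows "Lpn p M g \<le> ennreal t \<longleftrightarrow> (\<integral>\<^sup>+x. enn_powr (g x) (enn2real p) \<partial>M) \<le> ennreal (t powr enn2real p)"
  using enn_powr_le_iff[of t "enn2real p"] exponent_ge_1[OF assms(1,2)] assms by (simp add: Lpn_def)

lemma Lpn_le_iff_inf:
  assumes p: "p = \<infinity>" and [measurable]: "g \<in> borel_measurable M"
  shows "Lpn p M g \<le> c \<longleftrightarrow> (AE x in M. g x \<le> c)"
proof
  assume c: "Lpn p M g \<le> c"
  show "AE x in M. g x \<le> c" using esssup_AE[of g M] by eventually_elim (use c p in \<open>auto simp: Lpn_def\<close>)
qed (auto simp: Lpn_def p intro: esssup_I)

lemma Lpn_inf_AE: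
  assumes "p = \<infinity>" "g \<in> borel_measurable M"
  shows "AE x in M. g x \<le> Lpn p M g"
  using Lpn_le_iff_inf[OF assms, of "Lpn p M g"] by simp

lemma Lpn_mono_AE:
  assumes "1 \<le> p" "AE x in M. g x \<le> g' x" "g \<in> borel_measurable M"
  shows "Lpn p M g \<le> Lpn p M g'"
proof (cases "p = \<infinity>")
  case True
  then show ?thesis using assms by (simp add: Lpn_def esssup_AE_mono)
next
  case False
  then have "0 \<le> enn2real p" "0 \<le> 1 / enn2real p" by auto
  moreover have "AE x in M. enn_powr (g x) (enn2real p) \<le> enn_powr (g' x) (enn2real p)"
    using assms(2) by eventually_elim (auto intro: enn_powr_mono)
  ultimately show ?thesis using False by (auto simp: Lpn_def intro!: enn_powr_mono nn_integral_mono_AE)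
qed

text \<open>Testing against positive real upper bounds removes the separate treatment of vanishing
  and infinite norms in the inequalities below.\<close>

lemma ennreal_le_by_reals:
  fixes a b :: ennreal
  assumes "\<And>t. 0 < t \<Longrightarrow> b < ennreal t \<Longrightarrow> a \<le> ennreal t"
  shows "a \<le> b"
proof (rule dense_ge)
  fix x assume x: "b < x"
  show "a \<le> x"
  proof (cases x)
    case (real t)
    then have "0 < t" using x by (cases "t = 0") auto
    then show ?thesis using assms real x by simp
  qed simp
qed

section \<open>Minkowski's inequality, finite and countable\<close>

lemma powr_convex_comb:
  fixes u v s P :: real
  assumes u: "0 \<le> u" and v: "0 \<le> v" and s: "0 < s" "s < 1" and P: "1 \<le> P"
  shows "(s * u + (1 - s) * v) powr P \<le> s * u powr P + (1 - s) * v powr P"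
proof -
  have z: "(r * w) powr P \<le> r * w powr P" if "0 < r" "r < 1" "0 \<le> w" for r w :: real
  proof -
    have "r powr P \<le> r powr 1" using that P by (intro powr_mono') auto
    then show ?thesis using that by (simp add: powr_mult mult_right_mono)
  qed
  consider "u = 0" | "v = 0" | "u > 0" "v > 0" using u v by fastforce
  then show ?thesis
  proof cases
    case 1 then show ?thesis using z[of "1 - s" v] s v by simp
  next
    case 2 then show ?thesis using z[of s u] s u by simp
  next
    case 3
    then show ?thesis using convex_onD[OF powr_convex[OF P], of "1 - s" u v] s by simp
  qed
qed

text \<open>Minkowski's inequality before integration: x + y is \<alpha> + \<beta> times the convex
  combination of x/\<alpha> and y/\<beta> with weights proportional to \<alpha> and \<beta>. When
  these bound the two norms, integrating the right side gives at most (\<alpha> +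
  \<beta>)^P.\<close>

lemma enn_powr_add_le:
  assumes a: "0 < \<alpha>" and b: "0 < \<beta>" and P: "1 \<le> P"
  shows "enn_powr (x + y) P \<le> ennreal ((\<alpha> + \<beta>) powr P * (\<alpha> / (\<alpha> + \<beta>)) / \<alpha> powr P) * enn_powr x P
     + ennreal ((\<alpha> + \<beta>) powr P * (\<beta> / (\<alpha> + \<beta>)) / \<beta> powr P) * enn_powr y P"
proof (cases "x = \<infinity> \<or> y = \<infinity>")
  case True
  then show ?thesis using a b by (auto simp: enn_powr_top[unfolded infinity_ennreal_def] ennreal_mult_top)
next
  case False
  then obtain u v where uv: "x = ennreal u" "y = ennreal v" "0 \<le> u" "0 \<le> v" by (cases x; cases y) auto
  define s where "s = \<alpha> / (\<alpha> + \<beta>)"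
  have s: "0 < s" "s < 1" "1 - s = \<beta> / (\<alpha> + \<beta>)" using a b by (auto simp: s_def field_simps)
  have "u + v = (\<alpha> + \<beta>) * (s * (u / \<alpha>) + (1 - s) * (v / \<beta>))"
  proof -
    have "s * (u / \<alpha>) = u / (\<alpha> + \<beta>)" "(1 - s) * (v / \<beta>) = v / (\<alpha> + \<beta>)" using a b unfolding s(3) by (auto simp: s_def)
    then show ?thesis using a b by (simp add: add_divide_distrib[symmetric])
  qed
  then have "(u + v) powr P = (\<alpha> + \<beta>) powr P * (s * (u / \<alpha>) + (1 - s) * (v / \<beta>)) powr P" by (simp only: powr_mult)
  also have "\<dots> \<le> (\<alpha> + \<beta>) powr P * (s * (u / \<alpha>) powr P + (1 - s) * (v / \<beta>) powr P)"
    using a b uv s P by (intro mult_left_mono powr_convex_comb) auto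
  also have "\<dots> = ((\<alpha> + \<beta>) powr P * s / \<alpha> powr P) * u powr P + ((\<alpha> + \<beta>) powr P * (1 - s) / \<beta> powr P) * v powr P"
    using a b uv by (simp add: powr_divide distrib_left mult_ac)
  finally show ?thesis
    using uv a b s unfolding s_def[symmetric] s(3)[symmetric]
    by (simp add: enn_powr_ennreal ennreal_mult[symmetric] ennreal_plus[symmetric] ennreal_leI del: ennreal_plus)
qed

lemma Lpn_add:
  assumes p: "1 \<le> p" and [measurable]: "g \<in> borel_measurable M" "g' \<in> borel_measurable M"
  shows "Lpn p M (\<lambda>x. g x + g' x) \<le> Lpn p M g + Lpn p M g'"
proof (cases "p = \<infinity>")
  case True
  have "AE x in M. g x \<le> Lpn p M g" "AE x in M. g' x \<le> Lpn p M g'" by (auto intro!: Lpn_inf_AE[OF True])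
  then have "AE x in M. g x + g' x \<le> Lpn p M g + Lpn p M g'" by eventually_elim (rule add_mono)
  then show ?thesis by (simp add: Lpn_le_iff_inf[OF True])
next
  case False
  define P where "P = enn2real p"
  have P: "1 \<le> P" unfolding P_def by (rule exponent_ge_1[OF p False])
  have key: "Lpn p M (\<lambda>x. g x + g' x) \<le> ennreal (\<alpha> + \<beta>)"
    if ab: "0 < \<alpha>" "0 < \<beta>" and A: "Lpn p M g \<le> ennreal \<alpha>" and B: "Lpn p M g' \<le> ennreal \<beta>" for \<alpha> \<beta>
  proof -
    let ?a = "(\<alpha> + \<beta>) powr P * (\<alpha> / (\<alpha> + \<beta>)) / \<alpha> powr P" and ?b = "(\<alpha> + \<beta>) powr P * (\<beta> / (\<alpha> + \<beta>)) / \<beta> powr P"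
    have A': "(\<integral>\<^sup>+x. enn_powr (g x) P \<partial>M) \<le> ennreal (\<alpha> powr P)" and B': "(\<integral>\<^sup>+x. enn_powr (g' x) P \<partial>M) \<le> ennreal (\<beta> powr P)"
      using A B ab by (simp_all add: Lpn_le_iff_fin[OF p False] P_def)
    have "(\<integral>\<^sup>+x. enn_powr (g x + g' x) P \<partial>M) \<le> (\<integral>\<^sup>+x. ennreal ?a * enn_powr (g x) P + ennreal ?b * enn_powr (g' x) P \<partial>M)"
      by (intro nn_integral_mono enn_powr_add_le ab P)
    also have "\<dots> = ennreal ?a * (\<integral>\<^sup>+x. enn_powr (g x) P \<partial>M) + ennreal ?b * (\<integral>\<^sup>+x. enn_powr (g' x) P \<partial>M)"
      by (simp add: nn_integral_add nn_integral_cmult)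
    also have "\<dots> \<le> ennreal ?a * ennreal (\<alpha> powr P) + ennreal ?b * ennreal (\<beta> powr P)"
      by (intro add_mono mult_left_mono A' B') auto
    also have "\<dots> = ennreal ((\<alpha> + \<beta>) powr P * (\<alpha> / (\<alpha> + \<beta>)) + (\<alpha> + \<beta>) powr P * (\<beta> / (\<alpha> + \<beta>)))"
      using ab by (simp add: ennreal_mult[symmetric] ennreal_plus[symmetric] del: ennreal_plus)
    also have "(\<alpha> + \<beta>) powr P * (\<alpha> / (\<alpha> + \<beta>)) + (\<alpha> + \<beta>) powr P * (\<beta> / (\<alpha> + \<beta>)) = (\<alpha> + \<beta>) powr P"
      using ab by (simp add: distrib_left[symmetric] add_divide_distrib[symmetric])
    finally show ?thesis using ab by (simp del: ennreal_plus add: Lpn_le_iff_fin[OF p False] P_def)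
  qed
  show ?thesis
  proof (rule ennreal_le_by_reals)
    fix t :: real assume t: "0 < t" "Lpn p M g + Lpn p M g' < ennreal t"
    then have "Lpn p M g < \<top>" "Lpn p M g' < \<top>"
      by (auto simp: less_top[symmetric] dest: order.strict_trans)
    then obtain A B where AB: "Lpn p M g = ennreal A" "Lpn p M g' = ennreal B" "0 \<le> A" "0 \<le> B" by (metis ennreal_cases less_irrefl)
    then have lt: "A + B < t" using t by (simp add: ennreal_plus[symmetric] ennreal_less_iff del: ennreal_plus)
    \<comment> \<open>Both bounds must be positive even if a norm is 0, so each receives half of the
      slack.\<close>
    define e where "e = (t - A - B) / 2"
    have e: "e > 0" "(A + e) + (B + e) = t" using lt by (auto simp: e_def)
    have "Lpn p M (\<lambda>x. g x + g' x) \<le> ennreal ((A + e) + (B + e))"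
      by (rule key) (use AB e in \<open>auto intro!: ennreal_leI\<close>)
    then show "Lpn p M (\<lambda>x. g x + g' x) \<le> ennreal t" by (simp only: e)
  qed
qed

lemma Lpn_zero: "1 \<le> p \<Longrightarrow> Lpn p M (\<lambda>x. 0) = 0"
proof -
  assume p: "1 \<le> p"
  have "Lpn p M (\<lambda>x. 0) \<le> ennreal 0"
    by (cases "p = \<infinity>") (simp_all del: ennreal_0 add: Lpn_le_iff_inf Lpn_le_iff_fin[OF p])
  then show ?thesis by simp
qed

text \<open>The finite inequality passes to the limit through a countable union of null sets for p =
  \<infinity> and by monotone convergence otherwise.\<close>

lemma Lpn_suminf:
  assumes p: "1 \<le> p" and [measurable]: "\<And>i. g i \<in> borel_measurable M"
  shows "Lpn p M (\<lambda>x. \<Sum>i. g i x) \<le> (\<Sum>i. Lpn p M (g i))"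
proof -
  define T where "T = (\<Sum>i. Lpn p M (g i))"
  have part: "Lpn p M (\<lambda>x. \<Sum>i<m. g i x) \<le> T" for m
  proof -
    have "Lpn p M (\<lambda>x. \<Sum>i<m. g i x) \<le> (\<Sum>i<m. Lpn p M (g i))"
    proof (induction m)
      case 0 then show ?case by (simp add: Lpn_zero[OF p])
    next
      case (Suc m)
      have "Lpn p M (\<lambda>x. \<Sum>i<Suc m. g i x) \<le> Lpn p M (\<lambda>x. \<Sum>i<m. g i x) + Lpn p M (g m)"
        by (simp, rule Lpn_add[OF p]) measurable
      then show ?case using Suc.IH by (auto intro: order_trans add_right_mono)
    qed
    also have "\<dots> \<le> T" unfolding T_def by (intro sum_le_suminf) auto
    finally show ?thesis .
  qed
  have S: "(\<Sum>i. g i x) = (SUP m. \<Sum>i<m. g i x)" for x by (rule suminf_eq_SUP)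
  show ?thesis unfolding T_def[symmetric]
  proof (cases "p = \<infinity>")
    case True
    have "AE x in M. (\<Sum>i<m. g i x) \<le> T" for m using part[of m] by (simp add: Lpn_le_iff_inf[OF True])
    then have "AE x in M. \<forall>m. (\<Sum>i<m. g i x) \<le> T" by (simp add: AE_all_countable)
    then have "AE x in M. (\<Sum>i. g i x) \<le> T" unfolding S by eventually_elim (auto intro: SUP_least)
    then show "Lpn p M (\<lambda>x. \<Sum>i. g i x) \<le> T" by (simp add: Lpn_le_iff_inf[OF True])
  next
    case False
    define P where "P = enn2real p"
    have P: "1 \<le> P" unfolding P_def by (rule exponent_ge_1[OF p False])
    show "Lpn p M (\<lambda>x. \<Sum>i. g i x) \<le> T"
    proof (rule ennreal_le_by_reals)
      fix t :: real assume t: "0 < t" "T < ennreal t"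
      have m: "(\<integral>\<^sup>+x. enn_powr (\<Sum>i<m. g i x) P \<partial>M) \<le> ennreal (t powr P)" for m
        using order_trans[OF part less_imp_le[OF t(2)], of m] t by (simp add: Lpn_le_iff_fin[OF p False] P_def)
      have pw: "enn_powr (\<Sum>i. g i x) P \<le> (SUP m. enn_powr (\<Sum>i<m. g i x) P)" for x
      proof -
        let ?Z = "SUP m. enn_powr (\<Sum>i<m. g i x) P"
        have "(\<Sum>i<m. g i x) \<le> enn_powr ?Z (1 / P)" for m
        proof -
          have "enn_powr (enn_powr (\<Sum>i<m. g i x) P) (1 / P) \<le> enn_powr ?Z (1 / P)"
            using P by (intro enn_powr_mono SUP_upper) auto
          then show ?thesis using P by (simp add: enn_powr_inverse)
        qed
        then have "(\<Sum>i. g i x) \<le> enn_powr ?Z (1 / P)" unfolding S by (rule SUP_least)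
        then have "enn_powr (\<Sum>i. g i x) P \<le> enn_powr (enn_powr ?Z (1 / P)) P" using P by (intro enn_powr_mono) auto
        then show ?thesis using P enn_powr_inverse[of "1 / P" ?Z] by simp
      qed
      have "(\<integral>\<^sup>+x. enn_powr (\<Sum>i. g i x) P \<partial>M) \<le> (\<integral>\<^sup>+x. (SUP m. enn_powr (\<Sum>i<m. g i x) P) \<partial>M)"
        by (intro nn_integral_mono pw)
      also have "\<dots> = (SUP m. \<integral>\<^sup>+x. enn_powr (\<Sum>i<m. g i x) P \<partial>M)"
        using P by (intro nn_integral_monotone_convergence_SUP)
          (auto simp: incseq_def le_fun_def intro!: enn_powr_mono sum_mono2)
      also have "\<dots> \<le> ennreal (t powr P)" by (intro SUP_least m)
      finally show "Lpn p M (\<lambda>x. \<Sum>i. g i x) \<le> ennreal t"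
        using t by (simp add: Lpn_le_iff_fin[OF p False] P_def)
    qed
  qed
qed

lemma Lpn_finite_AE:
  assumes p: "1 \<le> p" and [measurable]: "g \<in> borel_measurable M" and fin: "Lpn p M g < \<infinity>"
  shows "AE x in M. g x < \<infinity>"
proof (cases "p = \<infinity>")
  case True
  have "AE x in M. g x \<le> Lpn p M g" by (auto intro!: Lpn_inf_AE[OF True])
  then show ?thesis by eventually_elim (use fin in auto)
next
  case False
  obtain t where t: "Lpn p M g = ennreal t" "0 \<le> t" using fin by (cases "Lpn p M g") auto
  then have "(\<integral>\<^sup>+x. enn_powr (g x) (enn2real p) \<partial>M) \<le> ennreal (t powr enn2real p)"
    using Lpn_le_iff_fin[OF p False t(2), of M g] by simp
  then have "(\<integral>\<^sup>+x. enn_powr (g x) (enn2real p) \<partial>M) \<noteq> \<infinity>" by (auto simp: top_unique)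
  then have "AE x in M. enn_powr (g x) (enn2real p) \<noteq> \<infinity>" by (rule nn_integral_PInf_AE[rotated]) measurable
  then show ?thesis by eventually_elim (auto simp: enn_powr_def less_top[symmetric] split: if_splits)
qed

text \<open>Young's inequality normalized to hold with equality at x = \<tau>. Choosing \<tau> after
  integration gives Hoelder's inequality in \<open>schur_pointwise\<close>.\<close>

lemma young_scaled:
  assumes \<tau>: "0 < \<tau>" and P: "1 \<le> P"
  shows "x \<le> ennreal (1 / P * \<tau> powr (1 - P)) * enn_powr x P + ennreal ((1 - 1 / P) * \<tau>)"
proof (cases x)
  case (real a)
  have "a \<le> 1 / P * \<tau> powr (1 - P) * a powr P + (1 - 1 / P) * \<tau>"
  proof (cases "a = 0")
    case True then show ?thesis using \<tau> P by simp
  next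
    case False
    then have a: "a > 0" using real by simp
    have "(a powr P * \<tau> powr (1 - P)) powr (1 / P) * \<tau> powr (1 - 1 / P) \<le> 1 / P * (a powr P * \<tau> powr (1 - P)) + (1 - 1 / P) * \<tau>"
      by (rule Youngs_inequality_0) (use a \<tau> P in auto)
    moreover have "(a powr P * \<tau> powr (1 - P)) powr (1 / P) * \<tau> powr (1 - 1 / P) = a"
    proof -
      have "(1 - P) * (1 / P) + (1 - 1 / P) = 0" using P by (simp add: field_simps)
      then have "\<tau> powr ((1 - P) * (1 / P)) * \<tau> powr (1 - 1 / P) = 1" using \<tau> by (simp only: powr_add[symmetric]) simp
      moreover have "(a powr P) powr (1 / P) = a" using a P by (simp add: powr_powr)
      ultimately show ?thesis by (simp add: powr_mult powr_powr mult.assoc)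
    qed
    ultimately show ?thesis by (simp add: mult_ac)
  qed
  then have "ennreal a \<le> ennreal (1 / P * \<tau> powr (1 - P) * a powr P + (1 - 1 / P) * \<tau>)" by (rule ennreal_leI)
  also have "\<dots> = ennreal (1 / P * \<tau> powr (1 - P)) * ennreal (a powr P) + ennreal ((1 - 1 / P) * \<tau>)"
  proof -
    have n: "0 \<le> 1 / P * \<tau> powr (1 - P)" "0 \<le> a powr P" "0 \<le> (1 - 1 / P) * \<tau>" using \<tau> P by auto
    show ?thesis by (simp only: ennreal_plus[OF mult_nonneg_nonneg[OF n(1,2)] n(3)] ennreal_mult[OF n(1,2)])
  qed
  finally show ?thesis using real by (simp add: enn_powr_ennreal)
next
  case top
  then show ?thesis using \<tau> P by (simp add: enn_powr_top[unfolded infinity_ennreal_def] ennreal_mult_top)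
qed

text \<open>Hoelder's inequality for the measure with density K and total mass at most A.
  \<open>young_scaled\<close> is integrated against K and \<tau> is then optimized.\<close>

lemma schur_pointwise:
  assumes [measurable]: "K \<in> borel_measurable M" "g \<in> borel_measurable M" and A: "0 < A" and P: "1 \<le> P"
    and KA: "(\<integral>\<^sup>+x. K x \<partial>M) \<le> ennreal A"
  shows "enn_powr (\<integral>\<^sup>+x. K x * g x \<partial>M) P \<le> ennreal (A powr (P - 1)) * (\<integral>\<^sup>+x. K x * enn_powr (g x) P \<partial>M)"
proof (cases "(\<integral>\<^sup>+x. K x * enn_powr (g x) P \<partial>M)")
  case top
  then show ?thesis using A by (simp add: ennreal_mult_top)
next
  case (real I)
  have key: "(\<integral>\<^sup>+x. K x * g x \<partial>M) \<le> ennreal (A * \<tau>)" if t: "0 < \<tau>" "I \<le> A * \<tau> powr P" for \<tau>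
  proof -
    have "(\<integral>\<^sup>+x. K x * g x \<partial>M) \<le> (\<integral>\<^sup>+x. ennreal (1 / P * \<tau> powr (1 - P)) * (K x * enn_powr (g x) P) + ennreal ((1 - 1 / P) * \<tau>) * K x \<partial>M)"
    proof (rule nn_integral_mono)
      fix x
      have "K x * g x \<le> K x * (ennreal (1 / P * \<tau> powr (1 - P)) * enn_powr (g x) P + ennreal ((1 - 1 / P) * \<tau>))"
        by (intro mult_left_mono young_scaled t P) auto
      then show "K x * g x \<le> ennreal (1 / P * \<tau> powr (1 - P)) * (K x * enn_powr (g x) P) + ennreal ((1 - 1 / P) * \<tau>) * K x"
        by (simp add: distrib_left mult_ac)
    qed
    also have "\<dots> = ennreal (1 / P * \<tau> powr (1 - P)) * ennreal I + ennreal ((1 - 1 / P) * \<tau>) * (\<integral>\<^sup>+x. K x \<partial>M)"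
      by (simp add: nn_integral_add nn_integral_cmult real)
    also have "\<dots> \<le> ennreal (1 / P * \<tau> powr (1 - P)) * ennreal (A * \<tau> powr P) + ennreal ((1 - 1 / P) * \<tau>) * ennreal A"
      by (intro add_mono mult_left_mono ennreal_leI t KA) auto
    also have "\<dots> = ennreal (1 / P * \<tau> powr (1 - P) * (A * \<tau> powr P) + (1 - 1 / P) * \<tau> * A)"
      using A t P by (simp add: ennreal_mult[symmetric] ennreal_plus[symmetric] del: ennreal_plus)
    also have "1 / P * \<tau> powr (1 - P) * (A * \<tau> powr P) + (1 - 1 / P) * \<tau> * A = A * \<tau>"
    proof -
      have "\<tau> powr (1 - P) * \<tau> powr P = \<tau>" using t by (simp add: powr_add[symmetric])
      then have "1 / P * \<tau> powr (1 - P) * (A * \<tau> powr P) = 1 / P * (A * \<tau>)" by (metis mult.assoc mult.left_commute)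
      then show ?thesis by (simp add: algebra_simps)
    qed
    finally show ?thesis .
  qed
  show ?thesis
  proof (cases "I = 0")
    case True
    have "(\<integral>\<^sup>+x. K x * g x \<partial>M) \<le> 0"
    proof (rule ennreal_le_by_reals)
      fix t :: real assume "0 < t"
      then show "(\<integral>\<^sup>+x. K x * g x \<partial>M) \<le> ennreal t" using key[of "t / A"] A True by simp
    qed
    then show ?thesis using enn_powr_ennreal[of 0 P] by simp
  next
    case False
    then have I: "I > 0" using real by simp
    \<comment> \<open>The value that balances the two terms of Young's inequality. When I = 0 it
      would be 0, so that case uses arbitrarily small positive \<tau> instead.\<close>
    define \<tau> where "\<tau> = (I / A) powr (1 / P)"
    have t: "\<tau> > 0" "\<tau> powr P = I / A" using I A P by (auto simp: \<tau>_def powr_powr)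
    have "enn_powr (\<integral>\<^sup>+x. K x * g x \<partial>M) P \<le> enn_powr (ennreal (A * \<tau>)) P"
      using key[of \<tau>] t A P by (intro enn_powr_mono) auto
    also have "\<dots> = ennreal ((A * \<tau>) powr P)" using A t by (simp add: enn_powr_ennreal)
    also have "(A * \<tau>) powr P = A powr (P - 1) * I"
      unfolding powr_mult t(2) using A by (simp add: powr_diff)
    also have "ennreal \<dots> = ennreal (A powr (P - 1)) * ennreal I" using real by (simp add: ennreal_mult)
    finally show ?thesis by (simp add: real)
  qed
qed

text \<open>The constant interpolates between the row bound A at p = \<infinity> and the column
  bound B at p = 1. With A and B of order n^q1 and n^q2 this produces the exponent q1 + (q2 - q1)/p.
  For finite p the pointwise bound is integrated and the order of integration exchanged.\<close>

lemma schur_test: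
  assumes p: "1 \<le> p" and sf: "sigma_finite_measure M1" "sigma_finite_measure M2"
    and [measurable]: "(\<lambda>(x, y). K x y) \<in> borel_measurable (M1 \<Otimes>\<^sub>M M2)" "g \<in> borel_measurable M2"
    and A: "0 < A" "\<And>x. x \<in> space M1 \<Longrightarrow> (\<integral>\<^sup>+y. K x y \<partial>M2) \<le> ennreal A"
    and B: "0 < B" "\<And>y. y \<in> space M2 \<Longrightarrow> (\<integral>\<^sup>+x. K x y \<partial>M1) \<le> ennreal B"
  shows "Lpn p M1 (\<lambda>x. \<integral>\<^sup>+y. K x y * g y \<partial>M2) \<le> ennreal (A powr (1 - enn2real (1 / p)) * B powr enn2real (1 / p)) * Lpn p M2 g"
proof -
  interpret M1: sigma_finite_measure M1 by fact
  interpret M2: sigma_finite_measure M2 by fact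
  interpret pair_sigma_finite M1 M2 ..
  have Kx [measurable]: "K x \<in> borel_measurable M2" if "x \<in> space M1" for x
    using measurable_Pair2[OF assms(4), of x] that by simp
  show ?thesis
  proof (cases "p = \<infinity>")
    case True
    have g: "AE y in M2. g y \<le> Lpn p M2 g" by (auto intro!: Lpn_inf_AE[OF True])
    have "(\<integral>\<^sup>+y. K x y * g y \<partial>M2) \<le> ennreal A * Lpn p M2 g" if x: "x \<in> space M1" for x
    proof -
      have "(\<integral>\<^sup>+y. K x y * g y \<partial>M2) \<le> (\<integral>\<^sup>+y. K x y * Lpn p M2 g \<partial>M2)"
      proof (rule nn_integral_mono_AE)
        show "AE y in M2. K x y * g y \<le> K x y * Lpn p M2 g" using g by eventually_elim (simp add: mult_left_mono)
      qed
      also have "\<dots> = (\<integral>\<^sup>+y. K x y \<partial>M2) * Lpn p M2 g" using Kx[OF x] by (rule nn_integral_multc)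
      also have "\<dots> \<le> ennreal A * Lpn p M2 g" by (intro mult_right_mono A x) auto
      finally show ?thesis .
    qed
    then have "AE x in M1. (\<integral>\<^sup>+y. K x y * g y \<partial>M2) \<le> ennreal A * Lpn p M2 g" by (auto intro: AE_I2)
    then have "Lpn p M1 (\<lambda>x. \<integral>\<^sup>+y. K x y * g y \<partial>M2) \<le> ennreal A * Lpn p M2 g"
      by (simp add: Lpn_le_iff_inf[OF True])
    moreover have "enn2real (1 / p) = 0" by (simp add: True)
    ultimately show ?thesis using A(1) B(1) by simp
  next
    case False
    define P where "P = enn2real p"
    have P: "1 \<le> P" unfolding P_def by (rule exponent_ge_1[OF p False])
    have ip: "enn2real (1 / p) = 1 / P" unfolding P_def by (rule inverse_exponent[OF p False])
    define C where "C = A powr (P - 1) * B"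
    have C: "C powr (1 / P) = A powr (1 - 1 / P) * B powr (1 / P)"
    proof -
      have "(P - 1) * (1 / P) = 1 - 1 / P" using P by (simp add: field_simps)
      then show ?thesis unfolding C_def powr_mult powr_powr by simp
    qed
    have C0: "C > 0" using A B by (simp add: C_def)
    have "(\<integral>\<^sup>+x. enn_powr (\<integral>\<^sup>+y. K x y * g y \<partial>M2) P \<partial>M1) \<le> (\<integral>\<^sup>+x. ennreal (A powr (P - 1)) * (\<integral>\<^sup>+y. K x y * enn_powr (g y) P \<partial>M2) \<partial>M1)"
      by (intro nn_integral_mono schur_pointwise A P Kx) auto
    also have "\<dots> = ennreal (A powr (P - 1)) * (\<integral>\<^sup>+x. \<integral>\<^sup>+y. K x y * enn_powr (g y) P \<partial>M2 \<partial>M1)"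
      by (rule nn_integral_cmult) measurable
    also have "(\<integral>\<^sup>+x. \<integral>\<^sup>+y. K x y * enn_powr (g y) P \<partial>M2 \<partial>M1) = (\<integral>\<^sup>+y. \<integral>\<^sup>+x. K x y * enn_powr (g y) P \<partial>M1 \<partial>M2)"
      by (rule Fubini'[symmetric]) measurable
    also have "\<dots> \<le> (\<integral>\<^sup>+y. ennreal B * enn_powr (g y) P \<partial>M2)"
    proof (rule nn_integral_mono)
      fix y assume y: "y \<in> space M2"
      have "(\<lambda>x. K x y) \<in> borel_measurable M1" using measurable_Pair1[OF assms(4) y] by simp
      then have "(\<integral>\<^sup>+x. K x y * enn_powr (g y) P \<partial>M1) = (\<integral>\<^sup>+x. K x y \<partial>M1) * enn_powr (g y) P" by (rule nn_integral_multc)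
      also have "\<dots> \<le> ennreal B * enn_powr (g y) P" by (intro mult_right_mono B y) auto
      finally show "(\<integral>\<^sup>+x. K x y * enn_powr (g y) P \<partial>M1) \<le> ennreal B * enn_powr (g y) P" .
    qed
    also have "(\<integral>\<^sup>+y. ennreal B * enn_powr (g y) P \<partial>M2) = ennreal B * (\<integral>\<^sup>+y. enn_powr (g y) P \<partial>M2)"
      by (rule nn_integral_cmult) measurable
    finally have I: "(\<integral>\<^sup>+x. enn_powr (\<integral>\<^sup>+y. K x y * g y \<partial>M2) P \<partial>M1) \<le> ennreal C * (\<integral>\<^sup>+y. enn_powr (g y) P \<partial>M2)"
      using B(1) by (simp add: C_def ennreal_mult mult.assoc mult_left_mono)
    have e': "enn_powr (ennreal C * x) (1 / P) = ennreal (C powr (1 / P)) * enn_powr x (1 / P)" for x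
      using C0 P by (cases x) (auto simp: enn_powr_ennreal ennreal_mult[symmetric] powr_mult ennreal_mult_top enn_powr_top[unfolded infinity_ennreal_def])
    have "enn_powr (\<integral>\<^sup>+x. enn_powr (\<integral>\<^sup>+y. K x y * g y \<partial>M2) P \<partial>M1) (1 / P) \<le> enn_powr (ennreal C * (\<integral>\<^sup>+y. enn_powr (g y) P \<partial>M2)) (1 / P)"
      using P by (intro enn_powr_mono I) auto
    then show ?thesis using False unfolding e' C by (simp add: Lpn_def P_def[symmetric] ip)
  qed
qed

section \<open>Triangle inequality and completeness of L^p\<close>

lemma Lp_norm_triangle:
  assumes "1 \<le> p" and [measurable]: "f \<in> borel_measurable M" "g \<in> borel_measurable M"
  shows "Lp_norm p M (\<lambda>x. f x + g x) \<le> Lp_norm p M f + Lp_norm p M g"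
proof -
  have "Lp_norm p M (\<lambda>x. f x + g x) \<le> Lpn p M (\<lambda>x. ennreal (cmod (f x)) + ennreal (cmod (g x)))"
    unfolding Lp_norm_eq_Lpn by (intro Lpn_mono_AE assms(1) AE_I2) (auto simp: ennreal_plus[symmetric] norm_triangle_ineq simp del: ennreal_plus intro!: ennreal_leI)
  also have "\<dots> \<le> Lp_norm p M f + Lp_norm p M g"
    unfolding Lp_norm_eq_Lpn by (intro Lpn_add assms(1)) measurable
  finally show ?thesis .
qed

lemma Lp_norm_diff_triangle:
  assumes "1 \<le> p" and [measurable]: "f \<in> borel_measurable M" "g \<in> borel_measurable M" "k \<in> borel_measurable M"
  shows "Lp_norm p M (\<lambda>x. f x - k x) \<le> Lp_norm p M (\<lambda>x. f x - g x) + Lp_norm p M (\<lambda>x. g x - k x)"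
  using Lp_norm_triangle[OF assms(1), of "\<lambda>x. f x - g x" M "\<lambda>x. g x - k x"] by simp

lemma Lp_norm_minus_commute: "Lp_norm p M (\<lambda>x. f x - g x) = Lp_norm p M (\<lambda>x. g x - f x)"
  by (simp add: Lp_norm_eq_Lpn norm_minus_commute)

lemma Lp_norm_telescope:
  assumes p: "1 \<le> p" and [measurable]: "\<And>m. u m \<in> borel_measurable M"
  shows "Lp_norm p M (\<lambda>x. u (n + N) x - u n x) \<le> (\<Sum>m<N. Lp_norm p M (\<lambda>x. u (Suc (n + m)) x - u (n + m) x))"
proof (induction N)
  case 0
  then show ?case using Lpn_zero[OF p, of M] by (simp add: Lp_norm_eq_Lpn)
next
  case (Suc N)
  have "Lp_norm p M (\<lambda>x. u (n + Suc N) x - u n x) \<le> Lp_norm p M (\<lambda>x. u (n + Suc N) x - u (n + N) x) + Lp_norm p M (\<lambda>x. u (n + N) x - u n x)"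
    by (rule Lp_norm_diff_triangle[OF p]) measurable
  also have "\<dots> \<le> Lp_norm p M (\<lambda>x. u (n + Suc N) x - u (n + N) x) + (\<Sum>m<N. Lp_norm p M (\<lambda>x. u (Suc (n + m)) x - u (n + m) x))"
    by (intro add_left_mono Suc.IH)
  finally show ?case by (simp add: add.commute)
qed

text \<open>The argument of Riesz and Fischer: finiteness of the sum of the norms forces absolute
  convergence of the increments almost everywhere, and the countable Minkowski inequality bounds the
  remainder by the tail.\<close>

lemma Lp_series_limit:
  fixes u :: "nat \<Rightarrow> 'a \<Rightarrow> complex"
  assumes p: "1 \<le> p" and [measurable]: "\<And>m. u m \<in> borel_measurable M"
    and fin: "(\<Sum>m. Lp_norm p M (\<lambda>x. u (Suc m) x - u m x)) < \<infinity>"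
  obtains F where "F \<in> borel_measurable M"
    "\<And>n. Lp_norm p M (\<lambda>x. F x - u n x) \<le> (\<Sum>m. Lp_norm p M (\<lambda>x. u (Suc (n + m)) x - u (n + m) x))"
proof -
  define d where "d = (\<lambda>m x. u (Suc m) x - u m x)"
  have [measurable]: "d m \<in> borel_measurable M" for m unfolding d_def by measurable
  \<comment> \<open>On the null set where the increments fail to be absolutely summable the value of
    F is unspecified; the estimates hold almost everywhere.\<close>
  define F where "F = (\<lambda>x. u 0 x + (\<Sum>m. d m x))"
  have [measurable]: "F \<in> borel_measurable M" unfolding F_def by measurable
  have "Lpn p M (\<lambda>x. \<Sum>m. ennreal (cmod (d m x))) \<le> (\<Sum>m. Lp_norm p M (d m))"
    unfolding Lp_norm_eq_Lpn by (rule Lpn_suminf[OF p]) measurable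
  also have "\<dots> < \<infinity>" using fin by (simp add: d_def)
  finally have "AE x in M. (\<Sum>m. ennreal (cmod (d m x))) < \<infinity>" by (intro Lpn_finite_AE[OF p]) auto
  then have ae: "AE x in M. summable (\<lambda>m. cmod (d m x))"
    by eventually_elim (auto intro: summable_suminf_not_top)
  have bound: "Lp_norm p M (\<lambda>x. F x - u n x) \<le> (\<Sum>m. Lp_norm p M (d (n + m)))" for n
  proof -
    have "AE x in M. ennreal (cmod (F x - u n x)) \<le> (\<Sum>m. ennreal (cmod (d (n + m) x)))"
      using ae
    proof eventually_elim
      case (elim x)
      have un: "u n x = u 0 x + (\<Sum>m<n. d m x)"
        unfolding d_def by (subst sum_lessThan_telescope) simp
      have sn: "summable (\<lambda>m. cmod (d (n + m) x))"
        using summable_ignore_initial_segment[OF elim, of n] by (simp add: add.commute)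
      have "(\<Sum>m. d m x) = (\<Sum>m. d (m + n) x) + (\<Sum>m<n. d m x)"
        by (rule suminf_split_initial_segment[OF summable_norm_cancel[OF elim]])
      then have "F x - u n x = (\<Sum>m. d (n + m) x)" unfolding F_def un by (simp add: add.commute)
      then have "cmod (F x - u n x) \<le> (\<Sum>m. cmod (d (n + m) x))" using summable_norm[OF sn] by simp
      then have "ennreal (cmod (F x - u n x)) \<le> ennreal (\<Sum>m. cmod (d (n + m) x))" by (rule ennreal_leI)
      also have "\<dots> = (\<Sum>m. ennreal (cmod (d (n + m) x)))" by (rule suminf_ennreal2[symmetric]) (use sn in auto)
      finally show ?case .
    qed
    then have "Lp_norm p M (\<lambda>x. F x - u n x) \<le> Lpn p M (\<lambda>x. \<Sum>m. ennreal (cmod (d (n + m) x)))"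
      unfolding Lp_norm_eq_Lpn by (intro Lpn_mono_AE p) measurable
    also have "\<dots> \<le> (\<Sum>m. Lp_norm p M (d (n + m)))"
      unfolding Lp_norm_eq_Lpn by (rule Lpn_suminf[OF p]) measurable
    finally show ?thesis .
  qed
  show thesis by (rule that[of F]) (use bound in \<open>auto simp: d_def\<close>)
qed

text \<open>The tail bound for an arbitrary L^p limit F rather than the representative constructed
  above, because the rate is claimed for every such F.\<close>

lemma Lp_limit_bound:
  fixes u :: "nat \<Rightarrow> 'a \<Rightarrow> complex"
  assumes p: "1 \<le> p" and [measurable]: "\<And>m. u m \<in> borel_measurable M" "F \<in> borel_measurable M"
    and lim: "(\<lambda>n. Lp_norm p M (\<lambda>x. u n x - F x)) \<longlonglongrightarrow> 0"
  shows "Lp_norm p M (\<lambda>x. F x - u n x) \<le> (\<Sum>m. Lp_norm p M (\<lambda>x. u (Suc (n + m)) x - u (n + m) x))" (is "_ \<le> ?T")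
proof (rule LIMSEQ_le_const)
  show "(\<lambda>N. Lp_norm p M (\<lambda>x. u (N + n) x - F x) + ?T) \<longlonglongrightarrow> ?T"
    using tendsto_add[OF LIMSEQ_ignore_initial_segment[OF lim, of n] tendsto_const[of ?T]] by simp
  have "Lp_norm p M (\<lambda>x. F x - u n x) \<le> Lp_norm p M (\<lambda>x. u (N + n) x - F x) + ?T" for N
  proof -
    have "Lp_norm p M (\<lambda>x. F x - u n x) \<le> Lp_norm p M (\<lambda>x. F x - u (n + N) x) + Lp_norm p M (\<lambda>x. u (n + N) x - u n x)"
      by (rule Lp_norm_diff_triangle[OF p]) measurable
    also have "Lp_norm p M (\<lambda>x. u (n + N) x - u n x) \<le> (\<Sum>m<N. Lp_norm p M (\<lambda>x. u (Suc (n + m)) x - u (n + m) x))"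
      by (rule Lp_norm_telescope[OF p]) measurable
    also have "\<dots> \<le> ?T" by (intro sum_le_suminf) auto
    finally show ?thesis by (simp add: Lp_norm_minus_commute[of p M F] add.commute add_left_mono)
  qed
  then show "\<exists>N. \<forall>m\<ge>N. Lp_norm p M (\<lambda>x. F x - u n x) \<le> Lp_norm p M (\<lambda>x. u (m + n) x - F x) + ?T" by blast
qed

section \<open>The joint operators\<close>

text \<open>Measurability of the identity map says that the space of \<nu> lies in both spaces and
  that Borel sets of either one have \<nu>-measurable traces.\<close>

locale tensor_setup =
  X1: heat_system \<Xi>1 q1 c + X2: heat_system \<Xi>2 q2 c
  for \<Xi>1 \<Xi>2 :: "'a spectral_system" and q1 q2 c :: real +
  fixes \<nu> :: "'a measure" and \<Gamma> :: "nat \<Rightarrow> nat \<Rightarrow> complex" and h :: "real \<Rightarrow> real" and p :: ennreal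
  assumes nu: "prob_space \<nu>" and id1: "(\<lambda>y. y) \<in> measurable \<nu> (msr \<Xi>1)" and id2: "(\<lambda>y. y) \<in> measurable \<nu> (msr \<Xi>2)"
    and Gam: "\<Gamma> = conn_coeff \<Xi>1 \<Xi>2 \<nu>" and low: "low_pass_filter h" and smooth: "sufficiently_smooth q1 q2 h"
    and p1: "1 \<le> p"
begin

abbreviation "M1 \<equiv> msr \<Xi>1"
abbreviation "M2 \<equiv> msr \<Xi>2"
abbreviation "\<sigma> \<equiv> tensor_op \<Xi>1 \<Xi>2 \<Gamma> h"
abbreviation "K1 n \<equiv> {k. lam \<Xi>1 k < n}"
abbreviation "K2 n \<equiv> {k. lam \<Xi>2 k < n}"

lemma h_supp: "\<bar>u\<bar> \<ge> 1 \<Longrightarrow> h u = 0" and h_bound: "\<bar>h u\<bar> \<le> 1"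
  using low unfolding low_pass_filter_def by auto

lemma finK: "finite (K1 n)" "finite (K2 n)"
  using admissible_finite[OF X1.adm] admissible_finite[OF X2.adm] by auto

lemma sigma_finite: "sigma_finite_measure M1" "sigma_finite_measure M2"
  using X1.adm X2.adm by (simp_all add: admissible_system_def)

lemma nu_space: "y \<in> space \<nu> \<Longrightarrow> y \<in> pts \<Xi>1" "y \<in> space \<nu> \<Longrightarrow> y \<in> pts \<Xi>2"
  using measurable_space[OF id1] measurable_space[OF id2] by auto

lemma nu_measurable [measurable]:
  "phi \<Xi>1 j \<in> borel_measurable \<nu>" "phi \<Xi>2 k \<in> borel_measurable \<nu>"
  using measurable_compose[OF id1 X1.phi_measurable] measurable_compose[OF id2 X2.phi_measurable] by auto

lemma nu_integrable: "integrable \<nu> (\<lambda>y. cnj (phi \<Xi>1 j y) * phi \<Xi>2 k y)"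
proof -
  interpret prob_space \<nu> by (rule nu)
  obtain B1 where B1: "B1 \<ge> 0" "\<forall>x\<in>pts \<Xi>1. cmod (phi \<Xi>1 j x) \<le> B1" using admissible_phi(3)[OF X1.adm] by blast
  obtain B2 where B2: "B2 \<ge> 0" "\<forall>x\<in>pts \<Xi>2. cmod (phi \<Xi>2 k x) \<le> B2" using admissible_phi(3)[OF X2.adm] by blast
  show ?thesis
    by (rule integrable_const_bound[where B = "B1 * B2"])
       (use B1 B2 nu_space in \<open>auto intro!: AE_I2 mult_mono simp: norm_mult\<close>)
qed

lemma kernel_eq:
  assumes n: "n > 0"
  shows "tensor_kernel \<Xi>1 \<Xi>2 \<Gamma> h n x1 x2 =
    (\<Sum>j\<in>K1 n. \<Sum>k\<in>K2 n. complex_of_real (h (lam \<Xi>1 j / n)) * complex_of_real (h (lam \<Xi>2 k / n)) * \<Gamma> j k * phi \<Xi>1 j x1 * cnj (phi \<Xi>2 k x2))"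
proof -
  let ?f = "\<lambda>(j, k). complex_of_real (h (lam \<Xi>1 j / n)) * complex_of_real (h (lam \<Xi>2 k / n)) * \<Gamma> j k * phi \<Xi>1 j x1 * cnj (phi \<Xi>2 k x2)"
  have z: "?f jk = 0" if "jk \<notin> K1 n \<times> K2 n" for jk
  proof -
    obtain j k where jk: "jk = (j, k)" by (cases jk) auto
    have "h (lam \<Xi>1 j / n) = 0 \<or> h (lam \<Xi>2 k / n) = 0"
      using that n admissible_lam_nonneg[OF X1.adm, of j] admissible_lam_nonneg[OF X2.adm, of k] unfolding jk
      by (auto intro!: h_supp simp: not_less)
    then show ?thesis by (auto simp: jk)
  qed
  have "tensor_kernel \<Xi>1 \<Xi>2 \<Gamma> h n x1 x2 = infsum ?f (K1 n \<times> K2 n)"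
    unfolding tensor_kernel_def by (rule infsum_cong_neutral) (use z in auto)
  also have "\<dots> = sum ?f (K1 n \<times> K2 n)" using finK by (intro infsum_finite) auto
  finally show ?thesis by (simp add: sum.cartesian_product)
qed

lemma kernel_factor:
  assumes n: "n > 0"
  shows "tensor_kernel \<Xi>1 \<Xi>2 \<Gamma> h n x1 x2 = (LINT y|\<nu>. skern \<Xi>1 h n x1 y * skern \<Xi>2 h n y x2)"
proof -
  have e: "skern \<Xi>1 h n x1 y * skern \<Xi>2 h n y x2 = (\<Sum>j\<in>K1 n. \<Sum>k\<in>K2 n.
     (complex_of_real (h (lam \<Xi>1 j / n)) * complex_of_real (h (lam \<Xi>2 k / n)) * phi \<Xi>1 j x1 * cnj (phi \<Xi>2 k x2)) * (cnj (phi \<Xi>1 j y) * phi \<Xi>2 k y))" for y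
    unfolding skern_def sum_product by (intro sum.cong refl) (simp only: mult_ac)
  have "(LINT y|\<nu>. skern \<Xi>1 h n x1 y * skern \<Xi>2 h n y x2) = (\<Sum>j\<in>K1 n. \<Sum>k\<in>K2 n.
     (complex_of_real (h (lam \<Xi>1 j / n)) * complex_of_real (h (lam \<Xi>2 k / n)) * phi \<Xi>1 j x1 * cnj (phi \<Xi>2 k x2)) * \<Gamma> j k)"
    unfolding e Gam conn_coeff_def
    by (simp only: Bochner_Integration.integral_sum Bochner_Integration.integrable_sum integrable_mult_right nu_integrable integral_mult_right_zero)
  then show ?thesis unfolding kernel_eq[OF n] by (simp only: mult_ac)
qed

text \<open>Moduli are taken inside the \<nu>-integral, so the marginals of the joint kernel can be
  computed by Tonelli from the two kernels separately.\<close>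

definition majorant :: "real \<Rightarrow> 'a \<Rightarrow> 'a \<Rightarrow> ennreal"
  where "majorant n x1 x2 = (\<integral>\<^sup>+y. ennreal (cmod (skern \<Xi>1 h n x1 y)) * ennreal (cmod (skern \<Xi>2 h n y x2)) \<partial>\<nu>)"

lemma kernel_le_majorant: "n > 0 \<Longrightarrow> ennreal (cmod (tensor_kernel \<Xi>1 \<Xi>2 \<Gamma> h n x1 x2)) \<le> majorant n x1 x2"
proof -
  assume n: "n > 0"
  have "integrable \<nu> (\<lambda>y. skern \<Xi>1 h n x1 y * skern \<Xi>2 h n y x2)"
  proof -
    have e: "skern \<Xi>1 h n x1 y * skern \<Xi>2 h n y x2 = (\<Sum>j\<in>K1 n. \<Sum>k\<in>K2 n.
     (complex_of_real (h (lam \<Xi>1 j / n)) * complex_of_real (h (lam \<Xi>2 k / n)) * phi \<Xi>1 j x1 * cnj (phi \<Xi>2 k x2)) * (cnj (phi \<Xi>1 j y) * phi \<Xi>2 k y))" for y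
      unfolding skern_def sum_product by (intro sum.cong refl) (simp only: mult_ac)
    show ?thesis unfolding e by (intro Bochner_Integration.integrable_sum integrable_mult_right nu_integrable)
  qed
  from integral_norm_bound_ennreal[OF this] show ?thesis
    unfolding kernel_factor[OF n] majorant_def by (simp add: norm_mult ennreal_mult)
qed

lemma skern_pair_measurable [measurable]:
  "(\<lambda>(x, y). skern \<Xi>1 h n x y) \<in> borel_measurable (M1 \<Otimes>\<^sub>M \<nu>)"
  "(\<lambda>(y, x). skern \<Xi>2 h n y x) \<in> borel_measurable (\<nu> \<Otimes>\<^sub>M M2)"
  "skern \<Xi>1 h n x \<in> borel_measurable \<nu>"
  "(\<lambda>y. skern \<Xi>2 h n y x) \<in> borel_measurable \<nu>"
  unfolding skern_def by measurable

lemma majorant_measurable [measurable]: "(\<lambda>(x1, x2). majorant n x1 x2) \<in> borel_measurable (M1 \<Otimes>\<^sub>M M2)"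
proof -
  interpret prob_space \<nu> by (rule nu)
  have "(\<lambda>z. ennreal (cmod (skern \<Xi>1 h n (fst (fst z)) (snd z))) * ennreal (cmod (skern \<Xi>2 h n (snd z) (snd (fst z))))) \<in> borel_measurable ((M1 \<Otimes>\<^sub>M M2) \<Otimes>\<^sub>M \<nu>)"
    unfolding skern_def by measurable
  from borel_measurable_nn_integral_fst[OF this]
  show ?thesis unfolding majorant_def by (simp add: split_beta')
qed

lemma nu_mean_le:
  assumes "\<And>y. y \<in> space \<nu> \<Longrightarrow> g y \<le> C"
  shows "(\<integral>\<^sup>+y. g y \<partial>\<nu>) \<le> C"
proof -
  interpret prob_space \<nu> by (rule nu)
  have "(\<integral>\<^sup>+y. g y \<partial>\<nu>) \<le> (\<integral>\<^sup>+y. C \<partial>\<nu>)" by (intro nn_integral_mono assms)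
  then show ?thesis by (simp add: emeasure_space_1)
qed

lemma smooth_fd:
  obtains a Cf where "real a > q1" "real a > q2" "Cf \<ge> 0" "\<And>d u. \<bar>fd a d h u\<bar> \<le> Cf * \<bar>d\<bar> ^ a"
  using filter_fd_bound[OF low smooth X1.q0] by metis

text \<open>Integrating out x2 uses the L^1 bound of the second kernel and the uniform bound of
  order n^q1 of the first; integrating out x1 exchanges the roles and leaves n^q2. The remaining
  \<nu>-integral is a mean because \<nu> has mass one.\<close>

lemma majorant_bounds:
  obtains C where "C > 0"
    "\<And>n x. n \<ge> 1 \<Longrightarrow> x \<in> pts \<Xi>1 \<Longrightarrow> (\<integral>\<^sup>+x2. majorant n x x2 \<partial>M2) \<le> ennreal (C * n powr q1)"
    "\<And>n x. n \<ge> 1 \<Longrightarrow> x \<in> pts \<Xi>2 \<Longrightarrow> (\<integral>\<^sup>+x1. majorant n x1 x \<partial>M1) \<le> ennreal (C * n powr q2)"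
proof -
  interpret N: prob_space \<nu> by (rule nu)
  interpret S1: sigma_finite_measure M1 by (rule sigma_finite)
  interpret S2: sigma_finite_measure M2 by (rule sigma_finite)
  interpret P2: pair_sigma_finite M2 \<nu> ..
  interpret P1: pair_sigma_finite M1 \<nu> ..
  obtain a Cf where a: "real a > q1" "real a > q2" "Cf \<ge> 0" "\<And>d u. \<bar>fd a d h u\<bar> \<le> Cf * \<bar>d\<bar> ^ a" using smooth_fd by metis
  have a2: "real a > q1 / 2" "real a > q2 / 2" using a(1,2) X1.q0 X2.q0 by simp_all
  obtain D1 where D1: "D1 > 0" "\<And>n x y. n \<ge> 1 \<Longrightarrow> x \<in> pts \<Xi>1 \<Longrightarrow> y \<in> pts \<Xi>1 \<Longrightarrow> cmod (skern \<Xi>1 h n x y) \<le> D1 * n powr q1"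
    using X1.skern_sup[where h = h, OF h_bound h_supp] by metis
  obtain D2 where D2: "D2 > 0" "\<And>n x y. n \<ge> 1 \<Longrightarrow> x \<in> pts \<Xi>2 \<Longrightarrow> y \<in> pts \<Xi>2 \<Longrightarrow> cmod (skern \<Xi>2 h n x y) \<le> D2 * n powr q2"
    using X2.skern_sup[where h = h, OF h_bound h_supp] by metis
  obtain E1 where E1: "E1 > 0" "\<And>n x. n \<ge> 1 \<Longrightarrow> x \<in> pts \<Xi>1 \<Longrightarrow> (\<integral>\<^sup>+y. ennreal (cmod (skern \<Xi>1 h n x y)) \<partial>M1) \<le> ennreal E1"
    using X1.skern_L1[OF low a2(1) a(3,4)] by metis
  obtain E2 where E2: "E2 > 0" "\<And>n x. n \<ge> 1 \<Longrightarrow> x \<in> pts \<Xi>2 \<Longrightarrow> (\<integral>\<^sup>+y. ennreal (cmod (skern \<Xi>2 h n x y)) \<partial>M2) \<le> ennreal E2"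
    using X2.skern_L1[OF low a2(2) a(3,4)] by metis
  show thesis
  proof (rule that[of "max (D1 * E2) (D2 * E1)"])
    show "max (D1 * E2) (D2 * E1) > 0" using D1 E2 by (simp add: less_max_iff_disj)
    fix n :: real and x assume n: "n \<ge> 1"
    {
      assume x: "x \<in> pts \<Xi>1"
      have "(\<integral>\<^sup>+x2. majorant n x x2 \<partial>M2) = (\<integral>\<^sup>+y. \<integral>\<^sup>+x2. ennreal (cmod (skern \<Xi>1 h n x y)) * ennreal (cmod (skern \<Xi>2 h n y x2)) \<partial>M2 \<partial>\<nu>)"
        unfolding majorant_def by (rule P2.Fubini'[symmetric]) (unfold skern_def, measurable)
      also have "\<dots> = (\<integral>\<^sup>+y. ennreal (cmod (skern \<Xi>1 h n x y)) * (\<integral>\<^sup>+x2. ennreal (cmod (skern \<Xi>2 h n y x2)) \<partial>M2) \<partial>\<nu>)"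
        by (intro nn_integral_cong nn_integral_cmult) measurable
      also have "\<dots> \<le> ennreal (D1 * n powr q1) * ennreal E2"
        by (intro nu_mean_le mult_mono E2 ennreal_leI D1 n x nu_space) auto
      also have "\<dots> \<le> ennreal (max (D1 * E2) (D2 * E1) * n powr q1)"
      proof -
        have "D1 * n powr q1 * E2 = D1 * E2 * n powr q1" by (simp only: mult_ac)
        also have "\<dots> \<le> max (D1 * E2) (D2 * E1) * n powr q1" by (intro mult_right_mono) auto
        finally show ?thesis using D1 E2 by (simp add: ennreal_mult[symmetric] ennreal_leI)
      qed
      finally show "(\<integral>\<^sup>+x2. majorant n x x2 \<partial>M2) \<le> ennreal (max (D1 * E2) (D2 * E1) * n powr q1)" .
    next
      assume x: "x \<in> pts \<Xi>2"
      have sw: "cmod (skern \<Xi>1 h n x1 y) = cmod (skern \<Xi>1 h n y x1)" for x1 y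
        by (subst X1.skern_swap) simp
      have sw2: "cmod (skern \<Xi>2 h n y x) \<le> D2 * n powr q2" if "y \<in> space \<nu>" for y
        using D2(2)[OF n _ x] nu_space(2)[OF that] by simp
      have "(\<integral>\<^sup>+x1. majorant n x1 x \<partial>M1) = (\<integral>\<^sup>+y. \<integral>\<^sup>+x1. ennreal (cmod (skern \<Xi>1 h n x1 y)) * ennreal (cmod (skern \<Xi>2 h n y x)) \<partial>M1 \<partial>\<nu>)"
        unfolding majorant_def by (rule P1.Fubini'[symmetric]) (unfold skern_def, measurable)
      also have "\<dots> = (\<integral>\<^sup>+y. (\<integral>\<^sup>+x1. ennreal (cmod (skern \<Xi>1 h n y x1)) \<partial>M1) * ennreal (cmod (skern \<Xi>2 h n y x)) \<partial>\<nu>)"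
        unfolding sw by (intro nn_integral_cong nn_integral_multc) measurable
      also have "\<dots> \<le> ennreal E1 * ennreal (D2 * n powr q2)"
        by (intro nu_mean_le mult_mono E1 ennreal_leI sw2 n x nu_space) auto
      also have "\<dots> \<le> ennreal (max (D1 * E2) (D2 * E1) * n powr q2)"
      proof -
        have "E1 * (D2 * n powr q2) = D2 * E1 * n powr q2" by (simp only: mult_ac)
        also have "\<dots> \<le> max (D1 * E2) (D2 * E1) * n powr q2" by (intro mult_right_mono) auto
        finally show ?thesis using D2 E1 by (simp add: ennreal_mult[symmetric] ennreal_leI)
      qed
      finally show "(\<integral>\<^sup>+x1. majorant n x1 x \<partial>M1) \<le> ennreal (max (D1 * E2) (D2 * E1) * n powr q2)" .
    }
  qed
qed

text \<open>
  The condition under which the operators are finite sums of Fourier coefficients; it holds on $L^p$ and for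
  polynomials, and it passes to differences.
\<close>

definition testable :: "('a \<Rightarrow> complex) \<Rightarrow> bool"
  where "testable f \<longleftrightarrow> f \<in> borel_measurable M2 \<and> (\<forall>k. integrable M2 (\<lambda>x. f x * cnj (phi \<Xi>2 k x)))"

lemma testable_diff: "testable f \<Longrightarrow> testable g \<Longrightarrow> testable (\<lambda>x. f x - g x)"
  unfolding testable_def by (auto simp: left_diff_distrib)

text \<open>Each phi is both bounded and integrable: integrability handles the set where |f| \<le>
  1, and boundedness handles its complement, where |f| \<le> |f|^P.\<close>

lemma testable_Lp:
  assumes f: "f \<in> Lp p M2"
  shows "testable f"
  unfolding testable_def
proof (intro conjI allI)
  show m [measurable]: "f \<in> borel_measurable M2" using f by (simp add: Lp_def)
  fix k
  obtain B where B: "B \<ge> 0" "\<forall>x\<in>pts \<Xi>2. cmod (phi \<Xi>2 k x) \<le> B" using admissible_phi(3)[OF X2.adm] by blast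
  note ik = integrable_norm[OF admissible_phi(1)[OF X2.adm, of k]]
  obtain t where t: "0 \<le> t" "Lp_norm p M2 f = ennreal t" using f unfolding Lp_def by (cases "Lp_norm p M2 f") auto
  show "integrable M2 (\<lambda>x. f x * cnj (phi \<Xi>2 k x))"
  proof (cases "p = \<infinity>")
    case True
    have "AE x in M2. ennreal (cmod (f x)) \<le> ennreal t"
      using Lpn_inf_AE[OF True, of "\<lambda>x. ennreal (cmod (f x))" M2] t by (simp add: Lp_norm_eq_Lpn)
    then have "AE x in M2. norm (f x * cnj (phi \<Xi>2 k x)) \<le> norm (t * cmod (phi \<Xi>2 k x))"
      by eventually_elim (use t in \<open>auto simp: norm_mult intro!: mult_right_mono\<close>)
    then show ?thesis by (intro Bochner_Integration.integrable_bound[OF integrable_mult_right[OF ik, of t]]) auto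
  next
    case False
    define P where "P = enn2real p"
    have P: "1 \<le> P" unfolding P_def by (rule exponent_ge_1[OF p1 False])
    have "(\<integral>\<^sup>+x. enn_powr (ennreal (cmod (f x))) P \<partial>M2) \<le> ennreal (t powr P)"
      using t Lpn_le_iff_fin[OF p1 False t(1), of M2 "\<lambda>x. ennreal (cmod (f x))"] by (simp add: Lp_norm_eq_Lpn P_def)
    then have "(\<integral>\<^sup>+x. ennreal (norm (cmod (f x) powr P)) \<partial>M2) < \<infinity>"
      by (simp add: enn_powr_ennreal order.strict_trans1)
    then have iP: "integrable M2 (\<lambda>x. cmod (f x) powr P)" by (intro integrableI_bounded) auto
    have "AE x in M2. norm (f x * cnj (phi \<Xi>2 k x)) \<le> norm (cmod (phi \<Xi>2 k x) + cmod (f x) powr P * B)"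
    proof (rule AE_I2)
      fix x assume x: "x \<in> space M2"
      have "cmod (f x) * cmod (phi \<Xi>2 k x) \<le> cmod (phi \<Xi>2 k x) + cmod (f x) powr P * B"
      proof (cases "cmod (f x) \<le> 1")
        case True
        then have "cmod (f x) * cmod (phi \<Xi>2 k x) \<le> 1 * cmod (phi \<Xi>2 k x)" by (intro mult_right_mono) auto
        then show ?thesis using B by (simp add: add_increasing2)
      next
        case False
        then have "cmod (f x) powr 1 \<le> cmod (f x) powr P" using P by (intro powr_mono) auto
        then have "cmod (f x) \<le> cmod (f x) powr P" using False by simp
        then have "cmod (f x) * cmod (phi \<Xi>2 k x) \<le> cmod (f x) powr P * B" using B x by (intro mult_mono) auto
        then show ?thesis by (simp add: add_increasing)
      qed
      then show "norm (f x * cnj (phi \<Xi>2 k x)) \<le> norm (cmod (phi \<Xi>2 k x) + cmod (f x) powr P * B)"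
        unfolding norm_mult complex_mod_cnj real_norm_def by (rule order_trans[OF _ abs_ge_self])
    qed
    then show ?thesis
      by (intro Bochner_Integration.integrable_bound[OF Bochner_Integration.integrable_add[OF ik integrable_mult_left[OF iP, of B]]]) auto
  qed
qed

lemma testable_poly: "P \<in> diff_poly \<Xi>2 n \<Longrightarrow> testable P"
proof -
  assume "P \<in> diff_poly \<Xi>2 n"
  then obtain K a where "P = (\<lambda>x. \<Sum>k\<in>K. a k * phi \<Xi>2 k x)" "finite K" unfolding diff_poly_def by blast
  then show ?thesis
    unfolding testable_def using X2.phi_prod_integrable
    by (auto simp: sum_distrib_right mult.assoc intro!: Bochner_Integration.integrable_sum integrable_mult_right)
qed

section \<open>Mapping properties of the joint operators\<close>

lemma op_eq:
  assumes n: "n > 0" and f: "testable f"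
  shows "\<sigma> n f x1 = (\<Sum>j\<in>K1 n. (\<Sum>k\<in>K2 n. complex_of_real (h (lam \<Xi>1 j / n)) * complex_of_real (h (lam \<Xi>2 k / n)) * \<Gamma> j k *
     (LINT x|M2. f x * cnj (phi \<Xi>2 k x))) * phi \<Xi>1 j x1)"
proof -
  have e: "f x2 * tensor_kernel \<Xi>1 \<Xi>2 \<Gamma> h n x1 x2 = (\<Sum>j\<in>K1 n. \<Sum>k\<in>K2 n.
      (complex_of_real (h (lam \<Xi>1 j / n)) * complex_of_real (h (lam \<Xi>2 k / n)) * \<Gamma> j k * phi \<Xi>1 j x1) * (f x2 * cnj (phi \<Xi>2 k x2)))" for x2
    unfolding kernel_eq[OF n] sum_distrib_left by (intro sum.cong refl) (simp only: mult_ac)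
  have "\<sigma> n f x1 = (\<Sum>j\<in>K1 n. \<Sum>k\<in>K2 n.
      (complex_of_real (h (lam \<Xi>1 j / n)) * complex_of_real (h (lam \<Xi>2 k / n)) * \<Gamma> j k * phi \<Xi>1 j x1) * (LINT x|M2. f x * cnj (phi \<Xi>2 k x)))"
    unfolding tensor_op_def e using f unfolding testable_def
    by (simp add: Bochner_Integration.integral_sum)
  then show ?thesis unfolding sum_distrib_right by (simp only: mult_ac)
qed

lemma op_poly: "n > 0 \<Longrightarrow> testable f \<Longrightarrow> \<sigma> n f \<in> diff_poly \<Xi>1 n"
  unfolding diff_poly_def using finK(1)[of n] by (auto simp: op_eq fun_eq_iff intro!: exI[of _ "K1 n"])

lemma op_measurable: "n > 0 \<Longrightarrow> testable f \<Longrightarrow> \<sigma> n f \<in> borel_measurable M1"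
proof -
  assume "n > 0" "testable f"
  then have "\<sigma> n f = (\<lambda>x1. \<Sum>j\<in>K1 n. (\<Sum>k\<in>K2 n. complex_of_real (h (lam \<Xi>1 j / n)) * complex_of_real (h (lam \<Xi>2 k / n)) * \<Gamma> j k *
     (LINT x|M2. f x * cnj (phi \<Xi>2 k x))) * phi \<Xi>1 j x1)" by (intro ext op_eq)
  then show ?thesis by simp
qed

lemma op_diff: "n > 0 \<Longrightarrow> testable f \<Longrightarrow> testable g \<Longrightarrow> \<sigma> n (\<lambda>x. f x - g x) x1 = \<sigma> n f x1 - \<sigma> n g x1"
  using testable_diff[of f g]
  by (simp add: op_eq testable_def left_diff_distrib right_diff_distrib sum_subtractf)

theorem op_bounded:
  "\<exists>C>0. \<forall>n\<ge>1. \<forall>f. testable f \<longrightarrow> Lp_norm p M1 (\<sigma> n f) \<le> ennreal (C * n powr loss_exponent q1 q2 p) * Lp_norm p M2 f"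
proof -
  obtain C where C: "C > 0"
    "\<And>n x. n \<ge> 1 \<Longrightarrow> x \<in> pts \<Xi>1 \<Longrightarrow> (\<integral>\<^sup>+x2. majorant n x x2 \<partial>M2) \<le> ennreal (C * n powr q1)"
    "\<And>n x. n \<ge> 1 \<Longrightarrow> x \<in> pts \<Xi>2 \<Longrightarrow> (\<integral>\<^sup>+x1. majorant n x1 x \<partial>M1) \<le> ennreal (C * n powr q2)"
    using majorant_bounds by metis
  have "Lp_norm p M1 (\<sigma> n f) \<le> ennreal (C * n powr loss_exponent q1 q2 p) * Lp_norm p M2 f" if n: "n \<ge> 1" and f: "testable f" for n f
  proof -
    have n0: "n > 0" using n by simp
    have [measurable]: "f \<in> borel_measurable M2" using f by (simp add: testable_def)
    have [measurable]: "\<sigma> n f \<in> borel_measurable M1" by (rule op_measurable[OF n0 f])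
    define s where "s = enn2real (1 / p)"
    have "Lp_norm p M1 (\<sigma> n f) \<le> Lpn p M1 (\<lambda>x. \<integral>\<^sup>+y. majorant n x y * ennreal (cmod (f y)) \<partial>M2)"
      unfolding Lp_norm_eq_Lpn
    proof (intro Lpn_mono_AE p1 AE_I2)
      fix x
      have "integrable M2 (\<lambda>y. f y * tensor_kernel \<Xi>1 \<Xi>2 \<Gamma> h n x y)"
        unfolding kernel_eq[OF n0] sum_distrib_left using f unfolding testable_def
        by (auto intro!: Bochner_Integration.integrable_sum simp: mult.left_commute[of "f _"])
      from integral_norm_bound_ennreal[OF this]
      have "ennreal (cmod (\<sigma> n f x)) \<le> (\<integral>\<^sup>+y. ennreal (cmod (tensor_kernel \<Xi>1 \<Xi>2 \<Gamma> h n x y)) * ennreal (cmod (f y)) \<partial>M2)"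
        unfolding tensor_op_def by (simp add: norm_mult ennreal_mult mult.commute)
      also have "\<dots> \<le> (\<integral>\<^sup>+y. majorant n x y * ennreal (cmod (f y)) \<partial>M2)"
        by (intro nn_integral_mono mult_right_mono kernel_le_majorant n0) auto
      finally show "ennreal (cmod (\<sigma> n f x)) \<le> (\<integral>\<^sup>+y. majorant n x y * ennreal (cmod (f y)) \<partial>M2)" .
    qed measurable
    also have "\<dots> \<le> ennreal ((C * n powr q1) powr (1 - s) * (C * n powr q2) powr s) * Lpn p M2 (\<lambda>y. ennreal (cmod (f y)))"
      unfolding s_def by (rule schur_test[OF p1 sigma_finite]) (use C n in auto)
    also have "(C * n powr q1) powr (1 - s) * (C * n powr q2) powr s = C * n powr loss_exponent q1 q2 p"
    proof -
      have "(C * n powr q1) powr (1 - s) * (C * n powr q2) powr s = C powr ((1 - s) + s) * n powr (q1 * (1 - s) + q2 * s)"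
        unfolding powr_mult powr_powr powr_add by (simp only: mult_ac)
      also have "q1 * (1 - s) + q2 * s = loss_exponent q1 q2 p" by (simp add: loss_exponent_def s_def algebra_simps)
      finally show ?thesis using C(1) by simp
    qed
    finally show ?thesis unfolding Lp_norm_eq_Lpn .
  qed
  then show ?thesis using C(1) by blast
qed

text \<open>The exponent is the convex combination of q1 and q2 with weight 1/p on q2.\<close>

lemma loss_pos: "loss_exponent q1 q2 p > 0"
proof -
  define s where "s = enn2real (1 / p)"
  have s: "0 \<le> s" "s \<le> 1"
  proof -
    show "0 \<le> s" by (simp add: s_def)
    show "s \<le> 1"
    proof (cases "p = \<infinity>")
      case False
      then show ?thesis using exponent_ge_1[OF p1] inverse_exponent[OF p1] by (simp add: s_def)
    qed (simp add: s_def)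
  qed
  have "loss_exponent q1 q2 p = q1 * (1 - s) + q2 * s" by (simp add: loss_exponent_def s_def algebra_simps)
  also have "\<dots> > 0" using s X1.q0 X2.q0 by (cases "s = 0") (auto intro!: add_nonneg_pos)
  finally show ?thesis .
qed

end

section \<open>A discrete Hardy inequality\<close>

lemma suminf_swap_ennreal:
  fixes a :: "nat \<Rightarrow> nat \<Rightarrow> ennreal"
  shows "(\<Sum>n. \<Sum>m. a n m) = (\<Sum>m. \<Sum>n. a n m)"
  using nn_integral_suminf[of "\<lambda>m n. a n m" "count_space UNIV"] by (simp add: nn_integral_count_space_nat)

lemma suminf_tail_le_ennreal:
  fixes x :: "nat \<Rightarrow> ennreal"
  shows "(\<Sum>m. x (n + m)) \<le> (\<Sum>m. x m)"
proof (rule suminf_le_const[OF summableI])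
  fix N
  have "(\<Sum>m<N. x (n + m)) = sum x ((+) n ` {..<N})" by (subst sum.reindex) auto
  also have "\<dots> \<le> (\<Sum>m. x m)" by (rule sum_le_suminf) auto
  finally show "(\<Sum>m<N. x (n + m)) \<le> (\<Sum>m. x m)" .
qed

lemma suminf_tail_tendsto_ennreal:
  fixes x :: "nat \<Rightarrow> ennreal"
  assumes fin: "(\<Sum>m. x m) < \<infinity>"
  shows "(\<lambda>n. \<Sum>m. x (n + m)) \<longlonglongrightarrow> 0"
proof -
  have xf: "x m < \<infinity>" for m
    using sum_le_suminf[of x "{m}"] fin by (auto intro: order.strict_trans1)
  define r where "r = (\<lambda>m. enn2real (x m))"
  have x: "x m = ennreal (r m)" for m unfolding r_def using xf[of m] by (simp add: ennreal_enn2real)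
  have r0: "r m \<ge> 0" for m by (simp add: r_def)
  have s: "summable r" using fin r0 unfolding x by (intro summable_suminf_not_top) auto
  have "(\<Sum>m. x (n + m)) = ennreal (suminf r - (\<Sum>m<n. r m))" for n
  proof -
    have "(\<Sum>m. x (n + m)) = ennreal (\<Sum>m. r (m + n))"
      unfolding x by (subst suminf_ennreal2) (use r0 s in \<open>auto simp: add.commute summable_iff_shift\<close>)
    then show ?thesis using suminf_minus_initial_segment[OF s, of n] by simp
  qed
  moreover have "(\<lambda>n. ennreal (suminf r - (\<Sum>m<n. r m))) \<longlonglongrightarrow> ennreal (suminf r - suminf r)"
    by (intro tendsto_ennrealI tendsto_diff tendsto_const summable_LIMSEQ s)
  ultimately show ?thesis by simp
qed

lemma enn_powr_less_top_iff: "enn_powr x a < \<infinity> \<longleftrightarrow> x < \<infinity>"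
  by (auto simp: enn_powr_def less_top)

lemma enn_powr_mult:
  assumes "0 < c" "0 < r"
  shows "enn_powr (ennreal c * x) r = ennreal (c powr r) * enn_powr x r"
  using assms by (cases x)
    (auto simp: enn_powr_ennreal ennreal_mult[symmetric] powr_mult ennreal_mult_top enn_powr_top[unfolded infinity_ennreal_def])

text \<open>From x + y \<le> 2 max(x,y). It holds for every r > 0, including r < 1, where the
  triangle inequality of the sequence space fails.\<close>

lemma enn_powr_sum_le:
  assumes r: "0 < r"
  shows "enn_powr (x + y) r \<le> ennreal (2 powr r) * (enn_powr x r + enn_powr y r)"
proof -
  have "x + y \<le> ennreal 2 * max x y" by (metis add_mono max.cobounded1 max.cobounded2 mult_2 ennreal_numeral)
  then have "enn_powr (x + y) r \<le> enn_powr (ennreal 2 * max x y) r" using r by (intro enn_powr_mono) auto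
  also have "\<dots> = ennreal (2 powr r) * enn_powr (max x y) r" using r by (simp only: enn_powr_mult)
  also have "enn_powr (max x y) r \<le> enn_powr x r + enn_powr y r" by (auto simp: max_def)
  finally show ?thesis by (simp add: mult_left_mono)
qed

lemma suminf_geometric_ennreal:
  assumes "\<delta> > 0" shows "(\<Sum>m. ennreal (2 powr (- \<delta> * real m))) = ennreal (1 / (1 - 2 powr - \<delta>))"
proof -
  have "(\<lambda>m. (2 powr - \<delta>) ^ m) sums (1 / (1 - 2 powr - \<delta>))"
    using assms by (intro geometric_sums) (simp add: powr_less_one)
  moreover have "2 powr (- \<delta> * real m) = (2 powr - \<delta>) ^ m" for m :: nat
  proof -
    have "(2 powr - \<delta>) ^ m = (2 powr - \<delta>) powr real m" by (rule powr_realpow[symmetric]) simp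
    then show ?thesis by (simp only: powr_powr)
  qed
  ultimately show ?thesis by (intro suminf_ennreal_eq) simp_all
qed

text \<open>The weight is split into two equal halves. One is summed as a geometric series, while
  the terms carrying the other are bounded by the l^r quantity V; this works for every r > 0.
  Exchanging the two summations then bounds the result by the sum of the r-th powers of z.\<close>

lemma hardy_sum:
  fixes z :: "nat \<Rightarrow> ennreal"
  assumes d: "\<delta> > 0" and r: "r > 0" and fin: "(\<Sum>n. enn_powr (z n) r) < \<infinity>"
  shows "(\<Sum>n. enn_powr (\<Sum>m. ennreal (2 powr (- \<delta> * real m)) * z (n + m)) r) < \<infinity>"
proof -
  define c where "c = 1 / (1 - 2 powr - (\<delta> / 2))"
  have c: "c > 0" using d unfolding c_def by (simp add: powr_less_one)
  have tb: "enn_powr (\<Sum>m. ennreal (2 powr (- \<delta> * real m)) * z (n + m)) r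
      \<le> ennreal (c powr r) * (\<Sum>m. ennreal (2 powr (- (\<delta> / 2 * r) * real m)) * enn_powr (z (n + m)) r)" for n
  proof -
    define V where "V = (\<Sum>m. enn_powr (ennreal (2 powr (- (\<delta> / 2) * real m)) * z (n + m)) r)"
    have Vm: "ennreal (2 powr (- (\<delta> / 2) * real m)) * z (n + m) \<le> enn_powr V (1 / r)" for m
    proof -
      let ?g = "\<lambda>m. enn_powr (ennreal (2 powr (- (\<delta> / 2) * real m)) * z (n + m)) r"
      have "?g m \<le> V" unfolding V_def using sum_le_suminf[of ?g "{m}"] by auto
      then have "enn_powr (?g m) (1 / r) \<le> enn_powr V (1 / r)" using r by (intro enn_powr_mono) auto
      moreover have "enn_powr (?g m) (1 / r) = ennreal (2 powr (- (\<delta> / 2) * real m)) * z (n + m)"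
        by (rule enn_powr_inverse) (use r in simp)
      ultimately show ?thesis by simp
    qed
    have "(\<Sum>m. ennreal (2 powr (- \<delta> * real m)) * z (n + m)) \<le> (\<Sum>m. ennreal (2 powr (- (\<delta> / 2) * real m)) * enn_powr V (1 / r))"
    proof (intro suminf_le summableI)
      fix m
      have "ennreal (2 powr (- \<delta> * real m)) = ennreal (2 powr (- (\<delta> / 2) * real m)) * ennreal (2 powr (- (\<delta> / 2) * real m))"
        by (simp add: ennreal_mult[symmetric] powr_add[symmetric])
      then show "ennreal (2 powr (- \<delta> * real m)) * z (n + m) \<le> ennreal (2 powr (- (\<delta> / 2) * real m)) * enn_powr V (1 / r)"
        using mult_left_mono[OF Vm[of m]] by (simp only: mult.assoc) simp
    qed
    also have "\<dots> = ennreal c * enn_powr V (1 / r)"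
      unfolding ennreal_suminf_multc c_def using d by (subst suminf_geometric_ennreal) auto
    finally have "enn_powr (\<Sum>m. ennreal (2 powr (- \<delta> * real m)) * z (n + m)) r \<le> enn_powr (ennreal c * enn_powr V (1 / r)) r"
      using r by (intro enn_powr_mono) auto
    also have "\<dots> = ennreal (c powr r) * V"
      using r enn_powr_inverse[of "1 / r" V] by (simp add: enn_powr_mult[OF c r])
    also have "V = (\<Sum>m. ennreal (2 powr (- (\<delta> / 2 * r) * real m)) * enn_powr (z (n + m)) r)"
      unfolding V_def
    proof (rule suminf_cong)
      fix m
      have "(2 powr (- (\<delta> / 2) * real m)) powr r = 2 powr (- (\<delta> / 2 * r) * real m)"
        unfolding powr_powr by (simp add: mult_ac)
      then show "enn_powr (ennreal (2 powr (- (\<delta> / 2) * real m)) * z (n + m)) r = ennreal (2 powr (- (\<delta> / 2 * r) * real m)) * enn_powr (z (n + m)) r"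
        using r by (simp only: enn_powr_mult powr_gt_zero)
    qed
    finally show ?thesis .
  qed
  have "(\<Sum>n. enn_powr (\<Sum>m. ennreal (2 powr (- \<delta> * real m)) * z (n + m)) r)
      \<le> (\<Sum>n. ennreal (c powr r) * (\<Sum>m. ennreal (2 powr (- (\<delta> / 2 * r) * real m)) * enn_powr (z (n + m)) r))"
    by (intro suminf_le summableI tb)
  also have "\<dots> = ennreal (c powr r) * (\<Sum>m. \<Sum>n. ennreal (2 powr (- (\<delta> / 2 * r) * real m)) * enn_powr (z (n + m)) r)"
    by (subst ennreal_suminf_cmult, subst suminf_swap_ennreal) (rule refl)
  also have "\<dots> = ennreal (c powr r) * (\<Sum>m. ennreal (2 powr (- (\<delta> / 2 * r) * real m)) * (\<Sum>n. enn_powr (z (m + n)) r))"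
    by (simp only: ennreal_suminf_cmult add.commute)
  also have "\<dots> \<le> ennreal (c powr r) * (\<Sum>m. ennreal (2 powr (- (\<delta> / 2 * r) * real m)) * (\<Sum>n. enn_powr (z n) r))"
    by (rule mult_left_mono[OF suminf_le[OF mult_left_mono[OF suminf_tail_le_ennreal]]]) auto
  also have "\<dots> = ennreal (c powr r) * (ennreal (1 / (1 - 2 powr - (\<delta> / 2 * r))) * (\<Sum>n. enn_powr (z n) r))"
    unfolding ennreal_suminf_multc using d r by (subst suminf_geometric_ennreal) auto
  also have "\<dots> < \<infinity>" using fin by (simp add: ennreal_mult_less_top)
  finally show ?thesis .
qed

section \<open>Convergence and rate of approximation\<close>

lemma approx_err_mono: "m \<le> n \<Longrightarrow> approx_err p \<Xi> n g \<le> approx_err p \<Xi> m g"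
  unfolding approx_err_def diff_poly_def by (rule INF_superset_mono) (force, rule order_refl)

lemma approx_err_le_norm: "approx_err p \<Xi> n g \<le> Lp_norm p (msr \<Xi>) g"
proof -
  have "(\<lambda>x. 0) \<in> diff_poly \<Xi> n" unfolding diff_poly_def by (auto intro!: exI[of _ "{}"])
  then have "approx_err p \<Xi> n g \<le> Lp_norm p (msr \<Xi>) (\<lambda>x. g x - 0)" unfolding approx_err_def by (rule INF_lower)
  then show ?thesis by simp
qed

lemma diff_poly_mono: "P \<in> diff_poly \<Xi> m \<Longrightarrow> m \<le> n \<Longrightarrow> P \<in> diff_poly \<Xi> n"
  unfolding diff_poly_def by force

lemma diff_poly_diff:
  assumes "P \<in> diff_poly \<Xi> n" "R \<in> diff_poly \<Xi> n"
  shows "(\<lambda>x. P x - R x) \<in> diff_poly \<Xi> n"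
proof -
  obtain K a where K: "P = (\<lambda>x. \<Sum>k\<in>K. a k * phi \<Xi> k x)" "finite K" "K \<subseteq> {k. lam \<Xi> k < n}" using assms(1) unfolding diff_poly_def by blast
  obtain J b where J: "R = (\<lambda>x. \<Sum>k\<in>J. b k * phi \<Xi> k x)" "finite J" "J \<subseteq> {k. lam \<Xi> k < n}" using assms(2) unfolding diff_poly_def by blast
  define d where "d = (\<lambda>k. (if k \<in> K then a k else 0) - (if k \<in> J then b k else 0))"
  have "(\<Sum>k\<in>K. a k * phi \<Xi> k x) = (\<Sum>k\<in>K \<union> J. (if k \<in> K then a k else 0) * phi \<Xi> k x)" for x
    using K(2) J(2) by (intro sum.mono_neutral_cong_left) auto
  moreover have "(\<Sum>k\<in>J. b k * phi \<Xi> k x) = (\<Sum>k\<in>K \<union> J. (if k \<in> J then b k else 0) * phi \<Xi> k x)" for x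
    using K(2) J(2) by (intro sum.mono_neutral_cong_left) auto
  ultimately have "(\<lambda>x. P x - R x) = (\<lambda>x. \<Sum>k\<in>K \<union> J. d k * phi \<Xi> k x)"
    unfolding K(1) J(1) d_def by (simp add: left_diff_distrib sum_subtractf)
  then show ?thesis unfolding diff_poly_def using K J by blast
qed

locale connected_pair = tensor_setup +
  fixes \<beta> :: real
  assumes beta: "\<beta> > 0"
    and gain: "\<exists>c>0. \<forall>m n :: nat. m \<ge> 1 \<longrightarrow> n \<ge> 1 \<longrightarrow> (\<forall>P\<in>diff_poly \<Xi>2 (real n).
           Lp_norm p (msr \<Xi>1)
             (\<lambda>x. tensor_op \<Xi>1 \<Xi>2 \<Gamma> h (2 ^ (m + 1)) P x - tensor_op \<Xi>1 \<Xi>2 \<Gamma> h (2 ^ m) P x)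
           \<le> ennreal (c * 2 powr (- real m * \<beta>) * real n powr loss_exponent q1 q2 p)
               * Lp_norm p (msr \<Xi>2) P)"
begin

abbreviation "Q \<equiv> loss_exponent q1 q2 p"

definition step :: "nat \<Rightarrow> ('a \<Rightarrow> complex) \<Rightarrow> ennreal"
  where "step m g = Lp_norm p M1 (\<lambda>x. \<sigma> (2 ^ Suc m) g x - \<sigma> (2 ^ m) g x)"

definition err :: "('a \<Rightarrow> complex) \<Rightarrow> nat \<Rightarrow> ennreal"
  where "err f k = approx_err p \<Xi>2 (2 ^ k) f"

definition weighted_tail :: "('a \<Rightarrow> complex) \<Rightarrow> nat \<Rightarrow> ennreal"
  where "weighted_tail f n = (\<Sum>m. ennreal (2 powr (real (n + m) * Q)) * err f (n + m))"

lemma step_le_norm: "\<exists>B>0. \<forall>m g. testable g \<longrightarrow> step m g \<le> ennreal (B * 2 powr (real m * Q)) * Lp_norm p M2 g"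
proof -
  obtain C where C: "C > 0" "\<And>n f. n \<ge> 1 \<Longrightarrow> testable f \<Longrightarrow> Lp_norm p M1 (\<sigma> n f) \<le> ennreal (C * n powr Q) * Lp_norm p M2 f"
    using op_bounded by blast
  have "step m g \<le> ennreal (C * (2 powr Q + 1) * 2 powr (real m * Q)) * Lp_norm p M2 g" if g: "testable g" for m g
  proof -
    have [measurable]: "\<sigma> (2 ^ k) g \<in> borel_measurable M1" for k by (rule op_measurable[OF _ g]) simp
    have b: "Lp_norm p M1 (\<sigma> (2 ^ k) g) \<le> ennreal (C * 2 powr (real k * Q)) * Lp_norm p M2 g" for k
    proof -
      have "(2 ^ k) powr Q = 2 powr (real k * Q)" by (simp add: powr_realpow[symmetric] powr_powr)
      then show ?thesis using C(2)[OF _ g, of "2 ^ k"] by simp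
    qed
    have "step m g \<le> Lp_norm p M1 (\<lambda>x. \<sigma> (2 ^ Suc m) g x - 0) + Lp_norm p M1 (\<lambda>x. 0 - \<sigma> (2 ^ m) g x)"
      unfolding step_def by (rule Lp_norm_diff_triangle[OF p1]) measurable
    also have "\<dots> = Lp_norm p M1 (\<sigma> (2 ^ Suc m) g) + Lp_norm p M1 (\<sigma> (2 ^ m) g)"
      using Lp_norm_minus_commute[of p M1 "\<lambda>x. 0" "\<sigma> (2 ^ m) g"] by simp
    also have "\<dots> \<le> ennreal (C * 2 powr (real (Suc m) * Q)) * Lp_norm p M2 g + ennreal (C * 2 powr (real m * Q)) * Lp_norm p M2 g"
      by (intro add_mono b)
    also have "\<dots> = ennreal (C * 2 powr (real (Suc m) * Q) + C * 2 powr (real m * Q)) * Lp_norm p M2 g"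
      using C(1) by (simp add: distrib_right ennreal_plus)
    also have "C * 2 powr (real (Suc m) * Q) + C * 2 powr (real m * Q) = C * (2 powr Q + 1) * 2 powr (real m * Q)"
      by (simp add: distrib_right distrib_left powr_add)
    finally show ?thesis .
  qed
  moreover have "C * (2 powr Q + 1) > 0" using C(1) by (simp add: add_pos_nonneg)
  ultimately show ?thesis by blast
qed

text \<open>The hypothesis starts at m = 1. For m = 0 the operator bound takes over, and the factor
  2^(kQ) \<ge> 1 may be inserted because Q is positive.\<close>

lemma step_poly: "\<exists>G>0. \<forall>m k. \<forall>P\<in>diff_poly \<Xi>2 (2 ^ k). step m P \<le> ennreal (G * 2 powr (- real m * \<beta>) * 2 powr (real k * Q)) * Lp_norm p M2 P"
proof -
  obtain B where B: "B > 0" "\<And>m g. testable g \<Longrightarrow> step m g \<le> ennreal (B * 2 powr (real m * Q)) * Lp_norm p M2 g"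
    using step_le_norm by blast
  obtain c where c: "c > 0" "\<And>m n P. m \<ge> 1 \<Longrightarrow> n \<ge> 1 \<Longrightarrow> P \<in> diff_poly \<Xi>2 (real n) \<Longrightarrow> step m P \<le> ennreal (c * 2 powr (- real m * \<beta>) * real n powr Q) * Lp_norm p M2 P"
  proof -
    from gain obtain c where "c > 0" and c: "\<forall>m n :: nat. m \<ge> 1 \<longrightarrow> n \<ge> 1 \<longrightarrow> (\<forall>P\<in>diff_poly \<Xi>2 (real n).
       Lp_norm p M1 (\<lambda>x. \<sigma> (2 ^ (m + 1)) P x - \<sigma> (2 ^ m) P x) \<le> ennreal (c * 2 powr (- real m * \<beta>) * real n powr Q) * Lp_norm p M2 P)"
      by blast
    show thesis
    proof (rule that[OF \<open>c > 0\<close>])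
      fix m n :: nat and P assume "m \<ge> 1" "n \<ge> 1" "P \<in> diff_poly \<Xi>2 (real n)"
      with c show "step m P \<le> ennreal (c * 2 powr (- real m * \<beta>) * real n powr Q) * Lp_norm p M2 P"
        unfolding step_def Suc_eq_plus1 by blast
    qed
  qed
  have "step m P \<le> ennreal (max B c * 2 powr (- real m * \<beta>) * 2 powr (real k * Q)) * Lp_norm p M2 P" if P: "P \<in> diff_poly \<Xi>2 (2 ^ k)" for m k P
  proof (cases "m = 0")
    case True
    have "step m P \<le> ennreal (B * 1 * 1) * Lp_norm p M2 P" using B(2)[OF testable_poly[OF P], of m] True by simp
    also have "\<dots> \<le> ennreal (max B c * 1 * 2 powr (real k * Q)) * Lp_norm p M2 P"
      using B loss_pos by (intro mult_right_mono ennreal_leI mult_mono ge_one_powr_ge_zero) auto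
    finally show ?thesis using True by simp
  next
    case False
    have "real (2 ^ k) powr Q = 2 powr (real k * Q)" by (simp add: powr_realpow[symmetric] powr_powr)
    then have "step m P \<le> ennreal (c * 2 powr (- real m * \<beta>) * 2 powr (real k * Q)) * Lp_norm p M2 P"
      using c(2)[of m "2 ^ k" P] False P by simp
    also have "\<dots> \<le> ennreal (max B c * 2 powr (- real m * \<beta>) * 2 powr (real k * Q)) * Lp_norm p M2 P"
      by (intro mult_right_mono ennreal_leI) auto
    finally show ?thesis .
  qed
  moreover have "max B c > 0" using B by simp
  ultimately show ?thesis by blast
qed

lemma step_split:
  assumes f: "testable f" and g: "testable g"
  shows "step m f \<le> step m (\<lambda>x. f x - g x) + step m g"
proof -
  have [measurable]: "\<sigma> (2 ^ k) f \<in> borel_measurable M1" "\<sigma> (2 ^ k) g \<in> borel_measurable M1" for k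
    by (rule op_measurable[OF _ f], simp, rule op_measurable[OF _ g], simp)
  have [measurable]: "\<sigma> (2 ^ k) (\<lambda>x. f x - g x) \<in> borel_measurable M1" for k
    by (rule op_measurable[OF _ testable_diff[OF f g]]) simp
  have "step m f = Lp_norm p M1 (\<lambda>x. (\<sigma> (2 ^ Suc m) (\<lambda>x. f x - g x) x - \<sigma> (2 ^ m) (\<lambda>x. f x - g x) x) + (\<sigma> (2 ^ Suc m) g x - \<sigma> (2 ^ m) g x))"
    unfolding step_def by (simp add: op_diff[OF _ f g])
  also have "\<dots> \<le> step m (\<lambda>x. f x - g x) + step m g"
    unfolding step_def by (rule Lp_norm_triangle[OF p1]) measurable
  finally show ?thesis .
qed

lemma step_telescope:
  assumes P: "\<And>k. testable (P k)"
  shows "step m (P (n + j)) \<le> step m (P n) + (\<Sum>k<j. step m (\<lambda>x. P (Suc (n + k)) x - P (n + k) x))"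
proof (induction j)
  case (Suc j)
  have "step m (P (n + Suc j)) \<le> step m (\<lambda>x. P (Suc (n + j)) x - P (n + j) x) + step m (P (n + j))"
    using step_split[OF P[of "Suc (n + j)"] P[of "n + j"], of m] by simp
  also have "\<dots> \<le> step m (\<lambda>x. P (Suc (n + j)) x - P (n + j) x) + (step m (P n) + (\<Sum>k<j. step m (\<lambda>x. P (Suc (n + k)) x - P (n + k) x)))"
    by (intro add_left_mono Suc.IH)
  finally show ?case by (simp add: add_ac)
qed simp

text \<open>A minimizer need not be at hand; the additive slack also covers the case that the error
  is 0.\<close>

lemma near_best:
  assumes f: "f \<in> Lp p M2" and e: "\<epsilon> > 0"
  shows "\<exists>P\<in>diff_poly \<Xi>2 (2 ^ k). Lp_norm p M2 (\<lambda>x. f x - P x) \<le> err f k + ennreal \<epsilon>"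
proof -
  have "err f k \<le> Lp_norm p M2 f" unfolding err_def by (rule approx_err_le_norm)
  then have "err f k < \<infinity>" using f unfolding Lp_def by (auto intro: order.strict_trans1)
  then have "err f k < err f k + ennreal \<epsilon>" using e by (cases "err f k") (auto simp: ennreal_plus[symmetric] ennreal_less_iff simp del: ennreal_plus)
  then show ?thesis unfolding err_def approx_err_def INF_less_iff by (auto intro: less_imp_le)
qed

text \<open>The expansion of P_(n+j) starts at P_n, whose norm is at most that of f plus an error.
  This leaves 2^(nQ) times the norm of f, and the gain 2^(-n \<beta>) turns it into the second term
  of the claim; the increments go into the tail. The slack of the near-best choices is sent to 0 at
  the end.\<close>

theorem step_series_bound:
  "\<exists>c>0. \<forall>f\<in>Lp p M2. \<forall>n. (\<Sum>m. step (n + m) f) \<le> ennreal c * (weighted_tail f n + ennreal (2 powr (real n * (Q - \<beta>))) * Lp_norm p M2 f)"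
proof -
  obtain B where B: "B > 0" "\<And>m g. testable g \<Longrightarrow> step m g \<le> ennreal (B * 2 powr (real m * Q)) * Lp_norm p M2 g"
    using step_le_norm by blast
  obtain G where G: "G > 0" "\<And>m k P. P \<in> diff_poly \<Xi>2 (2 ^ k) \<Longrightarrow> step m P \<le> ennreal (G * 2 powr (- real m * \<beta>) * 2 powr (real k * Q)) * Lp_norm p M2 P"
    using step_poly by blast
  define H where "H = 1 / (1 - 2 powr - \<beta>)"
  \<comment> \<open>The tail S enters once through the error of P_n, and twice with the factor 2^Q
    through the increments.\<close>
  define c3 where "c3 = 1 + 2 * 2 powr Q"
  have H: "H > 0" using beta unfolding H_def by (simp add: powr_less_one)
  have c3: "c3 > 0" unfolding c3_def by (simp add: add_pos_nonneg)
  define c where "c = max (B + G * H * c3) (G * H)"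
  have c0: "c > 0" unfolding c_def using B G H by (simp add: less_max_iff_disj)
  have em: "ennreal (g * w) * X = ennreal g * (ennreal w * X)" if "0 \<le> g" "0 \<le> w" for g w X
    using that by (simp add: ennreal_mult mult.assoc)
  have main: "(\<Sum>m. step (n + m) f) \<le> ennreal c * (weighted_tail f n + ennreal (2 powr (real n * (Q - \<beta>))) * Lp_norm p M2 f)"
    if f: "f \<in> Lp p M2" for f n
  proof -
    define R where "R = weighted_tail f n + ennreal (2 powr (real n * (Q - \<beta>))) * Lp_norm p M2 f"
    have tf: "testable f" by (rule testable_Lp[OF f])
    have [measurable]: "f \<in> borel_measurable M2" using f by (simp add: Lp_def)
    have eps: "(\<Sum>m. step (n + m) f) \<le> ennreal c * R + ennreal (c * (2 * \<epsilon>))" if e: "\<epsilon> > 0" for \<epsilon>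
    proof -
      \<comment> \<open>After multiplication by the weight 2^(kQ) the slack at level k is \<epsilon>
        2^(-k), so the total is at most 2 \<epsilon>.\<close>
      define \<epsilon>k where "\<epsilon>k = (\<lambda>k. \<epsilon> * 2 powr (- (real k * Q)) * (1/2) ^ k)"
      have ek: "\<epsilon>k k > 0" for k using e by (simp add: \<epsilon>k_def)
      have "\<forall>k. \<exists>P. P \<in> diff_poly \<Xi>2 (2 ^ k) \<and> Lp_norm p M2 (\<lambda>x. f x - P x) \<le> err f k + ennreal (\<epsilon>k k)"
        using near_best[OF f ek] by blast
      from choice[OF this] obtain P where P: "\<And>k. P k \<in> diff_poly \<Xi>2 (2 ^ k)" "\<And>k. Lp_norm p M2 (\<lambda>x. f x - P k x) \<le> err f k + ennreal (\<epsilon>k k)"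
        by blast
      have tP: "testable (P k)" for k by (rule testable_poly[OF P(1)])
      have [measurable]: "P k \<in> borel_measurable M2" for k using tP by (simp add: testable_def)
      define a where "a = (\<lambda>k. err f k + ennreal (\<epsilon>k k))"
      define b where "b = (\<lambda>k. ennreal (2 powr (real k * Q)) * a k)"
      define S where "S = (\<Sum>m. b (n + m))"
      have Sb: "S \<le> weighted_tail f n + ennreal (2 * \<epsilon>)"
      proof -
        have "b k = ennreal (2 powr (real k * Q)) * err f k + ennreal (\<epsilon> * (1/2) ^ k)" for k
        proof -
          have "2 powr (real k * Q) * \<epsilon>k k = \<epsilon> * (1/2) ^ k" unfolding \<epsilon>k_def by (simp add: powr_minus)
          then show ?thesis unfolding b_def a_def using ek[of k] by (simp add: distrib_left ennreal_mult[symmetric])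
        qed
        then have "S = weighted_tail f n + (\<Sum>m. ennreal (\<epsilon> * (1/2) ^ (n + m)))"
          unfolding S_def weighted_tail_def by (simp add: suminf_add[symmetric])
        also have "(\<Sum>m. ennreal (\<epsilon> * (1/2) ^ (n + m))) \<le> (\<Sum>m. ennreal (\<epsilon> * (1/2) ^ m))"
          by (rule suminf_tail_le_ennreal)
        also have "(\<Sum>m. ennreal (\<epsilon> * (1/2) ^ m)) = ennreal (\<epsilon> * (1 / (1 - 1/2)))"
          using e by (intro suminf_ennreal_eq sums_mult geometric_sums) auto
        finally show ?thesis by (simp add: add_left_mono mult.commute)
      qed
      have Pn: "Lp_norm p M2 (P n) \<le> Lp_norm p M2 f + a n"
      proof -
        have "Lp_norm p M2 (\<lambda>x. P n x - 0) \<le> Lp_norm p M2 (\<lambda>x. P n x - f x) + Lp_norm p M2 (\<lambda>x. f x - 0)"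
          by (rule Lp_norm_diff_triangle[OF p1]) measurable
        then have "Lp_norm p M2 (P n) \<le> Lp_norm p M2 (\<lambda>x. f x - P n x) + Lp_norm p M2 f"
          by (simp add: Lp_norm_minus_commute[of p M2 "P n"])
        also have "\<dots> \<le> a n + Lp_norm p M2 f" unfolding a_def by (intro add_right_mono P)
        finally show ?thesis by (simp add: add.commute)
      qed
      \<comment> \<open>The difference belongs to the polynomial space of the finer level k + 1;
        expressing its weight through \<open>b k\<close> costs the factor 2^Q.\<close>
      have stepP: "step m (\<lambda>x. P (Suc k) x - P k x) \<le> ennreal (G * 2 powr (- real m * \<beta>)) * (ennreal (2 powr Q) * (b k + b (Suc k)))" for m k
      proof -
        have d: "(\<lambda>x. P (Suc k) x - P k x) \<in> diff_poly \<Xi>2 (2 ^ Suc k)"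
          by (rule diff_poly_diff[OF P(1) diff_poly_mono[OF P(1)]]) simp
        have "Lp_norm p M2 (\<lambda>x. P (Suc k) x - P k x) \<le> Lp_norm p M2 (\<lambda>x. P (Suc k) x - f x) + Lp_norm p M2 (\<lambda>x. f x - P k x)"
          by (rule Lp_norm_diff_triangle[OF p1]) measurable
        also have "\<dots> \<le> a (Suc k) + a k"
          unfolding a_def Lp_norm_minus_commute[of p M2 "P (Suc k)"] by (intro add_mono P)
        finally have nd: "Lp_norm p M2 (\<lambda>x. P (Suc k) x - P k x) \<le> a (Suc k) + a k" .
        have "step m (\<lambda>x. P (Suc k) x - P k x) \<le> ennreal (G * 2 powr (- real m * \<beta>) * 2 powr (real (Suc k) * Q)) * (a (Suc k) + a k)"
          by (rule order_trans[OF G(2)[OF d] mult_left_mono[OF nd]]) simp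
        also have "\<dots> = ennreal (G * 2 powr (- real m * \<beta>)) * (ennreal (2 powr (real (Suc k) * Q)) * a (Suc k) + ennreal (2 powr (real (Suc k) * Q)) * a k)"
          using G(1) by (simp only: em mult_nonneg_nonneg less_imp_le powr_ge_zero distrib_left)
        also have "\<dots> \<le> ennreal (G * 2 powr (- real m * \<beta>)) * (ennreal (2 powr Q) * b (Suc k) + ennreal (2 powr Q) * b k)"
        proof (intro mult_left_mono add_mono)
          have q1: "1 \<le> 2 powr Q" using loss_pos by (intro ge_one_powr_ge_zero) auto
          have "1 * b (Suc k) \<le> ennreal (2 powr Q) * b (Suc k)" using q1 by (intro mult_right_mono) (auto simp: ennreal_ge_1)
          then show "ennreal (2 powr (real (Suc k) * Q)) * a (Suc k) \<le> ennreal (2 powr Q) * b (Suc k)" by (simp add: b_def)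
          have "2 powr (real (Suc k) * Q) = 2 powr Q * 2 powr (real k * Q)" by (simp add: powr_add[symmetric] algebra_simps)
          then show "ennreal (2 powr (real (Suc k) * Q)) * a k \<le> ennreal (2 powr Q) * b k"
            by (simp add: b_def ennreal_mult mult.assoc)
        qed auto
        also have "\<dots> = ennreal (G * 2 powr (- real m * \<beta>)) * (ennreal (2 powr Q) * (b k + b (Suc k)))"
          by (simp add: distrib_left add.commute)
        finally show ?thesis .
      qed
      have bS: "b n \<le> S" "(\<Sum>k<j. b (n + k) + b (Suc (n + k))) \<le> S + S" for j
      proof -
        show "b n \<le> S" unfolding S_def using sum_le_suminf[of "\<lambda>m. b (n + m)" "{0}"] by simp
        have "(\<Sum>k<j. b (n + k)) \<le> S" unfolding S_def by (intro sum_le_suminf) auto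
        moreover have "(\<Sum>k<j. b (Suc (n + k))) \<le> (\<Sum>m. b (Suc (n + m)))" by (intro sum_le_suminf) auto
        moreover have "(\<Sum>m. b (Suc (n + m))) \<le> S"
          unfolding S_def using suminf_tail_le_ennreal[of "\<lambda>m. b (n + m)" 1] by simp
        ultimately show "(\<Sum>k<j. b (n + k) + b (Suc (n + k))) \<le> S + S" by (auto simp: sum.distrib intro: add_mono order_trans)
      qed
      \<comment> \<open>A bound free of j, so that the gains 2^(-(n+j) \<beta>) can be summed as a
        geometric series.\<close>
      define W where "W = ennreal (2 powr (real n * Q)) * Lp_norm p M2 f + ennreal c3 * S"
      have stepPm: "step (n + j) (P (n + j)) \<le> ennreal (G * 2 powr (- real (n + j) * \<beta>)) * W" for j
      proof -
        let ?g = "ennreal (G * 2 powr (- real (n + j) * \<beta>))"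
        have "step (n + j) (P n) \<le> ennreal (G * 2 powr (- real (n + j) * \<beta>) * 2 powr (real n * Q)) * (Lp_norm p M2 f + a n)"
          by (rule order_trans[OF G(2)[OF P(1)] mult_left_mono[OF Pn]]) simp
        also have "\<dots> = ?g * (ennreal (2 powr (real n * Q)) * (Lp_norm p M2 f + a n))"
          using G(1) by (intro em) auto
        finally have "step (n + j) (P n) \<le> ?g * (ennreal (2 powr (real n * Q)) * (Lp_norm p M2 f + a n))" .
        then have 1: "step (n + j) (P n) \<le> ?g * (ennreal (2 powr (real n * Q)) * Lp_norm p M2 f + S)"
          by (rule order_trans) (use bS(1) in \<open>auto intro!: mult_left_mono simp: distrib_left b_def\<close>)
        have "(\<Sum>k<j. step (n + j) (\<lambda>x. P (Suc (n + k)) x - P (n + k) x)) \<le> (\<Sum>k<j. ?g * (ennreal (2 powr Q) * (b (n + k) + b (Suc (n + k)))))"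
          by (intro sum_mono stepP)
        also have "\<dots> = ?g * (ennreal (2 powr Q) * (\<Sum>k<j. b (n + k) + b (Suc (n + k))))" by (simp only: sum_distrib_left)
        also have "\<dots> \<le> ?g * (ennreal (2 powr Q) * (S + S))" by (intro mult_left_mono bS) auto
        finally have 2: "(\<Sum>k<j. step (n + j) (\<lambda>x. P (Suc (n + k)) x - P (n + k) x)) \<le> ?g * (ennreal (2 powr Q) * (S + S))" .
        have "step (n + j) (P (n + j)) \<le> ?g * (ennreal (2 powr (real n * Q)) * Lp_norm p M2 f + S) + ?g * (ennreal (2 powr Q) * (S + S))"
          by (rule order_trans[OF step_telescope[OF tP] add_mono[OF 1 2]])
        also have "\<dots> = ?g * W"
        proof -
          have "ennreal c3 * S = S + ennreal (2 powr Q) * (S + S)"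
          proof -
            have "ennreal c3 = 1 + (ennreal (2 powr Q) + ennreal (2 powr Q))"
              by (simp add: c3_def ennreal_plus[symmetric] ennreal_1[symmetric] del: ennreal_plus ennreal_1)
            then show ?thesis by (simp only: distrib_right distrib_left mult_1)
          qed
          then show ?thesis unfolding W_def by (simp only: distrib_left add.assoc)
        qed
        finally show ?thesis .
      qed
      have stepd: "step (n + j) (\<lambda>x. f x - P (n + j) x) \<le> ennreal B * b (n + j)" for j
      proof -
        have "step (n + j) (\<lambda>x. f x - P (n + j) x) \<le> ennreal (B * 2 powr (real (n + j) * Q)) * a (n + j)"
          unfolding a_def by (rule order_trans[OF B(2)[OF testable_diff[OF tf tP]] mult_left_mono[OF P(2)]]) simp
        then show ?thesis unfolding b_def by (simp only: ennreal_mult'' mult.assoc powr_ge_zero)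
      qed
      have "(\<Sum>j. step (n + j) f) \<le> (\<Sum>j. ennreal B * b (n + j) + ennreal (G * 2 powr (- real (n + j) * \<beta>)) * W)"
        by (intro suminf_le summableI order_trans[OF step_split[OF tf tP] add_mono[OF stepd stepPm]])
      also have "\<dots> = ennreal B * S + (\<Sum>j. ennreal (G * 2 powr (- real (n + j) * \<beta>))) * W"
        unfolding S_def by (simp only: suminf_add[OF summableI summableI, symmetric] ennreal_suminf_cmult ennreal_suminf_multc)
      also have "(\<Sum>j. ennreal (G * 2 powr (- real (n + j) * \<beta>))) = ennreal (G * 2 powr (- real n * \<beta>) * H)"
      proof -
        have "ennreal (G * 2 powr (- real (n + j) * \<beta>)) = ennreal (G * 2 powr (- real n * \<beta>)) * ennreal (2 powr (- \<beta> * real j))" for j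
          using G(1) by (simp add: ennreal_mult[symmetric] powr_add[symmetric] algebra_simps)
        then have "(\<Sum>j. ennreal (G * 2 powr (- real (n + j) * \<beta>))) = ennreal (G * 2 powr (- real n * \<beta>)) * ennreal H"
          by (simp only: ennreal_suminf_cmult suminf_geometric_ennreal[OF beta] H_def)
        then show ?thesis using G(1) H by (simp add: ennreal_mult[symmetric])
      qed
      also have "ennreal (G * 2 powr (- real n * \<beta>) * H) * W \<le> ennreal (G * H) * (ennreal (2 powr (real n * (Q - \<beta>))) * Lp_norm p M2 f) + ennreal (G * H * c3) * S"
      proof -
        have 1: "G * 2 powr (- real n * \<beta>) * H * 2 powr (real n * Q) = G * H * 2 powr (real n * (Q - \<beta>))"
        proof -
          have "2 powr (- real n * \<beta>) * 2 powr (real n * Q) = 2 powr (real n * (Q - \<beta>))" by (simp add: powr_add[symmetric] algebra_simps)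
          then show ?thesis by (metis mult.assoc mult.commute)
        qed
        have "2 powr (- real n * \<beta>) \<le> 2 powr 0" using beta by (intro powr_mono) auto
        then have "(G * H * c3) * 2 powr (- real n * \<beta>) \<le> (G * H * c3) * 1" using G(1) H c3 by (intro mult_left_mono) auto
        then have "G * 2 powr (- real n * \<beta>) * H * c3 \<le> G * H * c3" by (simp add: mult_ac)
        then have 2: "ennreal (G * 2 powr (- real n * \<beta>) * H * c3) * S \<le> ennreal (G * H * c3) * S" by (intro mult_right_mono[OF ennreal_leI]) auto
        have "ennreal (G * 2 powr (- real n * \<beta>) * H) * W = ennreal (G * 2 powr (- real n * \<beta>) * H * 2 powr (real n * Q)) * Lp_norm p M2 f + ennreal (G * 2 powr (- real n * \<beta>) * H * c3) * S"
          unfolding W_def distrib_left using G H c3 by (simp add: ennreal_mult mult.assoc)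
        also have "\<dots> \<le> ennreal (G * H * 2 powr (real n * (Q - \<beta>))) * Lp_norm p M2 f + ennreal (G * H * c3) * S"
          unfolding 1 by (intro add_left_mono 2)
        finally show ?thesis using G H by (simp add: ennreal_mult mult.assoc)
      qed
      finally have "(\<Sum>j. step (n + j) f) \<le> ennreal B * S + (ennreal (G * H) * (ennreal (2 powr (real n * (Q - \<beta>))) * Lp_norm p M2 f) + ennreal (G * H * c3) * S)"
        by (simp add: add_left_mono)
      also have "\<dots> = ennreal (B + G * H * c3) * S + ennreal (G * H) * (ennreal (2 powr (real n * (Q - \<beta>))) * Lp_norm p M2 f)"
        using B G H c3 by (simp add: ennreal_plus distrib_right add_ac)
      also have "\<dots> \<le> ennreal c * S + ennreal c * (ennreal (2 powr (real n * (Q - \<beta>))) * Lp_norm p M2 f)"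
        by (intro add_mono mult_right_mono ennreal_leI) (auto simp: c_def)
      also have "\<dots> \<le> ennreal c * (weighted_tail f n + ennreal (2 * \<epsilon>)) + ennreal c * (ennreal (2 powr (real n * (Q - \<beta>))) * Lp_norm p M2 f)"
        by (intro add_right_mono mult_left_mono Sb) auto
      also have "\<dots> = ennreal c * R + ennreal (c * (2 * \<epsilon>))"
        unfolding R_def using c0 e by (simp add: distrib_left ennreal_mult add_ac)
      finally show ?thesis .
    qed
    have "(\<Sum>m. step (n + m) f) \<le> ennreal c * R"
    proof (rule ennreal_le_epsilon)
      fix e :: real assume "e > 0"
      then show "(\<Sum>m. step (n + m) f) \<le> ennreal c * R + ennreal e"
        using eps[of "e / (2 * c)"] c0 by simp
    qed
    then show ?thesis unfolding R_def .
  qed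
  then show ?thesis using c0 by blast
qed

lemma limit_exists:
  assumes f: "f \<in> Lp p M2" and fin: "(\<Sum>m. step m f) < \<infinity>"
  shows "\<exists>F. is_tensor_limit p \<Xi>1 \<Xi>2 \<Gamma> h f F"
proof -
  have tf: "testable f" by (rule testable_Lp[OF f])
  have [measurable]: "\<sigma> (2 ^ k) f \<in> borel_measurable M1" for k by (rule op_measurable[OF _ tf]) simp
  obtain F where F [measurable]: "F \<in> borel_measurable M1"
    and b: "\<And>n. Lp_norm p M1 (\<lambda>x. F x - \<sigma> (2 ^ n) f x) \<le> (\<Sum>m. Lp_norm p M1 (\<lambda>x. \<sigma> (2 ^ Suc (n + m)) f x - \<sigma> (2 ^ (n + m)) f x))"
    using Lp_series_limit[OF p1, of "\<lambda>m. \<sigma> (2 ^ m) f" M1] fin unfolding step_def by auto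
  have b': "Lp_norm p M1 (\<lambda>x. F x - \<sigma> (2 ^ n) f x) \<le> (\<Sum>m. step (n + m) f)" for n using b unfolding step_def by simp
  have lim: "(\<lambda>n. Lp_norm p M1 (\<lambda>x. \<sigma> (2 ^ n) f x - F x)) \<longlonglongrightarrow> 0"
  proof (rule tendsto_sandwich[OF _ _ tendsto_const suminf_tail_tendsto_ennreal[OF fin]])
    show "\<forall>\<^sub>F n in sequentially. Lp_norm p M1 (\<lambda>x. \<sigma> (2 ^ n) f x - F x) \<le> (\<Sum>m. step (n + m) f)"
    proof (intro always_eventually allI)
      fix n show "Lp_norm p M1 (\<lambda>x. \<sigma> (2 ^ n) f x - F x) \<le> (\<Sum>m. step (n + m) f)"
        using b'[of n] Lp_norm_minus_commute[of p M1 F "\<sigma> (2 ^ n) f"] by simp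
    qed
  qed simp
  have "Lp_norm p M1 F < \<infinity>"
  proof -
    obtain C where C: "C > 0" "\<And>n f. n \<ge> 1 \<Longrightarrow> testable f \<Longrightarrow> Lp_norm p M1 (\<sigma> n f) \<le> ennreal (C * n powr Q) * Lp_norm p M2 f"
      using op_bounded by blast
    have "Lp_norm p M1 (\<lambda>x. (F x - \<sigma> (2 ^ 0) f x) + \<sigma> (2 ^ 0) f x) \<le> Lp_norm p M1 (\<lambda>x. F x - \<sigma> (2 ^ 0) f x) + Lp_norm p M1 (\<sigma> (2 ^ 0) f)"
      by (rule Lp_norm_triangle[OF p1]) measurable
    also have "\<dots> \<le> (\<Sum>m. step (0 + m) f) + ennreal (C * 1 powr Q) * Lp_norm p M2 f"
      using C(2)[of 1 f] tf by (intro add_mono b') auto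
    also have "\<dots> < \<infinity>" using fin f by (simp add: Lp_def ennreal_mult_less_top)
    finally show ?thesis by simp
  qed
  then show ?thesis using lim F unfolding is_tensor_limit_def Lp_def by blast
qed

text \<open>The operator at level 2^n takes values in the polynomials of that level, so it is itself
  a competitor in the best approximation of F.\<close>

lemma limit_error:
  assumes f: "f \<in> Lp p M2" and F: "is_tensor_limit p \<Xi>1 \<Xi>2 \<Gamma> h f F"
  shows "approx_err p \<Xi>1 (2 ^ n) F \<le> (\<Sum>m. step (n + m) f)"
proof -
  have tf: "testable f" by (rule testable_Lp[OF f])
  have [measurable]: "\<sigma> (2 ^ k) f \<in> borel_measurable M1" for k by (rule op_measurable[OF _ tf]) simp
  have [measurable]: "F \<in> borel_measurable M1" using F unfolding is_tensor_limit_def Lp_def by blast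
  have "approx_err p \<Xi>1 (2 ^ n) F \<le> Lp_norm p M1 (\<lambda>x. F x - \<sigma> (2 ^ n) f x)"
    unfolding approx_err_def by (rule INF_lower[OF op_poly[OF _ tf]]) simp
  also have "\<dots> \<le> (\<Sum>m. step (n + m) f)"
    unfolding step_def
    using Lp_limit_bound[OF p1, of "\<lambda>m. \<sigma> (2 ^ m) f" M1 F n] F unfolding is_tensor_limit_def by auto
  finally show ?thesis .
qed

theorem limit_and_rate:
  "\<exists>c>0. \<forall>f\<in>Lp p M2. weighted_tail f 0 < \<infinity> \<longrightarrow>
     (\<exists>F. is_tensor_limit p \<Xi>1 \<Xi>2 \<Gamma> h f F) \<and>
     (\<forall>F. is_tensor_limit p \<Xi>1 \<Xi>2 \<Gamma> h f F \<longrightarrow> (\<forall>n::nat.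
       approx_err p \<Xi>1 (2 ^ n) F \<le> ennreal c * (weighted_tail f n + ennreal (2 powr (real n * (Q - \<beta>))) * Lp_norm p M2 f)))"
proof -
  obtain c where c: "c > 0" "\<And>f n. f \<in> Lp p M2 \<Longrightarrow> (\<Sum>m. step (n + m) f) \<le> ennreal c * (weighted_tail f n + ennreal (2 powr (real n * (Q - \<beta>))) * Lp_norm p M2 f)"
    using step_series_bound by blast
  show ?thesis
  proof (intro exI[of _ c] conjI ballI impI allI c(1))
    fix f assume f: "f \<in> Lp p M2" and fin: "weighted_tail f 0 < \<infinity>"
    have "(\<Sum>m. step (0 + m) f) \<le> ennreal c * (weighted_tail f 0 + ennreal (2 powr (real 0 * (Q - \<beta>))) * Lp_norm p M2 f)" by (rule c(2)[OF f])
    also have "\<dots> < \<infinity>" using fin f by (simp add: Lp_def ennreal_mult_less_top)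
    finally show "\<exists>F. is_tensor_limit p \<Xi>1 \<Xi>2 \<Gamma> h f F" by (intro limit_exists f) simp
    fix F n assume "is_tensor_limit p \<Xi>1 \<Xi>2 \<Gamma> h f F"
    then show "approx_err p \<Xi>1 (2 ^ n) F \<le> ennreal c * (weighted_tail f n + ennreal (2 powr (real n * (Q - \<beta>))) * Lp_norm p M2 f)"
      by (rule order_trans[OF limit_error[OF f] c(2)[OF f]])
  qed
qed

end

section \<open>Besov spaces\<close>

definition besov_seq :: "ennreal \<Rightarrow> real \<Rightarrow> 'a spectral_system \<Rightarrow> ('a \<Rightarrow> complex) \<Rightarrow> nat \<Rightarrow> ennreal"
  where "besov_seq p \<gamma> \<Xi> g j = ennreal (2 powr (\<gamma> * real j)) * approx_err p \<Xi> (2 ^ j) g"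

text \<open>Finiteness of the l^\<rho> quasi-norm, with the outer root omitted because finiteness
  does not depend on it.\<close>

definition rho_summable :: "ennreal \<Rightarrow> (nat \<Rightarrow> ennreal) \<Rightarrow> bool"
  where "rho_summable \<rho> z \<longleftrightarrow> (if \<rho> = \<infinity> then (SUP j. z j) < \<infinity> else (\<Sum>j. enn_powr (z j) (enn2real \<rho>)) < \<infinity>)"

lemma besov_iff:
  assumes "\<rho> > 0"
  shows "g \<in> besov p \<rho> \<gamma> \<Xi> \<longleftrightarrow> g \<in> approx_space p \<Xi> \<and> rho_summable \<rho> (besov_seq p \<gamma> \<Xi> g)"
proof (cases "\<rho> = \<infinity>")
  case True
  then show ?thesis by (simp add: besov_def rho_summable_def besov_seq_def)
next
  case False
  then have r: "enn2real \<rho> > 0" using assms by (simp add: enn2real_positive_iff less_top)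
  have "(2 powr (\<gamma> * real j)) powr enn2real \<rho> = 2 powr (\<gamma> * enn2real \<rho> * real j)" for j :: nat
    unfolding powr_powr by (simp add: mult_ac)
  then have "enn_powr (besov_seq p \<gamma> \<Xi> g j) (enn2real \<rho>) = ennreal (2 powr (\<gamma> * enn2real \<rho> * real j)) * enn_powr (approx_err p \<Xi> (2 ^ j) g) (enn2real \<rho>)" for j
    using r by (simp add: besov_seq_def enn_powr_mult)
  then show ?thesis using False by (simp add: besov_def rho_summable_def enn_powr_less_top_iff[unfolded infinity_ennreal_def])
qed

lemma rho_summable_bounded:
  assumes "\<rho> > 0" "rho_summable \<rho> z"
  obtains X :: real where "X \<ge> 0" "\<And>j. z j \<le> ennreal X"
proof -
  have "\<exists>Y<\<infinity>. \<forall>j. z j \<le> Y"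
  proof (cases "\<rho> = \<infinity>")
    case True
    then show ?thesis using assms(2) by (auto simp: rho_summable_def intro!: exI[of _ "SUP j. z j"] SUP_upper)
  next
    case False
    define r where "r = enn2real \<rho>"
    have r: "r > 0" using False assms(1) by (simp add: r_def enn2real_positive_iff less_top)
    define V where "V = (\<Sum>j. enn_powr (z j) r)"
    have V: "V < \<infinity>" using assms(2) False by (simp add: rho_summable_def V_def r_def)
    have "z j \<le> enn_powr V (1 / r)" for j
    proof -
      have "enn_powr (z j) r \<le> V" unfolding V_def using sum_le_suminf[of "\<lambda>j. enn_powr (z j) r" "{j}"] by simp
      then have "enn_powr (enn_powr (z j) r) (1 / r) \<le> enn_powr V (1 / r)" using r by (intro enn_powr_mono) auto
      then show ?thesis using r by (simp add: enn_powr_inverse)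
    qed
    moreover have "enn_powr V (1 / r) < \<infinity>" using V by (simp only: enn_powr_less_top_iff)
    ultimately show ?thesis by blast
  qed
  then obtain Y where Y: "Y < \<infinity>" "\<And>j. z j \<le> Y" by blast
  then obtain X where "Y = ennreal X" "X \<ge> 0" by (cases Y) auto
  then show thesis using that Y by blast
qed

lemma rho_summable_mono:
  assumes "\<rho> > 0" "rho_summable \<rho> z" "\<And>j. y j \<le> z j"
  shows "rho_summable \<rho> y"
proof (cases "\<rho> = \<infinity>")
  case True
  have "(SUP j. y j) \<le> (SUP j. z j)" by (intro SUP_mono) (use assms(3) in auto)
  then show ?thesis using assms(2) True by (auto simp: rho_summable_def intro: order.strict_trans1)
next
  case False
  have "(\<Sum>j. enn_powr (y j) (enn2real \<rho>)) \<le> (\<Sum>j. enn_powr (z j) (enn2real \<rho>))"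
    by (intro suminf_le summableI enn_powr_mono assms) auto
  then show ?thesis using assms(2) False by (auto simp: rho_summable_def intro: order.strict_trans1)
qed

lemma rho_summable_add:
  assumes "\<rho> > 0" "rho_summable \<rho> y" "rho_summable \<rho> z"
  shows "rho_summable \<rho> (\<lambda>j. y j + z j)"
proof (cases "\<rho> = \<infinity>")
  case True
  have "(SUP j. y j + z j) \<le> (SUP j. y j) + (SUP j. z j)" by (intro SUP_least add_mono SUP_upper) auto
  then show ?thesis using assms True by (auto simp: rho_summable_def intro: order.strict_trans1)
next
  case False
  define r where "r = enn2real \<rho>"
  have r: "r > 0" using False assms(1) by (simp add: r_def enn2real_positive_iff less_top)
  have "(\<Sum>j. enn_powr (y j + z j) r) \<le> (\<Sum>j. ennreal (2 powr r) * (enn_powr (y j) r + enn_powr (z j) r))"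
    by (intro suminf_le summableI enn_powr_sum_le r)
  also have "\<dots> = ennreal (2 powr r) * ((\<Sum>j. enn_powr (y j) r) + (\<Sum>j. enn_powr (z j) r))"
    by (simp add: ennreal_suminf_cmult suminf_add[symmetric])
  also have "\<dots> < \<infinity>" using assms(2,3) False by (simp add: rho_summable_def r_def ennreal_mult_less_top)
  finally show ?thesis using False by (simp add: rho_summable_def r_def)
qed

lemma rho_summable_cmult:
  assumes "\<rho> > 0" "rho_summable \<rho> z" "c > 0"
  shows "rho_summable \<rho> (\<lambda>j. ennreal c * z j)"
proof (cases "\<rho> = \<infinity>")
  case True
  have "(SUP j. ennreal c * z j) \<le> ennreal c * (SUP j. z j)" by (intro SUP_least mult_left_mono SUP_upper) auto
  also have "\<dots> < \<infinity>" using assms True by (simp add: rho_summable_def ennreal_mult_less_top)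
  finally show ?thesis using True by (simp add: rho_summable_def)
next
  case False
  then have r: "enn2real \<rho> > 0" using assms(1) by (simp add: enn2real_positive_iff less_top)
  then show ?thesis using assms False by (simp add: rho_summable_def enn_powr_mult ennreal_suminf_cmult ennreal_mult_less_top)
qed

lemma rho_summable_geometric:
  assumes "\<rho> > 0" "\<delta> > 0" "t < \<infinity>"
  shows "rho_summable \<rho> (\<lambda>j. ennreal (2 powr (- \<delta> * real j)) * t)"
proof (cases "\<rho> = \<infinity>")
  case True
  have "(SUP j::nat. ennreal (2 powr (- \<delta> * real j)) * t) \<le> t"
  proof (rule SUP_least)
    fix j :: nat
    have "2 powr (- \<delta> * real j) \<le> 2 powr 0" using assms(2) by (intro powr_mono) auto
    then have "ennreal (2 powr (- \<delta> * real j)) * t \<le> 1 * t" by (intro mult_right_mono) (auto simp: ennreal_le_1)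
    then show "ennreal (2 powr (- \<delta> * real j)) * t \<le> t" by simp
  qed
  then show ?thesis using assms(3) True by (auto simp: rho_summable_def intro: order.strict_trans1)
next
  case False
  define r where "r = enn2real \<rho>"
  have r: "r > 0" using False assms(1) by (simp add: r_def enn2real_positive_iff less_top)
  have "(2 powr (- \<delta> * real j)) powr r = 2 powr (- (\<delta> * r) * real j)" for j :: nat
    unfolding powr_powr by (simp add: mult_ac)
  then have "(\<Sum>j. enn_powr (ennreal (2 powr (- \<delta> * real j)) * t) r) = (\<Sum>j. ennreal (2 powr (- (\<delta> * r) * real j)) * enn_powr t r)"
    using r by (simp add: enn_powr_mult)
  also have "\<dots> = ennreal (1 / (1 - 2 powr - (\<delta> * r))) * enn_powr t r"
    using assms(2) r by (simp only: ennreal_suminf_multc suminf_geometric_ennreal mult_pos_pos)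
  also have "\<dots> < \<infinity>" using assms(3) by (simp add: ennreal_mult_less_top enn_powr_less_top_iff[unfolded infinity_ennreal_def])
  finally show ?thesis using False by (simp add: rho_summable_def r_def)
qed

lemma rho_summable_hardy:
  assumes "\<rho> > 0" "\<delta> > 0" "rho_summable \<rho> z"
  shows "rho_summable \<rho> (\<lambda>n. \<Sum>m. ennreal (2 powr (- \<delta> * real m)) * z (n + m))"
proof (cases "\<rho> = \<infinity>")
  case True
  have "(SUP n. \<Sum>m. ennreal (2 powr (- \<delta> * real m)) * z (n + m)) \<le> (\<Sum>m. ennreal (2 powr (- \<delta> * real m)) * (SUP j. z j))"
    by (intro SUP_least suminf_le summableI mult_left_mono SUP_upper) auto
  also have "\<dots> = ennreal (1 / (1 - 2 powr - \<delta>)) * (SUP j. z j)"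
    by (simp only: ennreal_suminf_multc suminf_geometric_ennreal[OF assms(2)])
  also have "\<dots> < \<infinity>" using assms(3) True by (simp add: rho_summable_def ennreal_mult_less_top)
  finally show ?thesis using True by (simp add: rho_summable_def)
next
  case False
  then have r: "enn2real \<rho> > 0" using assms(1) by (simp add: enn2real_positive_iff less_top)
  show ?thesis using hardy_sum[OF assms(2) r, of z] assms(3) False by (simp add: rho_summable_def)
qed

text \<open>Membership in the approximation space needs errors tending to 0 for real n. A bounded
  sequence with positive weight exponent gives this at dyadic levels, and monotonicity of the errors
  fills the gaps.\<close>

lemma approx_spaceI:
  assumes F: "F \<in> Lp p (msr \<Xi>)" and d: "\<delta> > 0" and b: "\<And>j. besov_seq p \<delta> \<Xi> F j \<le> ennreal X"
  shows "F \<in> approx_space p \<Xi>"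
  unfolding approx_space_def
proof (intro CollectI conjI F order_tendstoI)
  fix y :: ennreal assume y: "0 < y"
  have "(\<lambda>j::nat. ennreal (2 powr (- \<delta> * real j) * X)) \<longlonglongrightarrow> ennreal (0 * X)"
  proof (intro tendsto_ennrealI tendsto_mult tendsto_const)
    have "filterlim (\<lambda>j::nat. - (\<delta> * ln 2) * real j) at_bot sequentially"
      by (rule filterlim_tendsto_neg_mult_at_bot[OF tendsto_const _ filterlim_real_sequentially]) (use d in simp)
    then have "(\<lambda>j::nat. exp (- (\<delta> * ln 2) * real j)) \<longlonglongrightarrow> 0"
      by (rule filterlim_compose[OF exp_at_bot])
    then show "(\<lambda>j::nat. 2 powr (- \<delta> * real j)) \<longlonglongrightarrow> 0" by (simp add: powr_def mult_ac)
  qed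
  then have "\<forall>\<^sub>F j in sequentially. ennreal (2 powr (- \<delta> * real j) * X) < y"
    using y by (intro order_tendstoD(2)) auto
  then obtain j :: nat where j: "ennreal (2 powr (- \<delta> * real j) * X) < y" by (auto simp: eventually_sequentially)
  have "approx_err p \<Xi> (2 ^ j) F = ennreal (2 powr (- \<delta> * real j)) * besov_seq p \<delta> \<Xi> F j"
    by (simp add: besov_seq_def mult.assoc[symmetric] ennreal_mult[symmetric] powr_add[symmetric])
  also have "\<dots> \<le> ennreal (2 powr (- \<delta> * real j)) * ennreal X" by (intro mult_left_mono b) simp
  also have "\<dots> = ennreal (2 powr (- \<delta> * real j) * X)" by (simp add: ennreal_mult')
  also note j
  finally have e: "approx_err p \<Xi> (2 ^ j) F < y" .
  show "\<forall>\<^sub>F n in at_top. approx_err p \<Xi> n F < y"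
    using eventually_ge_at_top[of "2 ^ j :: real"] by eventually_elim (rule order.strict_trans1[OF approx_err_mono e])
qed simp

context connected_pair
begin

text \<open>Multiplying the rate by 2^(n(\<gamma> - Q)) turns the tail into a Hardy mean of the
  Besov sequence of f, with weights 2^(-m(\<gamma> - Q)), and the norm term into the geometric
  sequence 2^(-n(\<beta> - \<gamma>)). The two inequalities on \<gamma> make both exponents
  negative.\<close>

theorem besov_conclusion:
  assumes g: "Q < \<gamma>" "\<gamma> < \<beta>" and r: "0 < \<rho>" and f: "f \<in> besov p \<rho> \<gamma> \<Xi>2"
  shows "\<exists>F. is_tensor_limit p \<Xi>1 \<Xi>2 \<Gamma> h f F"
    and "is_tensor_limit p \<Xi>1 \<Xi>2 \<Gamma> h f F \<Longrightarrow> F \<in> besov p \<rho> (\<gamma> - Q) \<Xi>1"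
proof -
  obtain c where c: "c > 0"
    and lim: "\<And>f. f \<in> Lp p M2 \<Longrightarrow> weighted_tail f 0 < \<infinity> \<Longrightarrow> \<exists>F. is_tensor_limit p \<Xi>1 \<Xi>2 \<Gamma> h f F"
    and rate: "\<And>f F n. f \<in> Lp p M2 \<Longrightarrow> weighted_tail f 0 < \<infinity> \<Longrightarrow> is_tensor_limit p \<Xi>1 \<Xi>2 \<Gamma> h f F \<Longrightarrow>
       approx_err p \<Xi>1 (2 ^ n) F \<le> ennreal c * (weighted_tail f n + ennreal (2 powr (real n * (Q - \<beta>))) * Lp_norm p M2 f)"
    using limit_and_rate by blast
  define x where "x = besov_seq p \<gamma> \<Xi>2 f"
  define \<delta> where "\<delta> = \<gamma> - Q"
  have d: "\<delta> > 0" using g by (simp add: \<delta>_def)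
  have x: "rho_summable \<rho> x" and as: "f \<in> approx_space p \<Xi>2" using f unfolding besov_iff[OF r] x_def by auto
  have fL: "f \<in> Lp p M2" using as by (simp add: approx_space_def)
  then have fn: "Lp_norm p M2 f < \<infinity>" by (simp add: Lp_def)
  have tail: "ennreal (2 powr (\<delta> * real n)) * weighted_tail f n = (\<Sum>m. ennreal (2 powr (- \<delta> * real m)) * x (n + m))" for n
  proof -
    have "ennreal (2 powr (\<delta> * real n)) * (ennreal (2 powr (real (n + m) * Q)) * err f (n + m)) = ennreal (2 powr (- \<delta> * real m)) * x (n + m)" for m
    proof -
      have "2 powr (\<delta> * real n) * 2 powr (real (n + m) * Q) = 2 powr (- \<delta> * real m) * 2 powr (\<gamma> * real (n + m))"
        unfolding powr_add[symmetric] \<delta>_def by (simp add: algebra_simps)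
      then show ?thesis
        unfolding x_def besov_seq_def err_def by (simp only: mult.assoc[symmetric] ennreal_mult[symmetric] powr_ge_zero)
    qed
    then show ?thesis unfolding weighted_tail_def ennreal_suminf_cmult[symmetric] by simp
  qed
  have hardy: "rho_summable \<rho> (\<lambda>n. \<Sum>m. ennreal (2 powr (- \<delta> * real m)) * x (n + m))"
    by (rule rho_summable_hardy[OF r d x])
  \<comment> \<open>Summability of the weighted errors is the value at n = 0 of the Hardy mean,
    which is finite because a summable sequence is bounded.\<close>
  have fin: "weighted_tail f 0 < \<infinity>"
  proof -
    obtain X where X: "\<And>n. (\<Sum>m. ennreal (2 powr (- \<delta> * real m)) * x (n + m)) \<le> ennreal X" using rho_summable_bounded[OF r hardy] by metis
    have "weighted_tail f 0 \<le> ennreal X" using tail[of 0] X[of 0] by simp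
    then show ?thesis by (rule order.strict_trans1) simp
  qed
  show "\<exists>F. is_tensor_limit p \<Xi>1 \<Xi>2 \<Gamma> h f F" by (rule lim[OF fL fin])
  assume F: "is_tensor_limit p \<Xi>1 \<Xi>2 \<Gamma> h f F"
  have bd: "besov_seq p \<delta> \<Xi>1 F n \<le> ennreal c * ((\<Sum>m. ennreal (2 powr (- \<delta> * real m)) * x (n + m)) + ennreal (2 powr (- (\<beta> - \<gamma>) * real n)) * Lp_norm p M2 f)" for n
  proof -
    have "besov_seq p \<delta> \<Xi>1 F n \<le> ennreal (2 powr (\<delta> * real n)) * (ennreal c * (weighted_tail f n + ennreal (2 powr (real n * (Q - \<beta>))) * Lp_norm p M2 f))"
      unfolding besov_seq_def by (intro mult_left_mono rate[OF fL fin F]) simp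
    also have "\<dots> = ennreal c * (ennreal (2 powr (\<delta> * real n)) * weighted_tail f n + ennreal (2 powr (\<delta> * real n)) * ennreal (2 powr (real n * (Q - \<beta>))) * Lp_norm p M2 f)"
      by (simp add: distrib_left mult_ac)
    also have "ennreal (2 powr (\<delta> * real n)) * ennreal (2 powr (real n * (Q - \<beta>))) = ennreal (2 powr (- (\<beta> - \<gamma>) * real n))"
      unfolding \<delta>_def by (simp add: ennreal_mult[symmetric] powr_add[symmetric] algebra_simps)
    finally show ?thesis unfolding tail .
  qed
  have bs: "rho_summable \<rho> (besov_seq p \<delta> \<Xi>1 F)"
    by (rule rho_summable_mono[OF r rho_summable_cmult[OF r rho_summable_add[OF r hardy rho_summable_geometric[OF r _ fn]] c] bd]) (use g in simp)
  obtain X where X: "\<And>j. besov_seq p \<delta> \<Xi>1 F j \<le> ennreal X" using rho_summable_bounded[OF r bs] by metis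
  have "F \<in> approx_space p \<Xi>1"
    by (rule approx_spaceI[OF _ d X]) (use F in \<open>simp add: is_tensor_limit_def\<close>)
  then show "F \<in> besov p \<rho> (\<gamma> - Q) \<Xi>1" using bs unfolding besov_iff[OF r] \<delta>_def by simp
qed

end

theorem theorem3p1:
  fixes \<Xi>1 \<Xi>2 :: "'a spectral_system" and q1 q2 \<beta> :: real and Y :: "'a set" and \<nu> :: "'a measure"
    and h :: "real \<Rightarrow> real" and p :: ennreal and \<Gamma> :: "nat \<Rightarrow> nat \<Rightarrow> complex"
  assumes "admissible_system \<Xi>1" and "admissible_system \<Xi>2"
    and "gaussian_upper_bound \<Xi>1 q1" and "gaussian_upper_bound \<Xi>2 q2"
    and "orthonormal_system \<Xi>1" and "orthonormal_system \<Xi>2"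
    and "Y \<subseteq> pts \<Xi>1 \<inter> pts \<Xi>2" and "Y \<in> sets (msr \<Xi>1)" and "Y \<in> sets (msr \<Xi>2)"
    and "prob_space \<nu>" and "space \<nu> = Y"
    and "(\<lambda>y. y) \<in> measurable \<nu> (msr \<Xi>1)" and "(\<lambda>y. y) \<in> measurable \<nu> (msr \<Xi>2)"
    and "\<Gamma> = conn_coeff \<Xi>1 \<Xi>2 \<nu>"
    and "low_pass_filter h" and "sufficiently_smooth q1 q2 h"
    and "\<exists>c>0. ball_growth \<Xi>1 q1 c \<and> ball_growth \<Xi>2 q2 c"
    and "1 \<le> p"
    and "\<beta> > 0"
    and "\<exists>c>0. \<forall>m n :: nat. m \<ge> 1 \<longrightarrow> n \<ge> 1 \<longrightarrow> (\<forall>P\<in>diff_poly \<Xi>2 (real n).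
           Lp_norm p (msr \<Xi>1)
             (\<lambda>x. tensor_op \<Xi>1 \<Xi>2 \<Gamma> h (2 ^ (m + 1)) P x - tensor_op \<Xi>1 \<Xi>2 \<Gamma> h (2 ^ m) P x)
           \<le> ennreal (c * 2 powr (- real m * \<beta>) * real n powr loss_exponent q1 q2 p)
               * Lp_norm p (msr \<Xi>2) P)"
  shows "(\<exists>c>0. \<forall>f\<in>Lp p (msr \<Xi>2).
            (\<Sum>m. ennreal (2 powr (real m * loss_exponent q1 q2 p)) * approx_err p \<Xi>2 (2 ^ m) f) < \<infinity> \<longrightarrow>
            (\<exists>F. is_tensor_limit p \<Xi>1 \<Xi>2 \<Gamma> h f F) \<and>
            (\<forall>F. is_tensor_limit p \<Xi>1 \<Xi>2 \<Gamma> h f F \<longrightarrow> (\<forall>n::nat.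
               approx_err p \<Xi>1 (2 ^ n) F \<le> ennreal c *
                 ((\<Sum>m. ennreal (2 powr (real (n + m) * loss_exponent q1 q2 p))
                          * approx_err p \<Xi>2 (2 ^ (n + m)) f)
                  + ennreal (2 powr (real n * (loss_exponent q1 q2 p - \<beta>))) * Lp_norm p (msr \<Xi>2) f))))
       \<and> (\<forall>\<gamma> \<rho>. loss_exponent q1 q2 p < \<gamma> \<and> \<gamma> < \<beta> \<and> 0 < \<rho> \<longrightarrow>
            (\<forall>f\<in>besov p \<rho> \<gamma> \<Xi>2.
               (\<exists>F. is_tensor_limit p \<Xi>1 \<Xi>2 \<Gamma> h f F) \<and>
               (\<forall>F. is_tensor_limit p \<Xi>1 \<Xi>2 \<Gamma> h f F \<longrightarrow>
                  F \<in> besov p \<rho> (\<gamma> - loss_exponent q1 q2 p) \<Xi>1)))"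
proof -
  obtain c where c: "c > 0" "ball_growth \<Xi>1 q1 c" "ball_growth \<Xi>2 q2 c" using assms(17) by blast
  interpret connected_pair \<Xi>1 \<Xi>2 q1 q2 c \<nu> \<Gamma> h p \<beta>
    by (intro connected_pair.intro connected_pair_axioms.intro tensor_setup.intro tensor_setup_axioms.intro heat_system.intro; fact assms c)
  have tail: "weighted_tail f n = (\<Sum>m. ennreal (2 powr (real (n + m) * loss_exponent q1 q2 p)) * approx_err p \<Xi>2 (2 ^ (n + m)) f)" for f n
    by (simp add: weighted_tail_def err_def)
  have tail0: "weighted_tail f 0 = (\<Sum>m. ennreal (2 powr (real m * loss_exponent q1 q2 p)) * approx_err p \<Xi>2 (2 ^ m) f)" for f
    by (simp add: tail)
  show ?thesis
    using limit_and_rate[unfolded tail0, unfolded tail] besov_conclusion by blast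
qed

end
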